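(* For $v=1,2,3$ let $X_v$ be a complex UMD Banach space of quartile type $q_v$, and let $\Pi:X_1\times X_2\times X_3\to\mathbb C$ be a bounded trilinear form. Suppose that $$\frac1{q_1}+\frac1{q_2}+\frac1{q_3}>1,$$ and that the exponents $p_1,p_2,r$ satisfy $$\frac1r=\frac1{p_1}+\frac1{p_2},\qquad q_1<p_1<\infty,\qquad q_2<p_2<\infty,\qquad 1<r<q_3',$$ where $q_3'=q_3/(q_3-1)$. Then the bilinear quartile operator $B$ (initially defined on finite dyadic step functions) extends to a bounded operator from $L^{p_1}(\mathbb R_+;X_1)\times L^{p_2}(\mathbb R_+;X_2)$ into $L^r(\mathbb R_+;X_3^* )$, that is, there is a constant $C$ such that $$\|B(f_1,f_2)\|_{L^r(\mathbb R_+;X_3^* )}\le C\,\|f_1\|_{L^{p_1}(\mathbb R_+;X_1)}\|f_2\|_{L^{p_2}(\mathbb R_+;X_2)}.$$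
   Context: Walsh wave packets. $\mathbb R_+=[0,\infty)$, $\mathbb N=\{0,1,2,\dots\}$. Dyadic intervals are $[2^kj,2^k(j+1))$, $k\in\mathbb Z$, $j\in\mathbb N$. Let $r_i(x)=\operatorname{sgn}\sin(2\pi 2^i x)$, and for $n=\sum_i 2^i n_i$ (binary expansion) let $w_n=\prod_i r_i^{n_i}$. For a dyadic interval $I$ and $n\in\mathbb N$ let $w_{I,n}(x)=|I|^{-1/2}\mathbf 1_I(x)w_n(x/|I|)$. For a Banach-valued $f$ and scalar $w$, $\langle f,w\rangle=\int f\,w\,dx$. Quartiles. A quartile is a rectangle $P=I_P\times\omega_P$ with $I_P$ dyadic and $\omega_P=|I_P|^{-1}[4n,4(n+1))$, $n\in\mathbb N$. For $v\in\{0,1,2,3\}$, $\omega_{P_v}=|I_P|^{-1}[4n+v,4n+v+1)$, $P_v=I_P\times\omega_{P_v}$, and $w_{P_v}=w_{I_P,4n+v}$. Order and trees. For dyadic rectangles of equal area, $P\le P'$ means $I_P\subseteq I_{P'}$ and $\omega_{P'}\subseteq\omega_P$. For quartiles, $P\le_v P'$ means $P_v\le P'_v$. A $v$-tree is a collection $\mathbf T$ of quartiles for which there is a quartile $T$ (a top, not necessarily in $\mathbf T$) with $P\le_v T$ for all $P\in\mathbf T$. Quartile type. For $u\ne v$ in $\{0,1,2,3\}$, a collection $\mathcal T$ of pairwise disjoint trees is $(v,u)$-good if every $\mathbf T\in\mathcal T$ is a $v$-tree and $P_u\cap P'_u=\emptyset$ whenever $P\in\mathbf T$, $P'\in\mathbf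 T'$, $\mathbf T,\mathbf T'\in\mathcal T$, $P\neq P'$. A Banach space $X$ has quartile type $q$ if there is a constant $C$ such that for all $u\neq v$, all $(v,u)$-good $\mathcal T$ and all $f\in L^q(\mathbb R_+;X)$, $$\Big(\sum_{\mathbf T\in\mathcal T}\Big\|\sum_{P\in\mathbf T}\langle f,w_{P_u}\rangle w_{P_u}\Big\|_{L^q(\mathbb R_+;X)}^q\Big)^{1/q}\le C\|f\|_{L^q(\mathbb R_+;X)}.$$ Quartile operator. Write $x_1\cdot x_2\cdot x_3=\Pi(x_1,x_2,x_3)$, where bounded means $|\Pi(x_1,x_2,x_3)|\lesssim\|x_1\|\|x_2\|\|x_3\|$; write $x_1\cdot x_2=\Pi(x_1,x_2,\cdot)\in X_3^*$. The quartile operator is $$B(f_1,f_2)=\sum_{P\text{ quartile}}|I_P|^{-1/2}\,\langle f_1,w_{P_1}\rangle\cdot\langle f_2,w_{P_2}\rangle\,w_{P_3},$$ initially defined for finite dyadic step functions, i.e. compactly supported functions that are constant on the dyadic intervals of length $2^{-N}$ for some integer $N$. *)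

theory Defs
  imports "HOL-Probability.Probability"
begin

section \<open>Complex Banach spaces\<close>

class complex_banach = banach +
  fixes scaleC :: "complex \<Rightarrow> 'a \<Rightarrow> 'a"
  assumes scaleC_add_right: "scaleC a (x + y) = scaleC a x + scaleC a y"
    and scaleC_add_left: "scaleC (a + b) x = scaleC a x + scaleC b x"
    and scaleC_scaleC: "scaleC a (scaleC b x) = scaleC (a * b) x"
    and scaleR_eq_scaleC: "r *\<^sub>R x = scaleC (complex_of_real r) x"
    and norm_scaleC: "norm (scaleC a x) = cmod a * norm x"

instantiation complex :: complex_banach
begin

definition scaleC_complex :: "complex \<Rightarrow> complex \<Rightarrow> complex" where
  "scaleC_complex a x = a * x"

instance
  by standard (simp_all add: scaleC_complex_def algebra_simps norm_mult scaleR_conv_of_real)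

end

definition complex_linear :: "('a::complex_banach \<Rightarrow> complex) \<Rightarrow> bool" where
  "complex_linear \<phi> \<longleftrightarrow>
     (\<forall>x y. \<phi> (x + y) = \<phi> x + \<phi> y) \<and> (\<forall>a x. \<phi> (scaleC a x) = a * \<phi> x)"

text \<open>
  The dual \<open>X\<^sup>*\<close> of a complex Banach space: the complex linear elements of the Banach space of
  bounded real linear maps into the complex numbers. The norm is the usual dual norm, because
  \<open>\<parallel>\<phi>\<parallel> = sup \<bar>\<phi> x\<bar> / \<parallel>x\<parallel>\<close> in either case.
\<close>
definition complex_dual :: "('a::complex_banach \<Rightarrow>\<^sub>L complex) set" where
  "complex_dual = {\<phi>. complex_linear (blinfun_apply \<phi>)}"

definition bounded_trilinear_form ::
  "('a::complex_banach \<Rightarrow> 'b::complex_banach \<Rightarrow> 'c::complex_banach \<Rightarrow> complex) \<Rightarrow> bool" where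
  "bounded_trilinear_form \<Phi> \<longleftrightarrow>
     (\<forall>x2 x3. complex_linear (\<lambda>x1. \<Phi> x1 x2 x3)) \<and>
     (\<forall>x1 x3. complex_linear (\<lambda>x2. \<Phi> x1 x2 x3)) \<and>
     (\<forall>x1 x2. complex_linear (\<lambda>x3. \<Phi> x1 x2 x3)) \<and>
     (\<exists>K. \<forall>x1 x2 x3. cmod (\<Phi> x1 x2 x3) \<le> K * norm x1 * norm x2 * norm x3)"


section \<open>Strong measurability, Bochner integral and Lebesgue--Bochner spaces\<close>

text \<open>
  The Bochner integral of the library, \<^const>\<open>has_bochner_integral\<close>, is restricted to second
  countable spaces. The definitions below are the same with measurability replaced by strong
  measurability, so that no separability of the Banach space is needed.
\<close>

definition strongly_measurable :: "'s measure \<Rightarrow> ('s \<Rightarrow> 'a::real_normed_vector) \<Rightarrow> bool" where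
  "strongly_measurable M f \<longleftrightarrow>
     (\<exists>s. (\<forall>i::nat. simple_function M (s i)) \<and> (\<forall>x\<in>space M. (\<lambda>i. s i x) \<longlonglongrightarrow> f x))"

definition has_Bochner_int :: "'s measure \<Rightarrow> ('s \<Rightarrow> 'a::real_normed_vector) \<Rightarrow> 'a \<Rightarrow> bool" where
  "has_Bochner_int M f y \<longleftrightarrow> strongly_measurable M f \<and>
     (\<exists>s. (\<forall>i::nat. Bochner_Integration.simple_bochner_integrable M (s i)) \<and>
          (\<lambda>i. \<integral>\<^sup>+x. ennreal (norm (f x - s i x)) \<partial>M) \<longlonglongrightarrow> 0 \<and>
          (\<lambda>i. Bochner_Integration.simple_bochner_integral M (s i)) \<longlonglongrightarrow> y)"

definition Bochner_int :: "'s measure \<Rightarrow> ('s \<Rightarrow> 'a::real_normed_vector) \<Rightarrow> 'a" where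
  "Bochner_int M f = (if \<exists>y. has_Bochner_int M f y then THE y. has_Bochner_int M f y else 0)"

lemma strongly_measurable_iff_borel:
  fixes f :: "'s \<Rightarrow> 'a::{real_normed_vector, second_countable_topology}"
  shows "strongly_measurable M f \<longleftrightarrow> f \<in> borel_measurable M"
proof
  assume "strongly_measurable M f"
  then obtain s where s: "\<And>i::nat. simple_function M (s i)"
    and lim: "\<And>x. x \<in> space M \<Longrightarrow> (\<lambda>i. s i x) \<longlonglongrightarrow> f x"
    unfolding strongly_measurable_def by blast
  show "f \<in> borel_measurable M"
    by (rule borel_measurable_LIMSEQ_metric[OF borel_measurable_simple_function[OF s] lim])
next
  assume "f \<in> borel_measurable M"
  from borel_measurable_implies_sequence_metric[OF this, of 0]
  show "strongly_measurable M f"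
    unfolding strongly_measurable_def by blast
qed

lemma has_Bochner_int_iff_has_bochner_integral:
  fixes f :: "'s \<Rightarrow> 'a::{real_normed_vector, second_countable_topology}"
  shows "has_Bochner_int M f y \<longleftrightarrow> has_bochner_integral M f y"
  unfolding has_Bochner_int_def strongly_measurable_iff_borel has_bochner_integral.simps
  by blast

lemma has_Bochner_int_unique:
  fixes f :: "'s \<Rightarrow> 'a::real_normed_vector"
  assumes y: "has_Bochner_int M f y" and z: "has_Bochner_int M f z"
  shows "y = z"
proof -
  obtain g where g: "\<And>i::nat. simple_function M (g i)"
    and lim: "\<And>x. x \<in> space M \<Longrightarrow> (\<lambda>i. g i x) \<longlonglongrightarrow> f x"
    using y unfolding has_Bochner_int_def strongly_measurable_def by blast
  have meas: "(\<lambda>x. ennreal (norm (f x - h x))) \<in> borel_measurable M"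
    if h: "simple_function M h" for h
  proof (rule measurable_compose[OF _ measurable_ennreal], rule borel_measurable_LIMSEQ_metric)
    show "(\<lambda>x. norm (g i x - h x)) \<in> borel_measurable M" for i
      by (rule borel_measurable_simple_function, rule simple_function_compose2[OF g h])
    show "(\<lambda>i. norm (g i x - h x)) \<longlonglongrightarrow> norm (f x - h x)" if "x \<in> space M" for x
      by (intro tendsto_intros lim that)
  qed
  obtain s where s: "\<And>i::nat. Bochner_Integration.simple_bochner_integrable M (s i)"
    and s0: "(\<lambda>i. \<integral>\<^sup>+x. ennreal (norm (f x - s i x)) \<partial>M) \<longlonglongrightarrow> 0"
    and sy: "(\<lambda>i. Bochner_Integration.simple_bochner_integral M (s i)) \<longlonglongrightarrow> y"
    using y unfolding has_Bochner_int_def by blast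
  obtain t where t: "\<And>i::nat. Bochner_Integration.simple_bochner_integrable M (t i)"
    and t0: "(\<lambda>i. \<integral>\<^sup>+x. ennreal (norm (f x - t i x)) \<partial>M) \<longlonglongrightarrow> 0"
    and tz: "(\<lambda>i. Bochner_Integration.simple_bochner_integral M (t i)) \<longlonglongrightarrow> z"
    using z unfolding has_Bochner_int_def by blast
  have sf: "simple_function M (s i)" "simple_function M (t i)" for i
    using s[of i] t[of i] by (auto elim: simple_bochner_integrable.cases)
  let ?I = "\<lambda>i. Bochner_Integration.simple_bochner_integral M (s i) - Bochner_Integration.simple_bochner_integral M (t i)"
  have le: "ennreal (norm (?I i)) \<le>
      (\<integral>\<^sup>+x. ennreal (norm (f x - s i x)) \<partial>M) + (\<integral>\<^sup>+x. ennreal (norm (f x - t i x)) \<partial>M)" for i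
  proof -
    have d: "Bochner_Integration.simple_bochner_integrable M (\<lambda>x. s i x - t i x)"
      by (rule simple_bochner_integrable_compose2[OF _ s t]) simp
    have "?I i = Bochner_Integration.simple_bochner_integral M (\<lambda>x. s i x - t i x)"
      by (rule simple_bochner_integral_diff[OF s t, symmetric])
    then have "ennreal (norm (?I i)) \<le>
        ennreal (Bochner_Integration.simple_bochner_integral M (\<lambda>x. norm (s i x - t i x)))"
      using simple_bochner_integral_norm_bound[OF d] by (simp add: ennreal_leI)
    also have "\<dots> = (\<integral>\<^sup>+x. ennreal (norm (s i x - t i x)) \<partial>M)"
      by (rule simple_bochner_integral_eq_nn_integral[OF simple_bochner_integrable_compose2
            [OF _ s t, where p="\<lambda>a b. norm (a - b)"]]) simp_all
    also have "\<dots> \<le> (\<integral>\<^sup>+x. ennreal (norm (f x - s i x)) + ennreal (norm (f x - t i x)) \<partial>M)"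
    proof (rule nn_integral_mono)
      fix x
      have "norm (s i x - t i x) \<le> norm (f x - s i x) + norm (f x - t i x)"
        using norm_triangle_ineq4[of "f x - t i x" "f x - s i x"] by simp
      then show "ennreal (norm (s i x - t i x))
          \<le> ennreal (norm (f x - s i x)) + ennreal (norm (f x - t i x))"
        by (simp add: ennreal_leI flip: ennreal_plus)
    qed
    also have "\<dots> = (\<integral>\<^sup>+x. ennreal (norm (f x - s i x)) \<partial>M) + (\<integral>\<^sup>+x. ennreal (norm (f x - t i x)) \<partial>M)"
      by (intro nn_integral_add meas sf)
    finally show ?thesis .
  qed
  have "(\<lambda>i. ennreal (norm (?I i))) \<longlonglongrightarrow> 0"
    by (rule tendsto_sandwich[OF _ _ tendsto_const tendsto_add[OF s0 t0, simplified]])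
       (simp, rule always_eventually, rule allI, rule le)
  moreover have "(\<lambda>i. ennreal (norm (?I i))) \<longlonglongrightarrow> ennreal (norm (y - z))"
    by (intro tendsto_intros sy tz)
  ultimately have "ennreal (norm (y - z)) = 0"
    using LIMSEQ_unique by blast
  then show ?thesis by simp
qed

lemma has_Bochner_int_eq: "has_Bochner_int M f y \<Longrightarrow> Bochner_int M f = y"
  unfolding Bochner_int_def using has_Bochner_int_unique by (auto intro!: the_equality)

definition Lp_space :: "'s measure \<Rightarrow> real \<Rightarrow> ('s \<Rightarrow> 'a::real_normed_vector) set" where
  "Lp_space M p = {f. strongly_measurable M f \<and> (\<integral>\<^sup>+x. ennreal (norm (f x) powr p) \<partial>M) < \<infinity>}"

definition Lp_norm :: "'s measure \<Rightarrow> real \<Rightarrow> ('s \<Rightarrow> 'a::real_normed_vector) \<Rightarrow> real" where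
  "Lp_norm M p f = enn2real (\<integral>\<^sup>+x. ennreal (norm (f x) powr p) \<partial>M) powr (1 / p)"

abbreviation Rplus :: "real measure" where
  "Rplus \<equiv> lebesgue_on {0..}"


section \<open>The UMD property\<close>

text \<open>
  The condition on the integrals over \<open>A \<in> F (k - 1)\<close> says that the conditional expectation of
  \<open>d k\<close> given \<open>F (k - 1)\<close> vanishes.
\<close>
definition martingale_differences ::
  "'s measure \<Rightarrow> real \<Rightarrow> nat \<Rightarrow> (nat \<Rightarrow> 's measure) \<Rightarrow> (nat \<Rightarrow> 's \<Rightarrow> 'a::banach) \<Rightarrow> bool" where
  "martingale_differences M p N F d \<longleftrightarrow>
     filtration (space M) F \<and> (\<forall>k. subalgebra M (F k)) \<and>
     (\<forall>k\<in>{1..N}. d k \<in> Lp_space M p \<and> strongly_measurable (F k) (d k) \<and>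
        (\<forall>A\<in>sets (F (k - 1)). has_Bochner_int M (\<lambda>x. indicator A x *\<^sub>R d k x) 0))"

text \<open>
  A definition cannot quantify over the type of sample points. Measures on the reals lose nothing:
  finitely many strongly measurable functions take almost all their values in a separable closed
  subspace, so their joint law lives on a Polish space, which is Borel isomorphic to a Borel set of
  reals, and martingale differences stay so for the filtration which they generate.
\<close>
definition UMD :: "'a::banach itself \<Rightarrow> bool" where
  "UMD (X :: 'a itself) \<longleftrightarrow>
     (\<forall>p>1. \<exists>\<beta>. \<forall>(M :: real measure) N F (d :: nat \<Rightarrow> real \<Rightarrow> 'a) (\<epsilon> :: nat \<Rightarrow> real).
        prob_space M \<longrightarrow> martingale_differences M p N F d \<longrightarrow> (\<forall>k. \<epsilon> k \<in> {-1, 1}) \<longrightarrow>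
        Lp_norm M p (\<lambda>x. \<Sum>k=1..N. \<epsilon> k *\<^sub>R d k x) \<le> \<beta> * Lp_norm M p (\<lambda>x. \<Sum>k=1..N. d k x))"


section \<open>Walsh wave packets and quartiles\<close>

definition dyadic_interval :: "int \<Rightarrow> nat \<Rightarrow> real set" where
  "dyadic_interval k j = {2 powi k * real j ..< 2 powi k * (real j + 1)}"

definition rademacher :: "nat \<Rightarrow> real \<Rightarrow> real" where
  "rademacher i x = sgn (sin (2 * pi * 2 ^ i * x))"

definition walsh :: "nat \<Rightarrow> real \<Rightarrow> real" where
  "walsh n x = (\<Prod>i\<in>{i. bit n i}. rademacher i x)"

definition wave_packet :: "int \<Rightarrow> nat \<Rightarrow> nat \<Rightarrow> real \<Rightarrow> real" where
  "wave_packet k j n x =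
     (2 powi k) powr (- 1 / 2) * indicator (dyadic_interval k j) x * walsh n (x / 2 powi k)"

definition wpairing :: "(real \<Rightarrow> 'a::real_normed_vector) \<Rightarrow> (real \<Rightarrow> real) \<Rightarrow> 'a" where
  "wpairing f w = Bochner_int Rplus (\<lambda>x. w x *\<^sub>R f x)"

text \<open>
  \<open>Quartile k j n\<close> stands for the rectangle with \<open>I = [2\<^sup>k j, 2\<^sup>k (j + 1))\<close> and frequency interval
  \<open>2\<^sup>-\<^sup>k [4 n, 4 (n + 1))\<close>, which determines \<open>k\<close>, \<open>j\<close> and \<open>n\<close>.
\<close>
datatype quartile = Quartile (scale: int) (pos: nat) (freq: nat)

definition time_interval :: "quartile \<Rightarrow> real set" where
  "time_interval P = dyadic_interval (scale P) (pos P)"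

definition freq_interval :: "quartile \<Rightarrow> nat \<Rightarrow> real set" where
  "freq_interval P v = dyadic_interval (- scale P) (4 * freq P + v)"

definition tile :: "quartile \<Rightarrow> nat \<Rightarrow> (real \<times> real) set" where
  "tile P v = time_interval P \<times> freq_interval P v"

definition tile_packet :: "quartile \<Rightarrow> nat \<Rightarrow> real \<Rightarrow> real" where
  "tile_packet P v = wave_packet (scale P) (pos P) (4 * freq P + v)"

definition tile_le :: "nat \<Rightarrow> quartile \<Rightarrow> quartile \<Rightarrow> bool" where
  "tile_le v P P' \<longleftrightarrow>
     time_interval P \<subseteq> time_interval P' \<and> freq_interval P' v \<subseteq> freq_interval P v"

definition is_tree :: "nat \<Rightarrow> quartile set \<Rightarrow> bool" where
  "is_tree v \<T> \<longleftrightarrow> (\<exists>T. \<forall>P\<in>\<T>. tile_le v P T)"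

definition good_trees :: "nat \<Rightarrow> nat \<Rightarrow> quartile set set \<Rightarrow> bool" where
  "good_trees v u \<TT> \<longleftrightarrow> disjoint \<TT> \<and> (\<forall>\<T>\<in>\<TT>. is_tree v \<T>) \<and>
     (\<forall>\<T>\<in>\<TT>. \<forall>\<T>'\<in>\<TT>. \<forall>P\<in>\<T>. \<forall>P'\<in>\<T>'. P \<noteq> P' \<longrightarrow> tile P u \<inter> tile P' u = {})"


section \<open>Quartile type\<close>

definition tree_summand :: "nat \<Rightarrow> (real \<Rightarrow> 'a::real_normed_vector) \<Rightarrow> quartile \<Rightarrow> real \<Rightarrow> 'a" where
  "tree_summand u f P x = tile_packet P u x *\<^sub>R wpairing f (tile_packet P u)"

text \<open>The unconditional sum of a family of functions, with convergence in \<open>L\<^sup>q\<close>.\<close>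
definition has_Lp_sum ::
  "real \<Rightarrow> ('i \<Rightarrow> real \<Rightarrow> 'a::real_normed_vector) \<Rightarrow> (real \<Rightarrow> 'a) \<Rightarrow> 'i set \<Rightarrow> bool" where
  "has_Lp_sum q g S J \<longleftrightarrow> S \<in> Lp_space Rplus q \<and>
     ((\<lambda>F. Lp_norm Rplus q (\<lambda>x. S x - (\<Sum>i\<in>F. g i x))) \<longlongrightarrow> 0) (finite_subsets_at_top J)"

text \<open>
  Trees and collections of trees may be infinite. The sum over each tree is required to converge
  unconditionally in \<open>L\<^sup>q\<close>; on UMD spaces and for \<open>1 < q\<close> this is no extra condition, as it follows
  from the estimate for finite collections of finite trees. The range \<open>1 \<le> q\<close> is what makes the
  pairing with wave packets meaningful on \<open>L\<^sup>q\<close>.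
\<close>
definition quartile_type :: "real \<Rightarrow> 'a::banach itself \<Rightarrow> bool" where
  "quartile_type q (X :: 'a itself) \<longleftrightarrow> 1 \<le> q \<and>
     (\<exists>C. \<forall>u<4. \<forall>v<4. u \<noteq> v \<longrightarrow> (\<forall>\<TT>. good_trees v u \<TT> \<longrightarrow>
        (\<forall>f \<in> (Lp_space Rplus q :: (real \<Rightarrow> 'a) set). \<exists>S.
           (\<forall>\<T>\<in>\<TT>. has_Lp_sum q (tree_summand u f) (S \<T>) \<T>) \<and>
           (\<lambda>\<T>. Lp_norm Rplus q (S \<T>) powr q) summable_on \<TT> \<and>
           (\<Sum>\<^sub>\<infinity>\<T>\<in>\<TT>. Lp_norm Rplus q (S \<T>) powr q) powr (1 / q) \<le> C * Lp_norm Rplus q f)))"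


section \<open>The quartile operator\<close>

definition finite_dyadic_step :: "(real \<Rightarrow> 'a::zero) \<Rightarrow> bool" where
  "finite_dyadic_step f \<longleftrightarrow> (\<exists>R. \<forall>x>R. f x = 0) \<and>
     (\<exists>N::int. \<forall>j. \<forall>x\<in>dyadic_interval (- N) j. \<forall>y\<in>dyadic_interval (- N) j. f x = f y)"

text \<open>
  For finite dyadic step functions the family is absolutely summable at every point, by the decay
  of the terms as the length of the time interval tends to infinity; at scales below that of the
  step functions all terms vanish.
\<close>
definition quartile_operator ::
  "('a::complex_banach \<Rightarrow> 'b::complex_banach \<Rightarrow> 'c::complex_banach \<Rightarrow> complex) \<Rightarrow>
   (real \<Rightarrow> 'a) \<Rightarrow> (real \<Rightarrow> 'b) \<Rightarrow> real \<Rightarrow> ('c \<Rightarrow>\<^sub>L complex)" where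
  "quartile_operator \<Phi> f1 f2 x =
     (\<Sum>\<^sub>\<infinity>P\<in>UNIV. ((2 powi scale P) powr (- 1 / 2) * tile_packet P 3 x) *\<^sub>R
        Blinfun (\<Phi> (wpairing f1 (tile_packet P 1)) (wpairing f2 (tile_packet P 2))))"

text \<open>
  A bounded bilinear operator from \<open>L\<^sup>p\<^sup>1(X\<^sub>1) \<times> L\<^sup>p\<^sup>2(X\<^sub>2)\<close> into \<open>L\<^sup>r(X\<^sub>3\<^sup>*)\<close>, acting on representatives:
  it respects equality almost everywhere by additivity and the norm bound.
\<close>
definition bounded_bilinear_Lp ::
  "real \<Rightarrow> real \<Rightarrow> real \<Rightarrow>
   ((real \<Rightarrow> 'a::complex_banach) \<Rightarrow> (real \<Rightarrow> 'b::complex_banach) \<Rightarrow>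
      real \<Rightarrow> ('c::complex_banach \<Rightarrow>\<^sub>L complex)) \<Rightarrow> bool" where
  "bounded_bilinear_Lp p1 p2 r B \<longleftrightarrow>
     (\<forall>f\<in>Lp_space Rplus p1. \<forall>g\<in>Lp_space Rplus p2.
        B f g \<in> Lp_space Rplus r \<and> (\<forall>x\<ge>0. B f g x \<in> complex_dual)) \<and>
     (\<forall>f\<in>Lp_space Rplus p1. \<forall>f'\<in>Lp_space Rplus p1. \<forall>g\<in>Lp_space Rplus p2.
        AE x in Rplus. B (\<lambda>t. f t + f' t) g x = B f g x + B f' g x) \<and>
     (\<forall>f\<in>Lp_space Rplus p1. \<forall>g\<in>Lp_space Rplus p2. \<forall>g'\<in>Lp_space Rplus p2.
        AE x in Rplus. B f (\<lambda>t. g t + g' t) x = B f g x + B f g' x) \<and>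
     (\<forall>f\<in>Lp_space Rplus p1. \<forall>g\<in>Lp_space Rplus p2. \<forall>a.
        (AE x in Rplus. \<forall>y. B (\<lambda>t. scaleC a (f t)) g x y = a * B f g x y) \<and>
        (AE x in Rplus. \<forall>y. B f (\<lambda>t. scaleC a (g t)) x y = a * B f g x y)) \<and>
     (\<exists>C. \<forall>f\<in>Lp_space Rplus p1. \<forall>g\<in>Lp_space Rplus p2.
        Lp_norm Rplus r (B f g) \<le> C * Lp_norm Rplus p1 f * Lp_norm Rplus p2 g)"

end

theory Submission
  imports Defs
begin

text \<open>
  By duality and density it suffices to bound, uniformly in \<open>L\<close>, the trilinear form
  \<open>\<Sum> |I\<^sub>P| \<Phi>(a\<^sub>P, b\<^sub>P, c\<^sub>P)\<close> of the normalised packet coefficients of three sequences on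
  \<open>{0, \<dots>, 2\<^sup>L - 1}\<close>. The size of a sequence over a set of quartiles is a supremum over all
  subsets of all trees in that set; hence inserting signs into a tree sum costs only a constant,
  and no unconditionality of Walsh series is needed. On a tree, one coefficient is replaced by a
  stopped average and is thus bounded pointwise by the size; random signs decouple the other two
  functions, and \<open>x y \<le> 1 + x\<^sup>p + y\<^sup>q\<close> for \<open>p, q \<ge> 2\<close> turns the product into sizes.
  That \<open>q \<ge> 2\<close> on a nontrivial space follows from quartile type. Removing greedily
  the trees of large size, in the order of the frequencies of their tops, produces a good
  collection, so quartile type bounds the total length of the tops by the \<open>L\<^sup>q\<close> norm (weak type);
  truncating the sequence at the level under consideration upgrades this to \<open>L\<^sup>p\<close>, \<open>p > q\<close>, summed
  over dyadic levels. Since the reciprocals of the three exponents add up to 1, summing the tree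
  estimate over the levels gives the bound.
\<close>

section \<open>Discrete Walsh packets\<close>

text \<open>The condition \<open>r < q3'\<close> amounts to \<open>q3 < r'\<close>. With
  \<open>p3 = r'\<close> the three exponents therefore lie strictly above their quartile types, and
  this gap is what makes the series over levels geometric. At level \<open>k\<close> the sizes are
  compared with \<open>2 powr (k / p_j)\<close>; the product of the three thresholds is
  \<open>2 powr k\<close>, which is also the weight of the tops of that level. The outcome is a
  bound by the sum of three p-th powers, and homogeneity turns it into a product of norms. The
  obstacle inside a \<open>v\<close>-tree is that only tiles of index other than \<open>v\<close>
  are disjoint, while the packets of index \<open>v\<close> are pieces of one single wave. The slot
  carrying them (slot 1 if \<open>v = 0\<close>, an index that the form does not contain) cannot be
  handled by orthogonality; it gets a bounded substitute instead. The bound for that substitute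
  involves quartiles lying between two members of the tree, so the sets that remain after each
  removal have to be convex in the order. Removing everything under a top preserves this.\<close>

text \<open>The sign of the \<open>n\<close>-th Walsh packet of an interval of length \<open>2\<^sup>k\<close> on the unit cell \<open>[i, i + 1)\<close>.\<close>
fun walsh_sg :: "nat \<Rightarrow> nat \<Rightarrow> nat \<Rightarrow> real" where
  "walsh_sg 0 n i = 1"
| "walsh_sg (Suc k) n i = (if odd n \<and> odd (i div 2 ^ k) then -1 else 1) * walsh_sg k (n div 2) i"

lemma abs_walsh_sg [simp]: "\<bar>walsh_sg k n i\<bar> = 1"
  by (induction k arbitrary: n) (auto simp: abs_mult)

lemma walsh_sg_sq [simp]: "walsh_sg k n i * walsh_sg k n i = 1"
  by (metis abs_mult_self_eq abs_walsh_sg mult.right_neutral)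

text \<open>Low bits of the frequency are paired with high digits of the position. The lowest
  \<open>d\<close> bits of \<open>m\<close> see only \<open>i div 2 ^ k\<close>, the other bits only
  the digits inside a block of length \<open>2 ^ k\<close>. Hence a long packet, cut to a short
  block, is up to a constant sign the packet of the block at the coarsened frequency.\<close>

lemma walsh_sg_shift:
  obtains \<rho> where "\<And>i. walsh_sg (k + d) m i = \<rho> (i div 2 ^ k) * walsh_sg k (m div 2 ^ d) i"
    and "\<And>j. \<bar>\<rho> j\<bar> = (1::real)"
proof -
  have "\<exists>\<rho>. (\<forall>i. walsh_sg (k + d) m i = \<rho> (i div 2 ^ k) * walsh_sg k (m div 2 ^ d) i) \<and> (\<forall>j. \<bar>\<rho> j\<bar> = (1::real))"
  proof (induction d arbitrary: m)
    case 0
    show ?case by (rule exI[of _ "\<lambda>_. 1"]) simp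
  next
    case (Suc d)
    from Suc[of "m div 2"] obtain \<rho> where
      \<rho>: "\<And>i. walsh_sg (k + d) (m div 2) i = \<rho> (i div 2 ^ k) * walsh_sg k (m div 2 div 2 ^ d) i" "\<And>j. \<bar>\<rho> j\<bar> = (1::real)"
      by blast
    show ?case
      by (rule exI[of _ "\<lambda>j. (if odd m \<and> odd (j div 2 ^ d) then -1 else 1) * \<rho> j"])
        (simp add: \<rho> div_mult2_eq[of m 2] abs_mult, metis div_mult2_eq power_add)
  qed
  then show thesis using that by blast
qed

definition dyadic_block :: "nat \<Rightarrow> nat \<Rightarrow> nat set" where
  "dyadic_block k j = {i. i div 2 ^ k = j}"

lemma dyadic_block_eq: "dyadic_block k j = {j * 2 ^ k..<(j + 1) * 2 ^ k}"
proof (rule set_eqI)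
  fix i
  have "i div 2 ^ k = j \<longleftrightarrow> j \<le> i div 2 ^ k \<and> i div 2 ^ k < j + 1" by auto
  then show "i \<in> dyadic_block k j \<longleftrightarrow> i \<in> {j * 2 ^ k..<(j + 1) * 2 ^ k}"
    by (simp only: dyadic_block_def mem_Collect_eq atLeastLessThan_iff less_eq_div_iff_mult_less_eq
        div_less_iff_less_mult zero_less_numeral zero_less_power)
qed

lemma finite_dyadic_block [simp]: "finite (dyadic_block k j)"
  by (simp add: dyadic_block_eq)

lemma card_dyadic_block [simp]: "card (dyadic_block k j) = 2 ^ k"
  by (simp add: dyadic_block_eq)

lemma dyadic_block_Suc: "dyadic_block (Suc k) j = dyadic_block k (2 * j) \<union> dyadic_block k (2 * j + 1)"
  unfolding dyadic_block_def by (auto simp: mult.commute[of 2 "2 ^ k"] div_mult2_eq)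

text \<open>
  \<open>DQ s j n\<close> is the quartile with time interval \<open>[2\<^sup>s j, 2\<^sup>s (j + 1))\<close> and frequency interval
  \<open>2\<^bsup>-s\<^esup> [4 n, 4 (n + 1))\<close>; functions are sequences, constant on unit cells, and \<open>qbox L\<close> is the
  set of quartiles inside \<open>[0, 2\<^sup>L) \<times> [0, 1)\<close>, the only ones that such a sequence sees.
\<close>
datatype dquart = DQ (sc: nat) (ps: nat) (fr: nat)

definition cells :: "dquart \<Rightarrow> nat set" where
  "cells P = dyadic_block (sc P) (ps P)"

definition qbox :: "nat \<Rightarrow> dquart set" where
  "qbox L = {P. 2 \<le> sc P \<and> sc P \<le> L \<and> ps P < 2 ^ (L - sc P) \<and> fr P < 2 ^ (sc P - 2)}"

text \<open>Nesting of dyadic intervals is integer division of indices. Going from \<open>P\<close>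
  to \<open>Q\<close>, time gets coarser and frequency finer, so the division hits the position of
  \<open>P\<close> but the frequency of \<open>Q\<close>. \<open>qle\<close> orders whole quartiles,
  \<open>qlev v\<close> orders their tiles of index \<open>v\<close>.\<close>

definition qle :: "dquart \<Rightarrow> dquart \<Rightarrow> bool" where
  "qle P Q \<longleftrightarrow> sc P \<le> sc Q \<and> ps P div 2 ^ (sc Q - sc P) = ps Q \<and> fr Q div 2 ^ (sc Q - sc P) = fr P"

definition qlev :: "nat \<Rightarrow> dquart \<Rightarrow> dquart \<Rightarrow> bool" where
  "qlev v P Q \<longleftrightarrow> sc P \<le> sc Q \<and> ps P div 2 ^ (sc Q - sc P) = ps Q \<and>
     (4 * fr Q + v) div 2 ^ (sc Q - sc P) = 4 * fr P + v"

definition packet :: "nat \<Rightarrow> dquart \<Rightarrow> nat \<Rightarrow> real" where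
  "packet u P i = indicator (cells P) i * walsh_sg (sc P) (4 * fr P + u) i"

text \<open>Packets here take the values \<open>1\<close>, \<open>-1\<close> and \<open>0\<close>,
  and the coefficient carries the full factor \<open>1 / |I|\<close>. The product of the two is then
  the projection \<open><f,w> w\<close> of the normalised packet, without square roots.\<close>

definition avg :: "nat \<Rightarrow> (nat \<Rightarrow> 'a::real_normed_vector) \<Rightarrow> dquart \<Rightarrow> 'a" where
  "avg u f P = (1 / 2 ^ sc P) *\<^sub>R (\<Sum>i\<in>cells P. walsh_sg (sc P) (4 * fr P + u) i *\<^sub>R f i)"

definition tree_sum :: "nat \<Rightarrow> (nat \<Rightarrow> 'a::real_normed_vector) \<Rightarrow> dquart set \<Rightarrow> nat \<Rightarrow> 'a" where
  "tree_sum u f B i = (\<Sum>P\<in>B. packet u P i *\<^sub>R avg u f P)"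

lemma finite_cells [simp]: "finite (cells P)"
  by (simp add: cells_def)

lemma card_cells [simp]: "card (cells P) = 2 ^ sc P"
  by (simp add: cells_def)

lemma finite_qbox [simp]: "finite (qbox L)"
proof -
  have "qbox L \<subseteq> (\<lambda>(k, j, n). DQ k j n) ` ({..L} \<times> {..2 ^ L} \<times> {..2 ^ L})"
  proof
    fix P assume "P \<in> qbox L"
    then have P: "sc P \<le> L" "ps P < 2 ^ (L - sc P)" "fr P < 2 ^ (sc P - 2)" by (auto simp: qbox_def)
    have "(2::nat) ^ (L - sc P) \<le> 2 ^ L" "(2::nat) ^ (sc P - 2) \<le> 2 ^ L"
      using P by (auto intro!: power_increasing)
    with P have "ps P \<le> 2 ^ L" "fr P \<le> 2 ^ L" by linarith+
    with P show "P \<in> (\<lambda>(k, j, n). DQ k j n) ` ({..L} \<times> {..2 ^ L} \<times> {..2 ^ L})"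
      by (intro image_eqI[of _ _ "(sc P, ps P, fr P)"]) auto
  qed
  then show ?thesis by (rule finite_subset) auto
qed

lemma cells_qbox: "P \<in> qbox L \<Longrightarrow> cells P \<subseteq> {..<2 ^ L}"
proof
  fix i assume P: "P \<in> qbox L" and i: "i \<in> cells P"
  from i have "i < (ps P + 1) * 2 ^ sc P" by (simp add: cells_def dyadic_block_eq)
  also have "\<dots> \<le> 2 ^ (L - sc P) * 2 ^ sc P"
    using P by (intro mult_right_mono) (auto simp: qbox_def)
  also have "\<dots> = 2 ^ L" using P by (simp add: qbox_def flip: power_add)
  finally show "i \<in> {..<2 ^ L}" by simp
qed

lemma div_pow_diff: "a \<le> b \<Longrightarrow> b \<le> c \<Longrightarrow> (x::nat) div 2 ^ (b - a) div 2 ^ (c - b) = x div 2 ^ (c - a)"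
  by (simp flip: div_mult2_eq power_add)

lemma div_pow_add: "(x::nat) div 2 ^ a div 2 ^ b = x div 2 ^ (a + b)"
  by (simp flip: div_mult2_eq power_add)

text \<open>The index \<open>v\<close> sits in the two lowest binary digits, so two halvings already
  forget it: a quartile at least four times longer has its whole frequency interval inside one tile
  of the shorter one.\<close>

lemma div4_shift: "v < 4 \<Longrightarrow> (4 * n + v) div 2 ^ (e + 2) = (n::nat) div 2 ^ e"
proof -
  assume "v < 4"
  have "(4 * n + v) div 2 ^ (e + 2) = (4 * n + v) div (4 * 2 ^ e)" by (simp add: power_add mult.commute)
  also have "\<dots> = (4 * n + v) div 4 div 2 ^ e" by (rule div_mult2_eq)
  also have "(4 * n + v) div 4 = n" using \<open>v < 4\<close> by simp
  finally show ?thesis .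
qed

section \<open>The two orders on quartiles and the geometry of trees\<close>

lemma cells_mono: "sc P \<le> sc Q \<Longrightarrow> ps P div 2 ^ (sc Q - sc P) = ps Q \<Longrightarrow> cells P \<subseteq> cells Q"
  unfolding cells_def dyadic_block_def by (clarsimp, metis div_pow_add le_add_diff_inverse)

lemma qlev_cells: "qlev v P Q \<Longrightarrow> cells P \<subseteq> cells Q"
  using cells_mono[of P Q] by (simp add: qlev_def)

lemma qle_refl [simp]: "qle P P" and qlev_refl [simp]: "qlev v P P"
  by (auto simp: qle_def qlev_def)

lemma qlev_qle: assumes "qlev v P Q" "v < 4" shows "qle P Q"
proof -
  have "(4 * fr Q + v) div 2 ^ (sc Q - sc P) div 4 = fr P" using assms by (simp add: qlev_def)
  moreover have "(4 * fr Q + v) div 2 ^ (sc Q - sc P) div 4 = (4 * fr Q + v) div 4 div 2 ^ (sc Q - sc P)"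
    by (metis div_mult2_eq mult.commute)
  ultimately show ?thesis using assms by (auto simp: qle_def qlev_def)
qed

text \<open>This is what splits everything under a top into four \<open>v\<close>-trees. For equal
  scales any \<open>v\<close> will do. If the scales differ by one, \<open>Q\<close> covers the
  lower or the upper half of the frequencies of \<open>P\<close>, and \<open>v\<close> is 0 or 3. If
  they differ more, \<open>Q\<close> fits into a single tile of \<open>P\<close>, whose index is
  \<open>v\<close>.\<close>

lemma qle_qlev_ex: assumes "qle P Q" shows "\<exists>v<4. qlev v P Q"
proof -
  define d where "d = sc Q - sc P"
  have *: "fr Q div 2 ^ d = fr P" using assms by (simp add: qle_def d_def)
  have "d = 0 \<or> d = 1 \<or> d = (d - 2) + 2" by arith
  then consider "d = 0" | "d = 1" | e where "d = e + 2" by blast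
  then have "\<exists>v<4. (4 * fr Q + v) div 2 ^ d = 4 * fr P + v"
  proof cases
    case 1 then show ?thesis using * by (intro exI[of _ 0]) auto
  next
    case 2
    then have "fr Q = 2 * fr P \<or> fr Q = 2 * fr P + 1" using * by auto
    then show ?thesis
    proof
      assume "fr Q = 2 * fr P" then show ?thesis using 2 by (intro exI[of _ 0]) auto
    next
      assume "fr Q = 2 * fr P + 1" then show ?thesis using 2 by (intro exI[of _ 3]) auto
    qed
  next
    case 3
    have e: "(4 * fr Q + v) div 2 ^ d = fr Q div 2 ^ e" if "v < 4" for v
      using div4_shift[OF that, of "fr Q" e] by (simp add: 3)
    have "fr Q div 2 ^ e div 4 = fr P" using * by (simp add: 3 power_add) (metis div_mult2_eq mult.commute)
    then have "fr Q div 2 ^ e = 4 * fr P + fr Q div 2 ^ e mod 4"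
      by (metis mult_div_mod_eq)
    then show ?thesis using e[of "fr Q div 2 ^ e mod 4"]
      by (intro exI[of _ "fr Q div 2 ^ e mod 4"]) simp
  qed
  then show ?thesis using assms by (auto simp: qlev_def qle_def d_def)
qed

lemma qle_trans: assumes "qle P Q" "qle Q R" shows "qle P R"
proof -
  have a: "sc P \<le> sc Q" "sc Q \<le> sc R" using assms by (auto simp: qle_def)
  have "fr R div 2 ^ (sc R - sc P) = fr R div 2 ^ (sc R - sc Q) div 2 ^ (sc Q - sc P)"
    using a by (simp add: div_pow_add)
  then show ?thesis using assms a div_pow_diff[OF a, of "ps P"] by (auto simp: qle_def)
qed

text \<open>If tile \<open>u\<close> of the longer quartile lies in tile \<open>u\<close> of the
  shorter one, then all other tiles of the longer one stay too close to follow. For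
  \<open>d \<ge> 2\<close> all four lie in that same tile \<open>u\<close>. For \<open>d = 1\<close>
  only \<open>u = 0\<close> and \<open>u = 3\<close> can occur, and the longer quartile fills the
  lower or the upper half. The direction of the strict inequality is what the selection of trees
  relies on.\<close>

lemma freq_gap:
  fixes u v :: nat
  assumes m: "(4 * n' + u) div 2 ^ d = 4 * n + u" and "u < 4" "v < 4" "d > 0"
  shows "u < v \<Longrightarrow> (4 * n' + v) div 2 ^ d < 4 * n + v"
    and "v < u \<Longrightarrow> 4 * n + v < (4 * n' + v) div 2 ^ d"
proof -
  have "d = 1 \<or> d = (d - 2) + 2" using \<open>d > 0\<close> by arith
  then consider "d = 1" | e where "d = e + 2" by blast
  then have "(u < v \<longrightarrow> (4 * n' + v) div 2 ^ d < 4 * n + v) \<and> (v < u \<longrightarrow> 4 * n + v < (4 * n' + v) div 2 ^ d)"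
  proof cases
    case 1
    have "u = 0 \<or> u = 1 \<or> u = 2 \<or> u = 3" "v = 0 \<or> v = 1 \<or> v = 2 \<or> v = 3"
      using assms(2,3) by arith+
    moreover have h: "(4 * n' + w) div 2 = 2 * n' + w div 2" for w :: nat by presburger
    then have "2 * n' + u div 2 = 4 * n + u" using m 1 by simp
    ultimately have "(u < v \<longrightarrow> 2 * n' + v div 2 < 4 * n + v) \<and> (v < u \<longrightarrow> 4 * n + v < 2 * n' + v div 2)"
      by - (elim disjE; simp; presburger?)
    then show ?thesis using 1 h by simp
  next
    case 2
    have e: "(4 * n' + v) div 2 ^ d = n' div 2 ^ e" if "v < 4" for v
      using div4_shift[OF that, of "n'" e] by (simp add: 2)
    show ?thesis using e[OF assms(2)] e[OF assms(3)] m by auto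
  qed
  then show "u < v \<Longrightarrow> (4 * n' + v) div 2 ^ d < 4 * n + v"
    and "v < u \<Longrightarrow> 4 * n + v < (4 * n' + v) div 2 ^ d" by blast+
qed

lemma qlev_eq_scale: "qlev v P Q \<Longrightarrow> sc P = sc Q \<Longrightarrow> P = Q"
  by (cases P; cases Q) (auto simp: qlev_def)

text \<open>Two members of a \<open>v\<close>-tree have comparable frequencies at index
  \<open>v\<close>, both containing that of the top. By \<open>freq_gap\<close> their frequencies at
  another index \<open>u\<close> can then not be nested in the same way unless the scales agree. A
  \<open>v\<close>-tree is thus lacunary at every other index.\<close>

lemma same_tree_disjoint:
  assumes "qlev v P T" "qlev v Q T" "qlev u P Q" "u \<noteq> v" "u < 4" "v < 4"
  shows "P = Q"
proof (rule ccontr)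
  assume "P \<noteq> Q"
  with assms(3) have lt: "sc P < sc Q"
    using qlev_eq_scale by (metis le_neq_implies_less qlev_def)
  have a: "sc Q \<le> sc T" using assms(2) by (simp add: qlev_def)
  have "(4 * fr Q + v) div 2 ^ (sc Q - sc P) = (4 * fr T + v) div 2 ^ (sc T - sc Q) div 2 ^ (sc Q - sc P)"
    using assms(2) by (simp add: qlev_def)
  also have "\<dots> = (4 * fr T + v) div 2 ^ (sc T - sc P)" using a lt by (simp add: div_pow_add)
  also have "\<dots> = 4 * fr P + v" using assms(1) by (simp add: qlev_def)
  finally have "(4 * fr Q + v) div 2 ^ (sc Q - sc P) = 4 * fr P + v" .
  moreover have "(4 * fr Q + u) div 2 ^ (sc Q - sc P) = 4 * fr P + u"
    using assms(3) by (simp add: qlev_def)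
  ultimately show False using freq_gap[of "fr Q" u "sc Q - sc P" "fr P" v] assms(4-6) lt
    by (metis less_irrefl linorder_neqE_nat zero_less_diff)
qed

text \<open>The lower endpoint of the frequency interval of tile \<open>v\<close> of
  \<open>T\<close>, in units of \<open>2 powr (- L)\<close>. For \<open>sc T \<le> L\<close> it is
  an integer, and tops of different scales become comparable.\<close>

definition fkey :: "nat \<Rightarrow> nat \<Rightarrow> dquart \<Rightarrow> nat" where
  "fkey L v T = (4 * fr T + v) * 2 ^ (L - sc T)"

lemma fkey_div:
  assumes "qlev v P T" "sc T \<le> L"
  shows "fkey L v T div 2 ^ (L - sc P) = 4 * fr P + v"
proof -
  have le: "sc P \<le> sc T" using assms by (simp add: qlev_def)
  have "fkey L v T div 2 ^ (L - sc P) = fkey L v T div 2 ^ (L - sc T) div 2 ^ (sc T - sc P)"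
    using le assms(2) by (simp add: div_pow_add)
  also have "\<dots> = 4 * fr P + v" using assms by (simp add: fkey_def qlev_def)
  finally show ?thesis .
qed

text \<open>At the frequency resolution of \<open>P\<close>, the key of \<open>T\<close> reads the
  tile \<open>v\<close> of \<open>P\<close>, and the key of \<open>T'\<close> the place where tile
  \<open>v\<close> of \<open>P'\<close> lies; \<open>freq_gap\<close> separates the two. In the
  greedy selection both orders are thereby excluded: if \<open>T'\<close> came first,
  \<open>P\<close> had already been removed with everything under \<open>T'\<close>; if
  \<open>T\<close> came first, the keys contradict its extremality.\<close>

lemma conflict:
  assumes P: "qlev v P T" and P': "qlev v P' T'" and u: "qlev u P P'" and ne: "P \<noteq> P'"
    and uv: "u \<noteq> v" "u < 4" "v < 4" and T: "sc T \<le> L" "sc T' \<le> L"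
  shows "qle P T'" and "u < v \<Longrightarrow> fkey L v T' < fkey L v T" and "v < u \<Longrightarrow> fkey L v T < fkey L v T'"
proof -
  show "qle P T'" using qlev_qle[OF u uv(2)] qlev_qle[OF P' uv(3)] qle_trans by blast
  have lt: "sc P < sc P'" using u ne qlev_eq_scale by (metis le_neq_implies_less qlev_def)
  have "fkey L v T' div 2 ^ (L - sc P) = fkey L v T' div 2 ^ (L - sc P') div 2 ^ (sc P' - sc P)"
    using lt T P' by (simp add: div_pow_add qlev_def)
  also have "\<dots> = (4 * fr P' + v) div 2 ^ (sc P' - sc P)" by (simp add: fkey_div[OF P' T(2)])
  finally have 1: "fkey L v T' div 2 ^ (L - sc P) = (4 * fr P' + v) div 2 ^ (sc P' - sc P)" .
  have 2: "fkey L v T div 2 ^ (L - sc P) = 4 * fr P + v" by (rule fkey_div[OF P T(1)])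
  have g: "(4 * fr P' + u) div 2 ^ (sc P' - sc P) = 4 * fr P + u" using u by (simp add: qlev_def)
  have lt0: "0 < sc P' - sc P" using lt by simp
  show "fkey L v T' < fkey L v T" if "u < v"
    using freq_gap(1)[OF g uv(2,3) lt0 that] 1 2 by (metis div_le_mono linorder_not_le)
  show "fkey L v T < fkey L v T'" if "v < u"
    using freq_gap(2)[OF g uv(2,3) lt0 that] 1 2 by (metis div_le_mono linorder_not_le)
qed

section \<open>The tree estimate\<close>

text \<open>The quantification over arbitrary subsets \<open>B\<close> of trees is what makes sizes stable under signs.\<close>
definition size_le :: "nat \<Rightarrow> real \<Rightarrow> (nat \<Rightarrow> 'a::real_normed_vector) \<Rightarrow> dquart set \<Rightarrow> real \<Rightarrow> bool" where
  "size_le L q f A \<mu> \<longleftrightarrow> (\<forall>u<4. \<forall>v<4. u \<noteq> v \<longrightarrow> (\<forall>T\<in>qbox L. \<forall>B. B \<subseteq> A \<longrightarrow> (\<forall>P\<in>B. qlev v P T) \<longrightarrow>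
     (\<Sum>x<2 ^ L. norm (tree_sum u f B x) powr q) \<le> \<mu> powr q * 2 ^ sc T))"

lemma size_le_D:
  "size_le L q f A \<mu> \<Longrightarrow> u < 4 \<Longrightarrow> v < 4 \<Longrightarrow> u \<noteq> v \<Longrightarrow> T \<in> qbox L \<Longrightarrow> B \<subseteq> A \<Longrightarrow> (\<And>P. P \<in> B \<Longrightarrow> qlev v P T) \<Longrightarrow>
    (\<Sum>x<2 ^ L. norm (tree_sum u f B x) powr q) \<le> \<mu> powr q * 2 ^ sc T"
  unfolding size_le_def by blast

lemma size_le_subset: "size_le L q f A \<mu> \<Longrightarrow> A' \<subseteq> A \<Longrightarrow> size_le L q f A' \<mu>"
  unfolding size_le_def by (meson subset_trans)

lemma abs_packet: "\<bar>packet u P x\<bar> = indicator (cells P) x"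
  by (simp add: packet_def abs_mult)

lemma sum_indicator_cells:
  fixes g :: "nat \<Rightarrow> 'a::real_vector"
  shows "P \<in> qbox L \<Longrightarrow> (\<Sum>x<2 ^ L. indicator (cells P) x *\<^sub>R g x) = (\<Sum>x\<in>cells P. g x)"
  by (rule sum.mono_neutral_cong_right) (use cells_qbox[of P L] in \<open>auto simp: indicator_def\<close>)

text \<open>One quartile is a tree with itself as top, for any \<open>v\<close> different from
  \<open>u\<close>; its tree sum has constant norm on its cells.\<close>

lemma size_le_single:
  assumes "size_le L q f A \<mu>" "0 \<le> \<mu>" "0 < q" "P \<in> A" "A \<subseteq> qbox L" "u < 4"
  shows "norm (avg u f P) \<le> \<mu>"
proof -
  define v where "v = (if u = 0 then 1 else 0 :: nat)"
  have v: "v < 4" "u \<noteq> v" by (auto simp: v_def)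
  have P: "P \<in> qbox L" using assms by auto
  have "(\<Sum>x<2 ^ L. norm (tree_sum u f {P} x) powr q) \<le> \<mu> powr q * 2 ^ sc P"
    using assms v P by (intro size_le_D) auto
  moreover have "(\<Sum>x<2 ^ L. norm (tree_sum u f {P} x) powr q) = (\<Sum>x<2 ^ L. indicator (cells P) x *\<^sub>R norm (avg u f P) powr q)"
    by (intro sum.cong refl) (simp add: tree_sum_def abs_packet indicator_def)
  ultimately have "2 ^ sc P * norm (avg u f P) powr q \<le> \<mu> powr q * 2 ^ sc P"
    unfolding sum_indicator_cells[OF P] by simp
  then have "norm (avg u f P) powr q \<le> \<mu> powr q" by (simp add: mult.commute)
  then show ?thesis using assms(2,3) powr_less_mono2[of q \<mu> "norm (avg u f P)"] by (meson linorder_not_le)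
qed

lemma powr_sum_le:
  assumes "0 \<le> (a::real)" "0 \<le> b" "0 \<le> q"
  shows "(a + b) powr q \<le> 2 powr q * (a powr q + b powr q)"
proof -
  have "(a + b) powr q \<le> (2 * max a b) powr q" using assms by (intro powr_mono2) auto
  also have "\<dots> = 2 powr q * (max a b) powr q" using assms by (simp add: powr_mult)
  also have "(max a b) powr q \<le> a powr q + b powr q" by (auto simp: max_def)
  finally show ?thesis by simp
qed

lemma norm_powr_add_le:
  fixes a b :: "'a::real_normed_vector"
  assumes "0 \<le> q"
  shows "norm (a + b) powr q \<le> 2 powr q * (norm a powr q + norm b powr q)"
  using powr_sum_le[of "norm a" "norm b" q] powr_mono2[OF assms norm_ge_zero norm_triangle_ineq[of a b]] assms
  by simp

lemma norm_powr_diff_le: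
  fixes a b :: "'a::real_normed_vector"
  assumes "0 \<le> q"
  shows "norm (a - b) powr q \<le> 2 powr q * (norm a powr q + norm b powr q)"
  using norm_powr_add_le[OF assms, of a "- b"] by simp

section \<open>Random signs\<close>

definition sgn_of :: "'i set \<Rightarrow> 'i \<Rightarrow> real" where
  "sgn_of E P = (if P \<in> E then 1 else -1)"

text \<open>The positive and the negative part of the sum run over two subsets of the same tree, and
  size controls all subsets. The constant is \<open>2 powr q\<close> from the quasi-triangle
  inequality times two parts.\<close>

lemma size_le_signed:
  assumes "size_le L q f A \<mu>" "0 \<le> q" "u < 4" "v < 4" "u \<noteq> v" "T \<in> qbox L" "B \<subseteq> A" "finite B" "\<And>P. P \<in> B \<Longrightarrow> qlev v P T"
  shows "(\<Sum>x<2 ^ L. norm (\<Sum>P\<in>B. sgn_of E P *\<^sub>R packet u P x *\<^sub>R avg u f P) powr q) \<le> 2 powr (q + 1) * (\<mu> powr q * 2 ^ sc T)"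
proof -
  have eq: "(\<Sum>P\<in>B. sgn_of E P *\<^sub>R packet u P x *\<^sub>R avg u f P) = tree_sum u f (B \<inter> E) x - tree_sum u f (B - E) x" for x
  proof -
    have "(\<Sum>P\<in>B. sgn_of E P *\<^sub>R packet u P x *\<^sub>R avg u f P) =
       (\<Sum>P\<in>B \<inter> E. sgn_of E P *\<^sub>R packet u P x *\<^sub>R avg u f P) + (\<Sum>P\<in>B - E. sgn_of E P *\<^sub>R packet u P x *\<^sub>R avg u f P)"
      using \<open>finite B\<close> by (subst sum.union_disjoint[symmetric]) (auto intro: sum.cong)
    also have "(\<Sum>P\<in>B \<inter> E. sgn_of E P *\<^sub>R packet u P x *\<^sub>R avg u f P) = tree_sum u f (B \<inter> E) x"
      unfolding tree_sum_def by (intro sum.cong) (auto simp: sgn_of_def)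
    also have "(\<Sum>P\<in>B - E. sgn_of E P *\<^sub>R packet u P x *\<^sub>R avg u f P) = - tree_sum u f (B - E) x"
      unfolding tree_sum_def sum_negf[symmetric] by (intro sum.cong) (auto simp: sgn_of_def)
    finally show ?thesis by simp
  qed
  have "(\<Sum>x<2 ^ L. norm (\<Sum>P\<in>B. sgn_of E P *\<^sub>R packet u P x *\<^sub>R avg u f P) powr q)
    \<le> (\<Sum>x<2 ^ L. 2 powr q * (norm (tree_sum u f (B \<inter> E) x) powr q + norm (tree_sum u f (B - E) x) powr q))"
    unfolding eq by (intro sum_mono norm_powr_diff_le assms)
  also have "\<dots> = 2 powr q * ((\<Sum>x<2 ^ L. norm (tree_sum u f (B \<inter> E) x) powr q) + (\<Sum>x<2 ^ L. norm (tree_sum u f (B - E) x) powr q))"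
    by (simp only: sum_distrib_left[symmetric] sum.distrib)
  also have "\<dots> \<le> 2 powr q * (\<mu> powr q * 2 ^ sc T + \<mu> powr q * 2 ^ sc T)"
    using assms by (intro mult_left_mono add_mono size_le_D[OF assms(1), of u v]) auto
  also have "\<dots> = 2 powr (q + 1) * (\<mu> powr q * 2 ^ sc T)" by (simp add: powr_add)
  finally show ?thesis .
qed

text \<open>A choice of signs is coded by the set on which it is \<open>1\<close>, so a sum over
  \<open>Pow B\<close> is \<open>2 ^ card B\<close> times an expectation. Toggling the membership of
  \<open>P\<close> flips exactly one of two distinct signs, and the sum cancels.\<close>

lemma sum_Pow_sgn:
  assumes "finite B" "P \<in> B" "Q \<in> B"
  shows "(\<Sum>E\<in>Pow B. sgn_of E P * sgn_of E Q) = (if P = Q then 2 ^ card B else 0)"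
proof (cases "P = Q")
  case True
  then show ?thesis using assms by (simp add: sgn_of_def if_distrib if_distribR card_Pow cong: if_cong)
next
  case False
  let ?t = "\<lambda>E. if P \<in> E then E - {P} else insert P E"
  have "(\<Sum>E\<in>Pow B. sgn_of E P * sgn_of E Q) = (\<Sum>E\<in>Pow B. - (sgn_of E P * sgn_of E Q))"
    using False assms by (intro sum.reindex_bij_witness[of _ ?t ?t]) (auto simp: sgn_of_def split: if_splits)
  then show ?thesis using False by (simp add: sum_negf)
qed

text \<open>Orthogonality of the signs kills the off-diagonal terms. A diagonal sum of products thus
  becomes an average of products of two signed sums, each of which is a tree sum of one
  function.\<close>

lemma sum_Pow_bilinear:
  fixes \<Psi> :: "'b::real_vector \<Rightarrow> 'c::real_vector \<Rightarrow> 'd::real_vector"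
  assumes "bilinear \<Psi>" "finite B"
  shows "(\<Sum>E\<in>Pow B. \<Psi> (\<Sum>P\<in>B. sgn_of E P *\<^sub>R a P) (\<Sum>P\<in>B. sgn_of E P *\<^sub>R b P)) =
     2 ^ card B *\<^sub>R (\<Sum>P\<in>B. \<Psi> (a P) (b P))"
proof -
  have "(\<Sum>E\<in>Pow B. \<Psi> (\<Sum>P\<in>B. sgn_of E P *\<^sub>R a P) (\<Sum>P\<in>B. sgn_of E P *\<^sub>R b P)) =
     (\<Sum>E\<in>Pow B. \<Sum>(P, Q)\<in>B \<times> B. (sgn_of E P * sgn_of E Q) *\<^sub>R \<Psi> (a P) (b Q))"
    using assms by (intro sum.cong refl) (simp add: bilinear_sum bilinear_lmul bilinear_rmul mult.commute)
  also have "\<dots> = (\<Sum>(P, Q)\<in>B \<times> B. (\<Sum>E\<in>Pow B. sgn_of E P * sgn_of E Q) *\<^sub>R \<Psi> (a P) (b Q))"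
    by (subst sum.swap) (simp add: scaleR_sum_left split_def)
  also have "\<dots> = (\<Sum>(P, Q)\<in>B \<times> B. if P = Q then 2 ^ card B *\<^sub>R \<Psi> (a P) (b Q) else 0)"
    using assms by (intro sum.cong refl) (auto simp: sum_Pow_sgn)
  also have "\<dots> = (\<Sum>P\<in>B. \<Sum>Q\<in>B. if P = Q then 2 ^ card B *\<^sub>R \<Psi> (a P) (b Q) else 0)"
    by (simp add: sum.cartesian_product)
  also have "\<dots> = 2 ^ card B *\<^sub>R (\<Sum>P\<in>B. \<Psi> (a P) (b P))"
    using assms by (simp add: scaleR_sum_right)
  finally show ?thesis .
qed

text \<open>Multiplication by fixed signs is a translation of the cube of signs, namely the
  symmetric difference with the set of negative ones. An average over the cube does not see
  it.\<close>

lemma sum_Pow_shift: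
  fixes c :: "'i \<Rightarrow> 'b::real_vector" and \<phi> :: "'b \<Rightarrow> real"
  assumes \<sigma>: "\<And>P. P \<in> B \<Longrightarrow> \<bar>\<sigma> P\<bar> = (1::real)"
  shows "(\<Sum>E\<in>Pow B. \<phi> (\<Sum>P\<in>B. sgn_of E P *\<^sub>R \<sigma> P *\<^sub>R c P)) = (\<Sum>E\<in>Pow B. \<phi> (\<Sum>P\<in>B. sgn_of E P *\<^sub>R c P))"
proof -
  define S where "S = {P \<in> B. \<sigma> P = -1}"
  let ?t = "\<lambda>E. (E - S) \<union> (S - E)"
  have *: "sgn_of E P * \<sigma> P = sgn_of (?t E) P" if "P \<in> B" for E P
    using \<sigma>[OF that] that by (auto simp: sgn_of_def S_def abs_if split: if_splits)
  have eq: "(\<Sum>P\<in>B. sgn_of E P *\<^sub>R \<sigma> P *\<^sub>R c P) = (\<Sum>P\<in>B. sgn_of (?t E) P *\<^sub>R c P)" for E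
    by (intro sum.cong refl) (metis * scaleR_scaleR)
  have SB: "S \<subseteq> B" by (auto simp: S_def)
  show ?thesis unfolding eq
    using SB by (intro sum.reindex_bij_witness[of _ ?t ?t]) auto
qed

section \<open>Stopped averages\<close>

definition hit :: "dquart set \<Rightarrow> nat \<Rightarrow> nat \<Rightarrow> bool" where
  "hit B k j \<longleftrightarrow> (\<exists>P\<in>B. sc P \<le> k \<and> ps P div 2 ^ (k - sc P) = j)"

text \<open>The averages of \<open>g\<close> over the maximal blocks that contain no time interval of \<open>B\<close>.\<close>
definition stopped :: "dquart set \<Rightarrow> (nat \<Rightarrow> 'a::real_normed_vector) \<Rightarrow> nat \<Rightarrow> 'a" where
  "stopped B g i = (let k = (LEAST k. hit B (Suc k) (i div 2 ^ Suc k))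
     in (1 / 2 ^ k) *\<^sub>R (\<Sum>i'\<in>dyadic_block k (i div 2 ^ k). g i'))"

lemma hit_mono: "hit B k j \<Longrightarrow> k \<le> k' \<Longrightarrow> hit B k' (j div 2 ^ (k' - k))"
  unfolding hit_def using div_pow_diff by (metis le_trans)

text \<open>A block with a hit parent is either a stopping block itself, on which
  \<open>stopped\<close> is the mean of \<open>g\<close>, or it is hit, and then both halves have a
  hit parent and the induction goes down. It ends before unit cells because the members of
  \<open>B\<close> have scale at least 2.\<close>

lemma stopped_sum:
  assumes B: "\<And>P. P \<in> B \<Longrightarrow> 2 \<le> sc P" and "hit B (Suc k) (j div 2)"
  shows "(\<Sum>i\<in>dyadic_block k j. stopped B g i) = (\<Sum>i\<in>dyadic_block k j. g i)"
  using assms(2)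
proof (induction k arbitrary: j)
  case (0 j)
  then show ?case using B by (fastforce simp: hit_def)
next
  case (Suc k j)
  show ?case
  proof (cases "hit B (Suc k) j")
    case True
    have d: "dyadic_block k (2 * j) \<inter> dyadic_block k (2 * j + 1) = {}" by (auto simp: dyadic_block_def)
    show ?thesis unfolding dyadic_block_Suc sum.union_disjoint[OF finite_dyadic_block finite_dyadic_block d]
      using Suc.IH[of "2 * j"] Suc.IH[of "2 * j + 1"] True by simp
  next
    case False
    \<comment> \<open>Here \<open>j\<close> is not hit but its parent is, so \<open>j\<close> is a
      maximal block without a time interval of \<open>B\<close>. The least scale is exactly
      \<open>Suc k\<close>: by \<open>hit_mono\<close>, a smaller one would make \<open>j\<close>
      hit.\<close>
    have *: "stopped B g i = (1 / 2 ^ Suc k) *\<^sub>R (\<Sum>i'\<in>dyadic_block (Suc k) j. g i')" if "i \<in> dyadic_block (Suc k) j" for i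
    proof -
      have i: "i div 2 ^ Suc k = j" using that by (simp add: dyadic_block_def)
      have "(LEAST k. hit B (Suc k) (i div 2 ^ Suc k)) = Suc k"
      proof (rule Least_equality)
        have "i div 2 ^ Suc (Suc k) = j div 2" using i by (metis div_mult2_eq power_Suc2)
        then show "hit B (Suc (Suc k)) (i div 2 ^ Suc (Suc k))" using Suc.prems by simp
      next
        fix k' assume h: "hit B (Suc k') (i div 2 ^ Suc k')"
        show "Suc k \<le> k'"
        proof (rule ccontr)
          assume "\<not> Suc k \<le> k'"
          then have le: "Suc k' \<le> Suc k" by simp
          from hit_mono[OF h le] have "hit B (Suc k) j"
            using i le by (metis div_pow_add le_add_diff_inverse)
          with False show False by simp
        qed
      qed
      then show ?thesis using i by (simp only: stopped_def Let_def)
    qed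
    then show ?thesis by (simp add: sum_constant_scaleR del: power_Suc)
  qed
qed

lemma half_eq: "(a::nat) div 2 = b div 2 \<Longrightarrow> (odd a = odd b) = (a = b)"
  by presburger

text \<open>The indicator of a half block is \<open>(1 + s * \<rho>) / 2\<close>, with
  \<open>\<rho>\<close> the coarsest Rademacher sign of the parent and \<open>s\<close> its value on
  that half. The frequencies \<open>2 * h\<close> and \<open>2 * h + 1\<close> of the parent differ
  just by the factor \<open>\<rho>\<close>.\<close>

lemma child_sum:
  fixes f :: "nat \<Rightarrow> 'a::real_normed_vector"
  shows "(\<Sum>i\<in>dyadic_block k j. walsh_sg k h i *\<^sub>R f i) = (1/2) *\<^sub>R ((\<Sum>i\<in>dyadic_block (Suc k) (j div 2). walsh_sg (Suc k) (2 * h) i *\<^sub>R f i) +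
     (if odd j then -1 else 1) *\<^sub>R (\<Sum>i\<in>dyadic_block (Suc k) (j div 2). walsh_sg (Suc k) (2 * h + 1) i *\<^sub>R f i))"
proof -
  let ?s = "if odd j then -1 else 1 :: real"
  have "(1/2) *\<^sub>R ((\<Sum>i\<in>dyadic_block (Suc k) (j div 2). walsh_sg (Suc k) (2 * h) i *\<^sub>R f i) +
     ?s *\<^sub>R (\<Sum>i\<in>dyadic_block (Suc k) (j div 2). walsh_sg (Suc k) (2 * h + 1) i *\<^sub>R f i)) =
     (\<Sum>i\<in>dyadic_block (Suc k) (j div 2). (1/2 * (walsh_sg (Suc k) (2 * h) i + ?s * walsh_sg (Suc k) (2 * h + 1) i)) *\<^sub>R f i)"
    by (simp add: scaleR_sum_right sum.distrib[symmetric] scaleR_add_left scaleR_add_right scaleR_diff_left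
        add_divide_distrib diff_divide_distrib del: walsh_sg.simps)
  also have "\<dots> = (\<Sum>i\<in>dyadic_block (Suc k) (j div 2). if i div 2 ^ k = j then walsh_sg k h i *\<^sub>R f i else 0)"
  proof (intro sum.cong refl)
    fix i assume "i \<in> dyadic_block (Suc k) (j div 2)"
    then have "i div 2 ^ k div 2 = j div 2" by (simp add: dyadic_block_def) (metis div_mult2_eq mult.commute)
    then have "(odd (i div 2 ^ k) = odd j) = (i div 2 ^ k = j)"
      by (rule half_eq)
    then show "(1/2 * (walsh_sg (Suc k) (2 * h) i + ?s * walsh_sg (Suc k) (2 * h + 1) i)) *\<^sub>R f i =
       (if i div 2 ^ k = j then walsh_sg k h i *\<^sub>R f i else 0)" by auto
  qed
  also have "\<dots> = (\<Sum>i\<in>dyadic_block (Suc k) (j div 2) \<inter> {i. i div 2 ^ k = j}. walsh_sg k h i *\<^sub>R f i)"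
    by (simp add: sum.If_cases)
  also have "dyadic_block (Suc k) (j div 2) \<inter> {i. i div 2 ^ k = j} = dyadic_block k j"
    by (auto simp: dyadic_block_def) (metis div_mult2_eq mult.commute)
  finally show ?thesis by simp
qed

text \<open>The parent of the stopping block at \<open>x\<close> contains some \<open>P\<close> in
  \<open>B\<close> and lies inside \<open>R\<close>. Taken with the matching frequency of
  \<open>T\<close>, it is a quartile between \<open>P\<close> and \<open>R\<close>, so convexity
  puts it into \<open>A\<close>. The average over the stopping block combines two of its
  coefficients, whence the factor 2.\<close>

lemma stopped_bound:
  fixes f :: "nat \<Rightarrow> 'a::real_normed_vector"
  assumes A: "\<And>P Q R. P \<in> A \<Longrightarrow> R \<in> A \<Longrightarrow> qle P Q \<Longrightarrow> qle Q R \<Longrightarrow> Q \<in> A"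
    and B: "B \<subseteq> A" "\<And>P. P \<in> B \<Longrightarrow> qlev v P T" and v: "v < 4"
    and sc: "\<And>P. P \<in> B \<Longrightarrow> 2 \<le> sc P"
    and bd: "\<And>Q u. Q \<in> A \<Longrightarrow> u < 4 \<Longrightarrow> norm (avg u f Q) \<le> \<mu>"
    and R: "R \<in> B" "x \<in> cells R"
  shows "norm (stopped B (\<lambda>i. walsh_sg (sc T) (4 * fr T + v) i *\<^sub>R f i) x) \<le> 2 * \<mu>"
proof -
  define k where "k = (LEAST k. hit B (Suc k) (x div 2 ^ Suc k))"
  have x: "x div 2 ^ sc R = ps R" using R by (simp add: cells_def dyadic_block_def)
  have scR: "Suc (sc R - 1) = sc R" using sc[OF R(1)] by simp
  have "hit B (Suc (sc R - 1)) (x div 2 ^ Suc (sc R - 1))"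
    unfolding scR x hit_def using R by (intro bexI[of _ R]) auto
  then have hk: "hit B (Suc k) (x div 2 ^ Suc k)" and "k \<le> sc R - 1"
    unfolding k_def by (rule LeastI, rule Least_le)
  then have kR: "Suc k \<le> sc R" using scR by linarith
  from hk obtain P where P: "P \<in> B" "sc P \<le> Suc k" "ps P div 2 ^ (Suc k - sc P) = x div 2 ^ Suc k"
    unfolding hit_def by blast
  have RT: "sc R \<le> sc T" "qle R T" "qle P T" using B(2) R(1) P(1) v qlev_qle by (auto simp: qlev_def)
  \<comment> \<open>The quartile over the parent of the stopping block whose frequency interval
    contains that of \<open>T\<close>.\<close>
  define Q where "Q = DQ (Suc k) (x div 2 ^ Suc k) (fr T div 2 ^ (sc T - Suc k))"
  have "qle P Q" using P RT kR by (auto simp: qle_def Q_def div_pow_add)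
  moreover have "qle Q R"
  proof -
    have "x div 2 ^ Suc k div 2 ^ (sc R - Suc k) = ps R"
      using x kR by (metis div_pow_add le_add_diff_inverse)
    moreover have "fr R div 2 ^ (sc R - Suc k) = fr T div 2 ^ (sc T - Suc k)"
    proof -
      have "fr R = fr T div 2 ^ (sc T - sc R)" using RT by (simp add: qle_def)
      then show ?thesis using RT kR by (simp add: div_pow_add)
    qed
    ultimately show ?thesis using kR by (simp add: qle_def Q_def)
  qed
  ultimately have Q: "Q \<in> A" using A B(1) P(1) R(1) by blast
  have kT: "sc T = k + (sc T - k)" "sc T - k = Suc (sc T - Suc k)" using kR RT by auto
  \<comment> \<open>The frequency to which the wave of \<open>T\<close> reduces on the stopping
    block, by \<open>walsh_sg_shift\<close>.\<close>
  define h where "h = (4 * fr T + v) div 2 ^ (sc T - k)"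
  obtain \<rho> where \<rho>: "\<And>i. walsh_sg (sc T) (4 * fr T + v) i = \<rho> (i div 2 ^ k) * walsh_sg k h i" "\<And>j. \<bar>\<rho> j\<bar> = (1::real)"
    unfolding h_def using walsh_sg_shift[of k "sc T - k" "4 * fr T + v"] kT(1) by metis
  have "h div 2 = (4 * fr T + v) div 2 ^ ((sc T - Suc k) + 2)"
    unfolding h_def kT(2) by (simp flip: div_mult2_eq add: mult.commute)
  then have h2: "h div 2 = fr Q" using div4_shift[OF v] by (simp add: Q_def)
  \<comment> \<open>The frequencies \<open>2 * h\<close> and \<open>2 * h + 1\<close> are two
    neighbouring tiles of \<open>Q\<close>, of indices 0 and 1 or 2 and 3 according to the parity of
    \<open>h\<close>.\<close>
  define u where "u = 2 * (h mod 2)"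
  have h: "2 * h = 4 * fr Q + u" and u: "u < 4" "u + 1 < 4"
    using h2 by (auto simp: u_def) presburger+
  let ?j = "x div 2 ^ k"
  have jQ: "dyadic_block (Suc k) (?j div 2) = cells Q"
    by (simp add: cells_def Q_def) (metis div_mult2_eq mult.commute)
  have scQ: "sc Q = Suc k" by (simp add: Q_def)
  have av: "(\<Sum>i\<in>cells Q. walsh_sg (Suc k) (4 * fr Q + w) i *\<^sub>R f i) = 2 ^ Suc k *\<^sub>R avg w f Q" for w
    by (simp add: avg_def scQ)
  have "stopped B (\<lambda>i. walsh_sg (sc T) (4 * fr T + v) i *\<^sub>R f i) x =
     (1 / 2 ^ k) *\<^sub>R (\<Sum>i\<in>dyadic_block k ?j. walsh_sg (sc T) (4 * fr T + v) i *\<^sub>R f i)"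
    unfolding stopped_def k_def[symmetric] Let_def ..
  also have "(\<Sum>i\<in>dyadic_block k ?j. walsh_sg (sc T) (4 * fr T + v) i *\<^sub>R f i) = \<rho> ?j *\<^sub>R (\<Sum>i\<in>dyadic_block k ?j. walsh_sg k h i *\<^sub>R f i)"
    unfolding scaleR_sum_right by (intro sum.cong) (auto simp: \<rho> dyadic_block_def)
  also have "(\<Sum>i\<in>dyadic_block k ?j. walsh_sg k h i *\<^sub>R f i) = (1/2) *\<^sub>R (2 ^ Suc k *\<^sub>R avg u f Q +
     (if odd ?j then -1 else 1) *\<^sub>R 2 ^ Suc k *\<^sub>R avg (u + 1) f Q)"
    using child_sum[where k = k and j = ?j and h = h and f = f] by (simp only: jQ h add.assoc av)
  also have "(1 / 2 ^ k) *\<^sub>R \<rho> ?j *\<^sub>R (1/2) *\<^sub>R (2 ^ Suc k *\<^sub>R avg u f Q +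
     (if odd ?j then -1 else 1) *\<^sub>R 2 ^ Suc k *\<^sub>R avg (u + 1) f Q) =
     \<rho> ?j *\<^sub>R (avg u f Q + (if odd ?j then -1 else 1) *\<^sub>R avg (u + 1) f Q)"
    by (simp add: scaleR_add_right)
  also have "norm \<dots> \<le> norm (avg u f Q) + norm (avg (u + 1) f Q)"
    using norm_triangle_ineq[of "avg u f Q" "avg (u + 1) f Q"] norm_triangle_ineq4[of "avg u f Q" "avg (u + 1) f Q"]
    by (simp add: \<rho>)
  also have "\<dots> \<le> 2 * \<mu>" using bd[OF Q u(1)] bd[OF Q u(2)] by simp
  finally show ?thesis .
qed

text \<open>Real linearity is enough for the discrete estimates. The form is invariant under
  permutation of slots, which lets one tree estimate serve all three of them.\<close>

definition trilin ::
  "('a::real_normed_vector \<Rightarrow> 'b::real_normed_vector \<Rightarrow> 'c::real_normed_vector \<Rightarrow> 'd::real_normed_vector) \<Rightarrow> real \<Rightarrow> bool" where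
  "trilin \<Psi> K \<longleftrightarrow> (\<forall>y z. linear (\<lambda>x. \<Psi> x y z)) \<and> (\<forall>x z. linear (\<lambda>y. \<Psi> x y z)) \<and> (\<forall>x y. linear (\<lambda>z. \<Psi> x y z)) \<and>
     (\<forall>x y z. norm (\<Psi> x y z) \<le> K * norm x * norm y * norm z) \<and> 0 \<le> K"

text \<open>Both factors are estimated through squares, and \<open>t ^ 2 \<le> 1 + t powr p\<close>
  for \<open>p \<ge> 2\<close>. The additive 1 is harmless on a tree, where it integrates to the
  length of the top; no relation between \<open>p\<close> and \<open>q\<close> is needed.\<close>

lemma mult_le_powr:
  fixes x y :: real
  assumes "0 \<le> x" "0 \<le> y" "2 \<le> p" "2 \<le> q"
  shows "x * y \<le> 1 + x powr p + y powr q"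
proof -
  have *: "t ^ 2 \<le> 1 + t powr p" if "0 \<le> t" "2 \<le> p" for t p :: real
  proof (cases "t \<le> 1")
    case True
    then have "t ^ 2 \<le> 1" using that by (simp add: power_le_one)
    then show ?thesis by (smt (verit) powr_ge_zero)
  next
    case False
    then have "t powr 2 \<le> t powr p" using that by (intro powr_mono) auto
    then show ?thesis using False by (simp add: powr_numeral)
  qed
  have "2 * (x * y) \<le> x ^ 2 + y ^ 2" using sum_squares_bound[of x y] by simp
  then show ?thesis using *[OF assms(1,3)] *[OF assms(2,4)] powr_ge_zero[of x p] powr_ge_zero[of y q] by linarith
qed

text \<open>On every member, the packet of index \<open>v\<close> is a signed piece of the wave of
  the top. Multiplying \<open>f\<close> by that wave turns the coefficient of \<open>f\<close> into
  an integral against a sign that is constant on both halves of the time interval. Such integrals do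
  not change when the modulated \<open>f\<close> is replaced by its stopped averages, which are
  bounded by twice the size. The slots \<open>b\<close> and \<open>c\<close> avoid \<open>v\<close>,
  so their signed tree sums are controlled by size.\<close>

lemma tree_estimate:
  fixes \<Psi> :: "'a::real_normed_vector \<Rightarrow> 'b::real_normed_vector \<Rightarrow> 'c::real_normed_vector \<Rightarrow> 'd::real_normed_vector"
  assumes \<Psi>: "trilin \<Psi> K"
    and A: "A \<subseteq> qbox L" "\<And>P Q R. P \<in> A \<Longrightarrow> R \<in> A \<Longrightarrow> qle P Q \<Longrightarrow> qle Q R \<Longrightarrow> Q \<in> A"
    and T: "T \<in> qbox L" and B: "B \<subseteq> A" "\<And>P. P \<in> B \<Longrightarrow> qlev v P T"
    and v: "v < 4" "w < 4" "b < 4" "c < 4" "v = w \<or> v = 0 \<and> w = 1" "b \<noteq> v" "c \<noteq> v"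
    and szs: "size_le L q f A \<mu>" "size_le L qb g A \<mu>b" "size_le L qc h A \<mu>c"
    and q: "1 \<le> q" "2 \<le> qb" "2 \<le> qc" and pos: "0 < \<mu>" "0 < \<mu>b" "0 < \<mu>c"
  shows "norm (\<Sum>P\<in>B. 2 ^ sc P *\<^sub>R \<Psi> (avg w f P) (avg b g P) (avg c h P))
     \<le> 2 * K * (1 + 2 powr (qb + 1) + 2 powr (qc + 1)) * 2 ^ sc T * (\<mu> * \<mu>b * \<mu>c)"
proof -
  have linx: "linear (\<lambda>x. \<Psi> x y z)" and liny: "linear (\<lambda>y. \<Psi> x y z)" and linz: "linear (\<lambda>z. \<Psi> x y z)"
    and bound: "norm (\<Psi> x y z) \<le> K * norm x * norm y * norm z" and K: "0 \<le> K" for x y z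
    using \<Psi> by (auto simp: trilin_def)
  have bil: "bilinear (\<Psi> x)" for x using liny linz by (simp add: bilinear_def)
  have Bq: "B \<subseteq> qbox L" using B A by auto
  have fin: "finite B" using Bq finite_qbox finite_subset by blast
  have sc2: "2 \<le> sc P" if "P \<in> B" for P using that Bq by (auto simp: qbox_def)
  let ?m = "4 * fr T + v"
  \<comment> \<open>\<open>walsh_sg_shift\<close> applied to the top: on the cells of
    \<open>P\<close> its wave is a constant sign times the packet of tile \<open>v\<close> of
    \<open>P\<close>.\<close>
  have "\<exists>r. \<bar>r\<bar> = (1::real) \<and> (\<forall>i\<in>cells P. walsh_sg (sc T) ?m i = r * walsh_sg (sc P) (4 * fr P + v) i)" if "P \<in> B" for P
  proof -
    have P: "sc P \<le> sc T" "?m div 2 ^ (sc T - sc P) = 4 * fr P + v" using B(2)[OF that] by (auto simp: qlev_def)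
    obtain \<rho> where "\<And>i. walsh_sg (sc P + (sc T - sc P)) ?m i = \<rho> (i div 2 ^ sc P) * walsh_sg (sc P) (?m div 2 ^ (sc T - sc P)) i"
      and "\<And>j. \<bar>\<rho> j\<bar> = (1::real)" using walsh_sg_shift by blast
    then show ?thesis using P by (intro exI[of _ "\<rho> (ps P)"]) (auto simp: cells_def dyadic_block_def)
  qed
  then have "\<forall>P\<in>B. \<exists>r. \<bar>r\<bar> = (1::real) \<and> (\<forall>i\<in>cells P. walsh_sg (sc T) ?m i = r * walsh_sg (sc P) (4 * fr P + v) i)" by blast
  from bchoice[OF this] obtain r where r: "\<And>P. P \<in> B \<Longrightarrow> \<bar>r P\<bar> = (1::real)"
    "\<And>P i. P \<in> B \<Longrightarrow> i \<in> cells P \<Longrightarrow> walsh_sg (sc T) ?m i = r P * walsh_sg (sc P) (4 * fr P + v) i"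
    by blast
  \<comment> \<open>\<open>f\<close> demodulated by the wave of the top, so that the coefficients of
    index \<open>v\<close> become plain averages up to sign.\<close>
  define g0 where "g0 i = walsh_sg (sc T) ?m i *\<^sub>R f i" for i
  define H where "H = stopped B g0"
  define \<tau> where "\<tau> P i = r P * (walsh_sg (sc P) (4 * fr P + w) i * walsh_sg (sc P) (4 * fr P + v) i)" for P i
  have key: "(\<Sum>i\<in>cells P. \<tau> P i *\<^sub>R H i) = 2 ^ sc P *\<^sub>R avg w f P" if P: "P \<in> B" for P
  proof -
    obtain k where k: "sc P = Suc k" using sc2[OF P] by (cases "sc P") auto
    have child: "(\<Sum>i\<in>dyadic_block k j. \<tau> P i *\<^sub>R H i) = (\<Sum>i\<in>dyadic_block k j. \<tau> P i *\<^sub>R g0 i)" if j: "j div 2 = ps P" for j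
    proof -
      \<comment> \<open>For \<open>w = v\<close> the two Walsh signs cancel. Frequencies
        \<open>4 * fr P\<close> and \<open>4 * fr P + 1\<close> differ by the coarsest Rademacher
        sign, which changes at the midpoint of the time interval.\<close>
      define t where "t = r P * (if v = 0 \<and> w = 1 \<and> odd j then -1 else 1)"
      have t: "\<tau> P i = t" if "i \<in> dyadic_block k j" for i
      proof -
        have "i div 2 ^ k = j" using that by (simp add: dyadic_block_def)
        then show ?thesis using v(5) by (auto simp: \<tau>_def t_def k)
      qed
      have "hit B (Suc k) (j div 2)" unfolding hit_def using P k j by (intro bexI[of _ P]) auto
      from stopped_sum[OF sc2 this, of g0] have "(\<Sum>i\<in>dyadic_block k j. H i) = (\<Sum>i\<in>dyadic_block k j. g0 i)"
        by (simp add: H_def)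
      then show ?thesis by (simp add: t flip: scaleR_sum_right)
    qed
    have d: "dyadic_block k (2 * ps P) \<inter> dyadic_block k (2 * ps P + 1) = {}" by (auto simp: dyadic_block_def)
    have "(\<Sum>i\<in>cells P. \<tau> P i *\<^sub>R H i) = (\<Sum>i\<in>cells P. \<tau> P i *\<^sub>R g0 i)"
      unfolding cells_def k dyadic_block_Suc sum.union_disjoint[OF finite_dyadic_block finite_dyadic_block d]
      using child[of "2 * ps P"] child[of "2 * ps P + 1"] by simp
    also have "\<dots> = (\<Sum>i\<in>cells P. walsh_sg (sc P) (4 * fr P + w) i *\<^sub>R f i)"
    proof (intro sum.cong refl)
      fix i assume i: "i \<in> cells P"
      have rr: "r P * r P = 1" using r(1)[OF P] by (auto simp: abs_if split: if_splits)
      have "r P * (walsh_sg (sc P) (4 * fr P + w) i * walsh_sg (sc P) (4 * fr P + v) i) * (r P * walsh_sg (sc P) (4 * fr P + v) i)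
          = (r P * r P) * (walsh_sg (sc P) (4 * fr P + v) i * walsh_sg (sc P) (4 * fr P + v) i) * walsh_sg (sc P) (4 * fr P + w) i"
        by (simp only: mult_ac)
      also have "\<dots> = walsh_sg (sc P) (4 * fr P + w) i" by (simp only: rr walsh_sg_sq mult_1_left)
      finally have "r P * (walsh_sg (sc P) (4 * fr P + w) i * walsh_sg (sc P) (4 * fr P + v) i) * (r P * walsh_sg (sc P) (4 * fr P + v) i)
          = walsh_sg (sc P) (4 * fr P + w) i" .
      then show "\<tau> P i *\<^sub>R g0 i = walsh_sg (sc P) (4 * fr P + w) i *\<^sub>R f i"
        by (simp add: \<tau>_def g0_def r(2)[OF P i])
    qed
    also have "\<dots> = 2 ^ sc P *\<^sub>R avg w f P" by (simp add: avg_def)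
    finally show ?thesis .
  qed
  \<comment> \<open>Collects \<open>\<tau>\<close> and the Walsh signs of slots \<open>b\<close> and
    \<open>c\<close>, so that the three packets leave exactly \<open>\<tau>\<close> in front of
    \<open>H\<close>. It depends on the point but is always a sign, and \<open>sum_Pow_shift\<close>
    can discard it once norms are taken.\<close>
  define \<sigma> where "\<sigma> P i = \<tau> P i * (walsh_sg (sc P) (4 * fr P + b) i * walsh_sg (sc P) (4 * fr P + c) i)" for P i
  have \<sigma>: "\<bar>\<sigma> P i\<bar> = 1" if "P \<in> B" for P i using r(1)[OF that] by (simp add: \<sigma>_def \<tau>_def abs_mult)
  define a1 where "a1 P i = packet b P i *\<^sub>R avg b g P" for P i
  define a2 where "a2 P i = packet c P i *\<^sub>R avg c h P" for P i
  define U where "U E i = (\<Sum>P\<in>B. sgn_of E P *\<^sub>R a1 P i)" for E i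
  define V where "V E i = (\<Sum>P\<in>B. sgn_of E P *\<^sub>R \<sigma> P i *\<^sub>R a2 P i)" for E i
  define V' where "V' E i = (\<Sum>P\<in>B. sgn_of E P *\<^sub>R a2 P i)" for E i
  have TL: "cells T \<subseteq> {..<2 ^ L}" using cells_qbox[OF T] .
  have trm: "2 ^ sc P *\<^sub>R \<Psi> (avg w f P) (avg b g P) (avg c h P) = (\<Sum>i\<in>cells T. \<Psi> (H i) (a1 P i) (\<sigma> P i *\<^sub>R a2 P i))"
    if P: "P \<in> B" for P
  proof -
    have "(\<Sum>i\<in>cells T. \<Psi> (H i) (a1 P i) (\<sigma> P i *\<^sub>R a2 P i)) = (\<Sum>i\<in>cells P. \<Psi> (\<tau> P i *\<^sub>R H i) (avg b g P) (avg c h P))"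
    proof (rule sum.mono_neutral_cong_right)
      show "cells P \<subseteq> cells T" using qlev_cells[OF B(2)[OF P]] .
      show "\<forall>i\<in>cells T - cells P. \<Psi> (H i) (a1 P i) (\<sigma> P i *\<^sub>R a2 P i) = 0"
        by (auto simp: a1_def packet_def linear_0[OF liny])
      fix i assume i: "i \<in> cells P"
      have "packet b P i * (\<sigma> P i * packet c P i) = \<tau> P i"
      proof -
        have "packet b P i * (\<sigma> P i * packet c P i) = \<tau> P i * (walsh_sg (sc P) (4 * fr P + b) i * walsh_sg (sc P) (4 * fr P + b) i) *
            (walsh_sg (sc P) (4 * fr P + c) i * walsh_sg (sc P) (4 * fr P + c) i)"
          using i unfolding packet_def \<sigma>_def by (simp only: indicator_simps mult_1_left mult_ac)
        then show ?thesis by (simp only: walsh_sg_sq mult_1_right)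
      qed
      then show "\<Psi> (H i) (a1 P i) (\<sigma> P i *\<^sub>R a2 P i) = \<Psi> (\<tau> P i *\<^sub>R H i) (avg b g P) (avg c h P)"
        by (simp add: a1_def a2_def linear_scale[OF linx] linear_scale[OF liny] linear_scale[OF linz] mult.commute)
    qed simp
    also have "\<dots> = \<Psi> (\<Sum>i\<in>cells P. \<tau> P i *\<^sub>R H i) (avg b g P) (avg c h P)"
      by (rule linear_sum[OF linx, symmetric])
    also have "\<dots> = 2 ^ sc P *\<^sub>R \<Psi> (avg w f P) (avg b g P) (avg c h P)"
      unfolding key[OF P] by (rule linear_scale[OF linx])
    finally show ?thesis by simp
  qed
  let ?X = "\<Sum>P\<in>B. 2 ^ sc P *\<^sub>R \<Psi> (avg w f P) (avg b g P) (avg c h P)"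
  have "2 ^ card B *\<^sub>R ?X = (\<Sum>i\<in>cells T. 2 ^ card B *\<^sub>R (\<Sum>P\<in>B. \<Psi> (H i) (a1 P i) (\<sigma> P i *\<^sub>R a2 P i)))"
    unfolding scaleR_sum_right[symmetric] by (subst sum.swap) (simp add: trm)
  also have "\<dots> = (\<Sum>i\<in>cells T. \<Sum>E\<in>Pow B. \<Psi> (H i) (U E i) (V E i))"
    unfolding U_def V_def by (intro sum.cong refl) (rule sum_Pow_bilinear[OF bil fin, symmetric])
  finally have X: "2 ^ card B *\<^sub>R ?X = (\<Sum>i\<in>cells T. \<Sum>E\<in>Pow B. \<Psi> (H i) (U E i) (V E i))" .
  have single: "norm (avg u f Q) \<le> \<mu>" if "Q \<in> A" "u < 4" for Q u
    by (rule size_le_single[OF szs(1) _ _ that(1) A(1) that(2)]) (use q pos in auto)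
  let ?M = "2 * K * (\<mu> * \<mu>b * \<mu>c)"
  have M: "0 \<le> ?M" using K pos by simp
  \<comment> \<open>Outside the cells of \<open>B\<close> the sum \<open>U\<close> vanishes; inside,
    \<open>H\<close> is at most twice the size. Dividing the other two factors by their sizes
    beforehand makes the powers in \<open>mult_le_powr\<close> scale invariant.\<close>
  have pt: "norm (\<Psi> (H i) (U E i) (V E i)) \<le> ?M * (1 + norm (U E i) powr qb / \<mu>b powr qb + norm (V E i) powr qc / \<mu>c powr qc)" for E i
  proof (cases "\<exists>R\<in>B. i \<in> cells R")
    case True
    then obtain R where R: "R \<in> B" "i \<in> cells R" by blast
    have Hb: "norm (H i) \<le> 2 * \<mu>"
      unfolding H_def g0_def
      by (rule stopped_bound[OF A(2) B v(1) sc2 single R])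
    have *: "norm (U E i) / \<mu>b * (norm (V E i) / \<mu>c) \<le> 1 + (norm (U E i) / \<mu>b) powr qb + (norm (V E i) / \<mu>c) powr qc"
      using q pos by (intro mult_le_powr) auto
    have "norm (\<Psi> (H i) (U E i) (V E i)) \<le> K * norm (H i) * norm (U E i) * norm (V E i)" by (rule bound)
    also have "\<dots> \<le> K * (2 * \<mu>) * norm (U E i) * norm (V E i)"
      using K Hb by (intro mult_right_mono mult_left_mono) auto
    also have "\<dots> = ?M * (norm (U E i) / \<mu>b * (norm (V E i) / \<mu>c))" using pos by (simp add: field_simps)
    also have "\<dots> \<le> ?M * (1 + (norm (U E i) / \<mu>b) powr qb + (norm (V E i) / \<mu>c) powr qc)"
      by (rule mult_left_mono[OF * M])
    finally show ?thesis using pos by (simp add: powr_divide)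
  next
    case False
    then have "U E i = 0" by (simp add: U_def a1_def packet_def)
    then show ?thesis using M pos by (simp add: linear_0[OF liny])
  qed
  let ?N = "2 ^ card B :: real"
  have cN: "real (card (Pow B)) = ?N" by (simp add: card_Pow fin)
  have sU: "(\<Sum>i\<in>cells T. norm (U E i) powr qb) \<le> 2 powr (qb + 1) * (\<mu>b powr qb * 2 ^ sc T)" for E
  proof -
    have "(\<Sum>i\<in>cells T. norm (U E i) powr qb) \<le> (\<Sum>i<2 ^ L. norm (U E i) powr qb)"
      by (rule sum_mono2) (use TL in auto)
    also have "\<dots> \<le> 2 powr (qb + 1) * (\<mu>b powr qb * 2 ^ sc T)"
      unfolding U_def a1_def using szs(2) q v T B fin by (intro size_le_signed[where v = v and A = A]) auto
    finally show ?thesis .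
  qed
  have sV: "(\<Sum>i\<in>cells T. norm (V' E i) powr qc) \<le> 2 powr (qc + 1) * (\<mu>c powr qc * 2 ^ sc T)" for E
  proof -
    have "(\<Sum>i\<in>cells T. norm (V' E i) powr qc) \<le> (\<Sum>i<2 ^ L. norm (V' E i) powr qc)"
      by (rule sum_mono2) (use TL in auto)
    also have "\<dots> \<le> 2 powr (qc + 1) * (\<mu>c powr qc * 2 ^ sc T)"
      unfolding V'_def a2_def using szs(3) q v T B fin by (intro size_le_signed[where v = v and A = A]) auto
    finally show ?thesis .
  qed
  have "(\<Sum>i\<in>cells T. \<Sum>E\<in>Pow B. norm (U E i) powr qb / \<mu>b powr qb) = (\<Sum>E\<in>Pow B. (\<Sum>i\<in>cells T. norm (U E i) powr qb) / \<mu>b powr qb)"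
    by (subst sum.swap) (simp add: sum_divide_distrib)
  also have "\<dots> \<le> (\<Sum>E\<in>Pow B. 2 powr (qb + 1) * 2 ^ sc T)"
    using sU pos by (intro sum_mono) (simp add: divide_le_eq mult.commute mult.left_commute)
  finally have S1: "(\<Sum>i\<in>cells T. \<Sum>E\<in>Pow B. norm (U E i) powr qb / \<mu>b powr qb) \<le> ?N * (2 powr (qb + 1) * 2 ^ sc T)"
    by (simp add: cN)
  \<comment> \<open>For each fixed cell the signs \<open>\<sigma>\<close> are absorbed by the
    average over \<open>E\<close>; what remains is the signed tree sum of \<open>h\<close>.\<close>
  have "(\<Sum>i\<in>cells T. \<Sum>E\<in>Pow B. norm (V E i) powr qc / \<mu>c powr qc) = (\<Sum>i\<in>cells T. \<Sum>E\<in>Pow B. norm (V' E i) powr qc / \<mu>c powr qc)"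
    unfolding V_def V'_def by (intro sum.cong refl sum_Pow_shift \<sigma>)
  also have "\<dots> = (\<Sum>E\<in>Pow B. (\<Sum>i\<in>cells T. norm (V' E i) powr qc) / \<mu>c powr qc)"
    by (subst sum.swap) (simp add: sum_divide_distrib)
  also have "\<dots> \<le> (\<Sum>E\<in>Pow B. 2 powr (qc + 1) * 2 ^ sc T)"
    using sV pos by (intro sum_mono) (simp add: divide_le_eq mult.commute mult.left_commute)
  finally have S2: "(\<Sum>i\<in>cells T. \<Sum>E\<in>Pow B. norm (V E i) powr qc / \<mu>c powr qc) \<le> ?N * (2 powr (qc + 1) * 2 ^ sc T)"
    by (simp add: cN)
  have S0: "(\<Sum>i\<in>cells T. \<Sum>E\<in>Pow B. 1) = ?N * 2 ^ sc T" by (simp add: cN mult.commute)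
  have "?N * norm ?X = norm (2 ^ card B *\<^sub>R ?X)" by simp
  also have "\<dots> \<le> (\<Sum>i\<in>cells T. \<Sum>E\<in>Pow B. norm (\<Psi> (H i) (U E i) (V E i)))"
    unfolding X by (intro sum_norm_le order_trans[OF norm_sum] sum_mono order_refl)
  also have "\<dots> \<le> (\<Sum>i\<in>cells T. \<Sum>E\<in>Pow B. ?M * (1 + norm (U E i) powr qb / \<mu>b powr qb + norm (V E i) powr qc / \<mu>c powr qc))"
    by (intro sum_mono pt)
  also have "\<dots> = ?M * ((\<Sum>i\<in>cells T. \<Sum>E\<in>Pow B. 1) + (\<Sum>i\<in>cells T. \<Sum>E\<in>Pow B. norm (U E i) powr qb / \<mu>b powr qb) +
      (\<Sum>i\<in>cells T. \<Sum>E\<in>Pow B. norm (V E i) powr qc / \<mu>c powr qc))"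
    by (simp only: sum_distrib_left[symmetric] sum.distrib)
  also have "\<dots> \<le> ?M * (?N * 2 ^ sc T + ?N * (2 powr (qb + 1) * 2 ^ sc T) + ?N * (2 powr (qc + 1) * 2 ^ sc T))"
    using S0 S1 S2 M by (intro mult_left_mono add_mono) auto
  also have "\<dots> = ?N * (2 * K * (1 + 2 powr (qb + 1) + 2 powr (qc + 1)) * 2 ^ sc T * (\<mu> * \<mu>b * \<mu>c))"
    by (simp add: algebra_simps)
  finally show ?thesis by simp
qed

section \<open>Selection of trees\<close>

definition down_set :: "dquart set \<Rightarrow> dquart set" where
  "down_set F = {P. \<exists>T\<in>F. qle P T}"

text \<open>Finite families only. Disjointness of tiles is expressed by incomparability, since
  dyadic tiles of equal area which meet are comparable. Both sides are q-th powers, so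
  \<open>C\<close> is the q-th power of a norm constant.\<close>

definition discrete_quartile_type :: "real \<Rightarrow> real \<Rightarrow> 'a::real_normed_vector itself \<Rightarrow> bool" where
  "discrete_quartile_type q C (X :: 'a itself) \<longleftrightarrow> 0 \<le> C \<and> (\<forall>L u v \<B> (f :: nat \<Rightarrow> 'a). u < 4 \<longrightarrow> v < 4 \<longrightarrow> u \<noteq> v \<longrightarrow> finite \<B> \<longrightarrow>
     (\<forall>B\<in>\<B>. B \<subseteq> qbox L \<and> (\<exists>T. \<forall>P\<in>B. qlev v P T)) \<longrightarrow> disjoint \<B> \<longrightarrow>
     (\<forall>P\<in>\<Union>\<B>. \<forall>Q\<in>\<Union>\<B>. P \<noteq> Q \<longrightarrow> \<not> qlev u P Q) \<longrightarrow>
     (\<Sum>B\<in>\<B>. \<Sum>x<2 ^ L. norm (tree_sum u f B x) powr q) \<le> C * (\<Sum>x<2 ^ L. norm (f x) powr q))"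

lemma discrete_quartile_type_D:
  fixes f :: "nat \<Rightarrow> 'a::real_normed_vector"
  assumes "discrete_quartile_type q C TYPE('a)" "u < 4" "v < 4" "u \<noteq> v" "finite \<B>"
    and "\<And>B. B \<in> \<B> \<Longrightarrow> B \<subseteq> qbox L \<and> (\<exists>T. \<forall>P\<in>B. qlev v P T)" "disjoint \<B>"
    and "\<And>P Q. P \<in> \<Union>\<B> \<Longrightarrow> Q \<in> \<Union>\<B> \<Longrightarrow> P \<noteq> Q \<Longrightarrow> \<not> qlev u P Q"
  shows "(\<Sum>B\<in>\<B>. \<Sum>x<2 ^ L. norm (tree_sum u f B x) powr q) \<le> C * (\<Sum>x<2 ^ L. norm (f x) powr q)"
  using assms(1)[unfolded discrete_quartile_type_def, THEN conjunct2, rule_format, OF assms(2-5) assms(6) assms(7) assms(8)] .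

lemma ex_min_key:
  fixes \<kappa> :: "'i \<Rightarrow> int"
  assumes "finite S" "S \<noteq> {}"
  obtains m where "m \<in> S" "\<And>x. x \<in> S \<Longrightarrow> \<kappa> m \<le> \<kappa> x"
proof -
  have "Min (\<kappa> ` S) \<in> \<kappa> ` S" using assms by (intro Min_in) auto
  then obtain m where "m \<in> S" "\<kappa> m = Min (\<kappa> ` S)" by auto
  then show thesis using that assms by (metis Min_le finite_imageI imageI)
qed

text \<open>The last clause removes everything under a top in the order \<open>qle\<close>, although
  the selected tree itself may be a small part of it. The family must consist of trees with large
  sums, whereas removal must be generous enough for the tiles of index \<open>u\<close> to be
  disjoint.\<close>

definition selection :: "nat \<Rightarrow> real \<Rightarrow> real \<Rightarrow> (nat \<Rightarrow> 'a::real_normed_vector) \<Rightarrow> nat \<Rightarrow> nat \<Rightarrow> dquart set \<Rightarrow>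
    dquart set set \<Rightarrow> (dquart set \<Rightarrow> dquart) \<Rightarrow> bool" where
  "selection L q \<mu> f u v A \<B> t \<longleftrightarrow> finite \<B> \<and> disjoint \<B> \<and>
    (\<forall>B\<in>\<B>. B \<noteq> {} \<and> B \<subseteq> A \<and> t B \<in> qbox L \<and> (\<forall>P\<in>B. qlev v P (t B)) \<and>
      \<mu> powr q * 2 ^ sc (t B) < (\<Sum>x<2 ^ L. norm (tree_sum u f B x) powr q)) \<and>
    (\<forall>P\<in>\<Union>\<B>. \<forall>Q\<in>\<Union>\<B>. P \<noteq> Q \<longrightarrow> \<not> qlev u P Q) \<and>
    (\<forall>T\<in>qbox L. \<forall>B. B \<subseteq> A - down_set (t ` \<B>) \<longrightarrow> (\<forall>P\<in>B. qlev v P T) \<longrightarrow>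
      (\<Sum>x<2 ^ L. norm (tree_sum u f B x) powr q) \<le> \<mu> powr q * 2 ^ sc T)"

lemma selectionD:
  assumes "selection L q \<mu> f u v A \<B> t"
  shows "finite \<B>" "disjoint \<B>"
    "\<And>B. B \<in> \<B> \<Longrightarrow> B \<noteq> {} \<and> B \<subseteq> A \<and> t B \<in> qbox L \<and> (\<forall>P\<in>B. qlev v P (t B)) \<and>
        \<mu> powr q * 2 ^ sc (t B) < (\<Sum>x<2 ^ L. norm (tree_sum u f B x) powr q)"
    "\<And>P Q. P \<in> \<Union>\<B> \<Longrightarrow> Q \<in> \<Union>\<B> \<Longrightarrow> P \<noteq> Q \<Longrightarrow> \<not> qlev u P Q"
    "\<And>T B. T \<in> qbox L \<Longrightarrow> B \<subseteq> A - down_set (t ` \<B>) \<Longrightarrow> (\<forall>P\<in>B. qlev v P T) \<Longrightarrow>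
        (\<Sum>x<2 ^ L. norm (tree_sum u f B x) powr q) \<le> \<mu> powr q * 2 ^ sc T"
  using assms unfolding selection_def by (elim conjE; fast)+

text \<open>
  Removing the trees in the order of the frequencies of their tops, increasing or decreasing
  according to the sign of \<open>v - u\<close>, makes the tiles \<open>P\<^sub>u\<close> of the selected trees disjoint.
\<close>
lemma select_trees:
  fixes f :: "nat \<Rightarrow> 'a::real_normed_vector"
  assumes uv: "u < 4" "v < 4" "u \<noteq> v" and A: "A \<subseteq> qbox L"
  shows "\<exists>\<B> t. selection L q \<mu> f u v A \<B> t"
  using finite_subset[OF A finite_qbox] A
proof (induction A rule: finite_psubset_induct)
  case (psubset A)
  define bad where "bad B T \<longleftrightarrow> B \<subseteq> A \<and> T \<in> qbox L \<and> (\<forall>P\<in>B. qlev v P T) \<and>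
     \<mu> powr q * 2 ^ sc T < (\<Sum>x<2 ^ L. norm (tree_sum u f B x) powr q)" for B T
  show ?case
  proof (cases "\<exists>B T. bad B T")
    case False
    have "(\<Sum>x<2 ^ L. norm (tree_sum u f B x) powr q) \<le> \<mu> powr q * 2 ^ sc T"
      if "T \<in> qbox L" "B \<subseteq> A" "\<forall>P\<in>B. qlev v P T" for B T
      using False that unfolding bad_def by (meson not_less)
    then show ?thesis
      by (intro exI[of _ "{}"]) (simp add: down_set_def selection_def)
  next
    case True
    \<comment> \<open>The sign of the key makes "take the least first" the right order in both cases
      of \<open>conflict\<close>.\<close>
    define \<kappa> where "\<kappa> T = (if u < v then int (fkey L v T) else - int (fkey L v T))" for T
    have "finite {T. \<exists>B. bad B T}" by (rule finite_subset[OF _ finite_qbox[of L]]) (auto simp: bad_def)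
    then obtain T where "T \<in> {T. \<exists>B. bad B T}" and min: "\<And>T'. T' \<in> {T. \<exists>B. bad B T} \<Longrightarrow> \<kappa> T \<le> \<kappa> T'"
      using True by (rule_tac ex_min_key[of "{T. \<exists>B. bad B T}" \<kappa>]) auto
    then obtain B0 where B0: "bad B0 T" by blast
    have ne: "B0 \<noteq> {}"
    proof
      assume "B0 = {}"
      then have "\<mu> powr q * 2 ^ sc T < 0" using B0 by (simp add: bad_def tree_sum_def)
      then show False by (simp add: not_less flip: linorder_not_le)
    qed
    have B0T: "qle P T" if "P \<in> B0" for P using B0 that qlev_qle uv(2) by (auto simp: bad_def)
    define A1 where "A1 = A - down_set {T}"
    have B0A1: "B0 \<inter> A1 = {}" using B0T by (auto simp: A1_def down_set_def)
    have "A1 \<subseteq> A" by (auto simp: A1_def)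
    moreover have "A1 \<noteq> A" using B0A1 B0 ne by (auto simp: bad_def)
    ultimately have sub: "A1 \<subset> A" "A1 \<subseteq> qbox L" using psubset.prems by auto
    from psubset.IH[OF this] obtain \<B> t where "selection L q \<mu> f u v A1 \<B> t" by blast
    note IH = selectionD[OF this]
    have nin: "B0 \<notin> \<B>" using IH(3) ne B0A1 by blast
    define t' where "t' = t(B0 := T)"
    have t': "t' B0 = T" "\<And>B. B \<in> \<B> \<Longrightarrow> t' B = t B" using nin by (auto simp: t'_def)
    \<comment> \<open>Trees chosen later were already bad in the larger set \<open>A\<close>, hence
      they competed for the minimum that \<open>T\<close> attains.\<close>
    have badIH: "bad B (t B)" if "B \<in> \<B>" for B using IH(3)[OF that] by (auto simp: bad_def A1_def)
    have scL: "sc T \<le> L" "\<And>B. B \<in> \<B> \<Longrightarrow> sc (t B) \<le> L" using B0 IH(3) by (auto simp: bad_def qbox_def)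
    have good: "\<not> qlev u P Q" if "P \<in> \<Union>(insert B0 \<B>)" "Q \<in> \<Union>(insert B0 \<B>)" "P \<noteq> Q" for P Q
    proof
      assume lev: "qlev u P Q"
      have "P \<in> B0 \<or> P \<in> \<Union>\<B>" "Q \<in> B0 \<or> Q \<in> \<Union>\<B>" using that by auto
      then consider "P \<in> B0" "Q \<in> B0" | "P \<in> B0" "Q \<in> \<Union>\<B>" | "P \<in> \<Union>\<B>" "Q \<in> B0" | "P \<in> \<Union>\<B>" "Q \<in> \<Union>\<B>"
        by blast
      then show False
      proof cases
        case 1
        then show False using same_tree_disjoint[OF _ _ lev] B0 uv that(3) unfolding bad_def by blast
      next
        case 2
        then obtain B where B: "B \<in> \<B>" "Q \<in> B" by blast
        have PT: "qlev v P T" using 2 B0 by (simp add: bad_def)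
        have QT: "qlev v Q (t B)" using B IH(3) by blast
        note c = conflict[OF PT QT lev that(3) uv(3,1,2) scL(1) scL(2)[OF B(1)]]
        \<comment> \<open>The first tree holds the smaller tile in time: \<open>conflict\<close>
          makes the key of the later top strictly less, against the choice of
          \<open>T\<close>.\<close>
        have "\<kappa> T \<le> \<kappa> (t B)" using min badIH[OF B(1)] by blast
        then show False using c(2,3) uv(3) by (auto simp: \<kappa>_def split: if_splits)
      next
        case 3
        then obtain B where B: "B \<in> \<B>" "P \<in> B" by blast
        have QT: "qlev v Q T" using 3 B0 by (simp add: bad_def)
        have PT: "qlev v P (t B)" using B IH(3) by blast
        \<comment> \<open>Now the later tree holds the smaller tile in time. Its quartile would lie
          under \<open>T\<close> and would have been removed before.\<close>
        have "qle P T" using conflict(1)[OF PT QT lev that(3) uv(3,1,2) scL(2)[OF B(1)] scL(1)] .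
        moreover have "P \<in> A1" using B IH(3) by blast
        ultimately show False by (auto simp: A1_def down_set_def)
      next
        case 4
        then show False using IH(4) that(3) lev by blast
      qed
    qed
    have dj: "disjoint (insert B0 \<B>)"
      using IH(2,3) B0A1 unfolding disjoint_def by (metis Int_commute disjoint_iff insert_iff subset_iff)
    have dneq: "A - down_set (t' ` insert B0 \<B>) \<subseteq> A1 - down_set (t ` \<B>)" using t' by (auto simp: A1_def down_set_def)
    show ?thesis unfolding selection_def
    proof (intro exI[of _ "insert B0 \<B>"] exI[of _ t'] conjI)
      show "finite (insert B0 \<B>)" using IH(1) by simp
      show "disjoint (insert B0 \<B>)" by (rule dj)
      show "\<forall>B\<in>insert B0 \<B>. B \<noteq> {} \<and> B \<subseteq> A \<and> t' B \<in> qbox L \<and> (\<forall>P\<in>B. qlev v P (t' B)) \<and>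
        \<mu> powr q * 2 ^ sc (t' B) < (\<Sum>x<2 ^ L. norm (tree_sum u f B x) powr q)"
      proof
        fix B assume "B \<in> insert B0 \<B>"
        then consider "B = B0" | "B \<in> \<B>" by blast
        then show "B \<noteq> {} \<and> B \<subseteq> A \<and> t' B \<in> qbox L \<and> (\<forall>P\<in>B. qlev v P (t' B)) \<and>
          \<mu> powr q * 2 ^ sc (t' B) < (\<Sum>x<2 ^ L. norm (tree_sum u f B x) powr q)"
          using ne B0 t' badIH IH(3) by cases (auto simp: bad_def)
      qed
      show "\<forall>P\<in>\<Union>(insert B0 \<B>). \<forall>Q\<in>\<Union>(insert B0 \<B>). P \<noteq> Q \<longrightarrow> \<not> qlev u P Q" using good by blast
      show "\<forall>T\<in>qbox L. \<forall>B. B \<subseteq> A - down_set (t' ` insert B0 \<B>) \<longrightarrow> (\<forall>P\<in>B. qlev v P T) \<longrightarrow>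
        (\<Sum>x<2 ^ L. norm (tree_sum u f B x) powr q) \<le> \<mu> powr q * 2 ^ sc T"
        using IH(5) dneq by (meson subset_trans)
    qed
  qed
qed

section \<open>Weak and strong type bounds for the total length of the tops\<close>

lemma sum_UN_le:
  fixes g :: "'i \<Rightarrow> real"
  assumes "finite I" "\<And>i. i \<in> I \<Longrightarrow> finite (F i)" "\<And>x. 0 \<le> g x"
  shows "sum g (\<Union>i\<in>I. F i) \<le> (\<Sum>i\<in>I. sum g (F i))"
  using assms(1,2)
proof (induction I rule: finite_induct)
  case (insert i I)
  have "sum g (F i \<union> (\<Union>i\<in>I. F i)) \<le> sum g (F i) + sum g (\<Union>i\<in>I. F i)"
    using insert sum.union_inter[of "F i" "\<Union>i\<in>I. F i" g] sum_nonneg[of "F i \<inter> (\<Union>i\<in>I. F i)" g] assms(3)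
    by (simp add: finite_UN) 
  then show ?case using insert by force
qed simp

lemma sum_image_le_real:
  fixes g :: "'i \<Rightarrow> real"
  assumes "finite I" "\<And>x. 0 \<le> g x"
  shows "sum g (t ` I) \<le> (\<Sum>i\<in>I. g (t i))"
  using sum_UN_le[OF assms(1), of "\<lambda>i. {t i}" g] assms(2) by (simp add: UNION_singleton_eq_range)

text \<open>A Chebyshev argument: every selected tree has a sum larger than
  \<open>\<mu> powr q\<close> times the length of its top, and quartile type bounds the total. One
  selection is made for each of the 16 pairs of indices, diagonal pairs contributing no top.\<close>

lemma weak_type:
  fixes f :: "nat \<Rightarrow> 'a::real_normed_vector"
  assumes C: "discrete_quartile_type q C TYPE('a)" and \<mu>: "0 < \<mu>"
  shows "\<exists>F\<subseteq>qbox L. size_le L q f (qbox L - down_set F) \<mu> \<and>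
     \<mu> powr q * (\<Sum>T\<in>F. 2 ^ sc T) \<le> 16 * (C * (\<Sum>x<2 ^ L. norm (f x) powr q))"
proof -
  let ?E = "C * (\<Sum>x<2 ^ L. norm (f x) powr q)"
  have C0: "0 \<le> C" using C by (simp add: discrete_quartile_type_def)
  have E: "0 \<le> ?E" using C0 by (intro mult_nonneg_nonneg sum_nonneg) auto
  let ?S = "{..<4::nat} \<times> {..<4::nat}"
  have "\<exists>F\<subseteq>qbox L. \<mu> powr q * (\<Sum>T\<in>F. 2 ^ sc T) \<le> ?E \<and> (fst p \<noteq> snd p \<longrightarrow>
      (\<forall>T\<in>qbox L. \<forall>B. B \<subseteq> qbox L - down_set F \<longrightarrow> (\<forall>P\<in>B. qlev (snd p) P T) \<longrightarrow>
      (\<Sum>x<2 ^ L. norm (tree_sum (fst p) f B x) powr q) \<le> \<mu> powr q * 2 ^ sc T))" if p: "p \<in> ?S" for p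
  proof (cases "fst p = snd p")
    case True
    then show ?thesis using E by (intro exI[of _ "{}"]) auto
  next
    case False
    have uv: "fst p < 4" "snd p < 4" "fst p \<noteq> snd p" using p False by auto
    from select_trees[OF uv subset_refl, of L q \<mu> f] obtain \<B> t where
      "selection L q \<mu> f (fst p) (snd p) (qbox L) \<B> t" by blast
    note S = selectionD[OF this]
    have le: "(\<Sum>B\<in>\<B>. \<Sum>x<2 ^ L. norm (tree_sum (fst p) f B x) powr q) \<le> ?E"
      by (rule discrete_quartile_type_D[OF C uv S(1) _ S(2)]) (use S(3) in blast, rule S(4))
    have "\<mu> powr q * (\<Sum>T\<in>t ` \<B>. 2 ^ sc T) \<le> \<mu> powr q * (\<Sum>B\<in>\<B>. 2 ^ sc (t B))"
      using S(1) by (intro mult_left_mono sum_image_le_real) auto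
    also have "\<dots> = (\<Sum>B\<in>\<B>. \<mu> powr q * 2 ^ sc (t B))" by (rule sum_distrib_left)
    also have "\<dots> \<le> (\<Sum>B\<in>\<B>. \<Sum>x<2 ^ L. norm (tree_sum (fst p) f B x) powr q)"
      using S(3) by (intro sum_mono) (simp add: less_imp_le)
    also note le
    finally show ?thesis using S(3,5) by (intro exI[of _ "t ` \<B>"]) auto
  qed
  then have "\<exists>F. \<forall>p\<in>?S. F p \<subseteq> qbox L \<and> \<mu> powr q * (\<Sum>T\<in>F p. 2 ^ sc T) \<le> ?E \<and> (fst p \<noteq> snd p \<longrightarrow>
      (\<forall>T\<in>qbox L. \<forall>B. B \<subseteq> qbox L - down_set (F p) \<longrightarrow> (\<forall>P\<in>B. qlev (snd p) P T) \<longrightarrow>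
      (\<Sum>x<2 ^ L. norm (tree_sum (fst p) f B x) powr q) \<le> \<mu> powr q * 2 ^ sc T))"
    by (intro bchoice ballI)
  then obtain F where FF: "\<forall>p\<in>?S. F p \<subseteq> qbox L \<and> \<mu> powr q * (\<Sum>T\<in>F p. 2 ^ sc T) \<le> ?E \<and> (fst p \<noteq> snd p \<longrightarrow>
      (\<forall>T\<in>qbox L. \<forall>B. B \<subseteq> qbox L - down_set (F p) \<longrightarrow> (\<forall>P\<in>B. qlev (snd p) P T) \<longrightarrow>
      (\<Sum>x<2 ^ L. norm (tree_sum (fst p) f B x) powr q) \<le> \<mu> powr q * 2 ^ sc T))" ..
  have F: "F p \<subseteq> qbox L" "\<mu> powr q * (\<Sum>T\<in>F p. 2 ^ sc T) \<le> ?E" if "p \<in> ?S" for p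
    by (rule bspec[OF FF that, THEN conjunct1], rule bspec[OF FF that, THEN conjunct2, THEN conjunct1])
  have F3: "(\<Sum>x<2 ^ L. norm (tree_sum (fst p) f B x) powr q) \<le> \<mu> powr q * 2 ^ sc T"
    if "p \<in> ?S" "fst p \<noteq> snd p" "T \<in> qbox L" "B \<subseteq> qbox L - down_set (F p)" "\<forall>P\<in>B. qlev (snd p) P T" for p T B
    using bspec[OF FF that(1), THEN conjunct2, THEN conjunct2] that(2-5) by fast
  let ?F = "\<Union>p\<in>?S. F p"
  show ?thesis
  proof (intro exI[of _ ?F] conjI)
    show "?F \<subseteq> qbox L" using F(1) by blast
    show "size_le L q f (qbox L - down_set ?F) \<mu>"
      unfolding size_le_def
    proof (intro allI ballI impI)
      fix u v T B assume "u < 4" "v < 4" "u \<noteq> v" "T \<in> qbox L" "B \<subseteq> qbox L - down_set ?F" "\<forall>P\<in>B. qlev v P T"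
      moreover have "down_set (F (u, v)) \<subseteq> down_set ?F" using \<open>u < 4\<close> \<open>v < 4\<close> by (fastforce simp: down_set_def)
      ultimately show "(\<Sum>x<2 ^ L. norm (tree_sum u f B x) powr q) \<le> \<mu> powr q * 2 ^ sc T"
        by (intro F3[of "(u, v)" T B, simplified]) auto
    qed
    have "\<mu> powr q * (\<Sum>T\<in>?F. 2 ^ sc T) \<le> \<mu> powr q * (\<Sum>p\<in>?S. \<Sum>T\<in>F p. 2 ^ sc T)"
    proof (intro mult_left_mono sum_UN_le)
      show "finite (F p)" if "p \<in> ?S" for p by (rule finite_subset[OF F(1)[OF that] finite_qbox])
    qed auto
    also have "\<dots> = (\<Sum>p\<in>?S. \<mu> powr q * (\<Sum>T\<in>F p. 2 ^ sc T))" by (rule sum_distrib_left)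
    also have "\<dots> \<le> (\<Sum>p\<in>?S. ?E)" by (intro sum_mono F(2))
    finally show "\<mu> powr q * (\<Sum>T\<in>?F. 2 ^ sc T) \<le> 16 * ?E" by simp
  qed
qed

text \<open>A tree sum sees \<open>f\<close> only on the cells of the top. A single tree is a good
  family by \<open>same_tree_disjoint\<close>, so quartile type applied to the localised function
  costs only \<open>C * M powr q\<close> times the length of the top.\<close>

lemma size_le_bounded:
  fixes f :: "nat \<Rightarrow> 'a::real_normed_vector"
  assumes C: "discrete_quartile_type q C TYPE('a)" and f: "\<And>x. norm (f x) \<le> M" and M: "C * M powr q \<le> \<mu> powr q" and q: "0 \<le> q"
  shows "size_le L q f (qbox L) \<mu>"
  unfolding size_le_def
proof (intro allI ballI impI)
  fix u v T B assume uv: "u < 4" "v < 4" "u \<noteq> v" and T: "T \<in> qbox L" and B: "B \<subseteq> qbox L" "\<forall>P\<in>B. qlev v P T"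
  have C0: "0 \<le> C" using C by (simp add: discrete_quartile_type_def)
  define f' where "f' x = indicator (cells T) x *\<^sub>R f x" for x
  have av: "avg u f P = avg u f' P" if "P \<in> B" for P
    unfolding avg_def using qlev_cells B that by (intro arg_cong2[of _ _ _ _ scaleR] sum.cong refl) (fastforce simp: f'_def)
  have eq: "tree_sum u f B x = tree_sum u f' B x" for x
    unfolding tree_sum_def by (intro sum.cong refl) (simp add: av)
  have "(\<Sum>B\<in>{B}. \<Sum>x<2 ^ L. norm (tree_sum u f' B x) powr q) \<le> C * (\<Sum>x<2 ^ L. norm (f' x) powr q)"
  proof (rule discrete_quartile_type_D[OF C uv])
    show "\<not> qlev u P Q" if "P \<in> \<Union>{B}" "Q \<in> \<Union>{B}" "P \<noteq> Q" for P Q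
      using that B(2) same_tree_disjoint[of v P T Q u] uv by auto
  qed (use B in \<open>auto simp: disjoint_def\<close>)
  also have "(\<Sum>x<2 ^ L. norm (f' x) powr q) = (\<Sum>x<2 ^ L. indicator (cells T) x *\<^sub>R norm (f x) powr q)"
    by (intro sum.cong refl) (simp add: f'_def indicator_def)
  also have "\<dots> = (\<Sum>x\<in>cells T. norm (f x) powr q)" by (rule sum_indicator_cells[OF T])
  also have "C * \<dots> \<le> C * (\<Sum>x\<in>cells T. M powr q)"
    using f C0 q by (intro mult_left_mono sum_mono powr_mono2) auto
  also have "\<dots> = 2 ^ sc T * (C * M powr q)" by simp
  also have "\<dots> \<le> 2 ^ sc T * \<mu> powr q" by (intro mult_left_mono M) simp
  finally show "(\<Sum>x<2 ^ L. norm (tree_sum u f B x) powr q) \<le> \<mu> powr q * 2 ^ sc T" by (simp add: eq mult.commute)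
qed

lemma avg_add: "avg u (\<lambda>x. f x + g x) P = avg u f P + avg u g P"
  by (simp add: avg_def scaleR_add_right sum.distrib)

lemma tree_sum_add: "tree_sum u (\<lambda>x. f x + g x) B x = tree_sum u f B x + tree_sum u g B x"
  by (simp add: tree_sum_def avg_add scaleR_add_right sum.distrib)

text \<open>The constant 4 comes from \<open>2 powr q * 2 \<le> 4 powr q\<close>, valid for
  \<open>q \<ge> 1\<close>.\<close>

lemma size_le_add:
  assumes f: "size_le L q f A \<mu>" and g: "size_le L q g A \<mu>" and q: "1 \<le> q" and \<mu>: "0 \<le> \<mu>"
  shows "size_le L q (\<lambda>x. f x + g x) A (4 * \<mu>)"
  unfolding size_le_def tree_sum_add
proof (intro allI ballI impI)
  fix u v T B assume *: "u < 4" "v < 4" "u \<noteq> v" "T \<in> qbox L" "B \<subseteq> A" "\<forall>P\<in>B. qlev v P T"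
  have "(\<Sum>x<2 ^ L. norm (tree_sum u f B x + tree_sum u g B x) powr q)
    \<le> (\<Sum>x<2 ^ L. 2 powr q * (norm (tree_sum u f B x) powr q + norm (tree_sum u g B x) powr q))"
    using q by (intro sum_mono norm_powr_add_le) simp
  also have "\<dots> = 2 powr q * ((\<Sum>x<2 ^ L. norm (tree_sum u f B x) powr q) + (\<Sum>x<2 ^ L. norm (tree_sum u g B x) powr q))"
    by (simp only: sum_distrib_left[symmetric] sum.distrib)
  also have "\<dots> \<le> 2 powr q * (\<mu> powr q * 2 ^ sc T + \<mu> powr q * 2 ^ sc T)"
    using * by (intro mult_left_mono add_mono size_le_D[OF f, of u v] size_le_D[OF g, of u v]) auto
  also have "\<dots> = 2 powr q * 2 * (\<mu> powr q * 2 ^ sc T)" by simp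
  also have "\<dots> \<le> 2 powr q * 2 powr q * (\<mu> powr q * 2 ^ sc T)"
    using powr_mono[of 1 q 2] q by (intro mult_right_mono mult_left_mono) auto
  also have "2 powr q * 2 powr q * (\<mu> powr q * 2 ^ sc T) = (4 * \<mu>) powr q * 2 ^ sc T"
  proof -
    have "2 powr q * 2 powr q = 4 powr q" using powr_mult[of 2 2 q] by simp
    then show ?thesis using \<mu> by (simp add: powr_mult)
  qed
  finally show "(\<Sum>x<2 ^ L. norm (tree_sum u f B x + tree_sum u g B x) powr q) \<le> (4 * \<mu>) powr q * 2 ^ sc T" .
qed

text \<open>Below a small multiple of \<open>\<mu>\<close> the function is bounded and has size at
  most \<open>\<mu> / 4\<close> everywhere, without removing any tree. Only the part above that
  height pays for tops.\<close>

lemma truncated_weak_type: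
  fixes f :: "nat \<Rightarrow> 'a::real_normed_vector"
  assumes C: "discrete_quartile_type q C TYPE('a)" and \<mu>: "0 < \<mu>" and q: "1 \<le> q"
  shows "\<exists>F\<subseteq>qbox L. size_le L q f (qbox L - down_set F) \<mu> \<and>
     (\<Sum>T\<in>F. 2 ^ sc T) \<le> 16 * C * 4 powr q * \<mu> powr (- q) *
       (\<Sum>x<2 ^ L. if \<mu> / (4 * (C + 1)) < norm (f x) then norm (f x) powr q else 0)"
proof -
  have C0: "0 \<le> C" using C by (simp add: discrete_quartile_type_def)
  \<comment> \<open>The 4 pays for \<open>size_le_add\<close>. The denominator \<open>C + 1\<close>
    gives \<open>C * (1 / (C + 1)) powr q \<le> 1\<close> and stays positive for
    \<open>C = 0\<close>.\<close>
  define M where "M = \<mu> / (4 * (C + 1))"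
  have M0: "0 \<le> M" using \<mu> C0 by (simp add: M_def)
  define f1 where "f1 x = (if M < norm (f x) then f x else 0)" for x
  define f2 where "f2 x = (if M < norm (f x) then 0 else f x)" for x
  from weak_type[OF C, of "\<mu> / 4" L f1] \<mu> obtain F where F: "F \<subseteq> qbox L" "size_le L q f1 (qbox L - down_set F) (\<mu> / 4)"
    "(\<mu> / 4) powr q * (\<Sum>T\<in>F. 2 ^ sc T) \<le> 16 * (C * (\<Sum>x<2 ^ L. norm (f1 x) powr q))" by auto
  have "size_le L q f2 (qbox L) (\<mu> / 4)"
  proof (rule size_le_bounded[OF C])
    show "norm (f2 x) \<le> M" for x using M0 by (auto simp: f2_def)
    have "C * M powr q = C * (1 / (C + 1)) powr q * (\<mu> / 4) powr q"
    proof -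
      have "M = 1 / (C + 1) * (\<mu> / 4)" by (simp add: M_def)
      then show ?thesis using \<mu> C0 by (simp only: powr_mult mult.assoc)
    qed
    also have "(1 / (C + 1)) powr q \<le> (1 / (C + 1)) powr 1"
      using C0 q by (intro powr_mono') auto
    also have "C * (1 / (C + 1)) powr 1 * (\<mu> / 4) powr q \<le> 1 * (\<mu> / 4) powr q"
      using C0 by (intro mult_right_mono) auto
    finally show "C * M powr q \<le> (\<mu> / 4) powr q" using C0 by (simp add: mult_left_mono mult_right_mono)
  qed (use q in auto)
  then have "size_le L q (\<lambda>x. f1 x + f2 x) (qbox L - down_set F) (4 * (\<mu> / 4))"
    using F(2) q \<mu> by (intro size_le_add) (auto intro: size_le_subset)
  moreover have "(\<lambda>x. f1 x + f2 x) = f" by (auto simp: f1_def f2_def)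
  ultimately have 1: "size_le L q f (qbox L - down_set F) \<mu>" by simp
  have "norm (f1 x) powr q = (if \<mu> / (4 * (C + 1)) < norm (f x) then norm (f x) powr q else 0)" for x
    by (simp add: f1_def M_def)
  with F(3) have "(\<mu> / 4) powr q * (\<Sum>T\<in>F. 2 ^ sc T) \<le>
     16 * C * (\<Sum>x<2 ^ L. if \<mu> / (4 * (C + 1)) < norm (f x) then norm (f x) powr q else 0)" by simp
  then have "(\<Sum>T\<in>F. 2 ^ sc T) \<le> 16 * C * 4 powr q * \<mu> powr (- q) *
       (\<Sum>x<2 ^ L. if \<mu> / (4 * (C + 1)) < norm (f x) then norm (f x) powr q else 0)"
    using \<mu> by (simp add: powr_divide powr_minus field_simps)
  with F(1) 1 show ?thesis by blast
qed

text \<open>After removal of the largest exponent \<open>b\<close> all others are at most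
  \<open>b - 1\<close>, so a finite sum is dominated by the geometric series descending from its
  largest term.\<close>

lemma geometric_le:
  fixes S :: "int set" and \<theta> y :: real
  assumes "finite S" "0 < \<theta>" "\<And>k. k \<in> S \<Longrightarrow> 2 powr (\<theta> * of_int k) \<le> y" "0 \<le> y"
  shows "(\<Sum>k\<in>S. 2 powr (\<theta> * of_int k)) \<le> y / (1 - 2 powr (- \<theta>))"
  using assms(1,3,4)
proof (induction S arbitrary: y rule: finite_linorder_max_induct)
  case empty
  have "(2::real) powr (- \<theta>) < 1" using assms(2) by (simp add: powr_minus_divide)
  then show ?case using empty by simp
next
  case (insert b A)
  have s: "(2::real) powr (- \<theta>) < 1" using assms(2) by (simp add: powr_minus_divide)
  have "(\<Sum>k\<in>A. 2 powr (\<theta> * of_int k)) \<le> 2 powr (\<theta> * of_int (b - 1)) / (1 - 2 powr (- \<theta>))"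
  proof (rule insert.IH)
    fix k assume "k \<in> A"
    then have "k \<le> b - 1" using insert.hyps(2) by fastforce
    then show "2 powr (\<theta> * of_int k) \<le> 2 powr (\<theta> * of_int (b - 1))"
      using assms(2) by (intro powr_mono mult_left_mono) auto
  qed simp
  moreover have "2 powr (\<theta> * of_int (b - 1)) = 2 powr (\<theta> * of_int b) * 2 powr (- \<theta>)"
    by (simp add: algebra_simps flip: powr_add)
  moreover have "b \<notin> A" using insert.hyps(2) by auto
  ultimately have "(\<Sum>k\<in>insert b A. 2 powr (\<theta> * of_int k)) \<le>
      2 powr (\<theta> * of_int b) + 2 powr (\<theta> * of_int b) * 2 powr (- \<theta>) / (1 - 2 powr (- \<theta>))"
    using insert.hyps(1) by simp
  also have "\<dots> = 2 powr (\<theta> * of_int b) / (1 - 2 powr (- \<theta>))" 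
  proof -
    have "a + a * t / (1 - t) = a / (1 - t)" if "t < 1" for a t :: real using that by (simp add: field_simps)
    then show ?thesis using s by blast
  qed
  also have "\<dots> \<le> y / (1 - 2 powr (- \<theta>))" using insert.prems(1)[of b] s by (intro divide_right_mono) auto
  finally show ?case .
qed

text \<open>Marcinkiewicz interpolation carried out pointwise. A value of norm \<open>a\<close> is
  charged \<open>a powr q * 2 powr (\<theta> * k)\<close> at each level with
  \<open>2 powr (k / p)\<close> below a multiple of \<open>a\<close>. As
  \<open>\<theta> = 1 - q / p\<close> is positive, these charges add up to a multiple of
  \<open>a powr p\<close>.\<close>

lemma strong_type:
  assumes C: "discrete_quartile_type q C TYPE('a::real_normed_vector)" and q: "1 \<le> q" and p: "q < p"
  obtains D where "0 \<le> D" and "\<And>L (f :: nat \<Rightarrow> 'a). \<exists>F :: int \<Rightarrow> dquart set. \<forall>k. F k \<subseteq> qbox L \<and>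
     size_le L q f (qbox L - down_set (F k)) (2 powr (of_int k / p)) \<and>
     (\<forall>S. finite S \<longrightarrow> (\<Sum>k\<in>S. 2 powr of_int k * (\<Sum>T\<in>F k. 2 ^ sc T)) \<le> D * (\<Sum>x<2 ^ L. norm (f x) powr p))"
proof -
  have C0: "0 \<le> C" using C by (simp add: discrete_quartile_type_def)
  define c where "c = 1 / (4 * (C + 1))"
  have c0: "0 < c" using C0 by (simp add: c_def)
  define \<theta> where "\<theta> = 1 - q / p"
  have \<theta>: "0 < \<theta>" using p q by (simp add: \<theta>_def)
  have s: "(2::real) powr (- \<theta>) < 1" using \<theta> by (simp add: powr_minus_divide)
  define E where "E = 16 * C * 4 powr q"
  have E0: "0 \<le> E" using C0 by (simp add: E_def)
  define D where "D = E * ((1 / c) powr (p - q) / (1 - 2 powr (- \<theta>)))"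
  have D0: "0 \<le> D" using E0 s by (simp add: D_def)
  show thesis
  proof (rule that[OF D0])
    fix L and f :: "nat \<Rightarrow> 'a"
    define G where "G k x = (if 2 powr (of_int k / p) * c < norm (f x) then norm (f x) powr q else 0)" for k :: int and x
    have "\<forall>k::int. \<exists>F. F \<subseteq> qbox L \<and> size_le L q f (qbox L - down_set F) (2 powr (of_int k / p)) \<and>
       (\<Sum>T\<in>F. 2 ^ sc T) \<le> E * (2 powr (of_int k / p)) powr (- q) * (\<Sum>x<2 ^ L. G k x)"
    proof
      fix k :: int
      show "\<exists>F. F \<subseteq> qbox L \<and> size_le L q f (qbox L - down_set F) (2 powr (of_int k / p)) \<and>
       (\<Sum>T\<in>F. 2 ^ sc T) \<le> E * (2 powr (of_int k / p)) powr (- q) * (\<Sum>x<2 ^ L. G k x)"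
        using truncated_weak_type[OF C _ q, of "2 powr (of_int k / p)" L f] by (simp add: E_def G_def c_def)
    qed
    from choice[OF this] obtain F where F: "\<And>k. F k \<subseteq> qbox L" "\<And>k. size_le L q f (qbox L - down_set (F k)) (2 powr (of_int k / p))"
       "\<And>k. (\<Sum>T\<in>F k. 2 ^ sc T) \<le> E * (2 powr (of_int k / p)) powr (- q) * (\<Sum>x<2 ^ L. G k x)" by blast
    have "(\<Sum>k\<in>S. 2 powr of_int k * (\<Sum>T\<in>F k. 2 ^ sc T)) \<le> D * (\<Sum>x<2 ^ L. norm (f x) powr p)" if S: "finite S" for S
    proof -
      have pt: "(\<Sum>k\<in>S. 2 powr (\<theta> * of_int k) * G k x) \<le> ((1 / c) powr (p - q) / (1 - 2 powr (- \<theta>))) * norm (f x) powr p" for x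
      proof -
        define S' where "S' = {k \<in> S. 2 powr (of_int k / p) * c < norm (f x)}"
        have "(\<Sum>k\<in>S. 2 powr (\<theta> * of_int k) * G k x) = (\<Sum>k\<in>S'. 2 powr (\<theta> * of_int k) * norm (f x) powr q)"
          using S unfolding S'_def G_def by (intro sum.mono_neutral_cong_right) auto
        also have "\<dots> = (\<Sum>k\<in>S'. 2 powr (\<theta> * of_int k)) * norm (f x) powr q" by (rule sum_distrib_right[symmetric])
        also have "\<dots> \<le> ((norm (f x) / c) powr (p - q) / (1 - 2 powr (- \<theta>))) * norm (f x) powr q"
        proof (intro mult_right_mono geometric_le)
          fix k assume "k \<in> S'"
          then have "2 powr (of_int k / p) \<le> norm (f x) / c" using c0 by (simp add: S'_def field_simps)
          then have "(2 powr (of_int k / p)) powr (p - q) \<le> (norm (f x) / c) powr (p - q)"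
            using p by (intro powr_mono2) auto
          moreover have "of_int k / p * (p - q) = \<theta> * of_int k" using p q by (simp add: \<theta>_def field_simps)
          ultimately show "2 powr (\<theta> * of_int k) \<le> (norm (f x) / c) powr (p - q)" by (simp add: powr_powr)
        qed (use S \<theta> in \<open>auto simp: S'_def\<close>)
        also have "\<dots> = ((1 / c) powr (p - q) / (1 - 2 powr (- \<theta>))) * (norm (f x) powr (p - q) * norm (f x) powr q)"
          using c0 by (simp add: powr_divide)
        finally show ?thesis by (simp flip: powr_add)
      qed
      have e: "2 powr of_int k * (2 powr (of_int k / p)) powr (- q) = 2 powr (\<theta> * of_int k)" for k :: int
      proof -
        have "of_int k + of_int k / p * - q = \<theta> * of_int k" by (simp add: \<theta>_def left_diff_distrib)
        then show ?thesis by (simp only: powr_powr powr_add[symmetric])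
      qed
      have "(\<Sum>k\<in>S. 2 powr of_int k * (\<Sum>T\<in>F k. 2 ^ sc T)) \<le>
         (\<Sum>k\<in>S. 2 powr of_int k * (E * (2 powr (of_int k / p)) powr (- q) * (\<Sum>x<2 ^ L. G k x)))"
        by (intro sum_mono mult_left_mono F) simp
      also have "\<dots> = (\<Sum>k\<in>S. E * (\<Sum>x<2 ^ L. 2 powr (\<theta> * of_int k) * G k x))"
      proof (intro sum.cong refl)
        fix k
        have "(\<Sum>x<2 ^ L. 2 powr (\<theta> * of_int k) * G k x) = 2 powr (\<theta> * of_int k) * (\<Sum>x<2 ^ L. G k x)"
          by (rule sum_distrib_left[symmetric])
        then show "2 powr of_int k * (E * (2 powr (of_int k / p)) powr (- q) * (\<Sum>x<2 ^ L. G k x)) =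
           E * (\<Sum>x<2 ^ L. 2 powr (\<theta> * of_int k) * G k x)"
          by (simp only: e[symmetric] mult_ac)
      qed
      also have "\<dots> = E * (\<Sum>x<2 ^ L. \<Sum>k\<in>S. 2 powr (\<theta> * of_int k) * G k x)"
        by (subst sum.swap) (simp add: sum_distrib_left)
      also have "\<dots> \<le> E * (\<Sum>x<2 ^ L. ((1 / c) powr (p - q) / (1 - 2 powr (- \<theta>))) * norm (f x) powr p)"
        by (intro mult_left_mono sum_mono pt E0)
      also have "\<dots> = D * (\<Sum>x<2 ^ L. norm (f x) powr p)" by (simp only: D_def sum_distrib_left mult.assoc)
      finally show ?thesis .
    qed
    with F(1,2) show "\<exists>F :: int \<Rightarrow> dquart set. \<forall>k. F k \<subseteq> qbox L \<and>
     size_le L q f (qbox L - down_set (F k)) (2 powr (of_int k / p)) \<and>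
     (\<forall>S. finite S \<longrightarrow> (\<Sum>k\<in>S. 2 powr of_int k * (\<Sum>T\<in>F k. 2 ^ sc T)) \<le> D * (\<Sum>x<2 ^ L. norm (f x) powr p))"
      by blast
  qed
qed

section \<open>The discrete trilinear inequality\<close>

text \<open>The dual form of the quartile operator. The weight is the length of the time interval:
  each of three pairings contributes the square root of it times an average, and the operator itself
  the inverse square root.\<close>

definition quartile_form ::
  "('a::real_normed_vector \<Rightarrow> 'b::real_normed_vector \<Rightarrow> 'c::real_normed_vector \<Rightarrow> 'd::real_normed_vector) \<Rightarrow>
   (nat \<Rightarrow> 'a) \<Rightarrow> (nat \<Rightarrow> 'b) \<Rightarrow> (nat \<Rightarrow> 'c) \<Rightarrow> dquart set \<Rightarrow> 'd" where
  "quartile_form \<Psi> f g h S = (\<Sum>P\<in>S. 2 ^ sc P *\<^sub>R \<Psi> (avg 1 f P) (avg 2 g P) (avg 3 h P))"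

lemma quartile_form_union:
  "finite S \<Longrightarrow> finite S' \<Longrightarrow> S \<inter> S' = {} \<Longrightarrow> quartile_form \<Psi> f g h (S \<union> S') = quartile_form \<Psi> f g h S + quartile_form \<Psi> f g h S'"
  by (simp add: quartile_form_def sum.union_disjoint)

definition qle_convex :: "dquart set \<Rightarrow> bool" where
  "qle_convex A \<longleftrightarrow> (\<forall>P\<in>A. \<forall>R\<in>A. \<forall>Q. qle P Q \<longrightarrow> qle Q R \<longrightarrow> Q \<in> A)"

lemma qle_convex_D: "qle_convex A \<Longrightarrow> P \<in> A \<Longrightarrow> R \<in> A \<Longrightarrow> qle P Q \<Longrightarrow> qle Q R \<Longrightarrow> Q \<in> A"
  unfolding qle_convex_def by blast

text \<open>If a quartile between \<open>P\<close> and \<open>R\<close> were under a top, the lower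
  end \<open>P\<close> would be under it as well.\<close>

lemma qle_convex_Diff_down_set: "qle_convex A \<Longrightarrow> qle_convex (A - down_set F)"
  unfolding qle_convex_def down_set_def using qle_trans by blast

lemma qle_convex_qbox: "qle_convex (qbox L)"
  unfolding qle_convex_def
proof (intro ballI allI impI)
  fix P R Q assume P: "P \<in> qbox L" and R: "R \<in> qbox L" and PQ: "qle P Q" and QR: "qle Q R"
  have sc: "sc P \<le> sc Q" "sc Q \<le> sc R" "sc R \<le> L" "2 \<le> sc P" using PQ QR P R by (auto simp: qle_def qbox_def)
  have "ps Q = ps P div 2 ^ (sc Q - sc P)" using PQ by (simp add: qle_def)
  moreover have "ps P < 2 ^ (L - sc Q) * 2 ^ (sc Q - sc P)" using P sc by (simp add: qbox_def flip: power_add)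
  ultimately have 1: "ps Q < 2 ^ (L - sc Q)" by (simp add: div_less_iff_less_mult)
  have "fr Q = fr R div 2 ^ (sc R - sc Q)" using QR by (simp add: qle_def)
  moreover have "fr R < 2 ^ (sc Q - 2) * 2 ^ (sc R - sc Q)" using R sc by (simp add: qbox_def flip: power_add)
  ultimately have "fr Q < 2 ^ (sc Q - 2)" by (simp add: div_less_iff_less_mult)
  with 1 sc show "Q \<in> qbox L" by (simp add: qbox_def)
qed

lemma avg_scaleR: "avg u (\<lambda>x. c *\<^sub>R f x) P = c *\<^sub>R avg u f P"
  by (simp add: avg_def scaleR_sum_right mult.left_commute mult.commute)

lemma avg_zero: assumes "P \<in> qbox L" "\<And>x. x < 2 ^ L \<Longrightarrow> f x = 0" shows "avg u f P = 0"
proof -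
  have "\<forall>i\<in>cells P. f i = 0" using cells_qbox[OF assms(1)] assms(2) by blast
  then show ?thesis by (simp add: avg_def)
qed

definition discrete_norm :: "nat \<Rightarrow> real \<Rightarrow> (nat \<Rightarrow> 'x::real_normed_vector) \<Rightarrow> real" where
  "discrete_norm L p f = (\<Sum>x<2 ^ L. norm (f x) powr p) powr (1 / p)"

lemma discrete_norm_zero:
  assumes "discrete_norm L p f = 0" "x < 2 ^ L" shows "f x = 0"
proof -
  have "(\<Sum>x<2 ^ L. norm (f x) powr p) = 0" using assms(1) by (simp add: discrete_norm_def)
  then have "norm (f x) powr p = 0" using assms(2) by (subst (asm) sum_nonneg_eq_0_iff) auto
  then show ?thesis by simp
qed

lemma discrete_norm_scaled:
  assumes "0 < p" "0 < discrete_norm L p f"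
  shows "(\<Sum>x<2 ^ L. norm ((1 / discrete_norm L p f) *\<^sub>R f x) powr p) = 1"
proof -
  let ?s = "\<Sum>x<2 ^ L. norm (f x) powr p"
  have s: "0 < ?s" using assms by (simp add: discrete_norm_def less_le sum_nonneg)
  have "discrete_norm L p f powr p = ?s" using s assms by (simp add: discrete_norm_def powr_powr)
  moreover have "norm ((1 / discrete_norm L p f) *\<^sub>R f x) powr p = norm (f x) powr p / discrete_norm L p f powr p" for x
    using assms by (simp add: powr_divide)
  ultimately show ?thesis using s by (simp flip: sum_divide_distrib)
qed

locale discrete_setup =
  fixes \<Psi> :: "'a::real_normed_vector \<Rightarrow> 'b::real_normed_vector \<Rightarrow> 'c::real_normed_vector \<Rightarrow> 'd::real_normed_vector"
    and K q1 q2 q3 :: real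
  assumes tri: "trilin \<Psi> K" and q1: "2 \<le> q1" and q2: "2 \<le> q2" and q3: "2 \<le> q3"
begin

text \<open>All three exponents enter, so that one constant covers every choice of the two lacunary
  slots.\<close>

definition M where "M = 2 * K * (1 + 2 powr (q1 + 1) + 2 powr (q2 + 1) + 2 powr (q3 + 1))"

lemma K0: "0 \<le> K" using tri by (simp add: trilin_def)

lemma M0: "0 \<le> M" using K0 by (simp add: M_def)

text \<open>The slot with the pointwise bound is slot \<open>v\<close> if \<open>v\<close> is 1, 2
  or 3. For \<open>v = 0\<close> it is slot 1, admissible because tiles 0 and 1 differ only by the
  coarsest sign. The last two cases permute the arguments of the form.\<close>

lemma v_tree:
  assumes A: "A \<subseteq> qbox L" "qle_convex A" and T: "T \<in> qbox L" and B: "B \<subseteq> A" "\<And>P. P \<in> B \<Longrightarrow> qlev v P T" and v: "v < 4"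
    and szs: "size_le L q1 f A \<mu>1" "size_le L q2 g A \<mu>2" "size_le L q3 h A \<mu>3" and pos: "0 < \<mu>1" "0 < \<mu>2" "0 < \<mu>3"
  shows "norm (quartile_form \<Psi> f g h B) \<le> M * 2 ^ sc T * (\<mu>1 * \<mu>2 * \<mu>3)"
proof -
  note qle_convex = qle_convex_D[OF A(2)]
  have M: "2 * K * (1 + 2 powr (q + 1) + 2 powr (q' + 1)) * 2 ^ sc T * (\<mu>1 * \<mu>2 * \<mu>3) \<le> M * 2 ^ sc T * (\<mu>1 * \<mu>2 * \<mu>3)"
    if "(q, q') \<in> {(q2, q3), (q1, q3), (q1, q2)}" for q q'
    using that K0 pos unfolding M_def by (intro mult_right_mono mult_left_mono) auto
  have q: "1 \<le> q1" "1 \<le> q2" "1 \<le> q3" using q1 q2 q3 by auto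
  consider "v = 0 \<or> v = 1" | "v = 2" | "v = 3" using v by linarith
  then show ?thesis
  proof cases
    case 1
    have "norm (quartile_form \<Psi> f g h B) \<le> 2 * K * (1 + 2 powr (q2 + 1) + 2 powr (q3 + 1)) * 2 ^ sc T * (\<mu>1 * \<mu>2 * \<mu>3)"
      unfolding quartile_form_def
      by (rule tree_estimate[OF tri A(1) qle_convex T B v _ _ _ _ _ _ szs q(1) q2 q3 pos]) (use 1 in auto)
    then show ?thesis by (rule order_trans[OF _ M]) simp
  next
    case 2
    have tri': "trilin (\<lambda>y x z. \<Psi> x y z) K" using tri by (auto simp: trilin_def mult_ac)
    have "norm (quartile_form \<Psi> f g h B)
       \<le> 2 * K * (1 + 2 powr (q1 + 1) + 2 powr (q3 + 1)) * 2 ^ sc T * (\<mu>2 * \<mu>1 * \<mu>3)"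
      unfolding quartile_form_def
      by (rule tree_estimate[OF tri' A(1) qle_convex T B v _ _ _ _ _ _ szs(2,1,3) q(2) q1 q3 pos(2,1,3)]) (use 2 in auto)
    also have "\<mu>2 * \<mu>1 * \<mu>3 = \<mu>1 * \<mu>2 * \<mu>3" by (simp add: mult_ac)
    finally show ?thesis by (rule order_trans[OF _ M]) simp
  next
    case 3
    have tri': "trilin (\<lambda>z x y. \<Psi> x y z) K" using tri by (auto simp: trilin_def mult_ac)
    have "norm (quartile_form \<Psi> f g h B)
       \<le> 2 * K * (1 + 2 powr (q1 + 1) + 2 powr (q2 + 1)) * 2 ^ sc T * (\<mu>3 * \<mu>1 * \<mu>2)"
      unfolding quartile_form_def
      by (rule tree_estimate[OF tri' A(1) qle_convex T B v _ _ _ _ _ _ szs(3,1,2) q(3) q1 q2 pos(3,1,2)]) (use 3 in auto)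
    also have "\<mu>3 * \<mu>1 * \<mu>2 = \<mu>1 * \<mu>2 * \<mu>3" by (simp add: mult_ac)
    finally show ?thesis by (rule order_trans[OF _ M]) simp
  qed
qed

lemma full_tree:
  assumes A: "A \<subseteq> qbox L" "qle_convex A" and T: "T \<in> qbox L"
    and szs: "size_le L q1 f A \<mu>1" "size_le L q2 g A \<mu>2" "size_le L q3 h A \<mu>3" and pos: "0 < \<mu>1" "0 < \<mu>2" "0 < \<mu>3"
  shows "norm (quartile_form \<Psi> f g h (A \<inter> down_set {T})) \<le> 4 * M * 2 ^ sc T * (\<mu>1 * \<mu>2 * \<mu>3)"
proof -
  have fin: "finite A" using A(1) finite_qbox finite_subset by blast
  have "\<forall>P\<in>A \<inter> down_set {T}. \<exists>v. v < 4 \<and> qlev v P T" using qle_qlev_ex by (auto simp: down_set_def)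
  from bchoice[OF this] obtain w where w: "\<forall>P\<in>A \<inter> down_set {T}. w P < 4 \<and> qlev (w P) P T" ..
  have "quartile_form \<Psi> f g h (A \<inter> down_set {T}) = (\<Sum>v\<in>{..<4}. quartile_form \<Psi> f g h {P \<in> A \<inter> down_set {T}. w P = v})"
    unfolding quartile_form_def using fin w by (intro sum.group[symmetric]) auto
  also have "norm \<dots> \<le> (\<Sum>v\<in>{..<4::nat}. M * 2 ^ sc T * (\<mu>1 * \<mu>2 * \<mu>3))"
    by (intro sum_norm_le v_tree[OF A T _ _ _ szs pos]) (use w in auto)
  finally show ?thesis by simp
qed

text \<open>Tops are removed one by one. Later trees are taken in what is left, which is still
  convex and has no larger sizes, so nothing is counted twice.\<close>

lemma forest:
  assumes "finite F" "F \<subseteq> qbox L" "A \<subseteq> qbox L" "qle_convex A"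
    and "size_le L q1 f A \<mu>1" "size_le L q2 g A \<mu>2" "size_le L q3 h A \<mu>3" and pos: "0 < \<mu>1" "0 < \<mu>2" "0 < \<mu>3"
  shows "norm (quartile_form \<Psi> f g h (A \<inter> down_set F)) \<le> 4 * M * (\<Sum>T\<in>F. 2 ^ sc T) * (\<mu>1 * \<mu>2 * \<mu>3)"
  using assms(1-7)
proof (induction F arbitrary: A rule: finite_induct)
  case empty
  then show ?case by (simp add: down_set_def quartile_form_def)
next
  case (insert T F)
  have fin: "finite A" using insert.prems(2) finite_qbox finite_subset by blast
  let ?A = "A - down_set {T}"
  have eq: "A \<inter> down_set (insert T F) = (A \<inter> down_set {T}) \<union> (?A \<inter> down_set F)" by (auto simp: down_set_def)
  have "norm (quartile_form \<Psi> f g h (?A \<inter> down_set F)) \<le> 4 * M * (\<Sum>T\<in>F. 2 ^ sc T) * (\<mu>1 * \<mu>2 * \<mu>3)"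
    using insert.prems by (intro insert.IH qle_convex_Diff_down_set) (auto intro: size_le_subset)
  moreover have "norm (quartile_form \<Psi> f g h (A \<inter> down_set {T})) \<le> 4 * M * 2 ^ sc T * (\<mu>1 * \<mu>2 * \<mu>3)"
    using insert.prems pos by (intro full_tree) auto
  moreover have "quartile_form \<Psi> f g h (A \<inter> down_set (insert T F)) = quartile_form \<Psi> f g h (A \<inter> down_set {T}) + quartile_form \<Psi> f g h (?A \<inter> down_set F)"
    unfolding eq using fin by (intro quartile_form_union) auto
  ultimately have "norm (quartile_form \<Psi> f g h (A \<inter> down_set (insert T F)))
      \<le> 4 * M * 2 ^ sc T * (\<mu>1 * \<mu>2 * \<mu>3) + 4 * M * (\<Sum>T\<in>F. 2 ^ sc T) * (\<mu>1 * \<mu>2 * \<mu>3)"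
    by (simp only: norm_triangle_mono)
  then show ?case using insert.hyps by (simp add: algebra_simps)
qed

text \<open>A crude bound depending on the box. It serves only to show that the remainder disappears
  when the sizes tend to zero with \<open>L\<close> fixed.\<close>

lemma quartile_form_sizes:
  assumes "A \<subseteq> qbox L" "size_le L q1 f A \<mu>1" "size_le L q2 g A \<mu>2" "size_le L q3 h A \<mu>3" "0 < \<mu>1" "0 < \<mu>2" "0 < \<mu>3"
  shows "norm (quartile_form \<Psi> f g h A) \<le> real (card (qbox L)) * 2 ^ L * K * (\<mu>1 * \<mu>2 * \<mu>3)"
proof -
  have "norm (2 ^ sc P *\<^sub>R \<Psi> (avg 1 f P) (avg 2 g P) (avg 3 h P)) \<le> 2 ^ L * (K * \<mu>1 * \<mu>2 * \<mu>3)" if P: "P \<in> A" for P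
  proof -
    have "norm (\<Psi> (avg 1 f P) (avg 2 g P) (avg 3 h P)) \<le> K * norm (avg 1 f P) * norm (avg 2 g P) * norm (avg 3 h P)"
      using tri by (simp add: trilin_def)
    also have "\<dots> \<le> K * \<mu>1 * \<mu>2 * \<mu>3"
      using size_le_single[OF assms(2) _ _ P assms(1), of 1] size_le_single[OF assms(3) _ _ P assms(1), of 2]
        size_le_single[OF assms(4) _ _ P assms(1), of 3] assms q1 q2 q3 K0 by (intro mult_mono) auto
    finally have 1: "norm (\<Psi> (avg 1 f P) (avg 2 g P) (avg 3 h P)) \<le> K * \<mu>1 * \<mu>2 * \<mu>3" .
    have "(2::real) ^ sc P \<le> 2 ^ L" using P assms(1) by (intro power_increasing) (auto simp: qbox_def)
    then show ?thesis using 1 K0 assms by (simp) (intro mult_mono; simp)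
  qed
  then have "norm (quartile_form \<Psi> f g h A) \<le> (\<Sum>P\<in>A. 2 ^ L * (K * \<mu>1 * \<mu>2 * \<mu>3))"
    unfolding quartile_form_def by (rule sum_norm_le)
  also have "\<dots> = real (card A) * (2 ^ L * (K * \<mu>1 * \<mu>2 * \<mu>3))" by simp
  also have "\<dots> \<le> real (card (qbox L)) * (2 ^ L * (K * \<mu>1 * \<mu>2 * \<mu>3))"
    using assms K0 by (intro mult_right_mono) (auto intro: card_mono)
  finally show ?thesis by (simp add: mult_ac)
qed

text \<open>Starting from the whole box, the tops of lower and lower levels are removed. Each
  removed forest still satisfies the thresholds of the level above, and its total length is weighted
  by the matching power of 2, so \<open>strong_type\<close> bounds the sum over all levels
  independently of \<open>L\<close>.\<close>

lemma additive_bound: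
  assumes C: "discrete_quartile_type q1 C1 TYPE('a)" "discrete_quartile_type q2 C2 TYPE('b)" "discrete_quartile_type q3 C3 TYPE('c)"
    and p: "q1 < p1" "q2 < p2" "q3 < p3" "1 / p1 + 1 / p2 + 1 / p3 = 1"
  obtains D where "0 \<le> D" "\<And>L f g h. norm (quartile_form \<Psi> f g h (qbox L)) \<le>
    D * ((\<Sum>x<2 ^ L. norm (f x) powr p1) + (\<Sum>x<2 ^ L. norm (g x) powr p2) + (\<Sum>x<2 ^ L. norm (h x) powr p3))"
proof -
  have q: "1 \<le> q1" "1 \<le> q2" "1 \<le> q3" using q1 q2 q3 by auto
  obtain D1 where D1: "0 \<le> D1" "\<And>L (f :: nat \<Rightarrow> 'a). \<exists>F :: int \<Rightarrow> dquart set. \<forall>k. F k \<subseteq> qbox L \<and>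
     size_le L q1 f (qbox L - down_set (F k)) (2 powr (of_int k / p1)) \<and>
     (\<forall>S. finite S \<longrightarrow> (\<Sum>k\<in>S. 2 powr of_int k * (\<Sum>T\<in>F k. 2 ^ sc T)) \<le> D1 * (\<Sum>x<2 ^ L. norm (f x) powr p1))"
    by (rule strong_type[OF C(1) q(1) p(1)]) blast
  obtain D2 where D2: "0 \<le> D2" "\<And>L (f :: nat \<Rightarrow> 'b). \<exists>F :: int \<Rightarrow> dquart set. \<forall>k. F k \<subseteq> qbox L \<and>
     size_le L q2 f (qbox L - down_set (F k)) (2 powr (of_int k / p2)) \<and>
     (\<forall>S. finite S \<longrightarrow> (\<Sum>k\<in>S. 2 powr of_int k * (\<Sum>T\<in>F k. 2 ^ sc T)) \<le> D2 * (\<Sum>x<2 ^ L. norm (f x) powr p2))"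
    by (rule strong_type[OF C(2) q(2) p(2)]) blast
  obtain D3 where D3: "0 \<le> D3" "\<And>L (f :: nat \<Rightarrow> 'c). \<exists>F :: int \<Rightarrow> dquart set. \<forall>k. F k \<subseteq> qbox L \<and>
     size_le L q3 f (qbox L - down_set (F k)) (2 powr (of_int k / p3)) \<and>
     (\<forall>S. finite S \<longrightarrow> (\<Sum>k\<in>S. 2 powr of_int k * (\<Sum>T\<in>F k. 2 ^ sc T)) \<le> D3 * (\<Sum>x<2 ^ L. norm (f x) powr p3))"
    by (rule strong_type[OF C(3) q(3) p(3)]) blast
  define D where "D = max D1 (max D2 D3)"
  have DD: "D1 \<le> D" "D2 \<le> D" "D3 \<le> D" by (auto simp: D_def)
  have D0: "0 \<le> D" using D1(1) DD(1) by linarith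
  show thesis
  proof (rule that)
    show "0 \<le> 8 * M * D" using M0 D0 by simp
    fix L and f :: "nat \<Rightarrow> 'a" and g :: "nat \<Rightarrow> 'b" and h :: "nat \<Rightarrow> 'c"
    let ?a = "\<Sum>x<2 ^ L. norm (f x) powr p1" and ?b = "\<Sum>x<2 ^ L. norm (g x) powr p2" and ?c = "\<Sum>x<2 ^ L. norm (h x) powr p3"
    have abc: "0 \<le> ?a" "0 \<le> ?b" "0 \<le> ?c" by (auto intro!: sum_nonneg)
    from D1(2)[of L f] obtain F1 :: "int \<Rightarrow> dquart set" where F1: "\<And>k. F1 k \<subseteq> qbox L"
      "\<And>k. size_le L q1 f (qbox L - down_set (F1 k)) (2 powr (of_int k / p1))"
      "\<And>S. finite S \<Longrightarrow> (\<Sum>k\<in>S. 2 powr of_int k * (\<Sum>T\<in>F1 k. 2 ^ sc T)) \<le> D1 * ?a" by blast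
    from D2(2)[of L g] obtain F2 :: "int \<Rightarrow> dquart set" where F2: "\<And>k. F2 k \<subseteq> qbox L"
      "\<And>k. size_le L q2 g (qbox L - down_set (F2 k)) (2 powr (of_int k / p2))"
      "\<And>S. finite S \<Longrightarrow> (\<Sum>k\<in>S. 2 powr of_int k * (\<Sum>T\<in>F2 k. 2 ^ sc T)) \<le> D2 * ?b" by blast
    from D3(2)[of L h] obtain F3 :: "int \<Rightarrow> dquart set" where F3: "\<And>k. F3 k \<subseteq> qbox L"
      "\<And>k. size_le L q3 h (qbox L - down_set (F3 k)) (2 powr (of_int k / p3))"
      "\<And>S. finite S \<Longrightarrow> (\<Sum>k\<in>S. 2 powr of_int k * (\<Sum>T\<in>F3 k. 2 ^ sc T)) \<le> D3 * ?c" by blast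
    define F where "F k = F1 k \<union> F2 k \<union> F3 k" for k
    define m where "m k = (\<Sum>T\<in>F k. 2 ^ sc T :: real)" for k
    have Fq: "F k \<subseteq> qbox L" for k using F1(1) F2(1) F3(1) by (auto simp: F_def)
    have fin: "finite (F1 k)" "finite (F2 k)" "finite (F3 k)" "finite (F k)" for k
      by (rule finite_subset[OF F1(1) finite_qbox], rule finite_subset[OF F2(1) finite_qbox],
          rule finite_subset[OF F3(1) finite_qbox], rule finite_subset[OF Fq finite_qbox])
    have szs: "size_le L q1 f (qbox L - down_set (F k)) (2 powr (of_int k / p1))" "size_le L q2 g (qbox L - down_set (F k)) (2 powr (of_int k / p2))"
      "size_le L q3 h (qbox L - down_set (F k)) (2 powr (of_int k / p3))" for k
      by (rule size_le_subset[OF F1(2)[of k]], force simp: F_def down_set_def, rule size_le_subset[OF F2(2)[of k]], force simp: F_def down_set_def,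
          rule size_le_subset[OF F3(2)[of k]], force simp: F_def down_set_def)
    have m_le: "m k \<le> (\<Sum>T\<in>F1 k. 2 ^ sc T) + (\<Sum>T\<in>F2 k. 2 ^ sc T) + (\<Sum>T\<in>F3 k. 2 ^ sc T)" for k
    proof -
      have *: "(\<Sum>T\<in>G \<union> G'. 2 ^ sc T) \<le> (\<Sum>T\<in>G. 2 ^ sc T) + (\<Sum>T\<in>G'. 2 ^ sc T :: real)" if "finite G" "finite G'" for G G'
        using sum.union_inter[OF that, of "\<lambda>T. 2 ^ sc T :: real"] sum_nonneg[of "G \<inter> G'" "\<lambda>T. 2 ^ sc T :: real"] by simp
      show ?thesis unfolding m_def F_def using *[of "F1 k \<union> F2 k" "F3 k"] *[of "F1 k" "F2 k"] fin by fastforce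
    qed
    have msum: "(\<Sum>k\<in>S. 2 powr of_int k * m k) \<le> D * (?a + ?b + ?c)" if S: "finite S" for S
    proof -
      have "(\<Sum>k\<in>S. 2 powr of_int k * m k) \<le>
        (\<Sum>k\<in>S. 2 powr of_int k * ((\<Sum>T\<in>F1 k. 2 ^ sc T) + (\<Sum>T\<in>F2 k. 2 ^ sc T) + (\<Sum>T\<in>F3 k. 2 ^ sc T)))"
        by (intro sum_mono mult_left_mono m_le) simp
      also have "\<dots> = (\<Sum>k\<in>S. 2 powr of_int k * (\<Sum>T\<in>F1 k. 2 ^ sc T)) + (\<Sum>k\<in>S. 2 powr of_int k * (\<Sum>T\<in>F2 k. 2 ^ sc T)) +
         (\<Sum>k\<in>S. 2 powr of_int k * (\<Sum>T\<in>F3 k. 2 ^ sc T))" by (simp only: distrib_left sum.distrib)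
      also have "\<dots> \<le> D1 * ?a + D2 * ?b + D3 * ?c" by (intro add_mono F1(3) F2(3) F3(3) S)
      also have "\<dots> \<le> D * ?a + D * ?b + D * ?c" by (intro add_mono mult_right_mono DD abc)
      finally show ?thesis by (simp only: distrib_left)
    qed
    \<comment> \<open>A top has length at least 1 and is weighted by \<open>2 ^ k0\<close> at level
      \<open>k0\<close>. Once this exceeds the available total, the level has no tops, and its
      thresholds hold on the full box.\<close>
    obtain k0 :: nat where k0: "D * (?a + ?b + ?c) < 2 ^ k0" using real_arch_pow[of 2] by force
    have empty: "F (int k0) = {}"
    proof (rule ccontr)
      assume "F (int k0) \<noteq> {}"
      then obtain T where T: "T \<in> F (int k0)" by blast
      have "(1::real) \<le> 2 ^ sc T" by simp
      also have "\<dots> \<le> m (int k0)" unfolding m_def using T fin by (intro member_le_sum) auto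
      finally have "2 powr of_int (int k0) * 1 \<le> 2 powr of_int (int k0) * m (int k0)" by (intro mult_left_mono) auto
      also have "\<dots> \<le> D * (?a + ?b + ?c)" using msum[of "{int k0}"] by simp
      finally show False using k0 by (simp add: powr_realpow)
    qed
    \<comment> \<open>What remains after the levels \<open>k0\<close> down to \<open>k0 - n\<close>;
      level \<open>k0\<close> removes nothing.\<close>
    define A where "A n = qbox L - (\<Union>i\<le>n. down_set (F (int k0 - int i)))" for n
    have A0: "A 0 = qbox L" by (simp add: A_def empty down_set_def)
    have AS: "A (Suc n) = A n - down_set (F (int k0 - int (Suc n)))" for n by (auto simp: A_def atMost_Suc)
    have Aq: "A n \<subseteq> qbox L" for n by (auto simp: A_def)
    have Ac: "qle_convex (A n)" for n by (induction n) (simp_all add: A0 qle_convex_qbox AS qle_convex_Diff_down_set del: of_nat_Suc)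
    define \<kappa> :: "nat \<Rightarrow> real" where "\<kappa> n = of_int (int k0 - int n)" for n
    have Asub: "A n \<subseteq> qbox L - down_set (F (int k0 - int n))" for n by (auto simp: A_def)
    have Asz: "size_le L q1 f (A n) (2 powr (\<kappa> n / p1))" "size_le L q2 g (A n) (2 powr (\<kappa> n / p2))" "size_le L q3 h (A n) (2 powr (\<kappa> n / p3))" for n
      unfolding \<kappa>_def using Asub szs size_le_subset by blast+
    have prod: "2 powr (\<kappa> n / p1) * 2 powr (\<kappa> n / p2) * 2 powr (\<kappa> n / p3) = 2 powr \<kappa> n" for n
    proof -
      have "\<kappa> n / p1 + \<kappa> n / p2 + \<kappa> n / p3 = \<kappa> n * (1 / p1 + 1 / p2 + 1 / p3)" by (simp add: algebra_simps)
      then show ?thesis by (simp add: p(4) flip: powr_add)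
    qed
    have step: "norm (quartile_form \<Psi> f g h (A n)) \<le> norm (quartile_form \<Psi> f g h (A (Suc n))) + 8 * M * (2 powr \<kappa> (Suc n) * m (int k0 - int (Suc n)))" for n
    proof -
      let ?F = "F (int k0 - int (Suc n))"
      have finA: "finite (A n)" using Aq finite_qbox finite_subset by blast
      have "A n = A (Suc n) \<union> (A n \<inter> down_set ?F)" by (auto simp: AS)
      then have "quartile_form \<Psi> f g h (A n) = quartile_form \<Psi> f g h (A (Suc n)) + quartile_form \<Psi> f g h (A n \<inter> down_set ?F)"
        using quartile_form_union[of "A (Suc n)" "A n \<inter> down_set ?F" \<Psi> f g h] finA by (auto simp: AS)
      moreover have "norm (quartile_form \<Psi> f g h (A n \<inter> down_set ?F)) \<le> 8 * M * (2 powr \<kappa> (Suc n) * m (int k0 - int (Suc n)))"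
      proof -
        have "norm (quartile_form \<Psi> f g h (A n \<inter> down_set ?F)) \<le> 4 * M * m (int k0 - int (Suc n)) *
           (2 powr (\<kappa> n / p1) * 2 powr (\<kappa> n / p2) * 2 powr (\<kappa> n / p3))"
          unfolding m_def by (rule forest[OF fin(4) Fq Aq Ac Asz]) auto
        \<comment> \<open>The sizes are those of the level above the removed one, hence one extra
          factor 2 and \<open>8 * M\<close> in place of \<open>4 * M\<close>.\<close>
        also have "2 powr (\<kappa> n / p1) * 2 powr (\<kappa> n / p2) * 2 powr (\<kappa> n / p3) = 2 * 2 powr \<kappa> (Suc n)"
          unfolding prod by (simp add: \<kappa>_def powr_diff powr_add)
        finally show ?thesis by (simp add: algebra_simps)
      qed
      ultimately show ?thesis by (simp only: norm_triangle_mono order_refl)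
    qed
    have iter: "norm (quartile_form \<Psi> f g h (qbox L)) \<le> norm (quartile_form \<Psi> f g h (A n)) + 8 * M * (\<Sum>i<n. 2 powr \<kappa> (Suc i) * m (int k0 - int (Suc i)))" for n
    proof (induction n)
      case (Suc n)
      then show ?case using step[of n] by (simp add: distrib_left)
    qed (simp add: A0)
    have tail: "norm (quartile_form \<Psi> f g h (A n)) \<le> real (card (qbox L)) * 2 ^ L * K * 2 powr \<kappa> n" for n
      using quartile_form_sizes[OF Aq Asz] by (simp add: prod)
    have main: "norm (quartile_form \<Psi> f g h (qbox L)) \<le> real (card (qbox L)) * 2 ^ L * K * 2 powr \<kappa> n + 8 * M * (D * (?a + ?b + ?c))" for n
    proof -
      have "(\<Sum>i<n. 2 powr \<kappa> (Suc i) * m (int k0 - int (Suc i))) = (\<Sum>k\<in>(\<lambda>i. int k0 - int (Suc i)) ` {..<n}. 2 powr of_int k * m k)"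
        by (subst sum.reindex) (auto simp: inj_on_def \<kappa>_def)
      also have "\<dots> \<le> D * (?a + ?b + ?c)" by (rule msum) simp
      finally have "8 * M * (\<Sum>i<n. 2 powr \<kappa> (Suc i) * m (int k0 - int (Suc i))) \<le> 8 * M * (D * (?a + ?b + ?c))"
        using M0 by (intro mult_left_mono) auto
      then show ?thesis using iter[of n] tail[of n] by linarith
    qed
    have "(\<lambda>n. 2 powr \<kappa> n) \<longlonglongrightarrow> 0"
    proof -
      have "2 powr \<kappa> n = 2 ^ k0 * (1 / 2) ^ n" for n :: nat
      proof -
        have "2 powr \<kappa> n = 2 powr real k0 / 2 powr real n" by (simp add: \<kappa>_def powr_diff)
        also have "\<dots> = 2 ^ k0 * (1 / 2) ^ n" by (simp add: powr_realpow power_divide)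
        finally show ?thesis .
      qed
      moreover have "(\<lambda>n. 2 ^ k0 * (1 / 2 :: real) ^ n) \<longlonglongrightarrow> 2 ^ k0 * 0"
        by (intro tendsto_mult tendsto_const LIMSEQ_realpow_zero) auto
      ultimately show ?thesis by simp
    qed
    then have "(\<lambda>n. real (card (qbox L)) * 2 ^ L * K * 2 powr \<kappa> n + 8 * M * (D * (?a + ?b + ?c)))
       \<longlonglongrightarrow> real (card (qbox L)) * 2 ^ L * K * 0 + 8 * M * (D * (?a + ?b + ?c))"
      by (intro tendsto_intros)
    from LIMSEQ_le_const[OF this] main
    show "norm (quartile_form \<Psi> f g h (qbox L)) \<le> 8 * M * D * (?a + ?b + ?c)" by (simp add: mult.assoc)
  qed
qed

lemma quartile_form_scaleR:
  "quartile_form \<Psi> (\<lambda>x. a *\<^sub>R f x) (\<lambda>x. b *\<^sub>R g x) (\<lambda>x. c *\<^sub>R h x) S = (a * b * c) *\<^sub>R quartile_form \<Psi> f g h S"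
proof -
  have "\<Psi> (a *\<^sub>R x) (b *\<^sub>R y) (c *\<^sub>R z) = (a * b * c) *\<^sub>R \<Psi> x y z" for x y z
    using tri linear_scale[of "\<lambda>x. \<Psi> x (b *\<^sub>R y) (c *\<^sub>R z)" a x] linear_scale[of "\<lambda>y. \<Psi> x y (c *\<^sub>R z)" b y]
      linear_scale[of "\<lambda>z. \<Psi> x y z" c z] by (simp add: trilin_def)
  then show ?thesis unfolding quartile_form_def avg_scaleR scaleR_sum_right by (intro sum.cong refl) simp
qed

text \<open>Each function is scaled to norm 1, where the additive bound is \<open>3 * D\<close>;
  trilinearity scales back. A function of norm zero cannot be scaled but has vanishing coefficients
  on the box.\<close>

lemma discrete_bound:
  assumes C: "discrete_quartile_type q1 C1 TYPE('a)" "discrete_quartile_type q2 C2 TYPE('b)" "discrete_quartile_type q3 C3 TYPE('c)"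
    and p: "q1 < p1" "q2 < p2" "q3 < p3" "1 / p1 + 1 / p2 + 1 / p3 = 1"
  obtains D where "0 \<le> D" "\<And>L f g h. norm (quartile_form \<Psi> f g h (qbox L)) \<le> D * discrete_norm L p1 f * discrete_norm L p2 g * discrete_norm L p3 h"
proof -
  obtain D where D: "0 \<le> D" "\<And>L f g h. norm (quartile_form \<Psi> f g h (qbox L)) \<le>
    D * ((\<Sum>x<2 ^ L. norm (f x) powr p1) + (\<Sum>x<2 ^ L. norm (g x) powr p2) + (\<Sum>x<2 ^ L. norm (h x) powr p3))"
    using additive_bound[OF C p] by blast
  have ppos: "0 < p1" "0 < p2" "0 < p3" using p q1 q2 q3 by auto
  show thesis
  proof (rule that)
    show "0 \<le> 3 * D" using D(1) by simp
    fix L and f :: "nat \<Rightarrow> 'a" and g :: "nat \<Rightarrow> 'b" and h :: "nat \<Rightarrow> 'c"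
    have nn: "0 \<le> discrete_norm L p1 f" "0 \<le> discrete_norm L p2 g" "0 \<le> discrete_norm L p3 h" by (auto simp: discrete_norm_def)
    show "norm (quartile_form \<Psi> f g h (qbox L)) \<le> 3 * D * discrete_norm L p1 f * discrete_norm L p2 g * discrete_norm L p3 h"
    proof (cases "discrete_norm L p1 f = 0 \<or> discrete_norm L p2 g = 0 \<or> discrete_norm L p3 h = 0")
      case True
      have lin0: "\<Psi> 0 y z = 0" "\<Psi> x 0 z = 0" "\<Psi> x y 0 = 0" for x y z
        using tri linear_0[of "\<lambda>x. \<Psi> x y z"] linear_0[of "\<lambda>y. \<Psi> x y z"] linear_0[of "\<lambda>z. \<Psi> x y z"] by (auto simp: trilin_def)
      have "2 ^ sc P *\<^sub>R \<Psi> (avg 1 f P) (avg 2 g P) (avg 3 h P) = 0" if "P \<in> qbox L" for P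
        using True avg_zero[OF that, of f] avg_zero[OF that, of g] avg_zero[OF that, of h] discrete_norm_zero lin0
        by (metis scaleR_zero_right)
      then have "quartile_form \<Psi> f g h (qbox L) = 0" by (simp add: quartile_form_def)
      then show ?thesis using nn D(1) by simp
    next
      case False
      define a where "a = discrete_norm L p1 f" define b where "b = discrete_norm L p2 g" define c where "c = discrete_norm L p3 h"
      have pos: "0 < a" "0 < b" "0 < c" using False nn by (auto simp: a_def b_def c_def)
      have "norm (quartile_form \<Psi> (\<lambda>x. (1 / a) *\<^sub>R f x) (\<lambda>x. (1 / b) *\<^sub>R g x) (\<lambda>x. (1 / c) *\<^sub>R h x) (qbox L)) \<le> D * (1 + 1 + 1)"
        using D(2)[of "\<lambda>x. (1 / a) *\<^sub>R f x" "\<lambda>x. (1 / b) *\<^sub>R g x" "\<lambda>x. (1 / c) *\<^sub>R h x" L]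
          discrete_norm_scaled[OF ppos(1), of L f] discrete_norm_scaled[OF ppos(2), of L g] discrete_norm_scaled[OF ppos(3), of L h] pos
        by (simp only: a_def b_def c_def)
      then have "norm (quartile_form \<Psi> f g h (qbox L)) \<le> D * 3 * (a * b * c)"
        unfolding quartile_form_scaleR using pos by (simp add: field_simps abs_mult)
      then show ?thesis by (simp add: a_def b_def c_def mult_ac)
    qed
  qed
qed

end

section \<open>Strongly measurable functions\<close>

lemma strongly_measurable_cong:
  "(\<And>x. x \<in> space M \<Longrightarrow> f x = g x) \<Longrightarrow> strongly_measurable M f \<longleftrightarrow> strongly_measurable M g"
  unfolding strongly_measurable_def by simp

lemma strongly_measurable_simple: "simple_function M f \<Longrightarrow> strongly_measurable M f"
  unfolding strongly_measurable_def by (intro exI[of _ "\<lambda>_. f"]) auto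

lemma strongly_measurable_compose2:
  assumes f: "strongly_measurable M f" and g: "strongly_measurable M g"
    and h: "\<And>s t a b. s \<longlonglongrightarrow> a \<Longrightarrow> t \<longlonglongrightarrow> b \<Longrightarrow> (\<lambda>n::nat. h (s n) (t n)) \<longlonglongrightarrow> h a b"
  shows "strongly_measurable M (\<lambda>x. h (f x) (g x))"
proof -
  obtain s where s: "\<And>i::nat. simple_function M (s i)" "\<And>x. x \<in> space M \<Longrightarrow> (\<lambda>i. s i x) \<longlonglongrightarrow> f x"
    using f unfolding strongly_measurable_def by blast
  obtain t where t: "\<And>i::nat. simple_function M (t i)" "\<And>x. x \<in> space M \<Longrightarrow> (\<lambda>i. t i x) \<longlonglongrightarrow> g x"
    using g unfolding strongly_measurable_def by blast
  show ?thesis unfolding strongly_measurable_def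
  proof (intro exI[of _ "\<lambda>i x. h (s i x) (t i x)"] conjI allI ballI)
    show "simple_function M (\<lambda>x. h (s i x) (t i x))" for i
      by (rule simple_function_compose2[OF s(1) t(1)])
    show "(\<lambda>i. h (s i x) (t i x)) \<longlonglongrightarrow> h (f x) (g x)" if "x \<in> space M" for x
      by (rule h[OF s(2)[OF that] t(2)[OF that]])
  qed
qed

lemma strongly_measurable_compose:
  assumes "strongly_measurable M f" and "\<And>s a. s \<longlonglongrightarrow> a \<Longrightarrow> (\<lambda>n::nat. h (s n)) \<longlonglongrightarrow> h a"
  shows "strongly_measurable M (\<lambda>x. h (f x))"
  using strongly_measurable_compose2[OF assms(1) assms(1), of "\<lambda>a _. h a"] assms(2) by blast

lemma strongly_measurable_add:
  "strongly_measurable M f \<Longrightarrow> strongly_measurable M g \<Longrightarrow> strongly_measurable M (\<lambda>x. f x + g x)"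
  by (rule strongly_measurable_compose2) (auto intro: tendsto_add)

lemma strongly_measurable_diff:
  "strongly_measurable M f \<Longrightarrow> strongly_measurable M g \<Longrightarrow> strongly_measurable M (\<lambda>x. f x - g x)"
  by (rule strongly_measurable_compose2) (auto intro: tendsto_diff)

lemma strongly_measurable_sum:
  "(\<And>i. i \<in> I \<Longrightarrow> strongly_measurable M (f i)) \<Longrightarrow> strongly_measurable M (\<lambda>x. \<Sum>i\<in>I. f i x)"
  by (induction I rule: infinite_finite_induct)
    (simp_all add: strongly_measurable_add strongly_measurable_simple)

lemma strongly_measurable_norm:
  assumes "strongly_measurable M f"
  shows "(\<lambda>x. norm (f x)) \<in> borel_measurable M"
proof -
  obtain s where s: "\<And>i::nat. simple_function M (s i)" "\<And>x. x \<in> space M \<Longrightarrow> (\<lambda>i. s i x) \<longlonglongrightarrow> f x"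
    using assms unfolding strongly_measurable_def by blast
  show ?thesis
  proof (rule borel_measurable_LIMSEQ_metric)
    show "(\<lambda>x. norm (s i x)) \<in> borel_measurable M" for i
      by (rule borel_measurable_simple_function[OF simple_function_compose1[OF s(1)]])
    show "(\<lambda>i. norm (s i x)) \<longlonglongrightarrow> norm (f x)" if "x \<in> space M" for x
      by (intro tendsto_norm s(2) that)
  qed
qed

text \<open>The p-th power of the norm, kept in \<open>ennreal\<close> and without the root: limit
  theorems for the integral then apply before finiteness is known.\<close>

definition pint :: "'s measure \<Rightarrow> real \<Rightarrow> ('s \<Rightarrow> 'a::real_normed_vector) \<Rightarrow> ennreal" where
  "pint M p f = (\<integral>\<^sup>+x. ennreal (norm (f x) powr p) \<partial>M)"

lemma Lp_space_iff: "f \<in> Lp_space M p \<longleftrightarrow> strongly_measurable M f \<and> pint M p f < \<infinity>"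
  by (simp add: Lp_space_def pint_def)

lemma Lp_norm_eq: "Lp_norm M p f = enn2real (pint M p f) powr (1 / p)"
  by (simp add: Lp_norm_def pint_def)

lemma pint_measurable:
  "strongly_measurable M f \<Longrightarrow> (\<lambda>x. ennreal (norm (f x) powr p)) \<in> borel_measurable M"
  using strongly_measurable_norm[of M f] by measurable

lemma pint_cong: "(\<And>x. x \<in> space M \<Longrightarrow> norm (f x) = norm (g x)) \<Longrightarrow> pint M p f = pint M p g"
  unfolding pint_def by (intro nn_integral_cong) simp

lemma pint_cong_AE: "AE x in M. norm (f x) = norm (g x) \<Longrightarrow> pint M p f = pint M p g"
  unfolding pint_def by (intro nn_integral_cong_AE) auto

text \<open>A pointwise inequality takes the place of Minkowski. Its constant is harmless in limit
  arguments; it survives as the factor 8 in \<open>extension_bound\<close>.\<close>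

lemma pint_add_le:
  assumes "strongly_measurable M f" "strongly_measurable M g" "0 \<le> p"
  shows "pint M p (\<lambda>x. f x + g x) \<le> ennreal (2 powr p) * (pint M p f + pint M p g)"
proof -
  have "pint M p (\<lambda>x. f x + g x) \<le> (\<integral>\<^sup>+x. ennreal (2 powr p) * (ennreal (norm (f x) powr p) + ennreal (norm (g x) powr p)) \<partial>M)"
    unfolding pint_def
  proof (rule nn_integral_mono)
    fix x
    have "ennreal (norm (f x + g x) powr p) \<le> ennreal (2 powr p * (norm (f x) powr p + norm (g x) powr p))"
      by (intro ennreal_leI norm_powr_add_le assms)
    then show "ennreal (norm (f x + g x) powr p) \<le> ennreal (2 powr p) * (ennreal (norm (f x) powr p) + ennreal (norm (g x) powr p))"
      by (simp add: ennreal_mult flip: ennreal_plus)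
  qed
  also have "\<dots> = ennreal (2 powr p) * (pint M p f + pint M p g)"
    using pint_measurable[OF assms(1)] pint_measurable[OF assms(2)]
    by (simp add: nn_integral_cmult nn_integral_add pint_def)
  finally show ?thesis .
qed

lemma pint_uminus: "pint M p (\<lambda>x. - f x) = pint M p f"
  by (simp add: pint_def)

lemma strongly_measurable_uminus: "strongly_measurable M f \<Longrightarrow> strongly_measurable M (\<lambda>x. - f x)"
  by (rule strongly_measurable_compose) (auto intro: tendsto_minus)

lemma pint_diff_le:
  assumes "strongly_measurable M f" "strongly_measurable M g" "0 \<le> p"
  shows "pint M p (\<lambda>x. f x - g x) \<le> ennreal (2 powr p) * (pint M p f + pint M p g)"
  using pint_add_le[OF assms(1) strongly_measurable_uminus[OF assms(2)] assms(3)] by (simp add: pint_uminus)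

lemma Lp_space_add:
  assumes "f \<in> Lp_space M p" "g \<in> Lp_space M p" "0 \<le> p"
  shows "(\<lambda>x. f x + g x) \<in> Lp_space M p"
proof -
  have "ennreal (2 powr p) * (pint M p f + pint M p g) < \<infinity>"
    using assms by (auto simp: Lp_space_iff ennreal_mult_less_top)
  then show ?thesis using assms pint_add_le[of M f g p] by (auto simp: Lp_space_iff strongly_measurable_add)
qed

lemma Lp_space_diff:
  assumes "f \<in> Lp_space M p" "g \<in> Lp_space M p" "0 \<le> p"
  shows "(\<lambda>x. f x - g x) \<in> Lp_space M p"
  using Lp_space_add[of f M p "\<lambda>x. - g x"] assms
  by (auto simp: Lp_space_iff pint_uminus strongly_measurable_uminus)

lemma pint_zero_AE:
  assumes "strongly_measurable M f" "pint M p f = 0"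
  shows "AE x in M. f x = 0"
proof -
  have "AE x in M. ennreal (norm (f x) powr p) = 0"
    using assms(2) unfolding pint_def nn_integral_0_iff_AE[OF pint_measurable[OF assms(1)]] .
  then show ?thesis
  proof eventually_elim
    case (elim x)
    then have "norm (f x) powr p = 0" using powr_ge_zero[of "norm (f x)" p] by (simp add: ennreal_eq_0_iff)
    then show ?case by simp
  qed
qed

section \<open>Bochner integrals of finite sums of scalar functions times vectors\<close>

lemma has_Bochner_int_scaleR_const:
  fixes \<phi> :: "'s \<Rightarrow> real" and c :: "'a::real_normed_vector"
  assumes "has_bochner_integral M \<phi> r"
  shows "has_Bochner_int M (\<lambda>x. \<phi> x *\<^sub>R c) (r *\<^sub>R c)"
proof -
  have "has_Bochner_int M \<phi> r" using assms by (simp add: has_Bochner_int_iff_has_bochner_integral)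
  then obtain s where sm: "strongly_measurable M \<phi>" and s: "\<And>i. Bochner_Integration.simple_bochner_integrable M (s i)"
    "(\<lambda>i::nat. \<integral>\<^sup>+x. ennreal (norm (\<phi> x - s i x)) \<partial>M) \<longlonglongrightarrow> 0"
    "(\<lambda>i. Bochner_Integration.simple_bochner_integral M (s i)) \<longlonglongrightarrow> r"
    unfolding has_Bochner_int_def by blast
  have sf: "simple_function M (s i)" for i using s(1)[of i] by (auto elim: simple_bochner_integrable.cases)
  have meas: "(\<lambda>x. ennreal (norm (\<phi> x - s i x))) \<in> borel_measurable M" for i
    using strongly_measurable_norm[OF strongly_measurable_diff[OF sm strongly_measurable_simple[OF sf[of i]]]] by measurable
  show ?thesis unfolding has_Bochner_int_def
  proof (intro conjI exI[of _ "\<lambda>i x. s i x *\<^sub>R c"] allI)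
    show "strongly_measurable M (\<lambda>x. \<phi> x *\<^sub>R c)"
      by (rule strongly_measurable_compose[OF sm]) (intro tendsto_intros)
    show "Bochner_Integration.simple_bochner_integrable M (\<lambda>x. s i x *\<^sub>R c)" for i
      using simple_bochner_integrable_compose2[OF _ s(1) s(1), of "\<lambda>a b. a *\<^sub>R c"] by simp
    have eq: "(\<integral>\<^sup>+x. ennreal (norm (\<phi> x *\<^sub>R c - s i x *\<^sub>R c)) \<partial>M) = ennreal (norm c) * (\<integral>\<^sup>+x. ennreal (norm (\<phi> x - s i x)) \<partial>M)" for i
      unfolding nn_integral_cmult[OF meas, symmetric]
      by (intro nn_integral_cong) (simp add: mult.commute flip: scaleR_diff_left ennreal_mult)
    have "(\<lambda>i. ennreal (norm c) * (\<integral>\<^sup>+x. ennreal (norm (\<phi> x - s i x)) \<partial>M)) \<longlonglongrightarrow> ennreal (norm c) * 0"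
      by (rule ennreal_tendsto_cmult[OF _ s(2)]) simp
    then show "(\<lambda>i. \<integral>\<^sup>+x. ennreal (norm (\<phi> x *\<^sub>R c - s i x *\<^sub>R c)) \<partial>M) \<longlonglongrightarrow> 0" by (simp add: eq)
    have "linear (\<lambda>a::real. a *\<^sub>R c)" by (intro linearI) (auto simp: scaleR_add_left)
    from simple_bochner_integral_linear[OF this s(1)]
    have "Bochner_Integration.simple_bochner_integral M (\<lambda>x. s i x *\<^sub>R c) = Bochner_Integration.simple_bochner_integral M (s i) *\<^sub>R c" for i .
    then show "(\<lambda>i. Bochner_Integration.simple_bochner_integral M (\<lambda>x. s i x *\<^sub>R c)) \<longlonglongrightarrow> r *\<^sub>R c"
      by (simp add: tendsto_scaleR s(3))
  qed
qed

lemma has_Bochner_int_add: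
  fixes f g :: "'s \<Rightarrow> 'a::real_normed_vector"
  assumes "has_Bochner_int M f y" "has_Bochner_int M g z"
  shows "has_Bochner_int M (\<lambda>x. f x + g x) (y + z)"
proof -
  obtain s where sm: "strongly_measurable M f" and s: "\<And>i. Bochner_Integration.simple_bochner_integrable M (s i)"
    "(\<lambda>i::nat. \<integral>\<^sup>+x. ennreal (norm (f x - s i x)) \<partial>M) \<longlonglongrightarrow> 0"
    "(\<lambda>i. Bochner_Integration.simple_bochner_integral M (s i)) \<longlonglongrightarrow> y"
    using assms(1) unfolding has_Bochner_int_def by blast
  obtain t where tm: "strongly_measurable M g" and t: "\<And>i. Bochner_Integration.simple_bochner_integrable M (t i)"
    "(\<lambda>i::nat. \<integral>\<^sup>+x. ennreal (norm (g x - t i x)) \<partial>M) \<longlonglongrightarrow> 0"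
    "(\<lambda>i. Bochner_Integration.simple_bochner_integral M (t i)) \<longlonglongrightarrow> z"
    using assms(2) unfolding has_Bochner_int_def by blast
  have sf: "simple_function M (s i)" "simple_function M (t i)" for i
    using s(1)[of i] t(1)[of i] by (auto elim: simple_bochner_integrable.cases)
  have meas: "(\<lambda>x. ennreal (norm (f x - s i x))) \<in> borel_measurable M" "(\<lambda>x. ennreal (norm (g x - t i x))) \<in> borel_measurable M" for i
    using strongly_measurable_norm[OF strongly_measurable_diff[OF sm strongly_measurable_simple[OF sf(1)[of i]]]]
      strongly_measurable_norm[OF strongly_measurable_diff[OF tm strongly_measurable_simple[OF sf(2)[of i]]]] by measurable
  show ?thesis unfolding has_Bochner_int_def
  proof (intro conjI exI[of _ "\<lambda>i x. s i x + t i x"] allI)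
    show "strongly_measurable M (\<lambda>x. f x + g x)" by (rule strongly_measurable_add[OF sm tm])
    show "Bochner_Integration.simple_bochner_integrable M (\<lambda>x. s i x + t i x)" for i
      by (rule simple_bochner_integrable_compose2[OF _ s(1) t(1)]) simp
    show "(\<lambda>i. \<integral>\<^sup>+x. ennreal (norm (f x + g x - (s i x + t i x))) \<partial>M) \<longlonglongrightarrow> 0"
    proof (rule tendsto_sandwich[OF _ _ tendsto_const tendsto_add[OF s(2) t(2), simplified]])
      show "\<forall>\<^sub>F i in sequentially. (\<integral>\<^sup>+x. ennreal (norm (f x + g x - (s i x + t i x))) \<partial>M) \<le>
        (\<integral>\<^sup>+x. ennreal (norm (f x - s i x)) \<partial>M) + (\<integral>\<^sup>+x. ennreal (norm (g x - t i x)) \<partial>M)"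
      proof (intro always_eventually allI)
        fix i
        have "(\<integral>\<^sup>+x. ennreal (norm (f x + g x - (s i x + t i x))) \<partial>M) \<le>
          (\<integral>\<^sup>+x. ennreal (norm (f x - s i x)) + ennreal (norm (g x - t i x)) \<partial>M)"
        proof (rule nn_integral_mono)
          fix x
          have "norm (f x + g x - (s i x + t i x)) \<le> norm (f x - s i x) + norm (g x - t i x)"
            by (rule norm_diff_triangle_ineq)
          then show "ennreal (norm (f x + g x - (s i x + t i x))) \<le> ennreal (norm (f x - s i x)) + ennreal (norm (g x - t i x))"
            by (simp add: ennreal_leI flip: ennreal_plus)
        qed
        then show "(\<integral>\<^sup>+x. ennreal (norm (f x + g x - (s i x + t i x))) \<partial>M) \<le>
        (\<integral>\<^sup>+x. ennreal (norm (f x - s i x)) \<partial>M) + (\<integral>\<^sup>+x. ennreal (norm (g x - t i x)) \<partial>M)"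
          by (simp add: nn_integral_add meas)
      qed
    qed simp
    show "(\<lambda>i. Bochner_Integration.simple_bochner_integral M (\<lambda>x. s i x + t i x)) \<longlonglongrightarrow> y + z"
      by (simp add: simple_bochner_integral_add[OF s(1) t(1)] tendsto_add s(3) t(3))
  qed
qed

lemma has_Bochner_int_zero: "has_Bochner_int M (\<lambda>x. 0 :: 'a::real_normed_vector) 0"
  using has_Bochner_int_scaleR_const[OF has_bochner_integral_zero, of M "0 :: 'a"] by simp

lemma has_Bochner_int_sum:
  "(\<And>i. i \<in> I \<Longrightarrow> has_Bochner_int M (f i) (y i)) \<Longrightarrow> has_Bochner_int M (\<lambda>x. \<Sum>i\<in>I. f i x) (\<Sum>i\<in>I. y i)"
  by (induction I rule: infinite_finite_induct) (auto intro: has_Bochner_int_zero has_Bochner_int_add)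

lemma has_Bochner_int_cong:
  assumes "\<And>x. x \<in> space M \<Longrightarrow> f x = g x"
  shows "has_Bochner_int M f y \<longleftrightarrow> has_Bochner_int M g y"
proof -
  have "(\<integral>\<^sup>+x. ennreal (norm (f x - s x)) \<partial>M) = (\<integral>\<^sup>+x. ennreal (norm (g x - s x)) \<partial>M)" for s
    using assms by (intro nn_integral_cong) simp
  then show ?thesis unfolding has_Bochner_int_def using strongly_measurable_cong[of M f g, OF assms] assms by simp
qed

section \<open>Step functions on dyadic intervals\<close>

text \<open>The conversion by \<open>nat\<close> sends all negative points to index 0, so statements
  about cells carry the condition \<open>0 \<le> x\<close>.\<close>

definition atom_index :: "nat \<Rightarrow> real \<Rightarrow> nat" where
  "atom_index N x = nat \<lfloor>2 ^ N * x\<rfloor>"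

definition atom :: "nat \<Rightarrow> nat \<Rightarrow> real set" where
  "atom N i = {real i / 2 ^ N ..< (real i + 1) / 2 ^ N}"

lemma atom_iff: "x \<in> atom N i \<longleftrightarrow> 0 \<le> x \<and> atom_index N x = i"
proof -
  have "x \<in> atom N i \<longleftrightarrow> real i \<le> 2 ^ N * x \<and> 2 ^ N * x < real i + 1"
    by (simp add: atom_def field_simps)
  also have "\<dots> \<longleftrightarrow> \<lfloor>2 ^ N * x\<rfloor> = int i" by (simp add: floor_eq_iff)
  also have "\<dots> \<longleftrightarrow> 0 \<le> x \<and> atom_index N x = i"
    unfolding atom_index_def by (auto simp: nat_eq_iff zero_le_mult_iff) (metis of_nat_0_le_iff zero_le_floor zero_le_mult_iff zero_less_numeral zero_less_power not_less)+
  finally show ?thesis .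
qed

lemma atom_nonneg: "atom N i \<subseteq> {0..}"
  by (auto simp: atom_iff)

lemma borel_imp_Rplus: "f \<in> measurable borel M \<Longrightarrow> f \<in> measurable Rplus M"
  by (intro measurable_restrict_space1 measurable_completion) simp

lemma atom_index_measurable: "atom_index N \<in> measurable Rplus (count_space UNIV)"
  unfolding atom_index_def by (rule borel_imp_Rplus) measurable

lemma atom_sets: "atom N i \<in> sets Rplus"
  using atom_nonneg[of N i] by (subst sets_restrict_space_iff) (auto simp: atom_def)

lemma emeasure_atom: "emeasure Rplus (atom N i) = ennreal (1 / 2 ^ N)"
proof -
  have "emeasure Rplus (atom N i) = emeasure lebesgue (atom N i)"
    using atom_nonneg by (intro emeasure_restrict_space) auto
  also have "\<dots> = ennreal (1 / 2 ^ N)"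
    by (simp add: atom_def divide_right_mono flip: diff_divide_distrib)
  finally show ?thesis .
qed

lemma step_simple:
  assumes "\<And>i. B \<le> i \<Longrightarrow> g i = 0"
  shows "simple_function Rplus (\<lambda>x. g (atom_index N x))"
proof -
  have "(\<lambda>x. g (atom_index N x)) ` space Rplus \<subseteq> g ` {..<B} \<union> {0}"
    using assms by (auto simp: not_less) (metis imageI lessThan_iff not_less)
  then have "finite ((\<lambda>x. g (atom_index N x)) ` space Rplus)" by (rule finite_subset) simp
  moreover have "(\<lambda>x. g (atom_index N x)) \<in> measurable Rplus (count_space UNIV)"
    by (rule measurable_compose[OF atom_index_measurable]) simp
  ultimately show ?thesis by (simp add: simple_function_eq_measurable)
qed

lemma nn_integral_step:
  fixes \<phi> :: "nat \<Rightarrow> real"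
  assumes "\<And>i. B \<le> i \<Longrightarrow> \<phi> i = 0" "\<And>i. 0 \<le> \<phi> i"
  shows "(\<integral>\<^sup>+x. ennreal (\<phi> (atom_index N x)) \<partial>Rplus) = ennreal ((1 / 2 ^ N) * (\<Sum>i<B. \<phi> i))"
proof -
  have "(\<integral>\<^sup>+x. ennreal (\<phi> (atom_index N x)) \<partial>Rplus) = (\<integral>\<^sup>+x. (\<Sum>i<B. ennreal (\<phi> i) * indicator (atom N i) x) \<partial>Rplus)"
  proof (rule nn_integral_cong)
    fix x assume "x \<in> space Rplus"
    then have "(\<Sum>i<B. ennreal (\<phi> i) * indicator (atom N i) x) = (\<Sum>i<B. if i = atom_index N x then ennreal (\<phi> i) else 0)"
      by (intro sum.cong refl) (auto simp: indicator_def atom_iff)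
    also have "\<dots> = (if atom_index N x < B then ennreal (\<phi> (atom_index N x)) else 0)" by (simp add: sum.delta)
    finally have "(\<Sum>i<B. ennreal (\<phi> i) * indicator (atom N i) x) = (if atom_index N x < B then ennreal (\<phi> (atom_index N x)) else 0)" .
    then show "ennreal (\<phi> (atom_index N x)) = (\<Sum>i<B. ennreal (\<phi> i) * indicator (atom N i) x)"
      using assms(1)[of "atom_index N x"] by (auto simp: not_less)
  qed
  also have "\<dots> = (\<Sum>i<B. ennreal (\<phi> i) * ennreal (1 / 2 ^ N))"
  proof (subst nn_integral_sum)
    show "(\<lambda>x. ennreal (\<phi> i) * indicator (atom N i) x) \<in> borel_measurable Rplus" for i
      using atom_sets[of N i] by measurable
    show "(\<Sum>i<B. \<integral>\<^sup>+x. ennreal (\<phi> i) * indicator (atom N i) x \<partial>Rplus) = (\<Sum>i<B. ennreal (\<phi> i) * ennreal (1 / 2 ^ N))"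
      by (simp only: nn_integral_cmult_indicator[OF atom_sets] emeasure_atom)
  qed
  also have "\<dots> = ennreal (\<Sum>i<B. \<phi> i * (1 / 2 ^ N))"
    using assms(2) by (simp add: sum_nonneg flip: ennreal_mult' ennreal_mult)
  finally show ?thesis by (simp add: sum_distrib_left mult.commute sum_divide_distrib)
qed

lemma pint_step:
  fixes g :: "nat \<Rightarrow> 'a::real_normed_vector"
  assumes "\<And>i. B \<le> i \<Longrightarrow> g i = 0" "AE x in Rplus. f x = g (atom_index N x)"
  shows "pint Rplus p f = ennreal ((1 / 2 ^ N) * (\<Sum>i<B. norm (g i) powr p))"
proof -
  have "pint Rplus p f = pint Rplus p (\<lambda>x. g (atom_index N x))"
    by (rule pint_cong_AE) (use assms(2) in auto)
  also have "\<dots> = ennreal ((1 / 2 ^ N) * (\<Sum>i<B. norm (g i) powr p))"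
    unfolding pint_def by (rule nn_integral_step) (use assms(1) in auto)
  finally show ?thesis .
qed

text \<open>At dyadic points \<open>sgn sin\<close> vanishes, and packets are not given by \<open>walsh_sg\<close>.\<close>
definition generic :: "real \<Rightarrow> bool" where
  "generic x \<longleftrightarrow> (\<forall>b::nat. x * 2 ^ b \<notin> \<int>)"

lemma countable_not_generic: "countable {x. \<not> generic x}"
proof -
  have "{x. \<not> generic x} = (\<Union>b::nat. \<Union>z::int. {of_int z / 2 ^ b})"
  proof (intro set_eqI iffI)
    fix x assume "x \<in> {x. \<not> generic x}"
    then obtain b :: nat and z where "x * 2 ^ b = of_int z" by (auto simp: generic_def Ints_def)
    then have "x = of_int z / 2 ^ b" by (simp add: field_simps)
    then show "x \<in> (\<Union>b::nat. \<Union>z::int. {of_int z / 2 ^ b})" by blast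
  next
    fix x :: real assume "x \<in> (\<Union>b::nat. \<Union>z::int. {of_int z / 2 ^ b})"
    then obtain b :: nat and z :: int where "x = of_int z / 2 ^ b" by blast
    then have "x * 2 ^ b = of_int z" by simp
    then have "x * 2 ^ b \<in> \<int>" by simp
    then show "x \<in> {x. \<not> generic x}" by (auto simp: generic_def)
  qed
  then show ?thesis by simp
qed

lemma AE_generic: "AE x in Rplus. generic x"
proof -
  have "{x. \<not> generic x} \<in> null_sets lborel" by (rule countable_imp_null_set_lborel[OF countable_not_generic])
  then have "AE x in lborel. generic x" by (rule AE_I') auto
  then have "AE x in lebesgue. generic x" by (rule AE_completion)
  then show ?thesis by (subst AE_restrict_space_iff) auto
qed

lemma sgn_sin_pi:
  assumes "t \<notin> \<int>"
  shows "sgn (sin (pi * t)) = (if even \<lfloor>t\<rfloor> then 1 else -1)"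
proof -
  have f: "0 < frac t" "frac t < 1" using assms frac_lt_1[of t] frac_gt_0_iff[of t] by auto
  then have "0 < sin (pi * frac t)" by (intro sin_gt_zero) auto
  moreover have "sin (pi * t) = sin (pi * of_int \<lfloor>t\<rfloor> + pi * frac t)" by (simp add: frac_def algebra_simps)
  ultimately show ?thesis by (simp add: sin_add)
qed

lemma atom_index_div: "atom_index (N + t) x div 2 ^ t = atom_index N x"
proof -
  have "\<lfloor>2 ^ (N + t) * x / real_of_int (2 ^ t)\<rfloor> = \<lfloor>2 ^ (N + t) * x\<rfloor> div 2 ^ t"
    by (rule floor_divide_real_eq_div) simp
  then have "\<lfloor>2 ^ N * x\<rfloor> = \<lfloor>2 ^ (N + t) * x\<rfloor> div 2 ^ t" by (simp add: power_add)
  then show ?thesis by (simp add: atom_index_def nat_div_distrib' nat_power_eq)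
qed

text \<open>After rescaling, \<open>r_b\<close> changes sign every \<open>2 ^ (k - 1 - b)\<close>
  cells, so it reads one binary digit of the cell index. At a generic point the argument of the sine
  is never a zero.\<close>

lemma rademacher_atom_index:
  assumes g: "generic x" and x: "0 \<le> x" and b: "b < k"
  shows "rademacher b (x / 2 powi (int k - int N)) = (if odd (atom_index N x div 2 ^ (k - 1 - b)) then -1 else 1)"
proof -
  define c where "c = k - 1 - b"
  have k: "k = c + Suc b" using b by (simp add: c_def)
  define t where "t = 2 ^ N * x / 2 ^ c"
  have "t \<notin> \<int>"
  proof
    assume "t \<in> \<int>"
    then have "t * 2 ^ c \<in> \<int>" by (intro Ints_mult Ints_power) auto
    then have "x * 2 ^ N \<in> \<int>" by (simp add: t_def mult.commute)
    then show False using g by (simp add: generic_def)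
  qed
  have "2 * pi * 2 ^ b * (x / 2 powi (int k - int N)) = pi * t"
    by (simp add: t_def k power_int_diff power_int_add power_add field_simps)
  then have "rademacher b (x / 2 powi (int k - int N)) = (if even \<lfloor>t\<rfloor> then 1 else -1)"
    unfolding rademacher_def using sgn_sin_pi[OF \<open>t \<notin> \<int>\<close>] by simp
  also have "\<lfloor>t\<rfloor> = \<lfloor>2 ^ N * x\<rfloor> div 2 ^ c"
    using floor_divide_real_eq_div[of "2 ^ c" "2 ^ N * x"] by (simp add: t_def)
  also have "\<lfloor>2 ^ N * x\<rfloor> = int (atom_index N x)" using x by (simp add: atom_index_def)
  also have "int (atom_index N x) div 2 ^ c = int (atom_index N x div 2 ^ c)" by (simp add: zdiv_int)
  finally show ?thesis by (simp add: c_def)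
qed

lemma bit_less: "bit (m::nat) b \<Longrightarrow> m < 2 ^ k \<Longrightarrow> b < k"
proof (rule ccontr)
  assume "bit m b" "m < 2 ^ k" "\<not> b < k"
  moreover have "(2::nat) ^ k \<le> 2 ^ b" using \<open>\<not> b < k\<close> by (intro power_increasing) auto
  ultimately have "m < 2 ^ b" by linarith
  then have "m div 2 ^ b = 0" by simp
  then show False using \<open>bit m b\<close> by (simp add: bit_iff_odd)
qed

text \<open>Each recursion step consumes the lowest bit of \<open>m\<close> together with the
  highest remaining digit of \<open>i\<close>, so bit \<open>b\<close> meets digit
  \<open>k - 1 - b\<close>. The bound \<open>m < 2 ^ k\<close> ensures that no bit is left.\<close>

lemma walsh_sg_prod:
  "m < 2 ^ k \<Longrightarrow> walsh_sg k m i = (\<Prod>b\<in>{b. bit m b}. if odd (i div 2 ^ (k - 1 - b)) then -1 else 1)"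
proof (induction k arbitrary: m)
  case 0
  then have "{b. bit m b} = {}" using bit_less by auto
  then show ?case by simp
next
  case (Suc k)
  let ?S = "{b. bit (m div 2) b}"
  have m2: "m div 2 < 2 ^ k" using Suc.prems by auto
  have fin: "finite ?S" by (rule finite_subset[of _ "{..<k}"]) (use m2 bit_less in auto)
  have "{b. bit m b} = (if odd m then {0} else {}) \<union> Suc ` ?S"
  proof (intro set_eqI)
    fix b show "b \<in> {b. bit m b} \<longleftrightarrow> b \<in> (if odd m then {0} else {}) \<union> Suc ` ?S"
      by (cases b) (auto simp: bit_0 bit_Suc)
  qed
  moreover have "(\<Prod>b\<in>Suc ` ?S. if odd (i div 2 ^ (Suc k - 1 - b)) then -1 else 1 :: real) = walsh_sg k (m div 2) i"
    by (subst prod.reindex) (auto simp: Suc.IH[OF m2] intro!: prod.cong)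
  ultimately show ?case using fin by (subst walsh_sg.simps) auto
qed

lemma dyadic_interval_iff:
  assumes "0 \<le> x"
  shows "x \<in> dyadic_interval (int k - int N) j \<longleftrightarrow> atom_index N x \<in> dyadic_block k j"
proof -
  have "x \<in> dyadic_interval (int k - int N) j \<longleftrightarrow> real (j * 2 ^ k) \<le> 2 ^ N * x \<and> 2 ^ N * x < real ((j + 1) * 2 ^ k)"
    by (simp add: dyadic_interval_def power_int_diff field_simps)
  also have "\<dots> \<longleftrightarrow> int (j * 2 ^ k) \<le> \<lfloor>2 ^ N * x\<rfloor> \<and> \<lfloor>2 ^ N * x\<rfloor> < int ((j + 1) * 2 ^ k)"
    by (simp add: le_floor_iff floor_less_iff)
  also have "\<lfloor>2 ^ N * x\<rfloor> = int (atom_index N x)" using assms by (simp add: atom_index_def)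
  finally show ?thesis by (simp only: of_nat_le_iff of_nat_less_iff dyadic_block_eq atLeastLessThan_iff)
qed

lemma wave_packet_generic:
  assumes "generic x" "0 \<le> x" "m < 2 ^ k"
  shows "wave_packet (int k - int N) j m x =
    (2 powi (int k - int N)) powr (- 1 / 2) * (indicator (dyadic_block k j) (atom_index N x) * walsh_sg k m (atom_index N x))"
proof -
  have "walsh m (x / 2 powi (int k - int N)) = walsh_sg k m (atom_index N x)"
    unfolding walsh_def walsh_sg_prod[OF assms(3)]
    by (intro prod.cong refl rademacher_atom_index assms(1,2)) (use bit_less assms(3) in auto)
  then show ?thesis using dyadic_interval_iff[OF assms(2)] by (simp add: wave_packet_def indicator_def)
qed

lemma rademacher_measurable: "rademacher i \<in> borel_measurable borel"
  unfolding rademacher_def by measurable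

lemma walsh_measurable: "walsh n \<in> borel_measurable borel"
  unfolding walsh_def using rademacher_measurable by (intro borel_measurable_prod)

lemma wave_packet_measurable: "wave_packet k j n \<in> borel_measurable borel"
proof -
  have "(\<lambda>x. walsh n (x / 2 powi k)) \<in> borel_measurable borel"
    by (rule measurable_compose[OF _ walsh_measurable]) measurable
  moreover have "dyadic_interval k j \<in> sets borel" by (simp add: dyadic_interval_def)
  ultimately show ?thesis unfolding wave_packet_def by measurable
qed

text \<open>On an atom \<open>f\<close> is a fixed vector and the packet is almost everywhere a
  constant, so only scalar integrals of atoms are computed. The factor \<open>1 / 2 ^ N\<close> is
  the length of an atom.\<close>

lemma wpairing_step:
  fixes f :: "real \<Rightarrow> 'a::real_normed_vector"
  assumes f: "\<And>x. 0 \<le> x \<Longrightarrow> f x = g (atom_index N x)" and m: "m < 2 ^ k"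
  shows "wpairing f (wave_packet (int k - int N) j m) =
     ((2 powi (int k - int N)) powr (- 1 / 2) / 2 ^ N) *\<^sub>R (\<Sum>i\<in>dyadic_block k j. walsh_sg k m i *\<^sub>R g i)"
proof -
  let ?W = "wave_packet (int k - int N) j m" and ?c = "(2 powi (int k - int N)) powr (- 1 / 2)"
  have "has_bochner_integral Rplus (\<lambda>x. ?W x * indicator (atom N i) x) (?c * walsh_sg k m i * (1 / 2 ^ N))" if i: "i \<in> dyadic_block k j" for i
  proof -
    have A: "has_bochner_integral Rplus (\<lambda>x. ?c * walsh_sg k m i * indicator (atom N i) x) (?c * walsh_sg k m i * measure Rplus (atom N i))"
      by (intro has_bochner_integral_mult_right has_bochner_integral_real_indicator) (auto simp: atom_sets emeasure_atom)
    have Ms: "measure Rplus (atom N i) = 1 / 2 ^ N" by (simp add: measure_def emeasure_atom)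
    have E: "AE x in Rplus. ?W x * indicator (atom N i) x = ?c * walsh_sg k m i * indicator (atom N i) x"
      using AE_generic AE_space
    proof eventually_elim
      case (elim x)
      then have "?W x = ?c * (indicator (dyadic_block k j) (atom_index N x) * walsh_sg k m (atom_index N x))" by (intro wave_packet_generic m) auto
      then show ?case using i by (auto simp: indicator_def atom_iff)
    qed
    have B: "(\<lambda>x. ?W x * indicator (atom N i) x) \<in> borel_measurable Rplus"
      "(\<lambda>x. ?c * walsh_sg k m i * indicator (atom N i) x) \<in> borel_measurable Rplus"
      using borel_imp_Rplus[OF wave_packet_measurable[of "int k - int N" j m]] atom_sets[of N i] by measurable
    show ?thesis using has_bochner_integral_cong_AE[OF B E] A by (simp only: Ms)
  qed
  then have S: "has_Bochner_int Rplus (\<lambda>x. \<Sum>i\<in>dyadic_block k j. (?W x * indicator (atom N i) x) *\<^sub>R g i)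
     (\<Sum>i\<in>dyadic_block k j. (?c * walsh_sg k m i * (1 / 2 ^ N)) *\<^sub>R g i)"
    by (intro has_Bochner_int_sum has_Bochner_int_scaleR_const)
  have E: "?W x *\<^sub>R f x = (\<Sum>i\<in>dyadic_block k j. (?W x * indicator (atom N i) x) *\<^sub>R g i)" if "x \<in> space Rplus" for x
  proof -
    have x: "0 \<le> x" using that by simp
    have "(\<Sum>i\<in>dyadic_block k j. (?W x * indicator (atom N i) x) *\<^sub>R g i) = (\<Sum>i\<in>dyadic_block k j. if i = atom_index N x then ?W x *\<^sub>R g i else 0)"
      by (intro sum.cong refl) (auto simp: indicator_def atom_iff x)
    also have "\<dots> = (if atom_index N x \<in> dyadic_block k j then ?W x *\<^sub>R g (atom_index N x) else 0)" by simp
    also have "\<dots> = ?W x *\<^sub>R f x"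
      using dyadic_interval_iff[OF x, of k N j] by (auto simp: f[OF x] wave_packet_def)
    finally show ?thesis by simp
  qed
  have "has_Bochner_int Rplus (\<lambda>x. ?W x *\<^sub>R f x) (\<Sum>i\<in>dyadic_block k j. (?c * walsh_sg k m i * (1 / 2 ^ N)) *\<^sub>R g i)"
    by (rule iffD2[OF has_Bochner_int_cong[OF E] S])
  then have "wpairing f ?W = (\<Sum>i\<in>dyadic_block k j. (?c * walsh_sg k m i * (1 / 2 ^ N)) *\<^sub>R g i)"
    unfolding wpairing_def by (rule has_Bochner_int_eq)
  then show ?thesis by (simp add: scaleR_sum_right)
qed

text \<open>If \<open>m div 2\<close> is positive, both halves vanish by induction; otherwise
  \<open>m = 1\<close>, and they have opposite signs and cancel.\<close>

lemma walsh_sg_sum_zero: "0 < m \<Longrightarrow> m < 2 ^ t \<Longrightarrow> (\<Sum>i\<in>dyadic_block t j. walsh_sg t m i) = 0"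
proof (induction t arbitrary: m j)
  case (Suc t)
  have d: "dyadic_block t (2 * j) \<inter> dyadic_block t (2 * j + 1) = {}" by (auto simp: dyadic_block_def)
  have "(\<Sum>i\<in>dyadic_block t (2 * j). walsh_sg (Suc t) m i) = (\<Sum>i\<in>dyadic_block t (2 * j). walsh_sg t (m div 2) i)"
    by (intro sum.cong refl) (simp add: dyadic_block_def)
  moreover have "(\<Sum>i\<in>dyadic_block t (2 * j + 1). walsh_sg (Suc t) m i) = (if odd m then -1 else 1) * (\<Sum>i\<in>dyadic_block t (2 * j + 1). walsh_sg t (m div 2) i)"
    unfolding sum_distrib_left by (intro sum.cong) (auto simp: dyadic_block_def)
  ultimately have eq: "(\<Sum>i\<in>dyadic_block (Suc t) j. walsh_sg (Suc t) m i) = (\<Sum>i\<in>dyadic_block t (2 * j). walsh_sg t (m div 2) i) +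
     (if odd m then -1 else 1) * (\<Sum>i\<in>dyadic_block t (2 * j + 1). walsh_sg t (m div 2) i)"
    unfolding dyadic_block_Suc sum.union_disjoint[OF finite_dyadic_block finite_dyadic_block d] by (simp only:)
  show ?case
  proof (cases "m div 2 = 0")
    case True
    then have m1: "m = 1" using Suc.prems(1) by auto
    have "walsh_sg t 0 i = 1" for i by (induction t) auto
    then show ?thesis unfolding eq by (simp add: m1)
  next
    case False
    then show ?thesis unfolding eq using Suc.IH[of "m div 2"] Suc.prems(2) by simp
  qed
qed simp

text \<open>Such packets oscillate faster than \<open>f\<close> can vary. The grid is refined until
  the packet becomes a discrete Walsh sign, which then has mean zero on every piece where
  \<open>f\<close> is constant. Frequency 0 has to be excluded, as short intervals with
  \<open>m = 0\<close> do see \<open>f\<close>.\<close>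

lemma wpairing_vanish:
  fixes f :: "real \<Rightarrow> 'a::real_normed_vector"
  assumes f: "\<And>x. 0 \<le> x \<Longrightarrow> f x = g (atom_index N x)" and m: "0 < m" "s + int N < 0 \<or> 2 ^ nat (s + int N) \<le> m"
  shows "wpairing f (wave_packet s j m) = 0"
proof (cases "s + int N < 0")
  case True
  \<comment> \<open>Chosen so that the interval consists of \<open>2 ^ m\<close> refined cells; then
    \<open>m < 2 ^ m\<close> makes the frequency admissible.\<close>
  define t where "t = m + nat (- (s + int N))"
  have s: "s = int m - int (N + t)" using True by (simp add: t_def)
  have h: "f x = (\<lambda>i. g (i div 2 ^ t)) (atom_index (N + t) x)" if "0 \<le> x" for x using f[OF that] by (simp add: atom_index_div)
  have "wpairing f (wave_packet s j m) = ((2 powi s) powr (- 1 / 2) / 2 ^ (N + t)) *\<^sub>R (\<Sum>i\<in>dyadic_block m j. walsh_sg m m i *\<^sub>R g (i div 2 ^ t))"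
    unfolding s by (rule wpairing_step[where g = "\<lambda>i. g (i div 2 ^ t)", OF h less_exp])
  also have "(\<Sum>i\<in>dyadic_block m j. walsh_sg m m i *\<^sub>R g (i div 2 ^ t)) = (\<Sum>i\<in>dyadic_block m j. walsh_sg m m i) *\<^sub>R g (j div 2 ^ (t - m))"
    unfolding scaleR_sum_left
  proof (intro sum.cong refl)
    fix i assume "i \<in> dyadic_block m j"
    then have "i div 2 ^ t = j div 2 ^ (t - m)" using div_pow_add[of i m "t - m"] by (simp add: dyadic_block_def t_def)
    then show "walsh_sg m m i *\<^sub>R g (i div 2 ^ t) = walsh_sg m m i *\<^sub>R g (j div 2 ^ (t - m))" by simp
  qed
  also have "(\<Sum>i\<in>dyadic_block m j. walsh_sg m m i) = 0" using m(1) less_exp by (intro walsh_sg_sum_zero) auto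
  finally show ?thesis by simp
next
  case False
  define k where "k = nat (s + int N)"
  \<comment> \<open>Each old atom is cut into \<open>2 ^ m\<close> cells. On it the packet is a
    signed packet of frequency \<open>m div 2 ^ k\<close>, positive since
    \<open>2 ^ k \<le> m\<close>.\<close>
  have s: "s = int (m + k) - int (N + m)" using False by (simp add: k_def)
  have mk: "2 ^ k \<le> m" using m(2) False by (simp add: k_def)
  have "m < 2 ^ m" by (rule less_exp)
  also have "(2::nat) ^ m \<le> 2 ^ (m + k)" by (intro power_increasing) auto
  finally have mlt: "m < 2 ^ (m + k)" .
  have h: "f x = (\<lambda>i. g (i div 2 ^ m)) (atom_index (N + m) x)" if "0 \<le> x" for x using f[OF that] by (simp add: atom_index_div)
  have "wpairing f (wave_packet s j m) = ((2 powi s) powr (- 1 / 2) / 2 ^ (N + m)) *\<^sub>R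
      (\<Sum>i\<in>dyadic_block (m + k) j. walsh_sg (m + k) m i *\<^sub>R g (i div 2 ^ m))"
    unfolding s by (rule wpairing_step[where g = "\<lambda>i. g (i div 2 ^ m)", OF h mlt])
  also have "(\<Sum>i\<in>dyadic_block (m + k) j. walsh_sg (m + k) m i *\<^sub>R g (i div 2 ^ m)) =
     (\<Sum>y\<in>(\<lambda>i. i div 2 ^ m) ` dyadic_block (m + k) j. \<Sum>i\<in>{i \<in> dyadic_block (m + k) j. i div 2 ^ m = y}. walsh_sg (m + k) m i *\<^sub>R g (i div 2 ^ m))"
    by (rule sum.image_gen) simp
  also have "\<dots> = 0"
  proof (rule sum.neutral, rule ballI)
    fix y assume "y \<in> (\<lambda>i. i div 2 ^ m) ` dyadic_block (m + k) j"
    then have y: "y div 2 ^ k = j" by (auto simp: dyadic_block_def div_pow_add)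
    have eq: "{i \<in> dyadic_block (m + k) j. i div 2 ^ m = y} = dyadic_block m y" using y by (auto simp: dyadic_block_def simp flip: div_pow_add)
    obtain \<rho> where \<rho>: "\<And>i. walsh_sg (m + k) m i = \<rho> (i div 2 ^ m) * walsh_sg m (m div 2 ^ k) i" using walsh_sg_shift by blast
    have "(\<Sum>i\<in>dyadic_block m y. walsh_sg (m + k) m i *\<^sub>R g (i div 2 ^ m)) = (\<rho> y * (\<Sum>i\<in>dyadic_block m y. walsh_sg m (m div 2 ^ k) i)) *\<^sub>R g y"
      unfolding scaleR_sum_left sum_distrib_left by (intro sum.cong refl) (auto simp: \<rho> dyadic_block_def)
    also have "(\<Sum>i\<in>dyadic_block m y. walsh_sg m (m div 2 ^ k) i) = 0"
    proof (rule walsh_sg_sum_zero)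
      show "0 < m div 2 ^ k" using mk by (simp add: div_greater_zero_iff)
      show "m div 2 ^ k < 2 ^ m" using div_le_dividend[of m "2 ^ k"] \<open>m < 2 ^ m\<close> by linarith
    qed
    finally show "(\<Sum>i\<in>{i \<in> dyadic_block (m + k) j. i div 2 ^ m = y}. walsh_sg (m + k) m i *\<^sub>R g (i div 2 ^ m)) = 0" by (simp add: eq)
  qed
  finally show ?thesis by simp
qed

text \<open>The unit cell of the discrete model corresponds to length \<open>2\<^bsup>-N\<^esup>\<close>.\<close>
definition quartile_of :: "nat \<Rightarrow> dquart \<Rightarrow> quartile" where
  "quartile_of N P = Quartile (int (sc P) - int N) (ps P) (fr P)"

definition amplitude :: "nat \<Rightarrow> dquart \<Rightarrow> real" where
  "amplitude N P = (2 powi (int (sc P) - int N)) powr (- 1 / 2)"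

lemma amplitude_sq: "amplitude N P * (amplitude N P * (2 ^ sc P / 2 ^ N)) = 1"
proof -
  define r :: real where "r = 2 ^ sc P / 2 ^ N"
  have r: "0 < r" by (simp add: r_def)
  have "2 powi (int (sc P) - int N) = r" by (simp add: r_def power_int_diff)
  then have "amplitude N P = r powr (- 1 / 2)" by (simp add: amplitude_def)
  then have "amplitude N P * (amplitude N P * r) = r powr (- 1 / 2) * (r powr (- 1 / 2) * r powr 1)" using r by simp
  also have "\<dots> = r powr (- 1 / 2 + (- 1 / 2 + 1))" by (simp only: powr_add)
  also have "\<dots> = 1" using r by simp
  finally show ?thesis by (simp only: r_def)
qed

text \<open>The quartiles visible to a grid: all four tiles have frequency below the resolution, but
  position and length are not bounded. They are exhausted by the boxes \<open>qbox L\<close> as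
  \<open>L\<close> grows.\<close>

definition valid :: "dquart \<Rightarrow> bool" where
  "valid P \<longleftrightarrow> 2 \<le> sc P \<and> fr P < 2 ^ (sc P - 2)"

lemma valid_qbox: "P \<in> qbox L \<Longrightarrow> valid P"
  by (simp add: valid_def qbox_def)

lemma valid_freq:
  assumes "valid P" "u < 4" shows "4 * fr P + u < 2 ^ sc P"
proof -
  have "4 * (fr P + 1) \<le> 4 * 2 ^ (sc P - 2)" using assms(1) by (intro mult_left_mono) (auto simp: valid_def)
  also have "(4::nat) * 2 ^ (sc P - 2) = 2 ^ (2 + (sc P - 2))" by (simp only: power_add) simp
  also have "2 + (sc P - 2) = sc P" using assms(1) unfolding valid_def by arith
  finally show ?thesis using assms(2) by simp
qed

lemma tile_packet_quartile_of: "tile_packet (quartile_of N P) u = wave_packet (int (sc P) - int N) (ps P) (4 * fr P + u)"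
  by (simp add: tile_packet_def quartile_of_def)

lemma wpairing_quartile_of:
  fixes f :: "real \<Rightarrow> 'a::real_normed_vector"
  assumes f: "\<And>x. 0 \<le> x \<Longrightarrow> f x = g (atom_index N x)" and P: "valid P" "u < 4"
  shows "wpairing f (tile_packet (quartile_of N P) u) = (amplitude N P * (2 ^ sc P / 2 ^ N)) *\<^sub>R avg u g P"
proof -
  have "wpairing f (wave_packet (int (sc P) - int N) (ps P) (4 * fr P + u)) =
     (amplitude N P / 2 ^ N) *\<^sub>R (\<Sum>i\<in>dyadic_block (sc P) (ps P). walsh_sg (sc P) (4 * fr P + u) i *\<^sub>R g i)"
    unfolding amplitude_def by (rule wpairing_step) (use f valid_freq[OF P] in auto)
  then show ?thesis by (simp add: tile_packet_quartile_of avg_def cells_def)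
qed

lemma tile_packet_generic:
  assumes "generic x" "0 \<le> x" "valid P" "u < 4"
  shows "tile_packet (quartile_of N P) u x = amplitude N P * packet u P (atom_index N x)"
  unfolding tile_packet_quartile_of wave_packet_generic[OF assms(1,2) valid_freq[OF assms(3,4)]] amplitude_def packet_def cells_def ..

text \<open>The pairing and the packet each bring one amplitude, and \<open>amplitude_sq\<close>
  cancels their product against the length of the interval. The grid parameter \<open>N\<close>
  thereby disappears.\<close>

lemma tree_summand_generic:
  fixes f :: "real \<Rightarrow> 'a::real_normed_vector"
  assumes f: "\<And>x. 0 \<le> x \<Longrightarrow> f x = g (atom_index N x)" and P: "valid P" "u < 4" and x: "generic x" "0 \<le> x"
  shows "tree_summand u f (quartile_of N P) x = packet u P (atom_index N x) *\<^sub>R avg u g P"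
proof -
  have w: "wpairing f (tile_packet (quartile_of N P) u) = (amplitude N P * (2 ^ sc P / 2 ^ N)) *\<^sub>R avg u g P"
    by (rule wpairing_quartile_of) (use f P in auto)
  have "tree_summand u f (quartile_of N P) x = (amplitude N P * (amplitude N P * (2 ^ sc P / 2 ^ N))) *\<^sub>R packet u P (atom_index N x) *\<^sub>R avg u g P"
    unfolding tree_summand_def w tile_packet_generic[OF x P] by (simp add: mult_ac)
  then show ?thesis by (simp only: amplitude_sq scaleR_one)
qed

section \<open>Quartile type for the discrete model\<close>

lemma dyadic_interval_mono:
  assumes "k \<le> k'" "j div 2 ^ (k' - k) = j'"
  shows "dyadic_interval (int k - int N) j \<subseteq> dyadic_interval (int k' - int N) j'"
proof
  fix x assume x: "x \<in> dyadic_interval (int k - int N) j"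
  then have x0: "0 \<le> x" unfolding dyadic_interval_def
    by (metis atLeastLessThan_iff mult_nonneg_nonneg of_nat_0_le_iff order_trans zero_le_numeral zero_le_power_int)
  have "atom_index N x div 2 ^ k = j" using x dyadic_interval_iff[OF x0] by (simp add: dyadic_block_def)
  then have "atom_index N x div 2 ^ k' = j'" using assms by (metis div_pow_add le_add_diff_inverse)
  then show "x \<in> dyadic_interval (int k' - int N) j'" using dyadic_interval_iff[OF x0] by (simp add: dyadic_block_def)
qed

lemma dyadic_freq_mono:
  assumes "k \<le> k'" "m' div 2 ^ (k' - k) = m"
  shows "dyadic_interval (- int k') m' \<subseteq> dyadic_interval (- int k) m"
  using dyadic_interval_mono[of 0 "k' - k" m' m k'] assms by simp

lemma dyadic_freq_meet:
  assumes "y \<in> dyadic_interval (- int k) m" "y \<in> dyadic_interval (- int k') m'" "k \<le> k'"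
  shows "m' div 2 ^ (k' - k) = m"
proof -
  have y0: "0 \<le> y" using assms(1) unfolding dyadic_interval_def
    by (metis atLeastLessThan_iff mult_nonneg_nonneg of_nat_0_le_iff order_trans zero_le_numeral zero_le_power_int)
  have "atom_index k y = m" using assms(1) dyadic_interval_iff[OF y0, of 0 k m] by (simp add: dyadic_block_def)
  moreover have "atom_index k' y = m'" using assms(2) dyadic_interval_iff[OF y0, of 0 k' m'] by (simp add: dyadic_block_def)
  ultimately show ?thesis using atom_index_div[of k "k' - k" y] assms(3) by simp
qed

lemma dyadic_time_meet:
  assumes "x \<in> dyadic_interval (int k) j" "x \<in> dyadic_interval (int k') j'" "k \<le> k'"
  shows "j div 2 ^ (k' - k) = j'"
proof -
  have x0: "0 \<le> x" using assms(1) unfolding dyadic_interval_def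
    by (metis atLeastLessThan_iff mult_nonneg_nonneg of_nat_0_le_iff order_trans zero_le_numeral zero_le_power_int)
  have "atom_index 0 x div 2 ^ k = j" using assms(1) dyadic_interval_iff[OF x0, of k 0 j] by (simp add: dyadic_block_def)
  moreover have "atom_index 0 x div 2 ^ k' = j'" using assms(2) dyadic_interval_iff[OF x0, of k' 0 j'] by (simp add: dyadic_block_def)
  ultimately show ?thesis using assms(3) by (metis div_pow_add le_add_diff_inverse)
qed

lemma qlev_tile_le: "qlev v P T \<Longrightarrow> tile_le v (quartile_of 0 P) (quartile_of 0 T)"
  using dyadic_interval_mono[of "sc P" "sc T" "ps P" "ps T" 0] dyadic_freq_mono[of "sc P" "sc T" "4 * fr T + v" "4 * fr P + v"]
  by (simp add: qlev_def tile_le_def time_interval_def freq_interval_def quartile_of_def)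

text \<open>All tiles have area 1, so the one shorter in time is longer in frequency. A common point
  then nests the intervals in both variables, in the directions that \<open>qlev\<close>
  demands.\<close>

lemma tiles_meet:
  assumes "tile (quartile_of 0 P) u \<inter> tile (quartile_of 0 Q) u \<noteq> {}"
  shows "qlev u P Q \<or> qlev u Q P"
proof -
  obtain x y where *: "x \<in> dyadic_interval (int (sc P)) (ps P)" "x \<in> dyadic_interval (int (sc Q)) (ps Q)"
    "y \<in> dyadic_interval (- int (sc P)) (4 * fr P + u)" "y \<in> dyadic_interval (- int (sc Q)) (4 * fr Q + u)"
    using assms by (auto simp: tile_def time_interval_def freq_interval_def quartile_of_def)
  show ?thesis
  proof (cases "sc P \<le> sc Q")
    case True
    then show ?thesis using dyadic_time_meet[OF *(1,2)] dyadic_freq_meet[OF *(3,4)] by (simp add: qlev_def)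
  next
    case False
    then show ?thesis using dyadic_time_meet[OF *(2,1)] dyadic_freq_meet[OF *(4,3)] by (simp add: qlev_def)
  qed
qed

lemma inj_quartile_of: "inj (quartile_of N)"
  by (rule injI) (auto simp: quartile_of_def intro: dquart.expand)

lemma Lp_norm_powr: "0 < q \<Longrightarrow> Lp_norm M q f powr q = enn2real (pint M q f)"
  by (simp add: Lp_norm_eq powr_powr)

lemma step_Lp:
  fixes g :: "nat \<Rightarrow> 'a::real_normed_vector"
  assumes "\<And>i. B \<le> i \<Longrightarrow> g i = 0"
  shows "(\<lambda>x. g (atom_index N x)) \<in> Lp_space Rplus p"
  unfolding Lp_space_iff using pint_step[of B g "\<lambda>x. g (atom_index N x)" N p] assms
  by (auto intro!: strongly_measurable_simple step_simple)

lemma tile_packet_measurable: "tile_packet P u \<in> borel_measurable borel"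
  unfolding tile_packet_def by (rule wave_packet_measurable)

lemma strongly_measurable_packet: "strongly_measurable Rplus (\<lambda>x. tile_packet P u x *\<^sub>R (c :: 'a::real_normed_vector))"
proof -
  have "strongly_measurable Rplus (tile_packet P u)"
    by (simp only: strongly_measurable_iff_borel borel_imp_Rplus[OF tile_packet_measurable])
  then show ?thesis by (rule strongly_measurable_compose) (intro tendsto_intros)
qed

text \<open>A sequence is read as a step function on unit cells, a discrete tree as a tree of
  quartiles with the same indices. Incomparability gives disjoint tiles by
  \<open>tiles_meet\<close>, and the finite tree sums agree off the dyadic points.\<close>

lemma quartile_type_imp_discrete:
  assumes "quartile_type q TYPE('a::banach)"
  obtains C where "discrete_quartile_type q C TYPE('a)"
proof -
  have q1: "1 \<le> q" using assms by (simp add: quartile_type_def)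
  from assms[unfolded quartile_type_def, THEN conjunct2] obtain C where C: "\<forall>u<4. \<forall>v<4. u \<noteq> v \<longrightarrow>
      (\<forall>\<TT>. good_trees v u \<TT> \<longrightarrow> (\<forall>f \<in> (Lp_space Rplus q :: (real \<Rightarrow> 'a) set). \<exists>S.
           (\<forall>\<T>\<in>\<TT>. has_Lp_sum q (tree_summand u f) (S \<T>) \<T>) \<and>
           (\<lambda>\<T>. Lp_norm Rplus q (S \<T>) powr q) summable_on \<TT> \<and>
           (\<Sum>\<^sub>\<infinity>\<T>\<in>\<TT>. Lp_norm Rplus q (S \<T>) powr q) powr (1 / q) \<le> C * Lp_norm Rplus q f))" ..
  define D where "D = max C 0 powr q"
  have "discrete_quartile_type q D TYPE('a)" unfolding discrete_quartile_type_def
  proof (intro conjI allI impI)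
    show "0 \<le> D" by (simp add: D_def)
    fix L u v :: nat and \<B> and f :: "nat \<Rightarrow> 'a"
    assume uv: "u < 4" "v < 4" "u \<noteq> v" and fin: "finite \<B>" and B: "\<forall>B\<in>\<B>. B \<subseteq> qbox L \<and> (\<exists>T. \<forall>P\<in>B. qlev v P T)"
      and dj: "disjoint \<B>" and good: "\<forall>P\<in>\<Union>\<B>. \<forall>Q\<in>\<Union>\<B>. P \<noteq> Q \<longrightarrow> \<not> qlev u P Q"
    \<comment> \<open>The sequence is arbitrary beyond the box; the cut makes the step function
      integrable and does not change any coefficient in the box.\<close>
    define g where "g i = (if i < 2 ^ L then f i else 0)" for i
    define F where "F x = g (atom_index 0 x)" for x
    have F: "F \<in> Lp_space Rplus q" unfolding F_def by (rule step_Lp[of "2 ^ L"]) (simp add: g_def)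
    define \<TT> where "\<TT> = (\<lambda>B. quartile_of 0 ` B) ` \<B>"
    have gt: "good_trees v u \<TT>" unfolding good_trees_def
    proof (intro conjI ballI impI)
      show "disjoint \<TT>"
        unfolding \<TT>_def disjoint_def
      proof (intro ballI impI)
        fix X Y assume "X \<in> (\<lambda>B. quartile_of 0 ` B) ` \<B>" "Y \<in> (\<lambda>B. quartile_of 0 ` B) ` \<B>" "X \<noteq> Y"
        then obtain B B' where BB: "B \<in> \<B>" "B' \<in> \<B>" "X = quartile_of 0 ` B" "Y = quartile_of 0 ` B'" "B \<noteq> B'" by blast
        then have "B \<inter> B' = {}" using dj by (auto simp: disjoint_def)
        then show "X \<inter> Y = {}" using BB image_Int[OF inj_quartile_of, of 0 B B'] by simp
      qed
      show "is_tree v \<T>" if T: "\<T> \<in> \<TT>" for \<T>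
      proof -
        obtain B where "B \<in> \<B>" "\<T> = quartile_of 0 ` B" using T by (auto simp: \<TT>_def)
        moreover then obtain T where "\<forall>P\<in>B. qlev v P T" using B by blast
        ultimately show ?thesis using qlev_tile_le by (auto simp: is_tree_def intro!: exI[of _ "quartile_of 0 T"])
      qed
      show "tile P u \<inter> tile P' u = {}" if T: "\<T> \<in> \<TT>" "\<T>' \<in> \<TT>" "P \<in> \<T>" "P' \<in> \<T>'" "P \<noteq> P'" for \<T> \<T>' P P'
      proof -
        obtain R R' where R: "R \<in> \<Union>\<B>" "R' \<in> \<Union>\<B>" "P = quartile_of 0 R" "P' = quartile_of 0 R'" using T by (auto simp: \<TT>_def)
        then have "R \<noteq> R'" using T(5) by blast
        then have "\<not> qlev u R R'" "\<not> qlev u R' R" using good R(1,2) by auto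
        then show ?thesis using tiles_meet[of R u R'] R by blast
      qed
    qed
    from C[rule_format, OF uv gt F] obtain S where SS: "(\<forall>\<T>\<in>\<TT>. has_Lp_sum q (tree_summand u F) (S \<T>) \<T>) \<and>
           (\<lambda>\<T>. Lp_norm Rplus q (S \<T>) powr q) summable_on \<TT> \<and>
           (\<Sum>\<^sub>\<infinity>\<T>\<in>\<TT>. Lp_norm Rplus q (S \<T>) powr q) powr (1 / q) \<le> C * Lp_norm Rplus q F" ..
    have S1: "has_Lp_sum q (tree_summand u F) (S \<T>) \<T>" if "\<T> \<in> \<TT>" for \<T>
      using bspec[OF conjunct1[OF SS] that] .
    note S2 = conjunct2[OF conjunct2[OF SS]]
    have key: "Lp_norm Rplus q (S (quartile_of 0 ` B)) powr q = (\<Sum>x<2 ^ L. norm (tree_sum u f B x) powr q)" if BB: "B \<in> \<B>" for B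
    proof -
      have Bq: "B \<subseteq> qbox L" using B BB by blast
      have finB: "finite (quartile_of 0 ` B)" using finite_subset[OF Bq finite_qbox] by simp
      define G where "G x = (\<Sum>P\<in>quartile_of 0 ` B. tree_summand u F P x)" for x
      have Gm: "strongly_measurable Rplus G"
        unfolding G_def tree_summand_def by (intro strongly_measurable_sum strongly_measurable_packet)
      have avg_eq: "avg u g P = avg u f P" if "P \<in> B" for P
        unfolding avg_def using cells_qbox[of P L] that Bq
        by (intro arg_cong2[of _ _ _ _ scaleR] sum.cong refl) (auto simp: g_def)
      have AE_G: "AE x in Rplus. G x = tree_sum u f B (atom_index 0 x)"
        using AE_generic AE_space
      proof eventually_elim
        case (elim x)
        then have x: "generic x" "0 \<le> x" by auto
        have "G x = (\<Sum>P\<in>B. tree_summand u F (quartile_of 0 P) x)"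
          unfolding G_def by (subst sum.reindex[OF inj_on_subset[OF inj_quartile_of subset_UNIV]]) simp
        also have "\<dots> = tree_sum u f B (atom_index 0 x)"
          unfolding tree_sum_def
        proof (rule sum.cong[OF refl])
          fix P assume P: "P \<in> B"
          have "valid P" using P Bq valid_qbox by blast
          then show "tree_summand u F (quartile_of 0 P) x = packet u P (atom_index 0 x) *\<^sub>R avg u f P"
            using tree_summand_generic[of F g 0 P u x] x uv(1) avg_eq[OF P] by (simp add: F_def)
        qed
        finally show ?case .
      qed
      have zero: "tree_sum u f B i = 0" if "2 ^ L \<le> i" for i
        unfolding tree_sum_def
      proof (rule sum.neutral, rule ballI)
        fix P assume "P \<in> B"
        then have "P \<in> qbox L" using Bq by blast
        from cells_qbox[OF this] have "i \<notin> cells P" using that by auto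
        then show "packet u P i *\<^sub>R avg u f P = 0" by (simp add: packet_def)
      qed
      have pG: "pint Rplus q G = ennreal (\<Sum>x<2 ^ L. norm (tree_sum u f B x) powr q)"
        using pint_step[OF zero AE_G] by simp
      have "quartile_of 0 ` B \<in> \<TT>" using BB by (simp add: \<TT>_def)
      note h = S1[OF this]
      have SB: "S (quartile_of 0 ` B) \<in> Lp_space Rplus q" using h by (simp add: has_Lp_sum_def)
      \<comment> \<open>For a finite tree the filter is principal at the whole tree, so convergence
        in norm forces \<open>S\<close> to equal the finite sum almost everywhere.\<close>
      have lim: "((\<lambda>FF. Lp_norm Rplus q (\<lambda>x. S (quartile_of 0 ` B) x - (\<Sum>i\<in>FF. tree_summand u F i x))) \<longlongrightarrow> 0) (principal {quartile_of 0 ` B})"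
        using h unfolding has_Lp_sum_def finite_subsets_at_top_finite[OF finB] by (rule conjunct2)
      have "((\<lambda>FF. Lp_norm Rplus q (\<lambda>x. S (quartile_of 0 ` B) x - (\<Sum>i\<in>FF. tree_summand u F i x))) \<longlongrightarrow>
         Lp_norm Rplus q (\<lambda>x. S (quartile_of 0 ` B) x - G x)) (principal {quartile_of 0 ` B})"
        by (rule tendsto_eventually) (simp add: eventually_principal G_def)
      then have "Lp_norm Rplus q (\<lambda>x. S (quartile_of 0 ` B) x - G x) = 0"
        by (rule tendsto_unique[OF _ _ lim, rotated]) (simp add: principal_eq_bot_iff)
      moreover have "G \<in> Lp_space Rplus q" using Gm pG by (simp add: Lp_space_iff)
      then have dL: "(\<lambda>x. S (quartile_of 0 ` B) x - G x) \<in> Lp_space Rplus q" using SB q1 by (intro Lp_space_diff) auto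
      ultimately have "pint Rplus q (\<lambda>x. S (quartile_of 0 ` B) x - G x) = 0"
        by (auto simp: Lp_norm_eq Lp_space_iff enn2real_eq_0_iff)
      then have "AE x in Rplus. S (quartile_of 0 ` B) x - G x = 0" using dL by (intro pint_zero_AE) (auto simp: Lp_space_iff)
      then have "pint Rplus q (S (quartile_of 0 ` B)) = pint Rplus q G" by (intro pint_cong_AE) auto
      then show ?thesis using q1 pG by (simp add: Lp_norm_powr sum_nonneg)
    qed
    have finT: "finite \<TT>" using fin by (simp add: \<TT>_def)
    have "(\<Sum>B\<in>\<B>. \<Sum>x<2 ^ L. norm (tree_sum u f B x) powr q) = (\<Sum>B\<in>\<B>. Lp_norm Rplus q (S (quartile_of 0 ` B)) powr q)"
      by (intro sum.cong refl key[symmetric])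
    also have "\<dots> = (\<Sum>\<T>\<in>\<TT>. Lp_norm Rplus q (S \<T>) powr q)"
      unfolding \<TT>_def by (subst sum.reindex) (auto simp: inj_on_def inj_image_eq_iff[OF inj_quartile_of])
    finally have eq: "(\<Sum>B\<in>\<B>. \<Sum>x<2 ^ L. norm (tree_sum u f B x) powr q) = (\<Sum>\<T>\<in>\<TT>. Lp_norm Rplus q (S \<T>) powr q)" .
    let ?X = "\<Sum>B\<in>\<B>. \<Sum>x<2 ^ L. norm (tree_sum u f B x) powr q"
    have X0: "0 \<le> ?X" by (intro sum_nonneg) auto
    have nF: "Lp_norm Rplus q F powr q = (\<Sum>x<2 ^ L. norm (f x) powr q)"
    proof -
      have "pint Rplus q F = ennreal ((1 / 2 ^ 0) * (\<Sum>i<2 ^ L. norm (g i) powr q))"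
        by (rule pint_step) (auto simp: g_def F_def)
      then show ?thesis using q1 by (simp add: Lp_norm_powr sum_nonneg g_def)
    qed
    have "?X powr (1 / q) \<le> C * Lp_norm Rplus q F" using S2 unfolding infsum_finite[OF finT] eq .
    also have "\<dots> \<le> max C 0 * Lp_norm Rplus q F" by (intro mult_right_mono) (auto simp: Lp_norm_eq)
    finally have "?X powr (1 / q) \<le> max C 0 * Lp_norm Rplus q F" .
    then have XX: "(?X powr (1 / q)) powr q \<le> (max C 0 * Lp_norm Rplus q F) powr q"
      using q1 by (intro powr_mono2) auto

    show "?X \<le> D * (\<Sum>x<2 ^ L. norm (f x) powr q)"
    proof -
      have "0 \<le> Lp_norm Rplus q F" by (simp add: Lp_norm_eq)
      with XX show ?thesis
        using q1 X0 by (simp add: powr_powr powr_mult D_def nF)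
    qed
  qed
  then show thesis by (rule that)
qed

text \<open>The test function is \<open>a\<close> on a single cell, with all
  \<open>2 ^ (k - 2)\<close> quartiles over the interval of length \<open>2 ^ k\<close> as
  one-element trees. Every coefficient has norm \<open>norm a / 2 ^ k\<close>, and the inequality
  becomes \<open>2 powr ((2 - q) * k) \<le> 4 * C\<close> for every
  \<open>k \<ge> 2\<close>.\<close>

lemma discrete_quartile_type_two_le:
  fixes a :: "'a::real_normed_vector"
  assumes C: "discrete_quartile_type q C TYPE('a)" and a: "a \<noteq> 0" and q: "0 \<le> q"
  shows "2 \<le> q"
proof (rule ccontr)
  assume "\<not> 2 \<le> q"
  then have q2: "0 < 2 - q" by simp
  define f where "f i = (if i = 0 then a else 0)" for i :: nat
  have bound: "2 powr ((2 - q) * real k) \<le> 4 * C" if k: "2 \<le> k" for k :: nat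
  proof -
    define \<B> where "\<B> = (\<lambda>n. {DQ k 0 n}) ` {..<2 ^ (k - 2)}"
    have P: "DQ k 0 n \<in> qbox k" if "n < 2 ^ (k - 2)" for n using that k by (simp add: qbox_def)
    have "(\<Sum>B\<in>\<B>. \<Sum>x<2 ^ k. norm (tree_sum 1 f B x) powr q) \<le> C * (\<Sum>x<2 ^ k. norm (f x) powr q)"
    proof (rule discrete_quartile_type_D[OF C, of 1 0])
      show "B \<subseteq> qbox k \<and> (\<exists>T. \<forall>P\<in>B. qlev 0 P T)" if "B \<in> \<B>" for B
        using that P by (auto simp: \<B>_def intro: qlev_refl)
      show "disjoint \<B>" by (auto simp: \<B>_def disjoint_def)
      show "\<not> qlev 1 P Q" if "P \<in> \<Union>\<B>" "Q \<in> \<Union>\<B>" "P \<noteq> Q" for P Q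
        using that qlev_eq_scale[of 1 P Q] by (auto simp: \<B>_def)
    qed (auto simp: \<B>_def)
    also have "(\<Sum>B\<in>\<B>. \<Sum>x<2 ^ k. norm (tree_sum 1 f B x) powr q) = (\<Sum>n<2 ^ (k - 2). \<Sum>x<2 ^ k. norm (tree_sum 1 f {DQ k 0 n} x) powr q)"
      unfolding \<B>_def by (subst sum.reindex) (auto simp: inj_on_def)
    also have "\<dots> = (\<Sum>n<(2::nat) ^ (k - 2). 2 ^ k * (norm a / 2 ^ k) powr q)"
    proof (rule sum.cong[OF refl])
      fix n assume "n \<in> {..<(2::nat) ^ (k - 2)}"
      then have n: "DQ k 0 n \<in> qbox k" using P by simp
      have s0: "walsh_sg k m 0 = 1" for m by (induction k arbitrary: m) auto
      have cells: "cells (DQ k 0 n) = {..<2 ^ k}" by (auto simp: cells_def dyadic_block_eq)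
      have "avg 1 f (DQ k 0 n) = (1 / 2 ^ k) *\<^sub>R (\<Sum>i<(2::nat) ^ k. if i = 0 then a else 0)"
        unfolding avg_def cells by (simp add: f_def s0 if_distrib cong: if_cong)
      then have av: "avg 1 f (DQ k 0 n) = (1 / 2 ^ k) *\<^sub>R a" by simp
      have "norm (tree_sum 1 f {DQ k 0 n} x) = norm a / 2 ^ k" if "x < 2 ^ k" for x
        using that by (simp add: tree_sum_def abs_packet av cells del: One_nat_def)
      then show "(\<Sum>x<2 ^ k. norm (tree_sum 1 f {DQ k 0 n} x) powr q) = 2 ^ k * (norm a / 2 ^ k) powr q" by simp
    qed
    also have "\<dots> = 2 ^ (k - 2) * (2 ^ k * (norm a / 2 ^ k) powr q)" by simp
    also have "(norm a / 2 ^ k) powr q = norm a powr q / 2 powr (q * k)"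
      by (simp add: powr_divide powr_realpow[symmetric] powr_powr mult.commute)
    also have "(\<Sum>x<2 ^ k. norm (f x) powr q) = norm a powr q"
      by (simp add: f_def if_distrib[of "\<lambda>r. norm r powr q"] cong: if_cong)
    finally have "norm a powr q * (2 ^ (k - 2) * 2 ^ k / 2 powr (q * k)) \<le> norm a powr q * C" by (simp add: mult_ac)
    then have "2 ^ (k - 2) * 2 ^ k / 2 powr (q * k) \<le> C" using a by (simp only: mult_le_cancel_left_pos powr_gt_zero norm_eq_zero not_False_eq_True)
    moreover have "(2::real) ^ (k - 2) * 2 ^ k * 4 = 2 powr (2 * k)"
    proof -
      have "(2::real) ^ (k - 2) * 2 ^ k * 4 = 2 ^ ((k - 2) + k + 2)" by (simp only: power_add) simp
      also have "(k - 2) + k + 2 = 2 * k" using k by simp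
      finally show ?thesis by (simp add: powr_realpow[symmetric])
    qed
    ultimately have "2 powr (2 * k) / 2 powr (q * k) \<le> 4 * C" by (simp add: field_simps)
    then show ?thesis by (simp add: powr_diff left_diff_distrib)
  qed
  obtain k :: nat where k: "log 2 (4 * \<bar>C\<bar> + 1) / (2 - q) < real k" using reals_Archimedean2 by blast
  define k' where "k' = max k 2"
  have "log 2 (4 * \<bar>C\<bar> + 1) < (2 - q) * real k'" 
  proof -
    have "real k \<le> real k'" by (simp add: k'_def)
    with k have "log 2 (4 * \<bar>C\<bar> + 1) / (2 - q) < real k'" by linarith
    then show ?thesis using pos_divide_less_eq[OF q2] by (simp add: mult.commute)
  qed
  then have "4 * \<bar>C\<bar> + 1 < 2 powr ((2 - q) * real k')" by (simp add: log_less_iff)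
  then show False using bound[of k'] by (simp add: k'_def)
qed

section \<open>The quartile operator on step functions\<close>

locale tri_form =
  fixes \<Phi> :: "'a::complex_banach \<Rightarrow> 'b::complex_banach \<Rightarrow> 'c::complex_banach \<Rightarrow> complex"
  assumes form: "bounded_trilinear_form \<Phi>"
begin

lemma complex_linear_linear: "complex_linear \<phi> \<Longrightarrow> linear \<phi>"
  by (intro linearI) (simp_all add: complex_linear_def scaleR_eq_scaleC scaleC_complex_def)

lemma cl: "complex_linear (\<lambda>x. \<Phi> x y z)" "complex_linear (\<lambda>y. \<Phi> x y z)" "complex_linear (\<lambda>z. \<Phi> x y z)"
  using form by (auto simp: bounded_trilinear_form_def)

definition K where "K = (SOME K. trilin \<Phi> K)"

lemma tri: "trilin \<Phi> K"
proof -
  obtain k where k: "\<And>x y z. cmod (\<Phi> x y z) \<le> k * norm x * norm y * norm z"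
    using form by (auto simp: bounded_trilinear_form_def)
  have "cmod (\<Phi> x y z) \<le> max k 0 * norm x * norm y * norm z" for x y z
    by (rule order_trans[OF k]) (intro mult_right_mono, auto)
  note A = this
  have "trilin \<Phi> (max k 0)" unfolding trilin_def
    by (intro conjI allI complex_linear_linear[OF cl(1)] complex_linear_linear[OF cl(2)] complex_linear_linear[OF cl(3)] A) simp
  then show ?thesis unfolding K_def by (rule someI)
qed

lemma K0: "0 \<le> K" and bound: "cmod (\<Phi> x y z) \<le> K * norm x * norm y * norm z"
  using tri by (auto simp: trilin_def)

definition form_blinfun :: "'a \<Rightarrow> 'b \<Rightarrow> ('c \<Rightarrow>\<^sub>L complex)" where
  "form_blinfun x y = Blinfun (\<Phi> x y)"

lemma form_blinfun_apply [simp]: "blinfun_apply (form_blinfun x y) z = \<Phi> x y z"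
proof -
  have "bounded_linear (\<Phi> x y)"
    by (rule bounded_linear_intro[of _ "K * norm x * norm y"])
      (use linear_add[OF complex_linear_linear[OF cl(3)]] linear_scale[OF complex_linear_linear[OF cl(3)]] bound in \<open>auto simp: mult_ac\<close>)
  then show ?thesis by (simp add: form_blinfun_def bounded_linear_Blinfun_apply)
qed

lemma norm_form_blinfun: "norm (form_blinfun x y) \<le> K * norm x * norm y"
  by (rule norm_blinfun_bound) (use K0 bound in auto)

lemma \<Phi>_add: "\<Phi> (x + x') y z = \<Phi> x y z + \<Phi> x' y z" "\<Phi> x (y + y') z = \<Phi> x y z + \<Phi> x y' z"
  "\<Phi> x y (z + z') = \<Phi> x y z + \<Phi> x y z'"
  using cl by (auto simp: complex_linear_def)

lemma \<Phi>_scaleC: "\<Phi> (scaleC c x) y z = c * \<Phi> x y z" "\<Phi> x (scaleC c y) z = c * \<Phi> x y z" "\<Phi> x y (scaleC c z) = c * \<Phi> x y z"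
  using cl by (auto simp: complex_linear_def)

lemma \<Phi>_scaleR: "\<Phi> (c *\<^sub>R x) y z = c *\<^sub>R \<Phi> x y z" "\<Phi> x (c *\<^sub>R y) z = c *\<^sub>R \<Phi> x y z" "\<Phi> x y (c *\<^sub>R z) = c *\<^sub>R \<Phi> x y z"
  by (simp_all add: scaleR_eq_scaleC \<Phi>_scaleC scaleC_complex_def)

lemma \<Phi>_zero: "\<Phi> 0 y z = 0" "\<Phi> x 0 z = 0" "\<Phi> x y 0 = 0"
  using \<Phi>_scaleR(1)[of 0 0 y z] \<Phi>_scaleR(2)[of x 0 0 z] \<Phi>_scaleR(3)[of x y 0 0] by simp_all

lemma form_blinfun_add: "form_blinfun (x + x') y = form_blinfun x y + form_blinfun x' y" "form_blinfun x (y + y') = form_blinfun x y + form_blinfun x y'"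
  by (auto intro!: blinfun_eqI simp: \<Phi>_add blinfun.add_left)

lemma form_blinfun_scaleR: "form_blinfun (c *\<^sub>R x) y = c *\<^sub>R form_blinfun x y" "form_blinfun x (c *\<^sub>R y) = c *\<^sub>R form_blinfun x y"
  by (auto intro!: blinfun_eqI simp: \<Phi>_scaleR blinfun.scaleR_left)

lemma form_blinfun_zero: "form_blinfun 0 y = 0" "form_blinfun x 0 = 0"
  by (auto intro!: blinfun_eqI simp: \<Phi>_zero)

definition discrete_operator :: "nat \<Rightarrow> (nat \<Rightarrow> 'a) \<Rightarrow> (nat \<Rightarrow> 'b) \<Rightarrow> nat \<Rightarrow> ('c \<Rightarrow>\<^sub>L complex)" where
  "discrete_operator L f g i = (\<Sum>P\<in>qbox L. packet 3 P i *\<^sub>R form_blinfun (avg 1 f P) (avg 2 g P))"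

lemma discrete_operator_apply: "blinfun_apply (discrete_operator L f g i) z = (\<Sum>P\<in>qbox L. packet 3 P i *\<^sub>R \<Phi> (avg 1 f P) (avg 2 g P) z)"
  by (simp add: discrete_operator_def blinfun.sum_left blinfun.scaleR_left)

lemma discrete_operator_zero: "2 ^ L \<le> i \<Longrightarrow> discrete_operator L f g i = 0"
  unfolding discrete_operator_def
proof (rule sum.neutral, rule ballI)
  fix P assume i: "2 ^ L \<le> i" and P: "P \<in> qbox L"
  have "i \<notin> cells P" using cells_qbox[OF P] i by auto
  then show "packet 3 P i *\<^sub>R form_blinfun (avg 1 f P) (avg 2 g P) = 0" by (simp add: packet_def)
qed

lemma discrete_operator_add:
  "discrete_operator L (\<lambda>i. f i + f' i) g i = discrete_operator L f g i + discrete_operator L f' g i" "discrete_operator L f (\<lambda>i. g i + g' i) i = discrete_operator L f g i + discrete_operator L f g' i"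
  by (simp_all add: discrete_operator_def avg_add form_blinfun_add scaleR_add_right sum.distrib)

lemma scaleC_sum: "scaleC c (\<Sum>i\<in>I. (f i :: 'x::complex_banach)) = (\<Sum>i\<in>I. scaleC c (f i))"
proof -
  have "scaleC c (0 :: 'x) = 0" using scaleC_add_right[of c "0 :: 'x" 0] by simp
  then show ?thesis by (induction I rule: infinite_finite_induct) (simp_all add: scaleC_add_right)
qed

lemma avg_scaleC: "avg u (\<lambda>i. scaleC c (f i :: 'x::complex_banach)) P = scaleC c (avg u f P)"
  by (simp add: avg_def scaleR_eq_scaleC scaleC_scaleC scaleC_sum mult.commute)

lemma discrete_operator_scaleC:
  "blinfun_apply (discrete_operator L (\<lambda>i. scaleC c (f i)) g i) z = c * blinfun_apply (discrete_operator L f g i) z"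
  "blinfun_apply (discrete_operator L f (\<lambda>i. scaleC c (g i)) i) z = c * blinfun_apply (discrete_operator L f g i) z"
  by (simp_all add: discrete_operator_apply avg_scaleC \<Phi>_scaleC sum_distrib_left scaleR_conv_of_real mult.left_commute)

lemma discrete_operator_complex_dual: "discrete_operator L f g i \<in> complex_dual"
  by (simp add: complex_dual_def complex_linear_def discrete_operator_apply \<Phi>_scaleC sum_distrib_left scaleR_conv_of_real
      mult.left_commute \<Phi>_add distrib_left sum.distrib)

text \<open>A functional need not attain its norm, hence the half. Multiplication by a suitable
  unimodular number makes the value real and positive.\<close>

lemma norming:
  assumes "\<phi> \<in> (complex_dual :: ('c \<Rightarrow>\<^sub>L complex) set)"
  obtains z t where "norm z \<le> 1" "blinfun_apply \<phi> z = complex_of_real t" "norm \<phi> / 2 \<le> t"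
proof (cases "\<phi> = 0")
  case True
  then show thesis using that[of 0 0] by simp
next
  case False
  have "\<exists>x. norm \<phi> / 2 * norm x < norm (blinfun_apply \<phi> x)"
  proof (rule ccontr)
    assume "\<not> ?thesis"
    then have "norm \<phi> \<le> norm \<phi> / 2" by (intro norm_blinfun_bound) (auto simp: not_less)
    then show False using False by simp
  qed
  then obtain x where x: "norm \<phi> / 2 * norm x < norm (blinfun_apply \<phi> x)" by blast
  let ?w = "blinfun_apply \<phi> x"
  have "0 \<le> norm \<phi> / 2 * norm x" by simp
  then have "0 < norm ?w" using x by linarith
  then have w0: "?w \<noteq> 0" by simp
  then have x0: "x \<noteq> 0" by auto
  define c where "c = cnj ?w / complex_of_real (cmod ?w * norm x)"
  have "norm (scaleC c x) = 1" using w0 x0 by (simp add: norm_scaleC c_def norm_divide norm_mult)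
  moreover have "blinfun_apply \<phi> (scaleC c x) = complex_of_real (cmod ?w / norm x)"
  proof -
    have "blinfun_apply \<phi> (scaleC c x) = c * ?w" using assms by (simp add: complex_dual_def complex_linear_def)
    also have "\<dots> = (?w * cnj ?w) / complex_of_real (cmod ?w * norm x)" by (simp add: c_def)
    also have "?w * cnj ?w = complex_of_real ((cmod ?w)\<^sup>2)" by (rule complex_norm_square[symmetric])
    finally show ?thesis using w0 by (simp add: power2_eq_square)
  qed
  moreover have "norm \<phi> / 2 \<le> cmod ?w / norm x" using x x0 by (simp add: field_simps)
  ultimately show thesis using that[of "scaleC c x" "cmod ?w / norm x"] by simp
qed

text \<open>The packet of index 3 is real, so it can be moved from the operator onto
  \<open>h\<close>, where it produces the third coefficient.\<close>

lemma sum_discrete_operator: "(\<Sum>i<2 ^ L. blinfun_apply (discrete_operator L f g i) (h i)) = quartile_form \<Phi> f g h (qbox L)"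
proof -
  have "(\<Sum>i<2 ^ L. blinfun_apply (discrete_operator L f g i) (h i)) = (\<Sum>P\<in>qbox L. \<Sum>i<2 ^ L. packet 3 P i *\<^sub>R \<Phi> (avg 1 f P) (avg 2 g P) (h i))"
    unfolding discrete_operator_apply by (rule sum.swap)
  also have "\<dots> = quartile_form \<Phi> f g h (qbox L)"
    unfolding quartile_form_def
  proof (rule sum.cong[OF refl])
    fix P assume P: "P \<in> qbox L"
    have lin: "linear (\<Phi> (avg 1 f P) (avg 2 g P))" using complex_linear_linear[OF cl(3)] .
    have "(\<Sum>i<2 ^ L. packet 3 P i *\<^sub>R \<Phi> (avg 1 f P) (avg 2 g P) (h i)) =
       (\<Sum>i<2 ^ L. indicator (cells P) i *\<^sub>R \<Phi> (avg 1 f P) (avg 2 g P) (walsh_sg (sc P) (4 * fr P + 3) i *\<^sub>R h i))"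
      by (simp add: packet_def \<Phi>_scaleR)
    also have "\<dots> = (\<Sum>i\<in>cells P. \<Phi> (avg 1 f P) (avg 2 g P) (walsh_sg (sc P) (4 * fr P + 3) i *\<^sub>R h i))"
      by (rule sum_indicator_cells[OF P])
    also have "\<dots> = \<Phi> (avg 1 f P) (avg 2 g P) (\<Sum>i\<in>cells P. walsh_sg (sc P) (4 * fr P + 3) i *\<^sub>R h i)"
      by (rule linear_sum[OF lin, symmetric])
    also have "(\<Sum>i\<in>cells P. walsh_sg (sc P) (4 * fr P + 3) i *\<^sub>R h i) = 2 ^ sc P *\<^sub>R avg 3 h P" by (simp add: avg_def)
    also have "\<Phi> (avg 1 f P) (avg 2 g P) (2 ^ sc P *\<^sub>R avg 3 h P) = 2 ^ sc P *\<^sub>R \<Phi> (avg 1 f P) (avg 2 g P) (avg 3 h P)"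
      by (rule \<Phi>_scaleR)
    finally show "(\<Sum>i<2 ^ L. packet 3 P i *\<^sub>R \<Phi> (avg 1 f P) (avg 2 g P) (h i)) = 2 ^ sc P *\<^sub>R \<Phi> (avg 1 f P) (avg 2 g P) (avg 3 h P)" .
  qed
  finally show ?thesis .
qed

text \<open>The test function is the value's norm to the power \<open>r - 1\<close> in a norming
  direction. Its norm in the conjugate exponent is at most \<open>S powr ((r - 1) / r)\<close>, and
  division leaves \<open>S powr (1 / r)\<close>. The factor 2 is that of
  \<open>norming\<close>.\<close>

lemma discrete_operator_bound_dual:
  assumes D: "0 \<le> D" "\<And>h. cmod (quartile_form \<Phi> f g h (qbox L)) \<le> D * discrete_norm L (r / (r - 1)) h" and r: "1 < r"
  shows "discrete_norm L r (discrete_operator L f g) \<le> 2 * D"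
proof -
  let ?\<beta> = "discrete_operator L f g"
  have "\<forall>i. \<exists>z t. norm z \<le> 1 \<and> blinfun_apply (?\<beta> i) z = complex_of_real t \<and> norm (?\<beta> i) / 2 \<le> t"
    by (metis norming[OF discrete_operator_complex_dual])
  then obtain z t where zt: "\<And>i. norm (z i) \<le> 1" "\<And>i. blinfun_apply (?\<beta> i) (z i) = complex_of_real (t i)" "\<And>i. norm (?\<beta> i) / 2 \<le> t i"
    by metis
  define h where "h i = (norm (?\<beta> i) powr (r - 1)) *\<^sub>R z i" for i
  define S where "S = (\<Sum>i<2 ^ L. norm (?\<beta> i) powr r)"
  have S0: "0 \<le> S" by (simp add: S_def sum_nonneg)
  have pw: "norm (?\<beta> i) powr (r - 1) * norm (?\<beta> i) = norm (?\<beta> i) powr r" for i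
    using powr_add[of "norm (?\<beta> i)" "r - 1" 1] by simp
  have "S / 2 \<le> (\<Sum>i<2 ^ L. norm (?\<beta> i) powr (r - 1) * t i)"
    unfolding S_def sum_divide_distrib pw[symmetric]
    using mult_left_mono[OF zt(3)] by (intro sum_mono) (simp add: times_divide_eq_right)
  also have "\<dots> = Re (\<Sum>i<2 ^ L. blinfun_apply (?\<beta> i) (h i))"
    by (simp add: h_def blinfun.scaleR_right zt(2))
  also have "\<dots> \<le> cmod (quartile_form \<Phi> f g h (qbox L))" unfolding sum_discrete_operator by (rule complex_Re_le_cmod)
  also have "\<dots> \<le> D * discrete_norm L (r / (r - 1)) h" by (rule D(2))
  also have "discrete_norm L (r / (r - 1)) h \<le> S powr ((r - 1) / r)"
  proof -
    have "norm (h i) powr (r / (r - 1)) \<le> norm (?\<beta> i) powr r" for i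
    proof -
      have "norm (h i) \<le> norm (?\<beta> i) powr (r - 1)"
        using zt(1)[of i] by (simp add: h_def mult_left_le)
      then have "norm (h i) powr (r / (r - 1)) \<le> (norm (?\<beta> i) powr (r - 1)) powr (r / (r - 1))"
        using r by (intro powr_mono2) auto
      then show ?thesis using r by (simp add: powr_powr)
    qed
    then have "(\<Sum>i<2 ^ L. norm (h i) powr (r / (r - 1))) \<le> S" unfolding S_def by (rule sum_mono)
    then have "(\<Sum>i<2 ^ L. norm (h i) powr (r / (r - 1))) powr ((r - 1) / r) \<le> S powr ((r - 1) / r)"
      using r by (intro powr_mono2) (auto intro: sum_nonneg)
    then show ?thesis by (simp add: discrete_norm_def)
  qed
  finally have le: "S / 2 \<le> D * S powr ((r - 1) / r)" using D(1) by (simp add: mult_left_mono)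
  show ?thesis
  proof (cases "S = 0")
    case True
    then show ?thesis using D(1) by (simp add: discrete_norm_def S_def)
  next
    case False
    then have Sp: "0 < S" using S0 by simp
    have "S powr (1 / r) * S powr ((r - 1) / r) = S"
      using Sp r by (simp add: diff_divide_distrib flip: powr_add)
    then have "S powr (1 / r) * S powr ((r - 1) / r) \<le> 2 * D * S powr ((r - 1) / r)" using le by simp
    then have "S powr (1 / r) \<le> 2 * D" using Sp by simp
    then show ?thesis by (simp add: discrete_norm_def S_def)
  qed
qed

lemma discrete_operator_bound:
  assumes C: "discrete_quartile_type q1 C1 TYPE('a)" "discrete_quartile_type q2 C2 TYPE('b)" "discrete_quartile_type q3 C3 TYPE('c)"
    and q: "0 \<le> q1" "0 \<le> q2" "0 \<le> q3"
    and p: "q1 < p1" "q2 < p2" "1 < r" "q3 < r / (r - 1)" "1 / r = 1 / p1 + 1 / p2"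
  obtains D where "0 \<le> D" "\<And>L f g. discrete_norm L r (discrete_operator L f g) \<le> D * discrete_norm L p1 f * discrete_norm L p2 g"
proof (cases "(\<exists>x::'a. x \<noteq> 0) \<and> (\<exists>x::'b. x \<noteq> 0) \<and> (\<exists>x::'c. x \<noteq> 0)")
  case True
  then have q2: "2 \<le> q1" "2 \<le> q2" "2 \<le> q3" using discrete_quartile_type_two_le[OF C(1)] discrete_quartile_type_two_le[OF C(2)] discrete_quartile_type_two_le[OF C(3)] q by blast+
  interpret discrete_setup \<Phi> K q1 q2 q3 by unfold_locales (use tri q2 in auto)
  have "1 / p1 + 1 / p2 + 1 / (r / (r - 1)) = 1" using p(3) by (simp add: diff_divide_distrib flip: p(5))
  from discrete_bound[OF C p(1,2,4) this] obtain D where D: "0 \<le> D"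
    "\<And>L f g h. cmod (quartile_form \<Phi> f g h (qbox L)) \<le> D * discrete_norm L p1 f * discrete_norm L p2 g * discrete_norm L (r / (r - 1)) h" by blast
  have "discrete_norm L r (discrete_operator L f g) \<le> 2 * (D * discrete_norm L p1 f * discrete_norm L p2 g)" for L f g
    by (rule discrete_operator_bound_dual[OF _ D(2) p(3)]) (use D(1) in \<open>simp add: discrete_norm_def\<close>)
  then show thesis using that[of "2 * D"] D(1) by (simp add: mult.assoc)
next
  case False
  have "\<Phi> x y z = 0" for x y z
  proof -
    have "x = 0 \<or> y = 0 \<or> z = 0" using False by blast
    then show ?thesis using \<Phi>_zero by blast
  qed
  then have "form_blinfun x y = 0" for x y by (intro blinfun_eqI) simp
  then have "discrete_operator L f g i = 0" for L f g i by (simp add: discrete_operator_def)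
  then have "discrete_norm L r (discrete_operator L f g) = 0" for L f g by (simp add: discrete_norm_def)
  then show thesis using that[of 0] by simp
qed

end

section \<open>Step functions on a common grid\<close>

definition rep :: "nat \<Rightarrow> (nat \<Rightarrow> 'a::zero) \<Rightarrow> (real \<Rightarrow> 'a) \<Rightarrow> bool" where
  "rep N g f \<longleftrightarrow> (\<exists>B. \<forall>i\<ge>B. g i = 0) \<and> (\<forall>x\<ge>0. f x = g (atom_index N x))"

lemma atom_index_grid: "atom_index N (real i / 2 ^ N) = i"
  by (simp add: atom_index_def)

text \<open>All sufficiently fine grids are provided, so that two or three functions can share one.
  The exponent in the definition of a step function may be negative, hence
  \<open>nat\<close>.\<close>

lemma finite_dyadic_step_rep:
  assumes "finite_dyadic_step f"
  obtains N0 where "\<And>N. N0 \<le> N \<Longrightarrow> \<exists>g. rep N g f"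
proof -
  obtain R N' where R: "\<forall>x>R. f x = 0" and N': "\<And>j x y. x \<in> dyadic_interval (- N') j \<Longrightarrow> y \<in> dyadic_interval (- N') j \<Longrightarrow> f x = f y"
    using assms unfolding finite_dyadic_step_def by blast
  show thesis
  proof (rule that[of "nat N'"])
    fix N assume N: "nat N' \<le> N"
    define k where "k = nat (int N - N')"
    have k: "- N' = int k - int N" using N by (simp add: k_def)
    define g where "g i = f (real i / 2 ^ N)" for i
    have "f x = g (atom_index N x)" if x: "0 \<le> x" for x
      unfolding g_def
    proof (rule N')
      show "x \<in> dyadic_interval (- N') (atom_index N x div 2 ^ k)"
        unfolding k dyadic_interval_iff[OF x] by (simp add: dyadic_block_def)
      show "real (atom_index N x) / 2 ^ N \<in> dyadic_interval (- N') (atom_index N x div 2 ^ k)"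
        unfolding k by (subst dyadic_interval_iff) (simp_all add: dyadic_block_def atom_index_grid)
    qed
    moreover have "g i = 0" if i: "nat \<lceil>2 ^ N * (\<bar>R\<bar> + 1)\<rceil> \<le> i" for i
    proof -
      have "2 ^ N * (\<bar>R\<bar> + 1) \<le> real i" using i by linarith
      then have "\<bar>R\<bar> + 1 \<le> real i / 2 ^ N" by (simp add: field_simps)
      then show ?thesis using R by (simp add: g_def)
    qed
    ultimately show "\<exists>g. rep N g f" unfolding rep_def by blast
  qed
qed

lemma finite_dyadic_step_atom_index:
  assumes "\<And>i. B \<le> i \<Longrightarrow> g i = 0"
  shows "finite_dyadic_step (\<lambda>x. g (atom_index N x))"
  unfolding finite_dyadic_step_def
proof (intro conjI exI[of _ "real B"] exI[of _ "int N"] allI impI ballI)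
  fix x :: real assume x: "real B < x"
  have "x \<le> 2 ^ N * x" using x by (simp add: mult_le_cancel_right1) 
  then have "B \<le> atom_index N x" using x unfolding atom_index_def by linarith
  then show "g (atom_index N x) = 0" by (rule assms)
next
  fix j x y assume x: "x \<in> dyadic_interval (- int N) j" and y: "y \<in> dyadic_interval (- int N) j"
  have "atom_index N x = j" if "x \<in> dyadic_interval (- int N) j" for x
  proof -
    have "0 \<le> x" using that unfolding dyadic_interval_def
      by (metis atLeastLessThan_iff mult_nonneg_nonneg of_nat_0_le_iff order_trans zero_le_numeral zero_le_power_int)
    then show ?thesis using dyadic_interval_iff[of x 0 N j] that by (simp add: dyadic_block_def)
  qed
  then show "g (atom_index N x) = g (atom_index N y)" using x y by simp
qed

lemma norm_avg_le:
  fixes g :: "nat \<Rightarrow> 'a::real_normed_vector"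
  assumes "\<And>i. B \<le> i \<Longrightarrow> g i = 0"
  shows "norm (avg u g P) \<le> (\<Sum>i<B. norm (g i)) / 2 ^ sc P"
proof -
  have "norm (\<Sum>i\<in>cells P. walsh_sg (sc P) (4 * fr P + u) i *\<^sub>R g i) \<le> (\<Sum>i\<in>cells P. norm (g i))"
    by (rule sum_norm_le) simp
  also have "\<dots> = (\<Sum>i\<in>cells P \<inter> {..<B}. norm (g i))"
  proof (rule sum.mono_neutral_right)
    show "\<forall>i\<in>cells P - cells P \<inter> {..<B}. norm (g i) = 0" using assms by (auto simp: not_less)
  qed auto
  also have "\<dots> \<le> (\<Sum>i<B. norm (g i))" by (intro sum_mono2) auto
  finally show ?thesis by (simp add: avg_def divide_right_mono)
qed

lemma rep_Lp:
  fixes g :: "nat \<Rightarrow> 'a::real_normed_vector"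
  assumes "rep N g f"
  shows "f \<in> Lp_space Rplus p"
proof -
  obtain B where B: "\<And>i. B \<le> i \<Longrightarrow> g i = 0" and f: "\<And>x. 0 \<le> x \<Longrightarrow> f x = g (atom_index N x)"
    using assms by (auto simp: rep_def)
  have "strongly_measurable Rplus f \<longleftrightarrow> strongly_measurable Rplus (\<lambda>x. g (atom_index N x))"
    by (rule strongly_measurable_cong) (simp add: f)
  moreover have "pint Rplus p f = pint Rplus p (\<lambda>x. g (atom_index N x))" by (rule pint_cong) (simp add: f)
  ultimately show ?thesis using step_Lp[of B g N p] B by (simp add: Lp_space_iff)
qed

lemma finite_dyadic_step_Lp:
  fixes f :: "real \<Rightarrow> 'a::real_normed_vector"
  assumes "finite_dyadic_step f" shows "f \<in> Lp_space Rplus p"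
  using finite_dyadic_step_rep[OF assms] rep_Lp by (metis order_refl)

text \<open>Passing from cells of length \<open>2 powr (- N)\<close> to unit cells multiplies the
  p-th power by \<open>2 ^ N\<close>. Only an inequality holds, because cells beyond
  \<open>2 ^ L\<close> are dropped.\<close>

lemma discrete_norm_rep:
  fixes g :: "nat \<Rightarrow> 'a::real_normed_vector"
  assumes "rep N g f" and p: "0 < p"
  shows "discrete_norm L p g \<le> 2 powr (N / p) * Lp_norm Rplus p f"
proof -
  obtain B where B: "\<And>i. B \<le> i \<Longrightarrow> g i = 0" and f: "\<And>x. 0 \<le> x \<Longrightarrow> f x = g (atom_index N x)"
    using assms by (auto simp: rep_def)
  let ?B = "max B (2 ^ L)"
  have "pint Rplus p f = ennreal ((1 / 2 ^ N) * (\<Sum>i<?B. norm (g i) powr p))"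
    by (rule pint_step) (use B f AE_space[of Rplus] in auto)
  then have e: "enn2real (pint Rplus p f) = (1 / 2 ^ N) * (\<Sum>i<?B. norm (g i) powr p)" by (simp add: sum_nonneg)
  have "(\<Sum>x<2 ^ L. norm (g x) powr p) \<le> (\<Sum>i<?B. norm (g i) powr p)" by (intro sum_mono2) auto
  also have "\<dots> = 2 ^ N * enn2real (pint Rplus p f)" by (simp add: e)
  finally have "discrete_norm L p g \<le> (2 ^ N * enn2real (pint Rplus p f)) powr (1 / p)"
    unfolding discrete_norm_def using p by (intro powr_mono2) (auto simp: sum_nonneg)
  also have "\<dots> = 2 powr (N / p) * Lp_norm Rplus p f"
    by (simp add: powr_mult Lp_norm_eq powr_realpow[symmetric] powr_powr)
  finally show ?thesis .
qed

text \<open>It turns the unconditional sum over all visible quartiles into a limit along the boxes,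
  where the uniform bounds are available.\<close>

lemma qbox_filterlim: "filterlim qbox (finite_subsets_at_top {D. valid D}) sequentially"
  unfolding filterlim_finite_subsets_at_top
proof (intro allI impI)
  fix X assume X: "finite X \<and> X \<subseteq> {D. valid D}"
  have "eventually (\<lambda>L. D \<in> qbox L) sequentially" if "D \<in> X" for D
  proof (rule eventually_sequentiallyI[of "sc D + ps D"])
    fix L assume L: "sc D + ps D \<le> L"
    have "ps D < 2 ^ ps D" by (rule less_exp)
    also have "(2::nat) ^ ps D \<le> 2 ^ (L - sc D)" using L by (intro power_increasing) auto
    finally show "D \<in> qbox L" using L X that by (auto simp: qbox_def valid_def)
  qed
  then have "eventually (\<lambda>L. \<forall>D\<in>X. D \<in> qbox L) sequentially"
    using X by (intro eventually_ball_finite) auto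
  then show "eventually (\<lambda>L. finite (qbox L) \<and> X \<subseteq> qbox L \<and> qbox L \<subseteq> {D. valid D}) sequentially"
    by eventually_elim (auto simp: valid_qbox)
qed

lemma geo_sum_le: "(\<Sum>k\<in>{2..M}. (1 / 2 :: real) ^ k) \<le> 2"
proof -
  have "(\<Sum>k\<in>{2..M}. (1 / 2 :: real) ^ k) \<le> (\<Sum>k<Suc M. (1 / 2) ^ k)" by (intro sum_mono2) auto
  also have "\<dots> \<le> (\<Sum>k. (1 / 2) ^ k)" by (intro sum_le_suminf summable_geometric) auto
  also have "\<dots> = 2" by (subst suminf_geometric) auto
  finally show ?thesis .
qed

text \<open>Over a given cell, scale \<open>k\<close> has one position and
  \<open>2 ^ (k - 2)\<close> frequencies, so it contributes at most
  \<open>2 ^ (k - 2) / 4 ^ k\<close>, a geometric term.\<close>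

lemma sum_valid_le:
  fixes i :: nat
  assumes "finite F" "F \<subseteq> {D. valid D}"
  shows "(\<Sum>D\<in>F. indicator (cells D) i / 4 ^ sc D) \<le> (1 :: real)"
proof -
  define M where "M = Max (insert 2 (sc ` F))"
  have M: "sc D \<le> M" if "D \<in> F" for D unfolding M_def using assms(1) that by (intro Max_ge) auto
  let ?S = "SIGMA k:{2..M}. {..<(2::nat) ^ (k - 2)}"
  let ?t = "\<lambda>(k, n). DQ k (i div 2 ^ k) n"
  have sub: "{D \<in> F. i \<in> cells D} \<subseteq> ?t ` ?S"
  proof
    fix D assume D: "D \<in> {D \<in> F. i \<in> cells D}"
    then have "D = ?t (sc D, fr D)" by (cases D) (auto simp: cells_def dyadic_block_def)
    moreover have "(sc D, fr D) \<in> ?S" using D assms(2) M by (auto simp: valid_def)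
    ultimately show "D \<in> ?t ` ?S" by (rule image_eqI)
  qed
  have inj: "inj_on ?t ?S" by (auto simp: inj_on_def)
  have "(\<Sum>D\<in>F. indicator (cells D) i / 4 ^ sc D) = (\<Sum>D\<in>{D \<in> F. i \<in> cells D}. 1 / 4 ^ sc D :: real)"
    using assms(1) by (intro sum.mono_neutral_cong_right) auto
  also have "\<dots> \<le> (\<Sum>D\<in>?t ` ?S. 1 / 4 ^ sc D)" using sub by (intro sum_mono2) auto
  also have "\<dots> = (\<Sum>x\<in>?S. 1 / 4 ^ fst x)" by (subst sum.reindex[OF inj]) (auto intro!: sum.cong)
  also have "\<dots> = (\<Sum>k\<in>{2..M}. \<Sum>n<(2::nat) ^ (k - 2). 1 / 4 ^ k)" by (subst sum.Sigma) (auto simp: split_def)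
  also have "\<dots> = (\<Sum>k\<in>{2..M}. (1 / 4) * (1 / 2) ^ k)"
  proof (rule sum.cong[OF refl])
    fix k assume "k \<in> {2..M}"
    then obtain j where k: "k = j + 2" by (metis add.commute atLeastAtMost_iff le_Suc_ex)
    have "(4::real) ^ j = 2 ^ j * 2 ^ j" by (simp flip: power_mult_distrib)
    then show "(\<Sum>n<(2::nat) ^ (k - 2). 1 / 4 ^ k) = (1 / 4 :: real) * (1 / 2) ^ k"
      by (simp add: k power_add power_divide)
  qed
  also have "\<dots> = (1 / 4) * (\<Sum>k\<in>{2..M}. (1 / 2) ^ k)" by (rule sum_distrib_left[symmetric])
  also have "\<dots> \<le> 1" using geo_sum_le[of M] by simp
  finally show ?thesis .
qed

lemma rep_add: "rep N g f \<Longrightarrow> rep N g' f' \<Longrightarrow> rep N (\<lambda>i. g i + g' i) (\<lambda>x. f x + (f' x :: 'x::real_normed_vector))"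
proof -
  assume a: "rep N g f" "rep N g' f'"
  then obtain B B' where "\<forall>i\<ge>B. g i = 0" "\<forall>i\<ge>B'. g' i = 0" by (auto simp: rep_def)
  then have "\<forall>i\<ge>max B B'. g i + g' i = 0" by simp
  then show ?thesis using a unfolding rep_def by (intro conjI exI[of _ "max B B'"]) auto
qed

lemma scaleC_zero: "scaleC c (0 :: 'x::complex_banach) = 0"
  using scaleC_add_right[of c "0 :: 'x" 0] by simp

lemma rep_scaleC: "rep N g f \<Longrightarrow> rep N (\<lambda>i. scaleC c (g i)) (\<lambda>x. scaleC c (f x :: 'x::complex_banach))"
proof -
  assume a: "rep N g f"
  then obtain B where "\<forall>i\<ge>B. g i = 0" by (auto simp: rep_def)
  then have "\<forall>i\<ge>B. scaleC c (g i) = 0" by (simp add: scaleC_zero)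
  then show ?thesis using a unfolding rep_def by (intro conjI exI[of _ B]) auto
qed

lemma reps2:
  assumes "finite_dyadic_step f" "finite_dyadic_step g"
  obtains N a b where "rep N a f" "rep N b g"
proof -
  obtain N1 where N1: "\<And>N. N1 \<le> N \<Longrightarrow> \<exists>g. rep N g f" by (rule finite_dyadic_step_rep[OF assms(1)]) blast
  obtain N2 where N2: "\<And>N. N2 \<le> N \<Longrightarrow> \<exists>g'. rep N g' g" by (rule finite_dyadic_step_rep[OF assms(2)]) blast
  show thesis using that N1[of "max N1 N2"] N2[of "max N1 N2"] by auto
qed

lemma reps3:
  assumes "finite_dyadic_step f" "finite_dyadic_step g" "finite_dyadic_step h"
  obtains N a b c where "rep N a f" "rep N b g" "rep N c h"
proof -
  obtain N1 where N1: "\<And>N. N1 \<le> N \<Longrightarrow> \<exists>g. rep N g f" by (rule finite_dyadic_step_rep[OF assms(1)]) blast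
  obtain N2 where N2: "\<And>N. N2 \<le> N \<Longrightarrow> \<exists>g'. rep N g' g" by (rule finite_dyadic_step_rep[OF assms(2)]) blast
  obtain N3 where N3: "\<And>N. N3 \<le> N \<Longrightarrow> \<exists>g'. rep N g' h" by (rule finite_dyadic_step_rep[OF assms(3)]) blast
  let ?N = "N1 + N2 + N3"
  obtain a where "rep ?N a f" using N1[of ?N] by auto
  moreover obtain b where "rep ?N b g" using N2[of ?N] by auto
  moreover obtain c where "rep ?N c h" using N3[of ?N] by auto
  ultimately show thesis by (rule that)
qed

lemma complex_dual_limit:
  fixes u :: "nat \<Rightarrow> ('x::complex_banach \<Rightarrow>\<^sub>L complex)"
  assumes "\<And>n. u n \<in> complex_dual" "u \<longlonglongrightarrow> \<phi>"
  shows "\<phi> \<in> complex_dual"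
proof -
  have ap: "(\<lambda>n. blinfun_apply (u n) y) \<longlonglongrightarrow> blinfun_apply \<phi> y" for y
    by (rule blinfun.tendsto[OF assms(2) tendsto_const])
  have "blinfun_apply \<phi> (scaleC a y) = a * blinfun_apply \<phi> y" for a y
  proof (rule LIMSEQ_unique[OF ap])
    have e: "blinfun_apply (u n) (scaleC a y) = a * blinfun_apply (u n) y" for n
      using assms(1)[of n] by (simp add: complex_dual_def complex_linear_def)
    show "(\<lambda>n. blinfun_apply (u n) (scaleC a y)) \<longlonglongrightarrow> a * blinfun_apply \<phi> y"
      unfolding e by (rule tendsto_mult[OF tendsto_const ap])
  qed
  then show ?thesis by (simp add: complex_dual_def complex_linear_def blinfun.add_right)
qed

lemma complex_dual_zero: "(0 :: 'x::complex_banach \<Rightarrow>\<^sub>L complex) \<in> complex_dual"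
  by (simp add: complex_dual_def complex_linear_def)

lemma generic_sets: "{x \<in> space Rplus. generic x \<and> 0 \<le> x} \<in> sets Rplus"
proof -
  have "{x. \<not> generic x} \<in> sets (borel :: real measure)"
    by (rule sets.countable[OF _ countable_not_generic]) simp
  then have "{0..} - {x. \<not> generic x} \<in> sets (borel :: real measure)" by (intro sets.Diff) auto
  moreover have "{0..} - {x. \<not> generic x} = {x. generic x \<and> 0 \<le> x}" by auto
  ultimately have "{x. generic x \<and> 0 \<le> x} \<in> sets lebesgue" by simp
  moreover have "{x \<in> space Rplus. generic x \<and> 0 \<le> x} = {x. generic x \<and> 0 \<le> x}" by auto
  ultimately show ?thesis by (simp only:) (subst sets_restrict_space_iff, auto)
qed

context tri_form
begin

text \<open>Quartiles outside the grid's resolution contribute zero. For the others each coefficient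
  is at most the l1 norm over the interval length, so the product decays like
  \<open>4 powr (- sc D)\<close> and \<open>sum_valid_le\<close> gives absolute summability.\<close>

lemma discrete_operator_tendsto:
  assumes r1: "rep N g1 f1" and r2: "rep N g2 f2" and x: "generic x" "0 \<le> x"
  shows "(\<lambda>L. discrete_operator L g1 g2 (atom_index N x)) \<longlonglongrightarrow> quartile_operator \<Phi> f1 f2 x"
proof -
  obtain B1 where B1: "\<And>i. B1 \<le> i \<Longrightarrow> g1 i = 0" and f1: "\<And>x. 0 \<le> x \<Longrightarrow> f1 x = g1 (atom_index N x)"
    using r1 by (auto simp: rep_def)
  obtain B2 where B2: "\<And>i. B2 \<le> i \<Longrightarrow> g2 i = 0" and f2: "\<And>x. 0 \<le> x \<Longrightarrow> f2 x = g2 (atom_index N x)"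
    using r2 by (auto simp: rep_def)
  define t where "t P = ((2 powi scale P) powr (- 1 / 2) * tile_packet P 3 x) *\<^sub>R
        form_blinfun (wpairing f1 (tile_packet P 1)) (wpairing f2 (tile_packet P 2))" for P
  have Q: "quartile_operator \<Phi> f1 f2 x = infsum t UNIV"
    unfolding quartile_operator_def t_def form_blinfun_def ..
  let ?V = "{D. valid D}"
  have valid: "t (quartile_of N D) = packet 3 D (atom_index N x) *\<^sub>R form_blinfun (avg 1 g1 D) (avg 2 g2 D)" if D: "valid D" for D
  proof -
    let ?c = "amplitude N D * (2 ^ sc D / 2 ^ N)"
    have w1: "wpairing f1 (tile_packet (quartile_of N D) 1) = ?c *\<^sub>R avg 1 g1 D"
      by (rule wpairing_quartile_of) (use f1 D in auto)
    have w2: "wpairing f2 (tile_packet (quartile_of N D) 2) = ?c *\<^sub>R avg 2 g2 D"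
      by (rule wpairing_quartile_of) (use f2 D in auto)
    have s: "(2 powi scale (quartile_of N D)) powr (- 1 / 2) = amplitude N D" by (simp add: amplitude_def quartile_of_def)
    have tp: "tile_packet (quartile_of N D) 3 x = amplitude N D * packet 3 D (atom_index N x)"
      by (rule tile_packet_generic[OF x D]) simp
    \<comment> \<open>Four amplitudes occur, one from the operator and one from each of the three
      packets; they cancel against the two interval lengths.\<close>
    have "t (quartile_of N D) = ((amplitude N D * ?c) * (amplitude N D * ?c) * packet 3 D (atom_index N x)) *\<^sub>R form_blinfun (avg 1 g1 D) (avg 2 g2 D)"
      unfolding t_def w1 w2 s tp by (simp add: form_blinfun_scaleR mult_ac)
    then show ?thesis by (simp only: amplitude_sq mult_1_left)
  qed
  have invalid: "t P = 0" if P: "P \<notin> quartile_of N ` ?V" for P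
  proof -
    obtain s j n where Pe: "P = Quartile s j n" by (cases P)
    define k where "k = nat (s + int N)"
    \<comment> \<open>The second slot is tested since its frequency is at least 2, which also covers
      intervals of one or two cells. In slot 1 the frequency 1 on two cells would still be
      visible.\<close>
    have "s + int N < 0 \<or> 2 ^ k \<le> 4 * n + 2"
    proof (rule ccontr)
      assume neg: "\<not> ?thesis"
      have "2 \<le> k"
      proof (rule ccontr)
        assume "\<not> 2 \<le> k"
        then have "(2::nat) ^ k \<le> 2 ^ 1" by (intro power_increasing) auto
        then show False using neg by simp
      qed
      then obtain l where l: "k = l + 2" by (metis add.commute le_Suc_ex)
      have "n < 2 ^ l" using neg by (simp add: l)
      then have "valid (DQ k j n)" by (simp add: valid_def l)
      moreover have "P = quartile_of N (DQ k j n)" using neg by (simp add: Pe quartile_of_def k_def)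
      ultimately show False using P by blast
    qed
    then have "wpairing f2 (wave_packet s j (4 * n + 2)) = 0"
      by (intro wpairing_vanish[where g = g2 and N = N] f2) (auto simp: k_def)
    then show ?thesis by (simp add: t_def Pe tile_packet_def form_blinfun_zero)
  qed
  let ?C = "K * (\<Sum>i<B1. norm (g1 i)) * (\<Sum>i<B2. norm (g2 i))"
  have C0: "0 \<le> ?C" using K0 by (intro mult_nonneg_nonneg sum_nonneg) auto
  have nb: "norm ((t \<circ> quartile_of N) D) \<le> ?C * (indicator (cells D) (atom_index N x) / 4 ^ sc D)" if D: "valid D" for D
  proof -
    have "norm (form_blinfun (avg 1 g1 D) (avg 2 g2 D)) \<le> K * norm (avg 1 g1 D) * norm (avg 2 g2 D)" by (rule norm_form_blinfun)
    also have "\<dots> \<le> K * ((\<Sum>i<B1. norm (g1 i)) / 2 ^ sc D) * ((\<Sum>i<B2. norm (g2 i)) / 2 ^ sc D)"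
      using K0 by (intro mult_mono norm_avg_le B1 B2) (auto intro!: mult_nonneg_nonneg divide_nonneg_nonneg sum_nonneg)
    also have "\<dots> = ?C / 4 ^ sc D"
    proof -
      have "(4::real) ^ sc D = 2 ^ sc D * 2 ^ sc D" by (simp flip: power_mult_distrib)
      then show ?thesis by simp
    qed
    finally have "indicator (cells D) (atom_index N x) * norm (form_blinfun (avg 1 g1 D) (avg 2 g2 D)) \<le> indicator (cells D) (atom_index N x) * (?C / 4 ^ sc D)"
      by (intro mult_left_mono) auto
    then show ?thesis using valid[OF D] by (simp add: abs_packet mult_ac)
  qed
  have "(t \<circ> quartile_of N) abs_summable_on ?V"
  proof (rule nonneg_bdd_above_summable_on)
    show "bdd_above (sum (\<lambda>D. norm ((t \<circ> quartile_of N) D)) ` {F. F \<subseteq> ?V \<and> finite F})"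
    proof (rule bdd_aboveI[of _ ?C])
      fix s assume "s \<in> sum (\<lambda>D. norm ((t \<circ> quartile_of N) D)) ` {F. F \<subseteq> ?V \<and> finite F}"
      then obtain F where F: "F \<subseteq> ?V" "finite F" "s = (\<Sum>D\<in>F. norm ((t \<circ> quartile_of N) D))" by blast
      have "s \<le> (\<Sum>D\<in>F. ?C * (indicator (cells D) (atom_index N x) / 4 ^ sc D))"
        unfolding F(3) using F(1) nb by (intro sum_mono) auto
      also have "\<dots> = ?C * (\<Sum>D\<in>F. indicator (cells D) (atom_index N x) / 4 ^ sc D)" by (rule sum_distrib_left[symmetric])
      also have "\<dots> \<le> ?C * 1" by (rule mult_left_mono[OF sum_valid_le[OF F(2,1)] C0])
      finally show "s \<le> ?C" by simp
    qed
  qed simp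
  then have "(t \<circ> quartile_of N) summable_on ?V" by (rule abs_summable_summable)
  then have "(sum (t \<circ> quartile_of N) \<longlongrightarrow> infsum (t \<circ> quartile_of N) ?V) (finite_subsets_at_top ?V)"
    using has_sum_infsum unfolding has_sum_def by blast
  from filterlim_compose[OF this qbox_filterlim]
  have lim: "(\<lambda>L. sum (t \<circ> quartile_of N) (qbox L)) \<longlonglongrightarrow> infsum (t \<circ> quartile_of N) ?V" .
  have e1: "sum (t \<circ> quartile_of N) (qbox L) = discrete_operator L g1 g2 (atom_index N x)" for L
    unfolding discrete_operator_def by (intro sum.cong refl) (simp add: valid valid_qbox)
  have "infsum (t \<circ> quartile_of N) ?V = infsum t (quartile_of N ` ?V)"
    by (rule infsum_reindex[OF inj_on_subset[OF inj_quartile_of subset_UNIV], symmetric])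
  also have "\<dots> = infsum t UNIV" by (rule infsum_cong_neutral) (use invalid in auto)
  finally have e2: "infsum (t \<circ> quartile_of N) ?V = infsum t UNIV" .
  show ?thesis using lim unfolding e1 e2 Q .
qed

text \<open>At dyadic and negative points the value is put to 0. Then grid operators, which are
  simple functions, converge at every point, and algebraic identities hold everywhere and not just
  almost everywhere.\<close>

definition step_operator :: "(real \<Rightarrow> 'a) \<Rightarrow> (real \<Rightarrow> 'b) \<Rightarrow> real \<Rightarrow> ('c \<Rightarrow>\<^sub>L complex)" where
  "step_operator f1 f2 x = (if generic x \<and> 0 \<le> x then quartile_operator \<Phi> f1 f2 x else 0)"

lemma step_operator_AE: "AE x in Rplus. step_operator f1 f2 x = quartile_operator \<Phi> f1 f2 x"
  using AE_generic AE_space by eventually_elim (simp add: step_operator_def)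

definition grid_operator :: "nat \<Rightarrow> (nat \<Rightarrow> 'a) \<Rightarrow> (nat \<Rightarrow> 'b) \<Rightarrow> real \<Rightarrow> nat \<Rightarrow> ('c \<Rightarrow>\<^sub>L complex)" where
  "grid_operator N a b x L = (if generic x \<and> 0 \<le> x then discrete_operator L a b (atom_index N x) else 0)"

lemma step_operator_tendsto:
  assumes "rep N g1 f1" "rep N g2 f2"
  shows "grid_operator N g1 g2 x \<longlonglongrightarrow> step_operator f1 f2 x"
proof -
  have "grid_operator N g1 g2 x = (\<lambda>L. if generic x \<and> 0 \<le> x then discrete_operator L g1 g2 (atom_index N x) else 0)"
    by (simp add: grid_operator_def fun_eq_iff)
  then show ?thesis using discrete_operator_tendsto[OF assms, of x] by (auto simp: step_operator_def)
qed

text \<open>The identity is exact for each box on a common grid and passes to the limit, so infinite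
  sums need not be rearranged.\<close>

lemma step_operator_add1:
  assumes "finite_dyadic_step f" "finite_dyadic_step f'" "finite_dyadic_step g"
  shows "step_operator (\<lambda>x. f x + f' x) g x = step_operator f g x + step_operator f' g x"
proof -
  obtain N a a' b where r: "rep N a f" "rep N a' f'" "rep N b g" using reps3[OF assms] .
  have "(\<lambda>L. grid_operator N a b x L + grid_operator N a' b x L) \<longlonglongrightarrow> step_operator f g x + step_operator f' g x"
    by (rule tendsto_add[OF step_operator_tendsto[OF r(1,3)] step_operator_tendsto[OF r(2,3)]])
  moreover have "(\<lambda>L. grid_operator N a b x L + grid_operator N a' b x L) = grid_operator N (\<lambda>i. a i + a' i) b x"
    by (auto simp: grid_operator_def discrete_operator_add)
  ultimately show ?thesis using LIMSEQ_unique[OF step_operator_tendsto[OF rep_add[OF r(1,2)] r(3), of x]] by simp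
qed

lemma step_operator_add2:
  assumes "finite_dyadic_step f" "finite_dyadic_step g" "finite_dyadic_step g'"
  shows "step_operator f (\<lambda>x. g x + g' x) x = step_operator f g x + step_operator f g' x"
proof -
  obtain N a b b' where r: "rep N a f" "rep N b g" "rep N b' g'" using reps3[OF assms] .
  have "(\<lambda>L. grid_operator N a b x L + grid_operator N a b' x L) \<longlonglongrightarrow> step_operator f g x + step_operator f g' x"
    by (rule tendsto_add[OF step_operator_tendsto[OF r(1,2)] step_operator_tendsto[OF r(1,3)]])
  moreover have "(\<lambda>L. grid_operator N a b x L + grid_operator N a b' x L) = grid_operator N a (\<lambda>i. b i + b' i) x"
    by (auto simp: grid_operator_def discrete_operator_add)
  ultimately show ?thesis using LIMSEQ_unique[OF step_operator_tendsto[OF r(1) rep_add[OF r(2,3)], of x]] by simp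
qed

lemma step_operator_scaleC:
  assumes "finite_dyadic_step f" "finite_dyadic_step g"
  shows "blinfun_apply (step_operator (\<lambda>x. scaleC c (f x)) g x) y = c * blinfun_apply (step_operator f g x) y"
    and "blinfun_apply (step_operator f (\<lambda>x. scaleC c (g x)) x) y = c * blinfun_apply (step_operator f g x) y"
proof -
  obtain N a b where r: "rep N a f" "rep N b g" using reps2[OF assms] .
  have l: "(\<lambda>L. c * blinfun_apply (grid_operator N a b x L) y) \<longlonglongrightarrow> c * blinfun_apply (step_operator f g x) y"
    by (rule tendsto_mult[OF tendsto_const blinfun.tendsto[OF step_operator_tendsto[OF r] tendsto_const]])
  have l1: "(\<lambda>L. blinfun_apply (grid_operator N (\<lambda>i. scaleC c (a i)) b x L) y) \<longlonglongrightarrow> blinfun_apply (step_operator (\<lambda>x. scaleC c (f x)) g x) y"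
    by (rule blinfun.tendsto[OF step_operator_tendsto[OF rep_scaleC[OF r(1)] r(2)] tendsto_const])
  have l2: "(\<lambda>L. blinfun_apply (grid_operator N a (\<lambda>i. scaleC c (b i)) x L) y) \<longlonglongrightarrow> blinfun_apply (step_operator f (\<lambda>x. scaleC c (g x)) x) y"
    by (rule blinfun.tendsto[OF step_operator_tendsto[OF r(1) rep_scaleC[OF r(2)]] tendsto_const])
  have e1: "blinfun_apply (grid_operator N (\<lambda>i. scaleC c (a i)) b x L) y = c * blinfun_apply (grid_operator N a b x L) y" for L
    by (simp add: grid_operator_def discrete_operator_scaleC)
  have e2: "blinfun_apply (grid_operator N a (\<lambda>i. scaleC c (b i)) x L) y = c * blinfun_apply (grid_operator N a b x L) y" for L
    by (simp add: grid_operator_def discrete_operator_scaleC)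
  show "blinfun_apply (step_operator (\<lambda>x. scaleC c (f x)) g x) y = c * blinfun_apply (step_operator f g x) y"
    by (rule LIMSEQ_unique[OF l1[unfolded e1] l])
  show "blinfun_apply (step_operator f (\<lambda>x. scaleC c (g x)) x) y = c * blinfun_apply (step_operator f g x) y"
    by (rule LIMSEQ_unique[OF l2[unfolded e2] l])
qed

lemma step_operator_dual:
  assumes "finite_dyadic_step f" "finite_dyadic_step g"
  shows "step_operator f g x \<in> complex_dual"
proof -
  obtain N a b where r: "rep N a f" "rep N b g" using reps2[OF assms] .
  show ?thesis
    by (rule complex_dual_limit[OF _ step_operator_tendsto[OF r, of x]]) (simp add: grid_operator_def discrete_operator_complex_dual complex_dual_zero)
qed

text \<open>The discrete bound is uniform in the box, and Fatou's lemma carries it to the limit. The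
  factors \<open>2 powr (N / p1)\<close> and \<open>2 powr (N / p2)\<close> multiply to
  \<open>2 powr (N / r)\<close>, which the cell length in the r-th power cancels.\<close>

lemma step_operator_bound:
  assumes f: "finite_dyadic_step f" and g: "finite_dyadic_step g"
    and D: "0 \<le> D" "\<And>L f g. discrete_norm L r (discrete_operator L f g) \<le> D * discrete_norm L p1 f * discrete_norm L p2 g"
    and p: "0 < p1" "0 < p2" "0 < r" "1 / r = 1 / p1 + 1 / p2"
  shows "strongly_measurable Rplus (step_operator f g)"
    and "pint Rplus r (step_operator f g) \<le> ennreal ((D * Lp_norm Rplus p1 f * Lp_norm Rplus p2 g) powr r)"
proof -
  obtain N a b where rr: "rep N a f" "rep N b g" using reps2[OF f g] .
  have simp_o: "simple_function Rplus (\<lambda>x. grid_operator N a b x L)" for L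
    unfolding grid_operator_def
    by (rule simple_function_If[OF step_simple[of "2 ^ L"] simple_function_const generic_sets]) (rule discrete_operator_zero)
  show sm: "strongly_measurable Rplus (step_operator f g)"
    unfolding strongly_measurable_def
    by (rule exI[of _ "\<lambda>L x. grid_operator N a b x L"]) (use simp_o step_operator_tendsto[OF rr] in blast)
  let ?X = "ennreal ((D * Lp_norm Rplus p1 f * Lp_norm Rplus p2 g) powr r)"
  have bd: "pint Rplus r (\<lambda>x. grid_operator N a b x L) \<le> ?X" for L
  proof -
    have nn: "0 \<le> Lp_norm Rplus p1 f" "0 \<le> Lp_norm Rplus p2 g" "0 \<le> discrete_norm L p1 a" "0 \<le> discrete_norm L p2 b" "0 \<le> discrete_norm L r (discrete_operator L a b)"
      by (auto simp: Lp_norm_eq discrete_norm_def)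
    have "AE x in Rplus. grid_operator N a b x L = discrete_operator L a b (atom_index N x)"
      using AE_generic AE_space by eventually_elim (simp add: grid_operator_def)
    then have "pint Rplus r (\<lambda>x. grid_operator N a b x L) = ennreal ((1 / 2 ^ N) * (\<Sum>i<2 ^ L. norm (discrete_operator L a b i) powr r))"
      by (rule pint_step[rotated]) (rule discrete_operator_zero)
    also have "(\<Sum>i<2 ^ L. norm (discrete_operator L a b i) powr r) = discrete_norm L r (discrete_operator L a b) powr r"
      using p(3) by (simp add: discrete_norm_def powr_powr sum_nonneg)
    also have "ennreal ((1 / 2 ^ N) * discrete_norm L r (discrete_operator L a b) powr r) \<le> ennreal ((1 / 2 ^ N) * (2 powr (N / r) * (D * Lp_norm Rplus p1 f * Lp_norm Rplus p2 g)) powr r)"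
    proof (intro ennreal_leI mult_left_mono powr_mono2)
      have "discrete_norm L r (discrete_operator L a b) \<le> D * discrete_norm L p1 a * discrete_norm L p2 b" by (rule D(2))
      also have "\<dots> \<le> D * (2 powr (N / p1) * Lp_norm Rplus p1 f) * (2 powr (N / p2) * Lp_norm Rplus p2 g)"
        using D(1) nn p by (intro mult_mono discrete_norm_rep[OF rr(1)] discrete_norm_rep[OF rr(2)] mult_nonneg_nonneg) auto
      also have "\<dots> = (2 powr (N / p1) * 2 powr (N / p2)) * (D * Lp_norm Rplus p1 f * Lp_norm Rplus p2 g)" by (simp add: mult_ac)
      also have "2 powr (N / p1) * 2 powr (N / p2) = 2 powr (N / r)"
      proof -
        have "N / p1 + N / p2 = N * (1 / r)" unfolding p(4) by (simp add: distrib_left)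
        then show ?thesis by (simp flip: powr_add)
      qed
      finally show "discrete_norm L r (discrete_operator L a b) \<le> 2 powr (N / r) * (D * Lp_norm Rplus p1 f * Lp_norm Rplus p2 g)" .
    qed (use nn p in auto)
    also have "(1 / 2 ^ N) * (2 powr (N / r) * (D * Lp_norm Rplus p1 f * Lp_norm Rplus p2 g)) powr r = (D * Lp_norm Rplus p1 f * Lp_norm Rplus p2 g) powr r"
      using nn D(1) p(3) by (simp add: powr_mult powr_powr powr_realpow)
    finally show ?thesis .
  qed
  have lim: "(\<lambda>L. ennreal (norm (grid_operator N a b x L) powr r)) \<longlonglongrightarrow> ennreal (norm (step_operator f g x) powr r)" for x
  proof -
    have "(\<lambda>L. norm (grid_operator N a b x L)) \<longlonglongrightarrow> norm (step_operator f g x)" by (rule tendsto_norm[OF step_operator_tendsto[OF rr]])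
    then have "(\<lambda>L. norm (grid_operator N a b x L) powr r) \<longlonglongrightarrow> norm (step_operator f g x) powr r"
      using p(3) by (intro tendsto_powr' tendsto_const) auto
    then show ?thesis by (rule tendsto_ennrealI)
  qed
  have "pint Rplus r (step_operator f g) = (\<integral>\<^sup>+x. liminf (\<lambda>L. ennreal (norm (grid_operator N a b x L) powr r)) \<partial>Rplus)"
    unfolding pint_def by (intro nn_integral_cong lim_imp_Liminf[symmetric] lim) simp
  also have "\<dots> \<le> liminf (\<lambda>L. \<integral>\<^sup>+x. ennreal (norm (grid_operator N a b x L) powr r) \<partial>Rplus)"
    by (rule nn_integral_liminf) (rule pint_measurable[OF strongly_measurable_simple[OF simp_o]])
  also have "\<dots> \<le> liminf (\<lambda>L::nat. ?X)"
    by (rule Liminf_mono) (use bd in \<open>simp add: pint_def\<close>)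
  also have "\<dots> = ?X" by (rule Liminf_const) simp
  finally show "pint Rplus r (step_operator f g) \<le> ?X" .
qed

end

section \<open>Density and completeness\<close>

text \<open>Strong measurability gives pointwise approximation without control of size. Values above
  twice the norm of \<open>f\<close> are replaced by 0, after which \<open>3 * norm (f x)\<close>
  dominates the error.\<close>

lemma simple_approx:
  fixes f :: "'s \<Rightarrow> 'a::real_normed_vector"
  assumes f: "f \<in> Lp_space M p" and p: "0 < p" and e: "0 < (e::real)"
  obtains t where "simple_function M t" "pint M p (\<lambda>x. f x - t x) \<le> ennreal e"
proof -
  have sm: "strongly_measurable M f" and fin: "pint M p f < \<infinity>" using f by (auto simp: Lp_space_iff)
  obtain s where s: "\<And>i::nat. simple_function M (s i)" and lim: "\<And>x. x \<in> space M \<Longrightarrow> (\<lambda>i. s i x) \<longlonglongrightarrow> f x"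
    using sm unfolding strongly_measurable_def by blast
  define t where "t i x = (if norm (s i x) \<le> 2 * norm (f x) then s i x else 0)" for i x
  have st: "simple_function M (t i)" for i
    unfolding t_def
  proof (rule simple_function_If[OF s simple_function_const])
    have "(\<lambda>x. norm (s i x)) \<in> borel_measurable M" by (rule strongly_measurable_norm[OF strongly_measurable_simple[OF s]])
    moreover have "(\<lambda>x. 2 * norm (f x)) \<in> borel_measurable M"
      using strongly_measurable_norm[OF sm] by (intro borel_measurable_times borel_measurable_const)
    ultimately show "{x \<in> space M. norm (s i x) \<le> 2 * norm (f x)} \<in> sets M" by (rule borel_measurable_le)
  qed
  have limt: "(\<lambda>i. t i x) \<longlonglongrightarrow> f x" if x: "x \<in> space M" for x
  proof (cases "f x = 0")
    case True
    then have "t i x = 0" for i by (auto simp: t_def)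
    then show ?thesis using True by simp
  next
    case False
    have "(\<lambda>i. norm (s i x)) \<longlonglongrightarrow> norm (f x)" by (rule tendsto_norm[OF lim[OF x]])
    then have "eventually (\<lambda>i. norm (s i x) < 2 * norm (f x)) sequentially"
      using False by (intro order_tendstoD(2)) auto
    then have "eventually (\<lambda>i. s i x = t i x) sequentially"
      by eventually_elim (simp add: t_def)
    then show ?thesis by (rule Lim_transform_eventually[OF lim[OF x]])
  qed
  have "(\<lambda>i. \<integral>\<^sup>+x. ennreal (norm (f x - t i x) powr p) \<partial>M) \<longlonglongrightarrow> (\<integral>\<^sup>+x. 0 \<partial>M)"
  proof (rule nn_integral_dominated_convergence)
    show "(\<lambda>x. ennreal (norm (f x - t i x) powr p)) \<in> borel_measurable M" for i
      by (rule pint_measurable[OF strongly_measurable_diff[OF sm strongly_measurable_simple[OF st]]])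
    have meas: "(\<lambda>x. ennreal (norm (f x) powr p)) \<in> borel_measurable M" by (rule pint_measurable[OF sm])
    then show "(\<lambda>x. ennreal (3 powr p) * ennreal (norm (f x) powr p)) \<in> borel_measurable M" by measurable
    show "AE x in M. ennreal (norm (f x - t j x) powr p) \<le> ennreal (3 powr p) * ennreal (norm (f x) powr p)" for j
    proof (rule AE_I2)
      fix x
      have "norm (t j x) \<le> 2 * norm (f x)" by (simp add: t_def)
      then have "norm (f x - t j x) \<le> 3 * norm (f x)" using norm_triangle_ineq4[of "f x" "t j x"] by linarith
      then have "norm (f x - t j x) powr p \<le> (3 * norm (f x)) powr p" using p by (intro powr_mono2) auto
      then show "ennreal (norm (f x - t j x) powr p) \<le> ennreal (3 powr p) * ennreal (norm (f x) powr p)"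
        by (simp add: powr_mult ennreal_leI flip: ennreal_mult)
    qed
    show "(\<integral>\<^sup>+x. ennreal (3 powr p) * ennreal (norm (f x) powr p) \<partial>M) < \<infinity>"
      using fin by (simp add: nn_integral_cmult[OF meas] pint_def ennreal_mult_less_top)
    show "AE x in M. (\<lambda>i. ennreal (norm (f x - t i x) powr p)) \<longlonglongrightarrow> 0"
    proof (rule AE_I2)
      fix x assume x: "x \<in> space M"
      have "(\<lambda>i. f x - t i x) \<longlonglongrightarrow> f x - f x" by (rule tendsto_diff[OF tendsto_const limt[OF x]])
      then have "(\<lambda>i. norm (f x - t i x)) \<longlonglongrightarrow> 0" by (simp add: tendsto_norm_zero)
      then have "(\<lambda>i. norm (f x - t i x) powr p) \<longlonglongrightarrow> 0"
        by (rule tendsto_zero_powrI[OF _ tendsto_const]) (use p in auto)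
      then have "(\<lambda>i. ennreal (norm (f x - t i x) powr p)) \<longlonglongrightarrow> ennreal 0" by (rule tendsto_ennrealI)
      then show "(\<lambda>i. ennreal (norm (f x - t i x) powr p)) \<longlonglongrightarrow> 0" by simp
    qed
  qed simp
  then have "(\<lambda>i. pint M p (\<lambda>x. f x - t i x)) \<longlonglongrightarrow> 0" by (simp add: pint_def)
  then have "eventually (\<lambda>i. pint M p (\<lambda>x. f x - t i x) < ennreal e) sequentially"
    using e by (intro order_tendstoD(2)) auto
  then obtain i where "pint M p (\<lambda>x. f x - t i x) < ennreal e" by (auto simp: eventually_sequentially)
  then show thesis using that[OF st] less_imp_le by blast
qed

definition approx :: "real \<Rightarrow> (real \<Rightarrow> 'a::real_normed_vector) \<Rightarrow> bool" where
  "approx p f \<longleftrightarrow> strongly_measurable Rplus f \<and>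
     (\<forall>e>0. \<exists>h. finite_dyadic_step h \<and> pint Rplus p (\<lambda>x. f x - h x) \<le> ennreal e)"

lemma finite_dyadic_step_diff:
  fixes f g :: "real \<Rightarrow> 'a::real_normed_vector"
  assumes f: "finite_dyadic_step f" and g: "finite_dyadic_step g"
  shows "finite_dyadic_step (\<lambda>x. f x - g x)" "finite_dyadic_step (\<lambda>x. f x + g x)"
proof -
  obtain R N where R: "\<And>x. x > R \<Longrightarrow> f x = 0" and N: "\<And>j x y. x \<in> dyadic_interval (- N) j \<Longrightarrow> y \<in> dyadic_interval (- N) j \<Longrightarrow> f x = f y"
    using f unfolding finite_dyadic_step_def by blast
  obtain R' N' where R': "\<And>x. x > R' \<Longrightarrow> g x = 0" and N': "\<And>j x y. x \<in> dyadic_interval (- N') j \<Longrightarrow> y \<in> dyadic_interval (- N') j \<Longrightarrow> g x = g y"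
    using g unfolding finite_dyadic_step_def by blast
  obtain M a b where ab: "rep M a f" "rep M b g" using reps2[OF f g] .
  have sub: "atom_index M x = j" "0 \<le> x" if "x \<in> dyadic_interval (- int M) j" for x j
  proof -
    show "0 \<le> x" using that unfolding dyadic_interval_def
      by (metis atLeastLessThan_iff mult_nonneg_nonneg of_nat_0_le_iff order_trans zero_le_numeral zero_le_power_int)
    then show "atom_index M x = j" using dyadic_interval_iff[of x 0 M j] that by (simp add: dyadic_block_def)
  qed
  have c: "f x = a j" "g x = b j" if "x \<in> dyadic_interval (- int M) j" for x j
    using ab sub[OF that] by (auto simp: rep_def)
  show "finite_dyadic_step (\<lambda>x. f x - g x)"
    unfolding finite_dyadic_step_def
    by (intro conjI exI[of _ "max R R'"] exI[of _ "int M"] allI ballI impI) (auto simp: R R' c)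
  show "finite_dyadic_step (\<lambda>x. f x + g x)"
    unfolding finite_dyadic_step_def
    by (intro conjI exI[of _ "max R R'"] exI[of _ "int M"] allI ballI impI) (auto simp: R R' c)
qed

lemma pint_add_real:
  assumes "strongly_measurable M f" "strongly_measurable M g" "0 \<le> p" "0 \<le> a" "0 \<le> b"
    and "pint M p f \<le> ennreal a" "pint M p g \<le> ennreal b"
  shows "pint M p (\<lambda>x. f x + g x) \<le> ennreal (2 powr p * (a + b))"
proof -
  have "pint M p (\<lambda>x. f x + g x) \<le> ennreal (2 powr p) * (pint M p f + pint M p g)"
    by (rule pint_add_le[OF assms(1-3)])
  also have "\<dots> \<le> ennreal (2 powr p) * (ennreal a + ennreal b)"
    by (intro mult_left_mono add_mono assms) simp
  also have "\<dots> = ennreal (2 powr p * (a + b))" using assms(4,5) by (simp add: ennreal_mult)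
  finally show ?thesis .
qed

lemma fds_sm: "finite_dyadic_step f \<Longrightarrow> strongly_measurable Rplus (f :: real \<Rightarrow> 'a::real_normed_vector)"
  using finite_dyadic_step_Lp[of f 1] by (simp add: Lp_space_iff)

lemma approx_via:
  assumes sm: "strongly_measurable Rplus f" and p: "0 < p"
    and t: "\<And>e. 0 < e \<Longrightarrow> \<exists>t. approx p t \<and> pint Rplus p (\<lambda>x. f x - t x) \<le> ennreal e"
  shows "approx p f"
  unfolding approx_def
proof (intro conjI allI impI sm)
  fix e :: real assume e: "0 < e"
  define d where "d = e / (2 powr p * 2)"
  have d: "0 < d" using e by (simp add: d_def)
  obtain t where t: "approx p t" "pint Rplus p (\<lambda>x. f x - t x) \<le> ennreal d" using t[OF d] by blast
  then obtain h where h: "finite_dyadic_step h" "pint Rplus p (\<lambda>x. t x - h x) \<le> ennreal d"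
    using d by (auto simp: approx_def)
  have tm: "strongly_measurable Rplus t" using t by (simp add: approx_def)
  have "pint Rplus p (\<lambda>x. (f x - t x) + (t x - h x)) \<le> ennreal (2 powr p * (d + d))"
    using d p by (intro pint_add_real strongly_measurable_diff sm tm fds_sm h t) auto
  also have "2 powr p * (d + d) = e" by (simp add: d_def)
  finally show "\<exists>h. finite_dyadic_step h \<and> pint Rplus p (\<lambda>x. f x - h x) \<le> ennreal e" using h(1) by auto
qed

lemma approx_add:
  assumes f: "approx p f" and g: "approx p g" and p: "0 < p"
  shows "approx p (\<lambda>x. f x + g x)"
  unfolding approx_def
proof (intro conjI allI impI)
  have sm: "strongly_measurable Rplus f" "strongly_measurable Rplus g" using f g by (auto simp: approx_def)
  then show "strongly_measurable Rplus (\<lambda>x. f x + g x)" by (rule strongly_measurable_add)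
  fix e :: real assume e: "0 < e"
  define d where "d = e / (2 powr p * 2)"
  have d: "0 < d" using e by (simp add: d_def)
  obtain h where h: "finite_dyadic_step h" "pint Rplus p (\<lambda>x. f x - h x) \<le> ennreal d" using f d by (auto simp: approx_def)
  obtain k where k: "finite_dyadic_step k" "pint Rplus p (\<lambda>x. g x - k x) \<le> ennreal d" using g d by (auto simp: approx_def)
  have "pint Rplus p (\<lambda>x. (f x - h x) + (g x - k x)) \<le> ennreal (2 powr p * (d + d))"
    using d p by (intro pint_add_real strongly_measurable_diff sm fds_sm h k) auto
  also have "2 powr p * (d + d) = e" by (simp add: d_def)
  also have "(\<lambda>x. (f x - h x) + (g x - k x)) = (\<lambda>x. f x + g x - (h x + k x))" by (simp add: fun_eq_iff)
  finally show "\<exists>h. finite_dyadic_step h \<and> pint Rplus p (\<lambda>x. f x + g x - h x) \<le> ennreal e"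
    using finite_dyadic_step_diff(2)[OF h(1) k(1)] by (intro exI[of _ "\<lambda>x. h x + k x"]) auto
qed

lemma finite_dyadic_step_zero: "finite_dyadic_step (\<lambda>x. 0 :: 'a::real_normed_vector)"
  by (simp add: finite_dyadic_step_def)

lemma approx_zero: "approx p (\<lambda>x. 0 :: 'a::real_normed_vector)"
  unfolding approx_def
  by (intro conjI allI impI exI[of _ "\<lambda>x. 0"] finite_dyadic_step_zero strongly_measurable_simple simple_function_const)
    (simp add: pint_def)

lemma approx_sum:
  fixes f :: "'i \<Rightarrow> real \<Rightarrow> 'a::real_normed_vector"
  assumes "finite I" "\<And>i. i \<in> I \<Longrightarrow> approx p (f i)" "0 < p"
  shows "approx p (\<lambda>x. \<Sum>i\<in>I. f i x)"
  using assms(1,2) by (induction I rule: finite_induct) (simp_all add: approx_zero approx_add assms(3))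

lemma approx_cong:
  assumes "\<And>x. 0 \<le> x \<Longrightarrow> f x = g x" "approx p g"
  shows "approx p f"
proof -
  have "strongly_measurable Rplus f \<longleftrightarrow> strongly_measurable Rplus g"
    by (rule strongly_measurable_cong) (simp add: assms(1))
  moreover have "pint Rplus p (\<lambda>x. f x - h x) = pint Rplus p (\<lambda>x. g x - h x)" for h
    by (rule pint_cong) (simp add: assms(1))
  ultimately show ?thesis using assms(2) by (simp add: approx_def)
qed

text \<open>By outer regularity \<open>A\<close> lies in an open set \<open>T\<close> of slightly
  larger measure. The atoms inside \<open>T\<close> fill it as the grid is refined, and dominated
  convergence leaves only the error on \<open>T - A\<close>.\<close>

lemma approx_indicator:
  fixes y :: "'a::real_normed_vector"
  assumes A: "A \<in> sets Rplus" "emeasure Rplus A < \<infinity>" and p: "0 < p"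
  shows "approx p (\<lambda>x. indicator A x *\<^sub>R y)"
proof (cases "y = 0")
  case True
  then show ?thesis using approx_zero by simp
next
  case False
  have A': "A \<in> sets lebesgue" "A \<subseteq> {0..}" using A(1) by (auto simp: sets_restrict_space_iff)
  have "emeasure lebesgue A = emeasure Rplus A" using A'(2) by (intro emeasure_restrict_space[symmetric]) auto
  then have Al: "A \<in> lmeasurable" using A A' by (intro fmeasurableI) auto
  have sA: "simple_function Rplus (\<lambda>x. indicator A x *\<^sub>R y)"
    using simple_function_indicator[OF A(1)] by (rule simple_function_compose1)
  show ?thesis unfolding approx_def
  proof (intro conjI allI impI)
    show "strongly_measurable Rplus (\<lambda>x. indicator A x *\<^sub>R y)" by (rule strongly_measurable_simple[OF sA])
    fix e :: real assume e: "0 < e"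
    have ny: "0 < norm y powr p" using False by simp
    define d where "d = e / norm y powr p"
    have d: "0 < d" using e ny by (simp add: d_def)
    obtain T where T: "open T" "A \<subseteq> T" "T - A \<in> lmeasurable" "emeasure lebesgue (T - A) < ennreal d"
      by (rule sets_lebesgue_outer_open[OF A'(1) d]) blast
    have Tl: "T \<in> sets lebesgue" using T(1) by simp
    have Tm: "emeasure lebesgue T < \<infinity>"
    proof -
      have "T = A \<union> (T - A)" using T(2) by auto
      then have "T \<in> lmeasurable" using Al T(3) by (metis fmeasurable.Un)
      then show ?thesis unfolding fmeasurable_def by blast
    qed
    \<comment> \<open>There are \<open>4 ^ N\<close> atoms in \<open>[0, 2 ^ N)\<close>, so support
      and resolution grow together and each step function has bounded support.\<close>
    define g where "g N i = (if i < 4 ^ N \<and> atom N i \<subseteq> T then y else 0)" for N i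
    define h where "h N x = g N (atom_index N x)" for N x
    have hs: "finite_dyadic_step (h N)" for N unfolding h_def by (rule finite_dyadic_step_atom_index[of "4 ^ N"]) (simp add: g_def)
    have hT: "h N x = y \<Longrightarrow> x \<in> T" "h N x = 0 \<or> h N x = y" if "0 \<le> x" for N x
      using that False atom_iff[of x N "atom_index N x"] by (auto simp: h_def g_def split: if_splits)
    have ev: "eventually (\<lambda>N. h N x = indicator T x *\<^sub>R y) sequentially" if x: "0 \<le> x" for x
    proof (cases "x \<in> T")
      case False
      then have "h N x = 0" for N using hT[OF x, of N] by auto
      then show ?thesis using False by simp
    next
      case True
      then obtain r where r: "0 < r" "ball x r \<subseteq> T" using T(1) openE by blast
      have "eventually (\<lambda>N. (1 / 2) ^ N < r) sequentially"
        by (rule order_tendstoD(2)[OF LIMSEQ_realpow_zero r(1)]) auto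
      moreover obtain N0 :: nat where N0: "x < 2 ^ N0" using real_arch_pow[of 2 x] by auto
      then have "eventually (\<lambda>N. x < 2 ^ N) sequentially"
        by (intro eventually_sequentiallyI[of N0]) (rule order_less_le_trans, assumption, rule power_increasing, auto)
      ultimately show ?thesis
      proof eventually_elim
        case (elim N)
        have "2 ^ N * x < 2 ^ N * 2 ^ N" using elim(2) by simp
        also have "(2::real) ^ N * 2 ^ N = 4 ^ N" by (simp flip: power_mult_distrib)
        finally have "\<lfloor>2 ^ N * x\<rfloor> < 4 ^ N" by (simp add: floor_less_iff)
        then have i: "atom_index N x < 4 ^ N" using x by (simp add: atom_index_def nat_less_iff)
        have "atom N (atom_index N x) \<subseteq> ball x r"
        proof
          fix z assume z: "z \<in> atom N (atom_index N x)"
          have x': "x \<in> atom N (atom_index N x)" using x by (simp add: atom_iff)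
          have "\<bar>x - z\<bar> < 1 / 2 ^ N" using z x' unfolding atom_def by (auto simp: add_divide_distrib abs_less_iff)
          then show "z \<in> ball x r" using elim(1) by (simp add: dist_real_def power_one_over)
        qed
        then show ?case using i r(2) True by (auto simp: h_def g_def)
      qed
    qed
    have "(\<lambda>N. \<integral>\<^sup>+x. ennreal (norm (indicator A x *\<^sub>R y - h N x) powr p) \<partial>Rplus) \<longlonglongrightarrow>
      (\<integral>\<^sup>+x. ennreal (norm y powr p) * indicator (T - A) x \<partial>Rplus)"
    proof (rule nn_integral_dominated_convergence)
      show "(\<lambda>x. ennreal (norm (indicator A x *\<^sub>R y - h N x) powr p)) \<in> borel_measurable Rplus" for N
        by (rule pint_measurable[OF strongly_measurable_diff[OF strongly_measurable_simple[OF sA] fds_sm[OF hs]]])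
      have ind: "(\<lambda>x. ennreal (norm y powr p) * indicator S x) \<in> borel_measurable Rplus" if S: "S \<in> sets lebesgue" for S
        by (rule measurable_restrict_space1,
            rule borel_measurable_times_ennreal[OF borel_measurable_const borel_measurable_indicator[OF S]])
      show "(\<lambda>x. ennreal (norm y powr p) * indicator (T - A) x) \<in> borel_measurable Rplus" using Tl A' by (intro ind) auto
      show "(\<lambda>x. ennreal (norm y powr p) * indicator T x) \<in> borel_measurable Rplus" using Tl by (intro ind) auto
      show "AE x in Rplus. ennreal (norm (indicator A x *\<^sub>R y - h N x) powr p) \<le> ennreal (norm y powr p) * indicator T x" for N
      proof (rule AE_I2)
        fix x assume "x \<in> space Rplus"
        then have x: "0 \<le> x" by simp
        show "ennreal (norm (indicator A x *\<^sub>R y - h N x) powr p) \<le> ennreal (norm y powr p) * indicator T x"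
          using hT[OF x, of N] T(2) p by (cases "x \<in> A"; cases "h N x = y") (auto simp: indicator_def)
      qed
      have "(\<integral>\<^sup>+x. ennreal (norm y powr p) * indicator T x \<partial>Rplus) \<le> (\<integral>\<^sup>+x. ennreal (norm y powr p) * indicator T x \<partial>lebesgue)"
        by (subst nn_integral_restrict_space) (auto intro!: nn_integral_mono simp: indicator_def)
      also have "\<dots> < \<infinity>" using Tl Tm by (simp add: nn_integral_cmult_indicator ennreal_mult_less_top)
      finally show "(\<integral>\<^sup>+x. ennreal (norm y powr p) * indicator T x \<partial>Rplus) < \<infinity>" .
      show "AE x in Rplus. (\<lambda>N. ennreal (norm (indicator A x *\<^sub>R y - h N x) powr p)) \<longlonglongrightarrow> ennreal (norm y powr p) * indicator (T - A) x"
      proof (rule AE_I2)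
        fix x assume "x \<in> space Rplus"
        then have x: "0 \<le> x" by simp
        show "(\<lambda>N. ennreal (norm (indicator A x *\<^sub>R y - h N x) powr p)) \<longlonglongrightarrow> ennreal (norm y powr p) * indicator (T - A) x"
        proof (rule tendsto_eventually)
          show "eventually (\<lambda>N. ennreal (norm (indicator A x *\<^sub>R y - h N x) powr p) = ennreal (norm y powr p) * indicator (T - A) x) sequentially"
            using ev[OF x] by eventually_elim (use T(2) p in \<open>auto simp: indicator_def\<close>)
        qed
      qed
    qed
    moreover have "(\<integral>\<^sup>+x. ennreal (norm y powr p) * indicator (T - A) x \<partial>Rplus) < ennreal e"
    proof -
      have "(\<integral>\<^sup>+x. ennreal (norm y powr p) * indicator (T - A) x \<partial>Rplus) \<le> (\<integral>\<^sup>+x. ennreal (norm y powr p) * indicator (T - A) x \<partial>lebesgue)"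
        by (subst nn_integral_restrict_space) (auto intro!: nn_integral_mono simp: indicator_def)
      also have "\<dots> = ennreal (norm y powr p) * emeasure lebesgue (T - A)"
        using Tl A' by (intro nn_integral_cmult_indicator) auto
      also have "\<dots> < ennreal (norm y powr p) * ennreal d"
        using T(4) ny by (intro ennreal_mult_strict_left_mono) auto
      also have "\<dots> = ennreal e" using ny d e by (simp add: d_def flip: ennreal_mult)
      finally show ?thesis .
    qed
    ultimately have "eventually (\<lambda>N. (\<integral>\<^sup>+x. ennreal (norm (indicator A x *\<^sub>R y - h N x) powr p) \<partial>Rplus) < ennreal e) sequentially"
      by (rule order_tendstoD(2))
    then obtain N where "pint Rplus p (\<lambda>x. indicator A x *\<^sub>R y - h N x) < ennreal e"
      by (auto simp: eventually_sequentially pint_def)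
    then show "\<exists>h. finite_dyadic_step h \<and> pint Rplus p (\<lambda>x. indicator A x *\<^sub>R y - h x) \<le> ennreal e"
      using hs less_imp_le by blast
  qed
qed

text \<open>A finite p-th moment forces each level set of a nonzero value to have finite measure;
  the value 0 must be left out of the sum.\<close>

lemma approx_simple:
  fixes t :: "real \<Rightarrow> 'a::real_normed_vector"
  assumes t: "simple_function Rplus t" and fin: "pint Rplus p t < \<infinity>" and p: "0 < p"
  shows "approx p t"
proof -
  let ?A = "\<lambda>y. t -` {y} \<inter> space Rplus"
  have fr: "finite (t ` space Rplus)" and As: "?A y \<in> sets Rplus" if "y \<in> t ` space Rplus" for y
    using t that by (auto simp: simple_function_def)
  have fr: "finite (t ` space Rplus)" using t by (simp add: simple_function_def)
  have "approx p (\<lambda>x. \<Sum>y\<in>t ` space Rplus - {0}. indicator (?A y) x *\<^sub>R y)"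
  proof (rule approx_sum[OF _ _ p])
    fix y assume y: "y \<in> t ` space Rplus - {0}"
    have "ennreal (norm y powr p) * emeasure Rplus (?A y) = (\<integral>\<^sup>+x. ennreal (norm y powr p) * indicator (?A y) x \<partial>Rplus)"
      using y As by (intro nn_integral_cmult_indicator[symmetric]) auto
    also have "\<dots> \<le> pint Rplus p t" unfolding pint_def by (intro nn_integral_mono) (auto simp: indicator_def)
    also note fin
    finally have "emeasure Rplus (?A y) < \<infinity>" using y by (auto simp: ennreal_mult_less_top)
    then show "approx p (\<lambda>x. indicator (?A y) x *\<^sub>R y)" using y As p by (intro approx_indicator) auto
  qed (use fr in auto)
  moreover have "t x = (\<Sum>y\<in>t ` space Rplus - {0}. indicator (?A y) x *\<^sub>R y)" if x: "0 \<le> x" for x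
  proof -
    have "(\<Sum>y\<in>t ` space Rplus - {0}. indicator (?A y) x *\<^sub>R y) = (\<Sum>y\<in>t ` space Rplus - {0}. if y = t x then y else 0)"
      using x by (intro sum.cong refl) (auto simp: indicator_def)
    also have "\<dots> = t x" using fr x by (simp add: sum.delta)
    finally show ?thesis by simp
  qed
  ultimately show ?thesis by (rule approx_cong[rotated])
qed

lemma step_dense:
  fixes f :: "real \<Rightarrow> 'a::real_normed_vector"
  assumes f: "f \<in> Lp_space Rplus p" and p: "0 < p" and e: "0 < (e::real)"
  obtains h where "finite_dyadic_step h" "pint Rplus p (\<lambda>x. f x - h x) \<le> ennreal e"
proof -
  have sm: "strongly_measurable Rplus f" and fin: "pint Rplus p f < \<infinity>" using f by (auto simp: Lp_space_iff)
  have "approx p f"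
  proof (rule approx_via[OF sm p])
    fix e :: real assume "0 < e"
    then obtain t where t: "simple_function Rplus t" "pint Rplus p (\<lambda>x. f x - t x) \<le> ennreal e"
      using simple_approx[OF f p] by blast
    have "pint Rplus p (\<lambda>x. f x - (f x - t x)) \<le> ennreal (2 powr p) * (pint Rplus p f + pint Rplus p (\<lambda>x. f x - t x))"
      using p by (intro pint_diff_le strongly_measurable_diff sm strongly_measurable_simple t) auto
    also have "\<dots> < \<infinity>" using fin t(2) by (auto simp: ennreal_mult_less_top intro: le_less_trans)
    finally have "pint Rplus p t < \<infinity>" by simp
    then show "\<exists>t. approx p t \<and> pint Rplus p (\<lambda>x. f x - t x) \<le> ennreal e"
      using approx_simple[OF t(1) _ p] t(2) by blast
  qed
  then show thesis using e that by (auto simp: approx_def)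
qed

text \<open>The gap between the norm bound \<open>(1 / 4) ^ n\<close> and the claimed
  \<open>(1 / 2) ^ n\<close> makes the series of \<open>(2 ^ n * norm (v n x)) powr p\<close>
  integrable, so its terms tend to zero almost everywhere.\<close>

lemma Borel_Cantelli_Lp:
  fixes v :: "nat \<Rightarrow> 's \<Rightarrow> 'a::real_normed_vector"
  assumes sm: "\<And>n. strongly_measurable M (v n)" and p: "0 < p"
    and v: "\<And>n. pint M p (v n) \<le> ennreal (((1 / 4) ^ n) powr p)"
  shows "AE x in M. eventually (\<lambda>n. norm (v n x) \<le> (1 / 2) ^ n) sequentially"
proof -
  define W where "W n x = (2 ^ n * norm (v n x)) powr p" for n x
  have Wm: "(\<lambda>x. ennreal (W n x)) \<in> borel_measurable M" for n
    unfolding W_def using strongly_measurable_norm[OF sm[of n]] by measurable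
  have Wint: "(\<integral>\<^sup>+x. ennreal (W n x) \<partial>M) \<le> ennreal ((1 / 2 powr p) ^ n)" for n
  proof -
    have "ennreal (W n x) = ennreal ((2 ^ n) powr p) * ennreal (norm (v n x) powr p)" for x
      by (simp add: W_def powr_mult ennreal_mult)
    then have "(\<integral>\<^sup>+x. ennreal (W n x) \<partial>M) = ennreal ((2 ^ n) powr p) * pint M p (v n)"
      using pint_measurable[OF sm[of n]] by (simp add: nn_integral_cmult pint_def)
    also have "\<dots> \<le> ennreal ((2 ^ n) powr p) * ennreal (((1 / 4) ^ n) powr p)" by (intro mult_left_mono v) simp
    also have "\<dots> = ennreal ((2 ^ n * (1 / 4) ^ n) powr p)" by (simp add: powr_mult flip: ennreal_mult)
    also have "(2::real) ^ n * (1 / 4) ^ n = (1 / 2) ^ n" by (simp flip: power_mult_distrib)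
    also have "((1 / 2 :: real) ^ n) powr p = (1 / 2 powr p) ^ n"
      by (simp add: power_one_over powr_divide powr_realpow[symmetric] powr_powr mult.commute)
    finally show ?thesis .
  qed
  have small: "1 / 2 powr p < 1" using p by simp
  have "(\<integral>\<^sup>+x. (\<Sum>n. ennreal (W n x)) \<partial>M) = (\<Sum>n. \<integral>\<^sup>+x. ennreal (W n x) \<partial>M)" by (rule nn_integral_suminf[OF Wm])
  also have "\<dots> \<le> (\<Sum>n. ennreal ((1 / 2 powr p) ^ n))" by (intro suminf_le Wint) auto
  also have "\<dots> = ennreal (\<Sum>n. (1 / 2 powr p) ^ n)" using small by (intro suminf_ennreal2 summable_geometric) auto
  also have "\<dots> < \<infinity>" by simp
  finally have "AE x in M. (\<Sum>n. ennreal (W n x)) \<noteq> \<infinity>"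
    using Wm by (intro nn_integral_noteq_infinite borel_measurable_suminf) auto
  then show ?thesis
  proof eventually_elim
    case (elim x)
    have "summable (\<lambda>n. W n x)" using elim by (intro summable_suminf_not_top) (auto simp: W_def)
    then have "(\<lambda>n. W n x) \<longlonglongrightarrow> 0" by (rule summable_LIMSEQ_zero)
    then have "eventually (\<lambda>n. W n x < 1) sequentially" by (rule order_tendstoD(2)) simp
    then show ?case
    proof eventually_elim
      case (elim n)
      have "2 ^ n * norm (v n x) \<le> 1"
      proof (rule ccontr)
        assume "\<not> ?thesis"
        then have "1 \<le> W n x" using p unfolding W_def by (intro ge_one_powr_ge_zero) auto
        then show False using elim by simp
      qed
      then show ?case by (simp add: power_one_over field_simps)
    qed
  qed
qed

text \<open>Completeness with an explicit rate. The almost everywhere convergent subsequence is part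
  of the conclusion, because it shows later that the limit takes values in the complex dual. Fatou's
  lemma transfers the rate from the sequence to the limit.\<close>

lemma Lp_limit:
  fixes u :: "nat \<Rightarrow> 's \<Rightarrow> 'a::banach"
  assumes u: "\<And>n. u n \<in> Lp_space M p" and p: "0 < p" and \<beta>: "\<beta> \<longlonglongrightarrow> (0::real)"
    and cauchy: "\<And>k m n. k \<le> m \<Longrightarrow> k \<le> n \<Longrightarrow> pint M p (\<lambda>x. u m x - u n x) \<le> ennreal (\<beta> k)"
  obtains h K where "strongly_measurable M h" "\<And>k. pint M p (\<lambda>x. h x - u k x) \<le> ennreal (\<beta> k)"
    "AE x in M. (\<lambda>i::nat. u (K i) x) \<longlonglongrightarrow> h x"
proof -
  define e where "e n = ((1 / 4 :: real) ^ n) powr p" for n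
  have e: "0 < e n" for n by (simp add: e_def)
  have "\<forall>n. \<exists>k. \<forall>j\<ge>k. \<beta> j < e n"
    using order_tendstoD(2)[OF \<beta> e] by (simp add: eventually_sequentially)
  from choice[OF this] obtain k where k: "\<forall>n. \<forall>j\<ge>k n. \<beta> j < e n" ..
  \<comment> \<open>Partial sums plus \<open>n\<close> make the subsequence increasing, at least
    \<open>n\<close>, and beyond the index \<open>k n\<close> required for the error.\<close>
  define K where "K n = (\<Sum>i\<le>n. k i) + n" for n
  have Kk: "k n \<le> K n" for n using member_le_sum[of n "{..n}" k] by (simp add: K_def)
  have Kn: "n \<le> K n" for n by (simp add: K_def)
  have KS: "K n \<le> K (Suc n)" for n by (simp add: K_def)
  have be: "ennreal (\<beta> (K n)) \<le> ennreal (e n)" for n using k Kk by (intro ennreal_leI) (simp add: less_imp_le)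
  have sm: "strongly_measurable M (u n)" for n using u[of n] by (simp add: Lp_space_iff)
  \<comment> \<open>Simple functions close to the subsequence have the same limit almost everywhere;
    they witness that the limit is strongly measurable without any separability.\<close>
  have "\<forall>n. \<exists>t. simple_function M t \<and> pint M p (\<lambda>x. u (K n) x - t x) \<le> ennreal (e n)"
    using simple_approx[OF u p e] by metis
  from choice[OF this] obtain t where tt: "\<forall>n. simple_function M (t n) \<and> pint M p (\<lambda>x. u (K n) x - t n x) \<le> ennreal (e n)" ..
  then have t: "simple_function M (t n)" "pint M p (\<lambda>x. u (K n) x - t n x) \<le> ennreal (e n)" for n by auto
  have AE1: "AE x in M. eventually (\<lambda>n. norm (u (K (Suc n)) x - u (K n) x) \<le> (1 / 2) ^ n) sequentially"
  proof (rule Borel_Cantelli_Lp[OF _ p])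
    show "pint M p (\<lambda>x. u (K (Suc n)) x - u (K n) x) \<le> ennreal (((1 / 4) ^ n) powr p)" for n
      using order_trans[OF cauchy[OF KS order_refl] be] by (simp add: e_def)
  qed (intro strongly_measurable_diff sm)
  have AE2: "AE x in M. eventually (\<lambda>n. norm (u (K n) x - t n x) \<le> (1 / 2) ^ n) sequentially"
  proof (rule Borel_Cantelli_Lp[OF _ p])
    show "pint M p (\<lambda>x. u (K n) x - t n x) \<le> ennreal (((1 / 4) ^ n) powr p)" for n using t(2)[of n] by (simp add: e_def)
  qed (intro strongly_measurable_diff sm strongly_measurable_simple t)
  have half: "(\<lambda>n. (1 / 2 :: real) ^ n) \<longlonglongrightarrow> 0" by (rule LIMSEQ_realpow_zero) auto
  have "AE x in M. \<exists>l. (\<lambda>n. u (K n) x) \<longlonglongrightarrow> l \<and> (\<lambda>n. t n x) \<longlonglongrightarrow> l"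
    using AE1 AE2
  proof eventually_elim
    case (elim x)
    have "summable (\<lambda>n. u (K (Suc n)) x - u (K n) x)"
      by (rule summable_comparison_test_ev[OF elim(1)]) (rule summable_geometric, simp)
    then have "(\<lambda>n. \<Sum>i<n. u (K (Suc i)) x - u (K i) x) \<longlonglongrightarrow> (\<Sum>i. u (K (Suc i)) x - u (K i) x)"
      by (rule summable_LIMSEQ)
    then have "(\<lambda>n. u (K n) x - u (K 0) x) \<longlonglongrightarrow> (\<Sum>i. u (K (Suc i)) x - u (K i) x)"
      using sum_lessThan_telescope[of "\<lambda>i. u (K i) x"] by simp
    from tendsto_add[OF this tendsto_const[of "u (K 0) x"]]
    have l: "(\<lambda>n. u (K n) x) \<longlonglongrightarrow> (\<Sum>i. u (K (Suc i)) x - u (K i) x) + u (K 0) x" by simp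
    have "(\<lambda>n. u (K n) x - t n x) \<longlonglongrightarrow> 0" by (rule Lim_null_comparison[OF elim(2) half])
    from tendsto_diff[OF l this] l show ?case by auto
  qed
  then obtain N where N: "{x \<in> space M. \<not> (\<exists>l. (\<lambda>n. u (K n) x) \<longlonglongrightarrow> l \<and> (\<lambda>n. t n x) \<longlonglongrightarrow> l)} \<subseteq> N"
    "emeasure M N = 0" "N \<in> sets M" by (rule AE_E)
  define h where "h x = (if x \<in> N then 0 else lim (\<lambda>n. t n x))" for x
  have hl: "(\<lambda>n. u (K n) x) \<longlonglongrightarrow> h x" "(\<lambda>n. t n x) \<longlonglongrightarrow> h x" if x: "x \<in> space M" "x \<notin> N" for x
  proof -
    obtain l where l: "(\<lambda>n. u (K n) x) \<longlonglongrightarrow> l" "(\<lambda>n. t n x) \<longlonglongrightarrow> l" using x N(1) by blast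
    then have "h x = l" using x by (simp add: h_def limI)
    then show "(\<lambda>n. u (K n) x) \<longlonglongrightarrow> h x" "(\<lambda>n. t n x) \<longlonglongrightarrow> h x" using l by simp_all
  qed
  have hm: "strongly_measurable M h"
    unfolding strongly_measurable_def
  proof (intro exI[of _ "\<lambda>n x. if x \<in> N then 0 else t n x"] conjI allI ballI)
    show "simple_function M (\<lambda>x. if x \<in> N then 0 else t n x)" for n
      using N(3) by (intro simple_function_If_set simple_function_const t) auto
    show "(\<lambda>n. if x \<in> N then 0 else t n x) \<longlonglongrightarrow> h x" if "x \<in> space M" for x
      using hl(2)[OF that] by (cases "x \<in> N") (auto simp: h_def)
  qed
  have AEh: "AE x in M. (\<lambda>i. u (K i) x) \<longlonglongrightarrow> h x"
    by (rule AE_I[OF _ N(2,3)]) (use hl(1) in auto)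
  have packet: "pint M p (\<lambda>x. h x - u k x) \<le> ennreal (\<beta> k)" for k
  proof -
    have "pint M p (\<lambda>x. h x - u k x) = (\<integral>\<^sup>+x. liminf (\<lambda>i. ennreal (norm (u (K i) x - u k x) powr p)) \<partial>M)"
      unfolding pint_def
    proof (rule nn_integral_cong_AE, use AEh in eventually_elim)
      case (elim x)
      have "(\<lambda>i. norm (u (K i) x - u k x)) \<longlonglongrightarrow> norm (h x - u k x)"
        by (rule tendsto_norm[OF tendsto_diff[OF elim tendsto_const]])
      then have "(\<lambda>i. norm (u (K i) x - u k x) powr p) \<longlonglongrightarrow> norm (h x - u k x) powr p"
        using p by (intro tendsto_powr' tendsto_const) auto
      then have "(\<lambda>i. ennreal (norm (u (K i) x - u k x) powr p)) \<longlonglongrightarrow> ennreal (norm (h x - u k x) powr p)"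
        by (rule tendsto_ennrealI)
      then show ?case by (rule lim_imp_Liminf[OF sequentially_bot, symmetric])
    qed
    also have "\<dots> \<le> liminf (\<lambda>i. \<integral>\<^sup>+x. ennreal (norm (u (K i) x - u k x) powr p) \<partial>M)"
      by (rule nn_integral_liminf) (rule pint_measurable[OF strongly_measurable_diff[OF sm sm]])
    also have "\<dots> \<le> liminf (\<lambda>i::nat. ennreal (\<beta> k))"
    proof (rule Liminf_mono, rule eventually_sequentiallyI[of k])
      fix i assume "k \<le> i"
      then have "k \<le> K i" using Kn[of i] by linarith
      from cauchy[OF this order_refl] show "(\<integral>\<^sup>+x. ennreal (norm (u (K i) x - u k x) powr p) \<partial>M) \<le> ennreal (\<beta> k)"
        by (simp add: pint_def)
    qed
    also have "\<dots> = ennreal (\<beta> k)" by (rule Liminf_const) simp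
    finally show ?thesis .
  qed
  show thesis by (rule that[OF hm packet AEh])
qed

section \<open>Extension to Lebesgue--Bochner spaces\<close>

text \<open>\<open>enn2real\<close> sends infinity to 0, so the value is meaningful, and the
  inequalities for sums hold, only for members of the Lebesgue space.\<close>

definition norm_pow :: "real \<Rightarrow> (real \<Rightarrow> 'a::real_normed_vector) \<Rightarrow> real" where
  "norm_pow p f = enn2real (pint Rplus p f)"

lemma norm_pow_nonneg [simp]: "0 \<le> norm_pow p f"
  by (simp add: norm_pow_def)

lemma Lp_norm_eq_norm_pow: "Lp_norm Rplus p f = norm_pow p f powr (1 / p)"
  by (simp add: Lp_norm_eq norm_pow_def)

lemma pint_norm_pow: "f \<in> Lp_space Rplus p \<Longrightarrow> pint Rplus p f = ennreal (norm_pow p f)"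
  by (simp add: norm_pow_def Lp_space_iff)

lemma Lp_sm: "f \<in> Lp_space M p \<Longrightarrow> strongly_measurable M f"
  by (simp add: Lp_space_iff)

lemma norm_pow_add:
  assumes "f \<in> Lp_space Rplus p" "g \<in> Lp_space Rplus p" "0 \<le> p"
  shows "norm_pow p (\<lambda>x. f x + g x) \<le> 2 powr p * (norm_pow p f + norm_pow p g)"
proof -
  have "pint Rplus p (\<lambda>x. f x + g x) \<le> ennreal (2 powr p * (norm_pow p f + norm_pow p g))"
    using assms by (intro pint_add_real) (auto simp: pint_norm_pow Lp_sm)
  then show ?thesis by (simp add: norm_pow_def enn2real_leI)
qed

lemma norm_pow_uminus: "norm_pow p (\<lambda>x. - f x) = norm_pow p f"
  by (simp add: norm_pow_def pint_uminus)

lemma norm_pow_commute: "norm_pow p (\<lambda>x. f x - g x) = norm_pow p (\<lambda>x. g x - f x)"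
  using norm_pow_uminus[of p "\<lambda>x. f x - g x"] by simp

lemma norm_pow_triangle:
  assumes "f \<in> Lp_space Rplus p" "g \<in> Lp_space Rplus p" "h \<in> Lp_space Rplus p" "0 \<le> p"
  shows "norm_pow p (\<lambda>x. f x - h x) \<le> 2 powr p * (norm_pow p (\<lambda>x. f x - g x) + norm_pow p (\<lambda>x. g x - h x))"
  using norm_pow_add[OF Lp_space_diff[OF assms(1,2,4)] Lp_space_diff[OF assms(2,3,4)] assms(4)] by simp

lemma norm_pow_scaled:
  fixes f :: "real \<Rightarrow> 'a::real_normed_vector" and g :: "real \<Rightarrow> 'b::real_normed_vector"
  assumes g: "g \<in> Lp_space Rplus p" and f: "strongly_measurable Rplus f" and p: "0 \<le> p" and c: "0 \<le> c"
    and le: "\<And>x. norm (f x) \<le> c * norm (g x)"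
  shows "f \<in> Lp_space Rplus p" and "norm_pow p f \<le> c powr p * norm_pow p g"
proof -
  have "pint Rplus p f \<le> (\<integral>\<^sup>+x. ennreal (c powr p) * ennreal (norm (g x) powr p) \<partial>Rplus)"
    unfolding pint_def
  proof (rule nn_integral_mono)
    fix x
    have "norm (f x) powr p \<le> (c * norm (g x)) powr p" using le p by (intro powr_mono2) auto
    then show "ennreal (norm (f x) powr p) \<le> ennreal (c powr p) * ennreal (norm (g x) powr p)"
      using c by (simp add: powr_mult ennreal_leI flip: ennreal_mult)
  qed
  also have "\<dots> = ennreal (c powr p) * pint Rplus p g"
    unfolding pint_def by (rule nn_integral_cmult[OF pint_measurable[OF Lp_sm[OF g]]])
  also have "\<dots> = ennreal (c powr p * norm_pow p g)" by (simp add: pint_norm_pow[OF g] ennreal_mult)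
  finally have b: "pint Rplus p f \<le> ennreal (c powr p * norm_pow p g)" .
  then show "f \<in> Lp_space Rplus p" using f by (auto simp: Lp_space_iff intro: le_less_trans)
  show "norm_pow p f \<le> c powr p * norm_pow p g" using b by (simp add: norm_pow_def enn2real_leI)
qed

lemma norm_pow_unique:
  assumes h: "h \<in> Lp_space Rplus p" and h': "h' \<in> Lp_space Rplus p" and u: "\<And>n. u n \<in> Lp_space Rplus p" and p: "0 \<le> p"
    and "(\<lambda>n. norm_pow p (\<lambda>x. h x - u n x)) \<longlonglongrightarrow> 0" "(\<lambda>n. norm_pow p (\<lambda>x. h' x - u n x)) \<longlonglongrightarrow> 0"
  shows "AE x in Rplus. h x = h' x"
proof -
  have le: "norm_pow p (\<lambda>x. h x - h' x) \<le> 2 powr p * (norm_pow p (\<lambda>x. h x - u n x) + norm_pow p (\<lambda>x. h' x - u n x))" for n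
    using norm_pow_triangle[OF h u h' p, of n] norm_pow_commute[of p h' "u n"] by simp
  have lim: "(\<lambda>n. 2 powr p * (norm_pow p (\<lambda>x. h x - u n x) + norm_pow p (\<lambda>x. h' x - u n x))) \<longlonglongrightarrow> 2 powr p * (0 + 0)"
    by (rule tendsto_mult[OF tendsto_const tendsto_add[OF assms(5,6)]])
  have "norm_pow p (\<lambda>x. h x - h' x) \<le> 2 powr p * (0 + 0)" by (rule LIMSEQ_le_const[OF lim]) (use le in blast)
  then have "norm_pow p (\<lambda>x. h x - h' x) \<le> 0" by simp
  then have "norm_pow p (\<lambda>x. h x - h' x) = 0" by (rule antisym[OF _ norm_pow_nonneg])
  then have "pint Rplus p (\<lambda>x. h x - h' x) = 0" using pint_norm_pow[OF Lp_space_diff[OF h h' p]] by simp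
  from pint_zero_AE[OF Lp_sm[OF Lp_space_diff[OF h h' p]] this] show ?thesis by eventually_elim simp
qed

definition step_approx :: "real \<Rightarrow> (nat \<Rightarrow> real \<Rightarrow> 'a::real_normed_vector) \<Rightarrow> (real \<Rightarrow> 'a) \<Rightarrow> bool" where
  "step_approx p F f \<longleftrightarrow> (\<forall>n. finite_dyadic_step (F n)) \<and> (\<lambda>n. norm_pow p (\<lambda>x. f x - F n x)) \<longlonglongrightarrow> 0"

lemma step_approx_ex:
  fixes f :: "real \<Rightarrow> 'a::real_normed_vector"
  assumes f: "f \<in> Lp_space Rplus p" and p: "0 < p"
  obtains F where "step_approx p F f" "\<And>n. norm_pow p (\<lambda>x. f x - F n x) \<le> inverse (real (Suc n))"
proof -
  have "\<exists>h. finite_dyadic_step h \<and> pint Rplus p (\<lambda>x. f x - h x) \<le> ennreal (inverse (real (Suc n)))" for n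
    by (rule step_dense[OF f p, of "inverse (real (Suc n))"]) auto
  then have "\<forall>n. \<exists>h. finite_dyadic_step h \<and> pint Rplus p (\<lambda>x. f x - h x) \<le> ennreal (inverse (real (Suc n)))" by blast
  from choice[OF this] obtain F where
    F: "\<forall>n. finite_dyadic_step (F n) \<and> pint Rplus p (\<lambda>x. f x - F n x) \<le> ennreal (inverse (real (Suc n)))" ..
  have le: "norm_pow p (\<lambda>x. f x - F n x) \<le> inverse (real (Suc n))" for n
    unfolding norm_pow_def using F by (intro enn2real_leI) auto
  have "(\<lambda>n. norm_pow p (\<lambda>x. f x - F n x)) \<longlonglongrightarrow> 0"
    by (rule tendsto_sandwich[OF _ _ tendsto_const LIMSEQ_inverse_real_of_nat]) (use le in auto)
  then have "step_approx p F f" using F by (simp add: step_approx_def)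
  then show thesis using le by (rule that)
qed

lemma step_approx_fds: "step_approx p F f \<Longrightarrow> finite_dyadic_step (F n)"
  by (simp add: step_approx_def)

lemma step_approx_Lp: "step_approx p F f \<Longrightarrow> F n \<in> Lp_space Rplus p"
  by (simp add: step_approx_def finite_dyadic_step_Lp)

lemma step_approx_lim: "step_approx p F f \<Longrightarrow> (\<lambda>n. norm_pow p (\<lambda>x. f x - F n x)) \<longlonglongrightarrow> 0"
  by (simp add: step_approx_def)

lemma step_approx_const: "finite_dyadic_step f \<Longrightarrow> step_approx p (\<lambda>n. f) f"
  by (simp add: step_approx_def norm_pow_def pint_def)

lemma step_approx_add:
  assumes F: "step_approx p F f" and G: "step_approx p G g" and f: "f \<in> Lp_space Rplus p" "g \<in> Lp_space Rplus p" and p: "0 \<le> p"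
  shows "step_approx p (\<lambda>n x. F n x + G n x) (\<lambda>x. f x + g x)"
  unfolding step_approx_def
proof (intro conjI allI)
  show "finite_dyadic_step (\<lambda>x. F n x + G n x)" for n by (rule finite_dyadic_step_diff(2)[OF step_approx_fds[OF F] step_approx_fds[OF G]])
  show "(\<lambda>n. norm_pow p (\<lambda>x. f x + g x - (F n x + G n x))) \<longlonglongrightarrow> 0"
  proof (rule tendsto_sandwich[OF _ _ tendsto_const])
    have "norm_pow p (\<lambda>x. (f x - F n x) + (g x - G n x)) \<le> 2 powr p * (norm_pow p (\<lambda>x. f x - F n x) + norm_pow p (\<lambda>x. g x - G n x))" for n
      by (intro norm_pow_add Lp_space_diff f step_approx_Lp[OF F] step_approx_Lp[OF G] p)
    then have "norm_pow p (\<lambda>x. f x + g x - (F n x + G n x)) \<le> 2 powr p * (norm_pow p (\<lambda>x. f x - F n x) + norm_pow p (\<lambda>x. g x - G n x))" for n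
      by (simp add: algebra_simps)
    then show "eventually (\<lambda>n. norm_pow p (\<lambda>x. f x + g x - (F n x + G n x)) \<le> 2 powr p * (norm_pow p (\<lambda>x. f x - F n x) + norm_pow p (\<lambda>x. g x - G n x))) sequentially"
      by simp
    show "(\<lambda>n. 2 powr p * (norm_pow p (\<lambda>x. f x - F n x) + norm_pow p (\<lambda>x. g x - G n x))) \<longlonglongrightarrow> 0"
      using tendsto_mult[OF tendsto_const tendsto_add[OF step_approx_lim[OF F] step_approx_lim[OF G]], of "2 powr p"] by simp
  qed simp
qed

lemma scaleC_diff: "scaleC c (x - y) = scaleC c x - scaleC c (y :: 'a::complex_banach)"
  using scaleC_add_right[of c "x - y" y] by simp

lemma tendsto_scaleC:
  fixes s :: "nat \<Rightarrow> 'a::complex_banach"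
  assumes "s \<longlonglongrightarrow> a" shows "(\<lambda>n. scaleC c (s n)) \<longlonglongrightarrow> scaleC c a"
proof -
  have "(\<lambda>n. cmod c * norm (s n - a)) \<longlonglongrightarrow> cmod c * 0"
    using tendsto_mult[OF tendsto_const tendsto_norm_zero[OF LIM_zero[OF assms]]] .
  then have "(\<lambda>n. norm (scaleC c (s n) - scaleC c a)) \<longlonglongrightarrow> 0" by (simp add: norm_scaleC flip: scaleC_diff)
  then show ?thesis by (rule LIM_zero_cancel[OF tendsto_norm_zero_cancel])
qed

lemma scaleC_Lp:
  fixes f :: "real \<Rightarrow> 'a::complex_banach"
  assumes f: "f \<in> Lp_space Rplus p" and p: "0 \<le> p"
  shows "(\<lambda>x. scaleC c (f x)) \<in> Lp_space Rplus p" "norm_pow p (\<lambda>x. scaleC c (f x)) \<le> cmod c powr p * norm_pow p f"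
proof -
  have sm: "strongly_measurable Rplus (\<lambda>x. scaleC c (f x))"
    by (rule strongly_measurable_compose[OF Lp_sm[OF f]]) (rule tendsto_scaleC)
  show "(\<lambda>x. scaleC c (f x)) \<in> Lp_space Rplus p" "norm_pow p (\<lambda>x. scaleC c (f x)) \<le> cmod c powr p * norm_pow p f"
    using norm_pow_scaled[OF f sm p, of "cmod c"] by (simp_all add: norm_scaleC)
qed

lemma finite_dyadic_step_scaleC:
  "finite_dyadic_step f \<Longrightarrow> finite_dyadic_step (\<lambda>x. scaleC c (f x :: 'a::complex_banach))"
  unfolding finite_dyadic_step_def by (metis scaleC_zero)

lemma step_approx_scaleC:
  fixes f :: "real \<Rightarrow> 'a::complex_banach"
  assumes F: "step_approx p F f" and f: "f \<in> Lp_space Rplus p" and p: "0 \<le> p"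
  shows "step_approx p (\<lambda>n x. scaleC c (F n x)) (\<lambda>x. scaleC c (f x))"
  unfolding step_approx_def
proof (intro conjI allI)
  show "finite_dyadic_step (\<lambda>x. scaleC c (F n x))" for n by (rule finite_dyadic_step_scaleC[OF step_approx_fds[OF F]])
  show "(\<lambda>n. norm_pow p (\<lambda>x. scaleC c (f x) - scaleC c (F n x))) \<longlonglongrightarrow> 0"
  proof (rule tendsto_sandwich[OF _ _ tendsto_const])
    show "eventually (\<lambda>n. norm_pow p (\<lambda>x. scaleC c (f x) - scaleC c (F n x)) \<le> cmod c powr p * norm_pow p (\<lambda>x. f x - F n x)) sequentially"
      using scaleC_Lp(2)[OF Lp_space_diff[OF f step_approx_Lp[OF F] p] p] by (simp add: scaleC_diff)
    show "(\<lambda>n. cmod c powr p * norm_pow p (\<lambda>x. f x - F n x)) \<longlonglongrightarrow> 0"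
      using tendsto_mult[OF tendsto_const step_approx_lim[OF F], of "cmod c powr p"] by simp
  qed simp
qed

text \<open>The ambient space of bounded real linear maps is only treated as a real normed space, so
  multiplication by a complex number is composition with a multiplication map.\<close>

definition scale_dual :: "complex \<Rightarrow> ('a::real_normed_vector \<Rightarrow>\<^sub>L complex) \<Rightarrow> ('a \<Rightarrow>\<^sub>L complex)" where
  "scale_dual a \<phi> = Blinfun ((*) a) o\<^sub>L \<phi>"

lemma scale_dual_apply [simp]: "blinfun_apply (scale_dual a \<phi>) y = a * blinfun_apply \<phi> y"
  by (simp add: scale_dual_def bounded_linear_Blinfun_apply bounded_linear_mult_right)

lemma norm_scale_dual: "norm (scale_dual a \<phi>) \<le> cmod a * norm \<phi>"
proof (rule norm_blinfun_bound)
  show "norm (blinfun_apply (scale_dual a \<phi>) x) \<le> cmod a * norm \<phi> * norm x" for x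
    using mult_left_mono[OF norm_blinfun[of \<phi> x], of "cmod a"] by (simp add: norm_mult mult.assoc)
qed simp

lemma scale_dual_diff: "scale_dual a (\<phi> - \<psi>) = scale_dual a \<phi> - scale_dual a \<psi>"
  by (rule blinfun_eqI) (simp add: blinfun.diff_left right_diff_distrib)

lemma tendsto_scale_dual:
  assumes "s \<longlonglongrightarrow> \<phi>" shows "(\<lambda>n::nat. scale_dual a (s n)) \<longlonglongrightarrow> scale_dual a \<phi>"
proof -
  have "(\<lambda>n. cmod a * norm (s n - \<phi>)) \<longlonglongrightarrow> cmod a * 0"
    using tendsto_mult[OF tendsto_const tendsto_norm_zero[OF LIM_zero[OF assms]]] .
  then have lim: "(\<lambda>n. cmod a * norm (s n - \<phi>)) \<longlonglongrightarrow> 0" by simp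
  have "(\<lambda>n. scale_dual a (s n) - scale_dual a \<phi>) \<longlonglongrightarrow> 0"
  proof (rule Lim_null_comparison[OF _ lim])
    show "\<forall>\<^sub>F n in sequentially. norm (scale_dual a (s n) - scale_dual a \<phi>) \<le> cmod a * norm (s n - \<phi>)"
      by (simp add: norm_scale_dual flip: scale_dual_diff)
  qed
  then show ?thesis by (rule LIM_zero_cancel)
qed

lemma scale_dual_Lp:
  assumes f: "f \<in> Lp_space Rplus p" and p: "0 \<le> p"
  shows "(\<lambda>x. scale_dual c (f x)) \<in> Lp_space Rplus p" "norm_pow p (\<lambda>x. scale_dual c (f x)) \<le> cmod c powr p * norm_pow p f"
proof -
  have sm: "strongly_measurable Rplus (\<lambda>x. scale_dual c (f x))"
    by (rule strongly_measurable_compose[OF Lp_sm[OF f]]) (rule tendsto_scale_dual)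
  show "(\<lambda>x. scale_dual c (f x)) \<in> Lp_space Rplus p" "norm_pow p (\<lambda>x. scale_dual c (f x)) \<le> cmod c powr p * norm_pow p f"
    using norm_pow_scaled[OF f sm p, of "cmod c"] norm_scale_dual by auto
qed

locale bounded_form = tri_form \<Phi> for \<Phi> :: "'a::complex_banach \<Rightarrow> 'b::complex_banach \<Rightarrow> 'c::complex_banach \<Rightarrow> complex" +
  fixes D p1 p2 r :: real
  assumes D0: "0 \<le> D" and D: "\<And>L f g. discrete_norm L r (discrete_operator L f g) \<le> D * discrete_norm L p1 f * discrete_norm L p2 g"
    and p1: "0 < p1" and p2: "0 < p2" and r: "0 < r" and pr12: "1 / r = 1 / p1 + 1 / p2"
begin

text \<open>The r-th power of the product bound, written in p-th powers of the norms. It is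
  continuous and vanishes when one argument does, which is all that the limit arguments use.\<close>

definition G :: "real \<Rightarrow> real \<Rightarrow> real" where
  "G a b = (D * a powr (1 / p1) * b powr (1 / p2)) powr r"

lemma G_mono: "0 \<le> a \<Longrightarrow> a \<le> a' \<Longrightarrow> 0 \<le> b \<Longrightarrow> b \<le> b' \<Longrightarrow> G a b \<le> G a' b'"
  unfolding G_def using D0 p1 p2 r
  by (intro powr_mono2 mult_mono mult_nonneg_nonneg mult_left_mono) auto

lemma G_nonneg: "0 \<le> G a b"
  by (simp add: G_def)

lemma G_zero: "G 0 b = 0" "G a 0 = 0"
  by (simp_all add: G_def)

lemma tendsto_G:
  assumes "u \<longlonglongrightarrow> a" "w \<longlonglongrightarrow> b" "\<And>n. 0 \<le> u n" "\<And>n::nat. 0 \<le> w n"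
  shows "(\<lambda>n. G (u n) (w n)) \<longlonglongrightarrow> G a b"
proof -
  have "(\<lambda>n. u n powr (1 / p1)) \<longlonglongrightarrow> a powr (1 / p1)"
    using p1 assms(3) by (intro tendsto_powr' assms(1) tendsto_const) auto
  moreover have "(\<lambda>n. w n powr (1 / p2)) \<longlonglongrightarrow> b powr (1 / p2)"
    using p2 assms(4) by (intro tendsto_powr' assms(2) tendsto_const) auto
  ultimately have "(\<lambda>n. D * u n powr (1 / p1) * w n powr (1 / p2)) \<longlonglongrightarrow> D * a powr (1 / p1) * b powr (1 / p2)"
    by (intro tendsto_mult tendsto_const)
  then show ?thesis unfolding G_def using r D0 by (intro tendsto_powr' tendsto_const) auto
qed

lemma step_operator_Lp:
  assumes "finite_dyadic_step f" "finite_dyadic_step g"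
  shows "step_operator f g \<in> Lp_space Rplus r" "norm_pow r (step_operator f g) \<le> G (norm_pow p1 f) (norm_pow p2 g)"
proof -
  note b = step_operator_bound[OF assms D0 D p1 p2 r pr12]
  show "step_operator f g \<in> Lp_space Rplus r" using b by (auto simp: Lp_space_iff intro: le_less_trans)
  show "norm_pow r (step_operator f g) \<le> G (norm_pow p1 f) (norm_pow p2 g)"
    using b(2) by (simp add: norm_pow_def[of r] G_def Lp_norm_eq_norm_pow enn2real_leI)
qed

text \<open>One argument is changed at a time:
  \<open>B(f,g) - B(f',g') = B(f - f',g) + B(f',g - g')\<close>.\<close>

lemma step_operator_diff:
  assumes f: "finite_dyadic_step f" "finite_dyadic_step f'" and g: "finite_dyadic_step g" "finite_dyadic_step g'"
  shows "norm_pow r (\<lambda>x. step_operator f g x - step_operator f' g' x) \<le>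
    2 powr r * (G (norm_pow p1 (\<lambda>x. f x - f' x)) (norm_pow p2 g) + G (norm_pow p1 f') (norm_pow p2 (\<lambda>x. g x - g' x)))"
proof -
  have fd: "finite_dyadic_step (\<lambda>x. f x - f' x)" and gd: "finite_dyadic_step (\<lambda>x. g x - g' x)"
    using finite_dyadic_step_diff f g by blast+
  have "step_operator f g x - step_operator f' g' x = step_operator (\<lambda>x. f x - f' x) g x + step_operator f' (\<lambda>x. g x - g' x) x" for x
    using step_operator_add1[OF fd f(2) g(1), of x] step_operator_add2[OF f(2) gd g(2), of x] by simp
  then have "norm_pow r (\<lambda>x. step_operator f g x - step_operator f' g' x) = norm_pow r (\<lambda>x. step_operator (\<lambda>x. f x - f' x) g x + step_operator f' (\<lambda>x. g x - g' x) x)" by simp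
  also have "\<dots> \<le> 2 powr r * (norm_pow r (step_operator (\<lambda>x. f x - f' x) g) + norm_pow r (step_operator f' (\<lambda>x. g x - g' x)))"
    using r by (intro norm_pow_add step_operator_Lp fd gd f g) auto
  also have "\<dots> \<le> 2 powr r * (G (norm_pow p1 (\<lambda>x. f x - f' x)) (norm_pow p2 g) + G (norm_pow p1 f') (norm_pow p2 (\<lambda>x. g x - g' x)))"
    by (intro mult_left_mono add_mono step_operator_Lp fd gd f g) simp
  finally show ?thesis .
qed

lemma norm_pow_step_le:
  assumes "f \<in> Lp_space Rplus p" "F \<in> Lp_space Rplus p" "0 \<le> p"
  shows "norm_pow p F \<le> 2 powr p * (norm_pow p f + norm_pow p (\<lambda>x. f x - F x))"
  using norm_pow_add[OF assms(1) Lp_space_diff[OF assms(2,1,3)] assms(3)] norm_pow_commute[of p f F] by simp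

lemma step_operator_step_approx:
  assumes F: "step_approx p1 F f" "step_approx p1 F' f" and f: "f \<in> Lp_space Rplus p1" and H: "step_approx p2 H g" "step_approx p2 H' g" and g: "g \<in> Lp_space Rplus p2"
  shows "(\<lambda>n. norm_pow r (\<lambda>x. step_operator (F n) (H n) x - step_operator (F' n) (H' n) x)) \<longlonglongrightarrow> 0"
proof -
  have pp: "0 \<le> p1" "0 \<le> p2" using p1 p2 by auto
  define a where "a n = 2 powr p1 * (norm_pow p1 (\<lambda>x. f x - F n x) + norm_pow p1 (\<lambda>x. f x - F' n x))" for n
  define b where "b n = 2 powr p2 * (norm_pow p2 (\<lambda>x. g x - H n x) + norm_pow p2 (\<lambda>x. g x - H' n x))" for n
  define a' where "a' n = 2 powr p1 * (norm_pow p1 f + norm_pow p1 (\<lambda>x. f x - F' n x))" for n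
  define b' where "b' n = 2 powr p2 * (norm_pow p2 g + norm_pow p2 (\<lambda>x. g x - H n x))" for n
  have nn: "0 \<le> a n" "0 \<le> b n" "0 \<le> a' n" "0 \<le> b' n" for n by (auto simp: a_def b_def a'_def b'_def)
  have "a \<longlonglongrightarrow> 2 powr p1 * (0 + 0)" unfolding a_def by (intro tendsto_mult tendsto_add tendsto_const step_approx_lim F)
  then have a: "a \<longlonglongrightarrow> 0" by simp
  have "b \<longlonglongrightarrow> 2 powr p2 * (0 + 0)" unfolding b_def by (intro tendsto_mult tendsto_add tendsto_const step_approx_lim H)
  then have b: "b \<longlonglongrightarrow> 0" by simp
  have a': "a' \<longlonglongrightarrow> 2 powr p1 * (norm_pow p1 f + 0)" unfolding a'_def by (intro tendsto_mult tendsto_add tendsto_const step_approx_lim F)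
  have b': "b' \<longlonglongrightarrow> 2 powr p2 * (norm_pow p2 g + 0)" unfolding b'_def by (intro tendsto_mult tendsto_add tendsto_const step_approx_lim H)
  have le: "norm_pow r (\<lambda>x. step_operator (F n) (H n) x - step_operator (F' n) (H' n) x) \<le> 2 powr r * (G (a n) (b' n) + G (a' n) (b n))" for n
  proof -
    have "norm_pow r (\<lambda>x. step_operator (F n) (H n) x - step_operator (F' n) (H' n) x) \<le>
      2 powr r * (G (norm_pow p1 (\<lambda>x. F n x - F' n x)) (norm_pow p2 (H n)) + G (norm_pow p1 (F' n)) (norm_pow p2 (\<lambda>x. H n x - H' n x)))"
      by (rule step_operator_diff[OF step_approx_fds[OF F(1)] step_approx_fds[OF F(2)] step_approx_fds[OF H(1)] step_approx_fds[OF H(2)]])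
    also have "\<dots> \<le> 2 powr r * (G (a n) (b' n) + G (a' n) (b n))"
    proof (intro mult_left_mono add_mono G_mono)
      show "norm_pow p1 (\<lambda>x. F n x - F' n x) \<le> a n"
        using norm_pow_triangle[OF step_approx_Lp[OF F(1)] f step_approx_Lp[OF F(2)] pp(1), of n n] norm_pow_commute[of p1 f "F n"] by (simp add: a_def)
      show "norm_pow p2 (\<lambda>x. H n x - H' n x) \<le> b n"
        using norm_pow_triangle[OF step_approx_Lp[OF H(1)] g step_approx_Lp[OF H(2)] pp(2), of n n] norm_pow_commute[of p2 g "H n"] by (simp add: b_def)
      show "norm_pow p1 (F' n) \<le> a' n" unfolding a'_def by (rule norm_pow_step_le[OF f step_approx_Lp[OF F(2)] pp(1)])
      show "norm_pow p2 (H n) \<le> b' n" unfolding b'_def by (rule norm_pow_step_le[OF g step_approx_Lp[OF H(1)] pp(2)])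
    qed auto
    finally show ?thesis .
  qed
  have "(\<lambda>n. 2 powr r * (G (a n) (b' n) + G (a' n) (b n))) \<longlonglongrightarrow> 2 powr r * (G 0 (2 powr p2 * (norm_pow p2 g + 0)) + G (2 powr p1 * (norm_pow p1 f + 0)) 0)"
    by (intro tendsto_mult tendsto_add tendsto_const tendsto_G a b a' b' nn)
  then have "(\<lambda>n. 2 powr r * (G (a n) (b' n) + G (a' n) (b n))) \<longlonglongrightarrow> 0" by (simp add: G_zero)
  then show ?thesis by (rule tendsto_sandwich[OF _ _ tendsto_const, rotated 2]) (use le in auto)
qed

definition is_extension :: "(real \<Rightarrow> 'a) \<Rightarrow> (real \<Rightarrow> 'b) \<Rightarrow> (real \<Rightarrow> ('c \<Rightarrow>\<^sub>L complex)) \<Rightarrow> bool" where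
  "is_extension f g h \<longleftrightarrow> h \<in> Lp_space Rplus r \<and> (\<forall>x\<ge>0. h x \<in> complex_dual) \<and>
     (\<forall>F H. step_approx p1 F f \<longrightarrow> step_approx p2 H g \<longrightarrow> (\<lambda>n. norm_pow r (\<lambda>x. h x - step_operator (F n) (H n) x)) \<longlonglongrightarrow> 0)"

lemma is_extension_ex:
  assumes f: "f \<in> Lp_space Rplus p1" and g: "g \<in> Lp_space Rplus p2"
  shows "\<exists>h. is_extension f g h"
proof -
  have pp: "0 \<le> p1" "0 \<le> p2" "0 \<le> r" using p1 p2 r by auto
  obtain F where F: "step_approx p1 F f" "\<And>n. norm_pow p1 (\<lambda>x. f x - F n x) \<le> inverse (real (Suc n))"
    by (rule step_approx_ex[OF f p1]) blast
  obtain H where H: "step_approx p2 H g" "\<And>n. norm_pow p2 (\<lambda>x. g x - H n x) \<le> inverse (real (Suc n))"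
    by (rule step_approx_ex[OF g p2]) blast
  define d where "d k = inverse (real (Suc k))" for k
  note F2 = F(2)[folded d_def] and H2 = H(2)[folded d_def]
  have dd: "d m \<le> d k" "0 \<le> d k" "d k \<le> 1" if "k \<le> m" for k m using that by (auto simp: d_def field_simps)
  have d0: "0 \<le> d k" for k by (simp add: d_def)
  have dlim: "d \<longlonglongrightarrow> 0" unfolding d_def by (rule LIMSEQ_inverse_real_of_nat)
  define u where "u n = step_operator (F n) (H n)" for n
  have uL: "u n \<in> Lp_space Rplus r" for n unfolding u_def by (rule step_operator_Lp[OF step_approx_fds[OF F(1)] step_approx_fds[OF H(1)]])
  define A where "A = 2 powr p1 * (norm_pow p1 f + 1)"
  define B where "B = 2 powr p2 * (norm_pow p2 g + 1)"
  \<comment> \<open>The modulus of the Cauchy property: each difference of approximants from index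
    \<open>k\<close> on is at most \<open>d k + d k\<close> up to the quasi-norm constant, and the
    other factor stays below \<open>A\<close> or \<open>B\<close>.\<close>
  define \<beta> where "\<beta> k = 2 powr r * (G (2 powr p1 * (d k + d k)) B + G A (2 powr p2 * (d k + d k)))" for k
  have AB: "0 \<le> A" "0 \<le> B" by (auto simp: A_def B_def)
  have "\<beta> \<longlonglongrightarrow> 2 powr r * (G (2 powr p1 * (0 + 0)) B + G A (2 powr p2 * (0 + 0)))"
    unfolding \<beta>_def using d0 AB by (intro tendsto_mult tendsto_add tendsto_const tendsto_G dlim) auto
  then have \<beta>0: "\<beta> \<longlonglongrightarrow> 0" by (simp add: G_zero)
  have cau: "pint Rplus r (\<lambda>x. u m x - u n x) \<le> ennreal (\<beta> k)" if k: "k \<le> m" "k \<le> n" for k m n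
  proof -
    have "norm_pow r (\<lambda>x. u m x - u n x) \<le> 2 powr r * (G (norm_pow p1 (\<lambda>x. F m x - F n x)) (norm_pow p2 (H m)) + G (norm_pow p1 (F n)) (norm_pow p2 (\<lambda>x. H m x - H n x)))"
      unfolding u_def by (rule step_operator_diff[OF step_approx_fds[OF F(1)] step_approx_fds[OF F(1)] step_approx_fds[OF H(1)] step_approx_fds[OF H(1)]])
    also have "\<dots> \<le> \<beta> k" unfolding \<beta>_def
    proof (intro mult_left_mono add_mono G_mono)
      have "norm_pow p1 (\<lambda>x. F m x - F n x) \<le> 2 powr p1 * (norm_pow p1 (\<lambda>x. F m x - f x) + norm_pow p1 (\<lambda>x. f x - F n x))"
        by (rule norm_pow_triangle[OF step_approx_Lp[OF F(1)] f step_approx_Lp[OF F(1)] pp(1)])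
      also have "\<dots> \<le> 2 powr p1 * (d k + d k)"
        using F2[of m] F2[of n] dd(1)[OF k(1)] dd(1)[OF k(2)] norm_pow_commute[of p1 f "F m"]
        by (intro mult_left_mono add_mono) auto
      finally show "norm_pow p1 (\<lambda>x. F m x - F n x) \<le> 2 powr p1 * (d k + d k)" .
      have "norm_pow p2 (\<lambda>x. H m x - H n x) \<le> 2 powr p2 * (norm_pow p2 (\<lambda>x. H m x - g x) + norm_pow p2 (\<lambda>x. g x - H n x))"
        by (rule norm_pow_triangle[OF step_approx_Lp[OF H(1)] g step_approx_Lp[OF H(1)] pp(2)])
      also have "\<dots> \<le> 2 powr p2 * (d k + d k)"
        using H2[of m] H2[of n] dd(1)[OF k(1)] dd(1)[OF k(2)] norm_pow_commute[of p2 g "H m"]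
        by (intro mult_left_mono add_mono) auto
      finally show "norm_pow p2 (\<lambda>x. H m x - H n x) \<le> 2 powr p2 * (d k + d k)" .
      have "norm_pow p2 (H m) \<le> 2 powr p2 * (norm_pow p2 g + norm_pow p2 (\<lambda>x. g x - H m x))" by (rule norm_pow_step_le[OF g step_approx_Lp[OF H(1)] pp(2)])
      also have "\<dots> \<le> B" unfolding B_def using H2[of m] dd(3)[of m m] by (intro mult_left_mono add_mono) auto
      finally show "norm_pow p2 (H m) \<le> B" .
      have "norm_pow p1 (F n) \<le> 2 powr p1 * (norm_pow p1 f + norm_pow p1 (\<lambda>x. f x - F n x))" by (rule norm_pow_step_le[OF f step_approx_Lp[OF F(1)] pp(1)])
      also have "\<dots> \<le> A" unfolding A_def using F2[of n] dd(3)[of n n] by (intro mult_left_mono add_mono) auto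
      finally show "norm_pow p1 (F n) \<le> A" .
    qed auto
    finally show ?thesis by (subst pint_norm_pow[OF Lp_space_diff[OF uL uL pp(3)]]) (rule ennreal_leI)
  qed
  obtain h0 K where h0: "strongly_measurable Rplus h0" "\<And>k. pint Rplus r (\<lambda>x. h0 x - u k x) \<le> ennreal (\<beta> k)"
    and AEh: "AE x in Rplus. (\<lambda>i. u (K i) x) \<longlonglongrightarrow> h0 x"
    by (rule Lp_limit[of u Rplus r \<beta>, OF uL r \<beta>0], rule cau) (assumption+, rule that)
  obtain N where N: "{x \<in> space Rplus. \<not> (\<lambda>i. u (K i) x) \<longlonglongrightarrow> h0 x} \<subseteq> N" "emeasure Rplus N = 0" "N \<in> sets Rplus"
    using AE_E[OF AEh] .
  \<comment> \<open>On the exceptional null set the limit is replaced by 0, because membership in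
    the complex dual is required at every nonnegative point.\<close>
  define h where "h x = (if x \<in> N then 0 else h0 x)" for x
  have hm: "strongly_measurable Rplus h"
  proof -
    obtain s where s: "\<And>i::nat. simple_function Rplus (s i)" "\<And>x. x \<in> space Rplus \<Longrightarrow> (\<lambda>i. s i x) \<longlonglongrightarrow> h0 x"
      using h0(1) unfolding strongly_measurable_def by blast
    show ?thesis unfolding strongly_measurable_def
    proof (intro exI[of _ "\<lambda>n x. if x \<in> N then 0 else s n x"] conjI allI ballI)
      show "simple_function Rplus (\<lambda>x. if x \<in> N then 0 else s n x)" for n
        by (rule simple_function_If_set[OF simple_function_const s(1)]) (rule sets.Int_space_eq2[OF N(3), THEN ssubst], rule N(3))
      show "(\<lambda>n. if x \<in> N then 0 else s n x) \<longlonglongrightarrow> h x" if "x \<in> space Rplus" for x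
        using s(2)[OF that] by (cases "x \<in> N") (auto simp: h_def)
    qed
  qed
  have AEeq: "AE x in Rplus. h x = h0 x" by (rule AE_I[OF _ N(2,3)]) (auto simp: h_def)
  have hb: "pint Rplus r (\<lambda>x. h x - u k x) \<le> ennreal (\<beta> k)" for k
  proof -
    have "AE x in Rplus. norm (h x - u k x) = norm (h0 x - u k x)" using AEeq by eventually_elim simp
    then have "pint Rplus r (\<lambda>x. h x - u k x) = pint Rplus r (\<lambda>x. h0 x - u k x)" by (rule pint_cong_AE)
    then show ?thesis using h0(2) by simp
  qed
  have hd: "(\<lambda>x. h x - u k x) \<in> Lp_space Rplus r" for k
    unfolding Lp_space_iff using strongly_measurable_diff[OF hm Lp_sm[OF uL]] hb[of k] by (auto intro: le_less_trans)
  have hL: "h \<in> Lp_space Rplus r" using Lp_space_add[OF hd uL pp(3), of 0 0] by simp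
  have hlim: "(\<lambda>n. norm_pow r (\<lambda>x. h x - u n x)) \<longlonglongrightarrow> 0"
  proof (rule tendsto_sandwich[OF _ _ tendsto_const \<beta>0])
    have "0 \<le> \<beta> n" for n by (simp add: \<beta>_def G_nonneg)
    then have "norm_pow r (\<lambda>x. h x - u n x) \<le> \<beta> n" for n using hb[of n] by (simp add: norm_pow_def enn2real_leI)
    then show "eventually (\<lambda>n. norm_pow r (\<lambda>x. h x - u n x) \<le> \<beta> n) sequentially" by simp
  qed simp
  have "is_extension f g h" unfolding is_extension_def
  proof (intro conjI allI impI hL)
    fix x :: real assume x: "0 \<le> x"
    show "h x \<in> complex_dual"
    proof (cases "x \<in> N")
      case True
      then show ?thesis by (simp add: h_def complex_dual_zero)
    next
      case False
      then have "(\<lambda>i. u (K i) x) \<longlonglongrightarrow> h0 x" using N(1) x by auto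
      then have "h0 x \<in> complex_dual"
        by (rule complex_dual_limit[rotated]) (simp add: u_def step_operator_dual[OF step_approx_fds[OF F(1)] step_approx_fds[OF H(1)]])
      then show ?thesis using False by (simp add: h_def)
    qed
  next
    fix F' H' assume F': "step_approx p1 F' f" and H': "step_approx p2 H' g"
    have QL: "step_operator (F' n) (H' n) \<in> Lp_space Rplus r" for n by (rule step_operator_Lp[OF step_approx_fds[OF F'] step_approx_fds[OF H']])
    have l: "(\<lambda>n. 2 powr r * (norm_pow r (\<lambda>x. h x - u n x) + norm_pow r (\<lambda>x. u n x - step_operator (F' n) (H' n) x))) \<longlonglongrightarrow> 2 powr r * (0 + 0)"
      unfolding u_def
      by (intro tendsto_mult tendsto_add tendsto_const hlim[unfolded u_def] step_operator_step_approx[OF F(1) F' f H(1) H' g])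
    show "(\<lambda>n. norm_pow r (\<lambda>x. h x - step_operator (F' n) (H' n) x)) \<longlonglongrightarrow> 0"
    proof (rule tendsto_sandwich[OF _ _ tendsto_const])
      show "eventually (\<lambda>n. norm_pow r (\<lambda>x. h x - step_operator (F' n) (H' n) x) \<le>
         2 powr r * (norm_pow r (\<lambda>x. h x - u n x) + norm_pow r (\<lambda>x. u n x - step_operator (F' n) (H' n) x))) sequentially"
        using norm_pow_triangle[OF hL uL QL pp(3)] by simp
      show "(\<lambda>n. 2 powr r * (norm_pow r (\<lambda>x. h x - u n x) + norm_pow r (\<lambda>x. u n x - step_operator (F' n) (H' n) x))) \<longlonglongrightarrow> 0"
        using l by simp
    qed simp
  qed
  then show ?thesis by (intro exI[of _ h])
qed

definition extension :: "(real \<Rightarrow> 'a) \<Rightarrow> (real \<Rightarrow> 'b) \<Rightarrow> real \<Rightarrow> ('c \<Rightarrow>\<^sub>L complex)" where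
  "extension f g = (SOME h. is_extension f g h)"

lemma
  assumes "f \<in> Lp_space Rplus p1" "g \<in> Lp_space Rplus p2"
  shows extension_Lp: "extension f g \<in> Lp_space Rplus r"
    and extension_dual: "0 \<le> x \<Longrightarrow> extension f g x \<in> complex_dual"
    and extension_step_approx: "step_approx p1 F f \<Longrightarrow> step_approx p2 H g \<Longrightarrow> (\<lambda>n. norm_pow r (\<lambda>x. extension f g x - step_operator (F n) (H n) x)) \<longlonglongrightarrow> 0"
proof -
  have "is_extension f g (extension f g)" unfolding extension_def by (rule someI_ex[OF is_extension_ex[OF assms]])
  then show "extension f g \<in> Lp_space Rplus r" "0 \<le> x \<Longrightarrow> extension f g x \<in> complex_dual"
    "step_approx p1 F f \<Longrightarrow> step_approx p2 H g \<Longrightarrow> (\<lambda>n. norm_pow r (\<lambda>x. extension f g x - step_operator (F n) (H n) x)) \<longlonglongrightarrow> 0"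
    unfolding is_extension_def by blast+
qed

lemma extension_add1:
  assumes f: "f \<in> Lp_space Rplus p1" "f' \<in> Lp_space Rplus p1" and g: "g \<in> Lp_space Rplus p2"
  shows "AE x in Rplus. extension (\<lambda>t. f t + f' t) g x = extension f g x + extension f' g x"
proof -
  have pp: "0 \<le> p1" "0 \<le> r" using p1 r by auto
  obtain F where F: "step_approx p1 F f" using step_approx_ex[OF f(1) p1] .
  obtain F' where F': "step_approx p1 F' f'" using step_approx_ex[OF f(2) p1] .
  obtain H where H: "step_approx p2 H g" using step_approx_ex[OF g p2] .
  have ff: "(\<lambda>t. f t + f' t) \<in> Lp_space Rplus p1" by (rule Lp_space_add[OF f pp(1)])
  note FF = step_approx_add[OF F F' f pp(1)]
  have Q: "step_operator (\<lambda>x. F n x + F' n x) (H n) x = step_operator (F n) (H n) x + step_operator (F' n) (H n) x" for n x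
    by (rule step_operator_add1[OF step_approx_fds[OF F] step_approx_fds[OF F'] step_approx_fds[OF H]])
  have l1: "(\<lambda>n. norm_pow r (\<lambda>x. extension (\<lambda>t. f t + f' t) g x - step_operator (\<lambda>x. F n x + F' n x) (H n) x)) \<longlonglongrightarrow> 0"
    by (rule extension_step_approx[OF ff g FF H])
  have QL: "step_operator (F n) (H n) \<in> Lp_space Rplus r" "step_operator (F' n) (H n) \<in> Lp_space Rplus r"
    "step_operator (\<lambda>x. F n x + F' n x) (H n) \<in> Lp_space Rplus r" for n
    by (rule step_operator_Lp[OF step_approx_fds[OF F] step_approx_fds[OF H]], rule step_operator_Lp[OF step_approx_fds[OF F'] step_approx_fds[OF H]], rule step_operator_Lp[OF step_approx_fds[OF FF] step_approx_fds[OF H]])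
  have l2: "(\<lambda>n. norm_pow r (\<lambda>x. (extension f g x + extension f' g x) - step_operator (\<lambda>x. F n x + F' n x) (H n) x)) \<longlonglongrightarrow> 0"
  proof (rule tendsto_sandwich[OF _ _ tendsto_const])
    have "norm_pow r (\<lambda>x. (extension f g x - step_operator (F n) (H n) x) + (extension f' g x - step_operator (F' n) (H n) x)) \<le>
       2 powr r * (norm_pow r (\<lambda>x. extension f g x - step_operator (F n) (H n) x) + norm_pow r (\<lambda>x. extension f' g x - step_operator (F' n) (H n) x))" for n
      by (intro norm_pow_add Lp_space_diff extension_Lp f g QL pp)
    moreover have "(\<lambda>x. (extension f g x + extension f' g x) - step_operator (\<lambda>x. F n x + F' n x) (H n) x) = (\<lambda>x. (extension f g x - step_operator (F n) (H n) x) + (extension f' g x - step_operator (F' n) (H n) x))" for n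
      by (simp add: Q fun_eq_iff)
    ultimately show "eventually (\<lambda>n. norm_pow r (\<lambda>x. (extension f g x + extension f' g x) - step_operator (\<lambda>x. F n x + F' n x) (H n) x) \<le>
       2 powr r * (norm_pow r (\<lambda>x. extension f g x - step_operator (F n) (H n) x) + norm_pow r (\<lambda>x. extension f' g x - step_operator (F' n) (H n) x))) sequentially"
      by simp
    show "(\<lambda>n. 2 powr r * (norm_pow r (\<lambda>x. extension f g x - step_operator (F n) (H n) x) + norm_pow r (\<lambda>x. extension f' g x - step_operator (F' n) (H n) x))) \<longlonglongrightarrow> 0"
      using tendsto_mult[OF tendsto_const tendsto_add[OF extension_step_approx[OF f(1) g F H] extension_step_approx[OF f(2) g F' H]], of "2 powr r"] by simp
  qed simp
  show ?thesis
    by (rule norm_pow_unique[OF extension_Lp[OF ff g] Lp_space_add[OF extension_Lp[OF f(1) g] extension_Lp[OF f(2) g] pp(2)] QL(3) pp(2) l1 l2])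
qed

lemma extension_add2:
  assumes f: "f \<in> Lp_space Rplus p1" and g: "g \<in> Lp_space Rplus p2" "g' \<in> Lp_space Rplus p2"
  shows "AE x in Rplus. extension f (\<lambda>t. g t + g' t) x = extension f g x + extension f g' x"
proof -
  have pp: "0 \<le> p2" "0 \<le> r" using p2 r by auto
  obtain F where F: "step_approx p1 F f" using step_approx_ex[OF f p1] .
  obtain H where H: "step_approx p2 H g" using step_approx_ex[OF g(1) p2] .
  obtain H' where H': "step_approx p2 H' g'" using step_approx_ex[OF g(2) p2] .
  have gg: "(\<lambda>t. g t + g' t) \<in> Lp_space Rplus p2" by (rule Lp_space_add[OF g pp(1)])
  note HH = step_approx_add[OF H H' g pp(1)]
  have Q: "step_operator (F n) (\<lambda>x. H n x + H' n x) x = step_operator (F n) (H n) x + step_operator (F n) (H' n) x" for n x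
    by (rule step_operator_add2[OF step_approx_fds[OF F] step_approx_fds[OF H] step_approx_fds[OF H']])
  have l1: "(\<lambda>n. norm_pow r (\<lambda>x. extension f (\<lambda>t. g t + g' t) x - step_operator (F n) (\<lambda>x. H n x + H' n x) x)) \<longlonglongrightarrow> 0"
    by (rule extension_step_approx[OF f gg F HH])
  have QL: "step_operator (F n) (H n) \<in> Lp_space Rplus r" "step_operator (F n) (H' n) \<in> Lp_space Rplus r"
    "step_operator (F n) (\<lambda>x. H n x + H' n x) \<in> Lp_space Rplus r" for n
    by (rule step_operator_Lp[OF step_approx_fds[OF F] step_approx_fds[OF H]], rule step_operator_Lp[OF step_approx_fds[OF F] step_approx_fds[OF H']], rule step_operator_Lp[OF step_approx_fds[OF F] step_approx_fds[OF HH]])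
  have l2: "(\<lambda>n. norm_pow r (\<lambda>x. (extension f g x + extension f g' x) - step_operator (F n) (\<lambda>x. H n x + H' n x) x)) \<longlonglongrightarrow> 0"
  proof (rule tendsto_sandwich[OF _ _ tendsto_const])
    have "norm_pow r (\<lambda>x. (extension f g x - step_operator (F n) (H n) x) + (extension f g' x - step_operator (F n) (H' n) x)) \<le>
       2 powr r * (norm_pow r (\<lambda>x. extension f g x - step_operator (F n) (H n) x) + norm_pow r (\<lambda>x. extension f g' x - step_operator (F n) (H' n) x))" for n
      by (intro norm_pow_add Lp_space_diff extension_Lp f g QL pp)
    moreover have "(\<lambda>x. (extension f g x + extension f g' x) - step_operator (F n) (\<lambda>x. H n x + H' n x) x) = (\<lambda>x. (extension f g x - step_operator (F n) (H n) x) + (extension f g' x - step_operator (F n) (H' n) x))" for n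
      by (simp add: Q fun_eq_iff)
    ultimately show "eventually (\<lambda>n. norm_pow r (\<lambda>x. (extension f g x + extension f g' x) - step_operator (F n) (\<lambda>x. H n x + H' n x) x) \<le>
       2 powr r * (norm_pow r (\<lambda>x. extension f g x - step_operator (F n) (H n) x) + norm_pow r (\<lambda>x. extension f g' x - step_operator (F n) (H' n) x))) sequentially"
      by simp
    show "(\<lambda>n. 2 powr r * (norm_pow r (\<lambda>x. extension f g x - step_operator (F n) (H n) x) + norm_pow r (\<lambda>x. extension f g' x - step_operator (F n) (H' n) x))) \<longlonglongrightarrow> 0"
      using tendsto_mult[OF tendsto_const tendsto_add[OF extension_step_approx[OF f g(1) F H] extension_step_approx[OF f g(2) F H']], of "2 powr r"] by simp
  qed simp
  show ?thesis
    by (rule norm_pow_unique[OF extension_Lp[OF f gg] Lp_space_add[OF extension_Lp[OF f g(1)] extension_Lp[OF f g(2)] pp(2)] QL(3) pp(2) l1 l2])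
qed

lemma scale_dual_extension_lim:
  assumes f: "f \<in> Lp_space Rplus p1" and g: "g \<in> Lp_space Rplus p2" and F: "step_approx p1 F f" and H: "step_approx p2 H g"
    and Q: "\<And>n x. Q n x = scale_dual a (step_operator (F n) (H n) x)"
  shows "(\<lambda>n. norm_pow r (\<lambda>x. scale_dual a (extension f g x) - Q n x)) \<longlonglongrightarrow> 0"
proof (rule tendsto_sandwich[OF _ _ tendsto_const])
  have r0: "0 \<le> r" using r by simp
  have QL: "step_operator (F n) (H n) \<in> Lp_space Rplus r" for n by (rule step_operator_Lp[OF step_approx_fds[OF F] step_approx_fds[OF H]])
  show "eventually (\<lambda>n. norm_pow r (\<lambda>x. scale_dual a (extension f g x) - Q n x) \<le> cmod a powr r * norm_pow r (\<lambda>x. extension f g x - step_operator (F n) (H n) x)) sequentially"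
    using scale_dual_Lp(2)[OF Lp_space_diff[OF extension_Lp[OF f g] QL r0] r0, of a] by (simp add: Q scale_dual_diff)
  show "(\<lambda>n. cmod a powr r * norm_pow r (\<lambda>x. extension f g x - step_operator (F n) (H n) x)) \<longlonglongrightarrow> 0"
    using tendsto_mult[OF tendsto_const extension_step_approx[OF f g F H], of "cmod a powr r"] by simp
qed simp

lemma extension_scaleC:
  assumes f: "f \<in> Lp_space Rplus p1" and g: "g \<in> Lp_space Rplus p2"
  shows "AE x in Rplus. \<forall>y. blinfun_apply (extension (\<lambda>t. scaleC a (f t)) g x) y = a * blinfun_apply (extension f g x) y"
    and "AE x in Rplus. \<forall>y. blinfun_apply (extension f (\<lambda>t. scaleC a (g t)) x) y = a * blinfun_apply (extension f g x) y"
proof -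
  have pp: "0 \<le> p1" "0 \<le> p2" "0 \<le> r" using p1 p2 r by auto
  obtain F where F: "step_approx p1 F f" using step_approx_ex[OF f p1] .
  obtain H where H: "step_approx p2 H g" using step_approx_ex[OF g p2] .
  note mL = scale_dual_Lp(1)[OF extension_Lp[OF f g] pp(3), of a]
  have af: "(\<lambda>t. scaleC a (f t)) \<in> Lp_space Rplus p1" by (rule scaleC_Lp[OF f pp(1)])
  have ag: "(\<lambda>t. scaleC a (g t)) \<in> Lp_space Rplus p2" by (rule scaleC_Lp[OF g pp(2)])
  note aF = step_approx_scaleC[OF F f pp(1), of a] and aH = step_approx_scaleC[OF H g pp(2), of a]
  have Q1: "step_operator (\<lambda>x. scaleC a (F n x)) (H n) x = scale_dual a (step_operator (F n) (H n) x)" for n x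
    by (rule blinfun_eqI) (simp add: step_operator_scaleC(1)[OF step_approx_fds[OF F] step_approx_fds[OF H]])
  have Q2: "step_operator (F n) (\<lambda>x. scaleC a (H n x)) x = scale_dual a (step_operator (F n) (H n) x)" for n x
    by (rule blinfun_eqI) (simp add: step_operator_scaleC(2)[OF step_approx_fds[OF F] step_approx_fds[OF H]])
  have "AE x in Rplus. extension (\<lambda>t. scaleC a (f t)) g x = scale_dual a (extension f g x)"
    by (rule norm_pow_unique[OF extension_Lp[OF af g] mL step_operator_Lp(1)[OF step_approx_fds[OF aF] step_approx_fds[OF H]] pp(3) extension_step_approx[OF af g aF H] scale_dual_extension_lim[OF f g F H Q1]])
  then show "AE x in Rplus. \<forall>y. blinfun_apply (extension (\<lambda>t. scaleC a (f t)) g x) y = a * blinfun_apply (extension f g x) y"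
    by eventually_elim simp
  have "AE x in Rplus. extension f (\<lambda>t. scaleC a (g t)) x = scale_dual a (extension f g x)"
    by (rule norm_pow_unique[OF extension_Lp[OF f ag] mL step_operator_Lp(1)[OF step_approx_fds[OF F] step_approx_fds[OF aH]] pp(3) extension_step_approx[OF f ag F aH] scale_dual_extension_lim[OF f g F H Q2]])
  then show "AE x in Rplus. \<forall>y. blinfun_apply (extension f (\<lambda>t. scaleC a (g t)) x) y = a * blinfun_apply (extension f g x) y"
    by eventually_elim simp
qed

text \<open>The three quasi-triangle inequalities, for \<open>f\<close>, for \<open>g\<close> and
  for the value of the operator, each give a factor 2 after the root; together they make the
  8.\<close>

lemma extension_bound:
  assumes f: "f \<in> Lp_space Rplus p1" and g: "g \<in> Lp_space Rplus p2"
  shows "Lp_norm Rplus r (extension f g) \<le> 8 * D * Lp_norm Rplus p1 f * Lp_norm Rplus p2 g"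
proof -
  have pp: "0 \<le> p1" "0 \<le> p2" "0 \<le> r" using p1 p2 r by auto
  obtain F where F: "step_approx p1 F f" using step_approx_ex[OF f p1] .
  obtain H where H: "step_approx p2 H g" using step_approx_ex[OF g p2] .
  have QL: "step_operator (F n) (H n) \<in> Lp_space Rplus r" for n by (rule step_operator_Lp[OF step_approx_fds[OF F] step_approx_fds[OF H]])
  define b where "b n = 2 powr r * (G (2 powr p1 * (norm_pow p1 f + norm_pow p1 (\<lambda>x. f x - F n x))) (2 powr p2 * (norm_pow p2 g + norm_pow p2 (\<lambda>x. g x - H n x))) +
     norm_pow r (\<lambda>x. extension f g x - step_operator (F n) (H n) x))" for n
  have le: "norm_pow r (extension f g) \<le> b n" for n
  proof -
    have "norm_pow r (extension f g) \<le> 2 powr r * (norm_pow r (step_operator (F n) (H n)) + norm_pow r (\<lambda>x. step_operator (F n) (H n) x - extension f g x))"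
      by (rule norm_pow_step_le[OF QL extension_Lp[OF f g] pp(3)])
    also have "\<dots> \<le> b n" unfolding b_def
    proof (intro mult_left_mono add_mono)
      have "norm_pow r (step_operator (F n) (H n)) \<le> G (norm_pow p1 (F n)) (norm_pow p2 (H n))" by (rule step_operator_Lp[OF step_approx_fds[OF F] step_approx_fds[OF H]])
      also have "\<dots> \<le> G (2 powr p1 * (norm_pow p1 f + norm_pow p1 (\<lambda>x. f x - F n x))) (2 powr p2 * (norm_pow p2 g + norm_pow p2 (\<lambda>x. g x - H n x)))"
        by (intro G_mono norm_pow_step_le f g step_approx_Lp[OF F] step_approx_Lp[OF H] pp) auto
      finally show "norm_pow r (step_operator (F n) (H n)) \<le> G (2 powr p1 * (norm_pow p1 f + norm_pow p1 (\<lambda>x. f x - F n x))) (2 powr p2 * (norm_pow p2 g + norm_pow p2 (\<lambda>x. g x - H n x)))" .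
    qed (simp_all add: norm_pow_commute[of r "step_operator (F n) (H n)"])
    finally show ?thesis .
  qed
  have blim: "b \<longlonglongrightarrow> 2 powr r * (G (2 powr p1 * (norm_pow p1 f + 0)) (2 powr p2 * (norm_pow p2 g + 0)) + 0)"
    unfolding b_def by (intro tendsto_mult tendsto_add tendsto_const tendsto_G step_approx_lim[OF F] step_approx_lim[OF H] extension_step_approx[OF f g F H]) auto
  have "norm_pow r (extension f g) \<le> 2 powr r * (G (2 powr p1 * (norm_pow p1 f + 0)) (2 powr p2 * (norm_pow p2 g + 0)) + 0)"
    by (rule LIMSEQ_le_const[OF blim]) (use le in blast)
  also have "\<dots> = (8 * D * Lp_norm Rplus p1 f * Lp_norm Rplus p2 g) powr r"
  proof -
    have "(2 powr p1 * norm_pow p1 f) powr (1 / p1) = 2 * Lp_norm Rplus p1 f" "(2 powr p2 * norm_pow p2 g) powr (1 / p2) = 2 * Lp_norm Rplus p2 g"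
      using p1 p2 by (simp_all add: powr_mult powr_powr Lp_norm_eq_norm_pow)
    then have "2 powr r * (G (2 powr p1 * (norm_pow p1 f + 0)) (2 powr p2 * (norm_pow p2 g + 0)) + 0) =
      2 powr r * (D * (2 * Lp_norm Rplus p1 f) * (2 * Lp_norm Rplus p2 g)) powr r" by (simp add: G_def)
    also have "\<dots> = (2 * (D * (2 * Lp_norm Rplus p1 f) * (2 * Lp_norm Rplus p2 g))) powr r"
      by (rule powr_mult[symmetric])
    also have "2 * (D * (2 * Lp_norm Rplus p1 f) * (2 * Lp_norm Rplus p2 g)) = 8 * D * Lp_norm Rplus p1 f * Lp_norm Rplus p2 g" by simp
    finally show ?thesis .
  qed
  finally have "norm_pow r (extension f g) powr (1 / r) \<le> ((8 * D * Lp_norm Rplus p1 f * Lp_norm Rplus p2 g) powr r) powr (1 / r)"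
    using r by (intro powr_mono2) auto
  also have "\<dots> = 8 * D * Lp_norm Rplus p1 f * Lp_norm Rplus p2 g"
    using r D0 by (simp add: powr_powr Lp_norm_eq_norm_pow)
  finally show ?thesis by (simp add: Lp_norm_eq_norm_pow[of r])
qed

lemma extension_step:
  assumes "finite_dyadic_step f" "finite_dyadic_step g"
  shows "AE x in Rplus. extension f g x = quartile_operator \<Phi> f g x"
proof -
  have f: "f \<in> Lp_space Rplus p1" and g: "g \<in> Lp_space Rplus p2" using assms finite_dyadic_step_Lp by blast+
  have r0: "0 \<le> r" using r by simp
  have QL: "step_operator f g \<in> Lp_space Rplus r" by (rule step_operator_Lp[OF assms])
  have z: "(\<lambda>n::nat. norm_pow r (\<lambda>x. step_operator f g x - step_operator f g x)) \<longlonglongrightarrow> 0" by (simp add: norm_pow_def pint_def)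
  have "AE x in Rplus. extension f g x = step_operator f g x"
    by (rule norm_pow_unique[OF extension_Lp[OF f g] QL QL r0 extension_step_approx[OF f g step_approx_const[OF assms(1)] step_approx_const[OF assms(2)]] z])
  then show ?thesis using step_operator_AE[of f g] by eventually_elim simp
qed

text \<open>For step functions no limit of approximants is involved, so the constant stays
  \<open>D\<close>.\<close>

lemma step_bound:
  assumes "finite_dyadic_step f" "finite_dyadic_step g"
  shows "Lp_norm Rplus r (quartile_operator \<Phi> f g) \<le> D * Lp_norm Rplus p1 f * Lp_norm Rplus p2 g"
proof -
  have "AE x in Rplus. norm (quartile_operator \<Phi> f g x) = norm (step_operator f g x)" using step_operator_AE[of f g] by eventually_elim simp
  then have "pint Rplus r (quartile_operator \<Phi> f g) = pint Rplus r (step_operator f g)" by (rule pint_cong_AE)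
  then have "norm_pow r (quartile_operator \<Phi> f g) \<le> (D * Lp_norm Rplus p1 f * Lp_norm Rplus p2 g) powr r"
    using step_operator_Lp(2)[OF assms] by (simp add: norm_pow_def[of r] G_def Lp_norm_eq_norm_pow)
  then have "norm_pow r (quartile_operator \<Phi> f g) powr (1 / r) \<le> ((D * Lp_norm Rplus p1 f * Lp_norm Rplus p2 g) powr r) powr (1 / r)"
    using r by (intro powr_mono2) auto
  also have "\<dots> = D * Lp_norm Rplus p1 f * Lp_norm Rplus p2 g" using r D0 by (simp add: powr_powr Lp_norm_eq_norm_pow)
  finally show ?thesis by (simp add: Lp_norm_eq_norm_pow[of r])
qed

end

theorem theorem1p1:
  fixes \<Phi> :: "'a::complex_banach \<Rightarrow> 'b::complex_banach \<Rightarrow> 'c::complex_banach \<Rightarrow> complex"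
    and q1 q2 q3 p1 p2 r :: real
  assumes "UMD TYPE('a)" and "UMD TYPE('b)" and "UMD TYPE('c)"
    and "quartile_type q1 TYPE('a)" and "quartile_type q2 TYPE('b)" and "quartile_type q3 TYPE('c)"
    and "bounded_trilinear_form \<Phi>"
    and "1 / q1 + 1 / q2 + 1 / q3 > 1"
    and "1 / r = 1 / p1 + 1 / p2"
    and "q1 < p1" and "q2 < p2" and "1 < r" and "r < q3 / (q3 - 1)"
  shows "\<exists>B. bounded_bilinear_Lp p1 p2 r B \<and>
           (\<forall>f1 f2. finite_dyadic_step f1 \<longrightarrow> finite_dyadic_step f2 \<longrightarrow>
              (AE x in Rplus. B f1 f2 x = quartile_operator \<Phi> f1 f2 x)) \<and>
           (\<exists>C. \<forall>f1 f2. finite_dyadic_step f1 \<longrightarrow> finite_dyadic_step f2 \<longrightarrow>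
              Lp_norm Rplus r (quartile_operator \<Phi> f1 f2)
                \<le> C * Lp_norm Rplus p1 f1 * Lp_norm Rplus p2 f2)"
proof -
  interpret tri_form \<Phi> by unfold_locales (rule assms(7))
  have q: "1 \<le> q1" "1 \<le> q2" "1 \<le> q3" using assms(4-6) by (auto simp: quartile_type_def)
  \<comment> \<open>At \<open>q3 = 1\<close> the quotient in the hypothesis would be division by
    zero, hence 0, which contradicts \<open>1 < r\<close>.\<close>
  have "q3 \<noteq> 1" using assms(12,13) by auto
  then have "r * (q3 - 1) < q3" using assms(13) q(3) by (simp add: pos_less_divide_eq)
  \<comment> \<open>Taking conjugate exponents reverses the inequality: \<open>r < q3'\<close>
    becomes \<open>q3 < r'\<close>, the form used for the third slot.\<close>
  then have q3: "q3 < r / (r - 1)" using assms(12) by (simp add: pos_less_divide_eq algebra_simps)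
  obtain C1 where C1: "discrete_quartile_type q1 C1 TYPE('a)" using quartile_type_imp_discrete[OF assms(4)] .
  obtain C2 where C2: "discrete_quartile_type q2 C2 TYPE('b)" using quartile_type_imp_discrete[OF assms(5)] .
  obtain C3 where C3: "discrete_quartile_type q3 C3 TYPE('c)" using quartile_type_imp_discrete[OF assms(6)] .
  have q0: "0 \<le> q1" "0 \<le> q2" "0 \<le> q3" using q by auto
  obtain D where D: "0 \<le> D" "\<And>L f g. discrete_norm L r (discrete_operator L f g) \<le> D * discrete_norm L p1 f * discrete_norm L p2 g"
    by (rule discrete_operator_bound[OF C1 C2 C3 q0 assms(10-12) q3 assms(9)]) (rule that)
  interpret bounded_form \<Phi> D p1 p2 r by unfold_locales (use D assms q in auto)
  have "bounded_bilinear_Lp p1 p2 r extension"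
    unfolding bounded_bilinear_Lp_def
    by (intro conjI ballI allI impI exI[of _ "8 * D"] extension_Lp extension_dual extension_add1 extension_add2 extension_scaleC extension_bound)
  then show ?thesis using extension_step step_bound by blast
qed

end
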